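(* Let $p=2$ and assume that $u_0\in W^{2,2}_{\rm per}(I)$ satisfies $$\int_I\cos(u_0+\phi)\,ds=\int_I\sin(u_0+\phi)\,ds=0 .$$ Then problem (P) with $p=2$ (defined in the context) possesses a unique global-in-time weak solution; that is, for arbitrarily large $T>0$ there is a unique weak solution of (P) on $[0,T)$.
   Context: Fix $L>0$ and a positive integer $\eta$; let $I=(0,L)$ and $\phi(s)=2\pi\eta s/L$. Function spaces: $C_{\rm per}(I)=\{u\in C(\mathbb R): u(s+kL)=u(s)\ \text{for all } s\in\bar I,\ k\in\mathbb Z\}$, $W^{1,p}_{\rm per}(I)=\{u\in W^{1,p}(I): u\in C_{\rm per}(I)\}$, $W^{2,p}_{\rm per}(I)=\{u\in W^{2,p}(I): u,\partial_su\in C_{\rm per}(I)\}$. For $\theta=u+\phi$ with $u\in W^{1,p}_{\rm per}(I)$ let $$A_T(\theta)=\begin{pmatrix}\int_I\sin^2\theta\,ds&-\int_I\sin\theta\cos\theta\,ds\\-\int_I\sin\theta\cos\theta\,ds&\int_I\cos^2\theta\,ds\end{pmatrix},$$ $$\tilde\lambda_1(u)=\frac{1}{\det A_T(\theta)}\Big[\int_I|\theta_s|^p\cos\theta\,ds\int_I\cos^2\theta\,ds+\int_I|\theta_s|^p\sin\theta\,ds\int_I\sin\theta\cos\theta\,ds\Big],$$ $$\tilde\lambda_2(u)=\frac{1}{\det A_T(\theta)}\Big[\int_I|\theta_s|^p\cos\theta\,ds\int_I\sin\theta\cos\theta\,ds+\int_I|\theta_s|^p\sin\theta\,ds\int_I\sin^2\theta\,ds\Big].$$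 Problem (P) is, formally, $$\partial_tu=\partial_s\big(|\partial_s(u+\phi)|^{p-2}\partial_s(u+\phi)\big)+\tilde\lambda_1(u)\sin(u+\phi)-\tilde\lambda_2(u)\cos(u+\phi),\qquad u(\cdot,0)=u_0 ,$$ here with $p=2$. Definition of weak solution. $u:I\times[0,T)\to\mathbb R$ is a weak solution of (P) (on $[0,T)$) if: (i) $u\in L^\infty(0,T;W^{1,p}_{\rm per}(I))\cap H^1(0,T;L^2(I))$; (ii) there exist $\lambda_1,\lambda_2\in L^2(0,T)$ such that for every $\varphi\in L^\infty(0,T;W^{1,p}_{\rm per}(I))$ $$\int_0^T\!\!\int_I\Big[\big\{\partial_tu-\lambda_1\sin(u+\phi)+\lambda_2\cos(u+\phi)\big\}\varphi+|\partial_s(u+\phi)|^{p-2}\partial_s(u+\phi)\,\partial_s\varphi\Big]ds\,dt=0;$$ (iii) for every $t\in[0,T)$, $\int_I\cos(u(\cdot,t)+\phi)\,ds=\int_I\sin(u(\cdot,t)+\phi)\,ds=0$; (iv) $u(0)=u_0$ in $W^{1,p}_{\rm per}(I)$. *)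

theory Defs
  imports "HOL-Analysis.Analysis"
begin

section \<open>Lebesgue and Sobolev spaces on a subset of the line\<close>

text \<open>Elements of the spaces below are functions, not classes modulo null sets.\<close>

definition Lp_space :: "real \<Rightarrow> real set \<Rightarrow> (real \<Rightarrow> real) set" where
  "Lp_space p S = {f \<in> borel_measurable (lebesgue_on S).
     integrable (lebesgue_on S) (\<lambda>x. \<bar>f x\<bar> powr p)}"

definition Lp_norm :: "real \<Rightarrow> real set \<Rightarrow> (real \<Rightarrow> real) \<Rightarrow> real" where
  "Lp_norm p S f = (LINT x|lebesgue_on S. \<bar>f x\<bar> powr p) powr (1 / p)"

definition test_functions :: "real set \<Rightarrow> (real \<Rightarrow> real) set" where
  "test_functions S = {\<psi>. (\<forall>n x. (deriv ^^ n) \<psi> field_differentiable at x) \<and>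
     compact (closure {x. \<psi> x \<noteq> 0}) \<and> closure {x. \<psi> x \<noteq> 0} \<subseteq> S}"

definition locally_integrable :: "real set \<Rightarrow> (real \<Rightarrow> real) \<Rightarrow> bool" where
  "locally_integrable S f \<longleftrightarrow> (\<forall>K. compact K \<and> K \<subseteq> S \<longrightarrow> set_integrable lebesgue K f)"

definition has_weak_deriv :: "real set \<Rightarrow> (real \<Rightarrow> real) \<Rightarrow> (real \<Rightarrow> real) \<Rightarrow> bool" where
  "has_weak_deriv S f g \<longleftrightarrow> locally_integrable S f \<and> locally_integrable S g \<and>
     (\<forall>\<psi>\<in>test_functions S.
        (LINT x|lebesgue_on S. f x * deriv \<psi> x) = - (LINT x|lebesgue_on S. g x * \<psi> x))"

text \<open>On an open set the weak derivative is determined up to a null set, so the choice of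
  representative is immaterial under an integral over the set.\<close>

definition weak_deriv :: "real set \<Rightarrow> (real \<Rightarrow> real) \<Rightarrow> real \<Rightarrow> real" where
  "weak_deriv S f = (SOME g. has_weak_deriv S f g)"

definition W1p :: "real \<Rightarrow> real set \<Rightarrow> (real \<Rightarrow> real) set" where
  "W1p p S = {f \<in> Lp_space p S. \<exists>g \<in> Lp_space p S. has_weak_deriv S f g}"

definition W2p :: "real \<Rightarrow> real set \<Rightarrow> (real \<Rightarrow> real) set" where
  "W2p p S = {f \<in> Lp_space p S. \<exists>g \<in> W1p p S. has_weak_deriv S f g}"

definition W1p_norm :: "real \<Rightarrow> real set \<Rightarrow> (real \<Rightarrow> real) \<Rightarrow> real" where
  "W1p_norm p S f =
     ((LINT x|lebesgue_on S. \<bar>f x\<bar> powr p) + (LINT x|lebesgue_on S. \<bar>weak_deriv S f x\<bar> powr p))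
       powr (1 / p)"

section \<open>Periodic spaces\<close>

definition C_per :: "real \<Rightarrow> (real \<Rightarrow> real) set" where
  "C_per L = {u. continuous_on UNIV u \<and> (\<forall>s\<in>{0..L}. \<forall>k::int. u (s + of_int k * L) = u s)}"

text \<open>An element of the periodic spaces is the continuous periodic function on the whole line,
  so equality in these spaces is equality of functions. The condition that the weak derivative lies
  in \<open>C_per\<close> says that it has a representative there.\<close>

definition W1p_per :: "real \<Rightarrow> real \<Rightarrow> (real \<Rightarrow> real) set" where
  "W1p_per p L = {u \<in> W1p p {0<..<L}. u \<in> C_per L}"

definition W2p_per :: "real \<Rightarrow> real \<Rightarrow> (real \<Rightarrow> real) set" where
  "W2p_per p L = {u \<in> W2p p {0<..<L}.
     u \<in> C_per L \<and> (\<exists>g \<in> C_per L. has_weak_deriv {0<..<L} u g)}"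

section \<open>Bochner spaces\<close>

text \<open>A space of values is given by its carrier \<open>V\<close> and its (semi)norm \<open>N\<close>.\<close>

definition bochner_measurable ::
    "real set \<Rightarrow> 'b::minus set \<Rightarrow> ('b \<Rightarrow> real) \<Rightarrow> (real \<Rightarrow> 'b) \<Rightarrow> bool" where
  "bochner_measurable J V N f \<longleftrightarrow>
     (\<exists>\<sigma> :: nat \<Rightarrow> real \<Rightarrow> 'b.
        (\<forall>n. simple_function (lebesgue_on J) (\<sigma> n) \<and> \<sigma> n ` J \<subseteq> V) \<and>
        (AE t in lebesgue_on J. f t \<in> V \<and> (\<lambda>n. N (\<sigma> n t - f t)) \<longlonglongrightarrow> 0))"

definition bochner_Linf ::
    "real set \<Rightarrow> 'b::minus set \<Rightarrow> ('b \<Rightarrow> real) \<Rightarrow> (real \<Rightarrow> 'b) set" where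
  "bochner_Linf J V N =
     {f. bochner_measurable J V N f \<and> (\<exists>C. AE t in lebesgue_on J. N (f t) \<le> C)}"

definition bochner_L2 ::
    "real set \<Rightarrow> 'b::minus set \<Rightarrow> ('b \<Rightarrow> real) \<Rightarrow> (real \<Rightarrow> 'b) set" where
  "bochner_L2 J V N =
     {f. bochner_measurable J V N f \<and> integrable (lebesgue_on J) (\<lambda>t. (N (f t))\<^sup>2)}"

abbreviation L2L2 :: "real set \<Rightarrow> real set \<Rightarrow> (real \<Rightarrow> real \<Rightarrow> real) set" where
  "L2L2 J S \<equiv> bochner_L2 J (Lp_space 2 S) (Lp_norm 2 S)"

text \<open>The identity
  \<open>\<integral>\<psi>'(t) u(t) dt = - \<integral>\<psi>(t) v(t) dt\<close> between elements of \<open>L\<^sup>2(S)\<close>, read off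
  by pairing both Bochner integrals with every \<open>w\<close> in \<open>L\<^sup>2(S)\<close>.\<close>

definition has_weak_time_deriv ::
    "real set \<Rightarrow> real set \<Rightarrow> (real \<Rightarrow> real \<Rightarrow> real) \<Rightarrow> (real \<Rightarrow> real \<Rightarrow> real) \<Rightarrow> bool" where
  "has_weak_time_deriv J S u v \<longleftrightarrow> u \<in> L2L2 J S \<and> v \<in> L2L2 J S \<and>
     (\<forall>\<psi>\<in>test_functions J. \<forall>w\<in>Lp_space 2 S.
        (LINT t|lebesgue_on J. deriv \<psi> t * (LINT s|lebesgue_on S. u t s * w s)) =
        - (LINT t|lebesgue_on J. \<psi> t * (LINT s|lebesgue_on S. v t s * w s)))"

definition weak_time_deriv ::
    "real set \<Rightarrow> real set \<Rightarrow> (real \<Rightarrow> real \<Rightarrow> real) \<Rightarrow> real \<Rightarrow> real \<Rightarrow> real" where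
  "weak_time_deriv J S u = (SOME v. has_weak_time_deriv J S u v)"

definition H1L2 :: "real set \<Rightarrow> real set \<Rightarrow> (real \<Rightarrow> real \<Rightarrow> real) set" where
  "H1L2 J S = {u. \<exists>v. has_weak_time_deriv J S u v}"

section \<open>Weak solutions\<close>

definition phi :: "real \<Rightarrow> nat \<Rightarrow> real \<Rightarrow> real" where
  "phi L \<eta> s = 2 * pi * real \<eta> * s / L"

definition closed_angle :: "real \<Rightarrow> nat \<Rightarrow> (real \<Rightarrow> real) \<Rightarrow> bool" where
  "closed_angle L \<eta> w \<longleftrightarrow>
     (LINT s|lebesgue_on {0<..<L}. cos (w s + phi L \<eta> s)) = 0 \<and>
     (LINT s|lebesgue_on {0<..<L}. sin (w s + phi L \<eta> s)) = 0"

text \<open>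
  The solution is written time first, \<open>u t s\<close>. An element of
  \<open>L\<^sup>\<infinity>(0,T;W\<^sup>1\<^sup>,\<^sup>p) \<inter> H\<^sup>1(0,T;L\<^sup>2)\<close> has a representative that is continuous in time with values
  in \<open>L\<^sup>2\<close>, and it is this representative that the pointwise-in-time conditions (the constraint for
  every \<open>t\<close> and the initial condition) refer to; \<open>time_regular\<close> says that \<open>u\<close> is given
  by it, each \<open>u t\<close> being given by its continuous periodic representative in \<open>s\<close>.
\<close>

definition time_regular :: "real \<Rightarrow> real \<Rightarrow> real \<Rightarrow> (real \<Rightarrow> real \<Rightarrow> real) \<Rightarrow> bool" where
  "time_regular p L T u \<longleftrightarrow>
     (\<forall>t\<in>{0..<T}. u t \<in> W1p_per p L \<and>
        ((\<lambda>r. Lp_norm 2 {0<..<L} (u r - u t)) \<longlongrightarrow> 0) (at t within {0..<T}))"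

text \<open>Since \<open>0 powr 0 = 0\<close>, the factor \<open>\<bar>z\<bar> powr (p - 2)\<close> with \<open>p = 2\<close> is not \<open>1\<close> at
  \<open>z = 0\<close>; the product with \<open>z\<close> below has the intended value \<open>0\<close> there.\<close>

definition weak_solution ::
    "real \<Rightarrow> real \<Rightarrow> nat \<Rightarrow> (real \<Rightarrow> real) \<Rightarrow> real \<Rightarrow> (real \<Rightarrow> real \<Rightarrow> real) \<Rightarrow> bool" where
  "weak_solution p L \<eta> u0 T u \<longleftrightarrow>
     (let I = {0<..<L}; J = {0<..<T};
          X = bochner_Linf J (W1p_per p L) (W1p_norm p I) in
      u \<in> X \<inter> H1L2 J I \<and> time_regular p L T u \<and>
      (\<exists>l1 \<in> Lp_space 2 J. \<exists>l2 \<in> Lp_space 2 J. \<forall>\<phi> \<in> X.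
         (LINT t|lebesgue_on J. LINT s|lebesgue_on I.
            (weak_time_deriv J I u t s
               - l1 t * sin (u t s + phi L \<eta> s) + l2 t * cos (u t s + phi L \<eta> s)) * \<phi> t s
            + \<bar>weak_deriv I (\<lambda>x. u t x + phi L \<eta> x) s\<bar> powr (p - 2)
               * weak_deriv I (\<lambda>x. u t x + phi L \<eta> x) s * weak_deriv I (\<phi> t) s) = 0) \<and>
      (\<forall>t\<in>{0..<T}. closed_angle L \<eta> (u t)) \<and>
      u 0 = u0)"

end

(*
  Existence. Write theta = u + phi and v = theta_s. The multipliers lambda_1, lambda_2 are replaced by
  bounded, globally Lipschitz functionals that agree with them as long as the energy int v^2 is at
  most N0 and det A_T is at least delta. The resulting equation is solved for (u, v) in mild form,
  with the heat semigroup written as f |-> E f(s + x Y), Y a standard Gaussian, which preserves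
  periodicity without Fourier series. Since v(., 0) is only Hoelder continuous with exponent 1/2, v_s
  is bounded by a multiple of t^(-1/4), which is square integrable in time. The energy is
  nonincreasing even for the truncated equation, and a curve of bounded energy that winds around has
  det A_T bounded below, so the truncation is never active; then int cos theta and int sin theta are
  conserved.

  Uniqueness. Test the difference of the equations of two weak solutions with their difference w, cut
  off at time b. No formula for the multipliers is needed: because both curves are closed,
  int sin(theta_i) w and int cos(theta_i) w are quadratic in w, so |w|^2 satisfies a Gronwall
  inequality whose coefficient, twice the sum of the absolute values of the multipliers, is integrable.
*)
theory Submission
  imports Defs "HOL-Probability.Distributions"
begin

section \<open>Smooth bump functions\<close>

text \<open>The multipliers are quadratic in theta_s, so an iteration for u alone would lose a
  derivative. With v as a second unknown carrying its own source term, the system is Lipschitz in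
  the sup norm on bounded v; the relation u_s = v - c, with c = 2 pi eta / L, survives because it is
  a closed condition that each iteration step preserves. Boundedness of the truncated multipliers
  supplies the a priori bound on v. No time derivative of v is available, so the energy is
  differentiated through difference quotients of u, after an integration by parts in s. Its decay
  survives truncation because the factor kappa that replaces 1 / det A_T still satisfies kappa det
  A_T <= 1. The lower bound for det A_T comes from energy and winding, so delta can be fixed from
  the initial energy before the flow exists, and it does not depend on T. Weak solutions have only
  weak derivatives in s and t. The product rules for them come from the fundamental theorem on short
  intervals, where one factor is frozen and the error is small relative to the integral of a fixed
  integrable function.\<close>

definition bump :: "real poly \<Rightarrow> nat \<Rightarrow> real \<Rightarrow> real" where
  "bump p k x = (if \<bar>x\<bar> < 1 then poly p x / (1 - x\<^sup>2) ^ k * exp (- 1 / (1 - x\<^sup>2)) else 0)"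

lemma power_div_fact_le_exp:
  fixes z :: real
  assumes "z \<ge> 0"
  shows "z ^ m / fact m \<le> exp z"
proof -
  have "(\<Sum>n\<in>{m}. z ^ n /\<^sub>R fact n) \<le> (\<Sum>n. z ^ n /\<^sub>R fact n)"
    by (rule sum_le_suminf) (use assms summable_exp_generic[of z] in auto)
  then show ?thesis
    by (simp add: exp_def field_simps)
qed

text \<open>Compare \<open>exp (1 / y)\<close> with a single term of its series: the essential
  singularity beats every power of y.\<close>

lemma exp_minus_inverse_le:
  fixes y :: real
  assumes "y > 0"
  shows "exp (- 1 / y) \<le> fact m * y ^ m"
proof -
  have "(1 / y) ^ m / fact m \<le> exp (1 / y)"
    using assms by (intro power_div_fact_le_exp) auto
  then have "exp (- (1 / y)) \<le> inverse ((1 / y) ^ m / fact m)"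
    unfolding exp_minus using assms by (intro le_imp_inverse_le) auto
  then show ?thesis
    using assms by (simp add: field_simps power_divide)
qed

text \<open>The exponential absorbs the k powers in the denominator and two more. The surplus square
  is what forces the difference quotients to vanish at x = 1 and x = -1.\<close>

lemma bump_bound:
  obtains C where "C \<ge> 0" "\<And>x. \<bar>bump p k x\<bar> \<le> C * (1 - x\<^sup>2)\<^sup>2"
proof -
  have "compact (poly p ` {-1..1::real})"
    by (intro compact_continuous_image continuous_intros) auto
  then obtain P where P: "\<And>x. x \<in> {-1..1::real} \<Longrightarrow> \<bar>poly p x\<bar> \<le> P"
    by (metis compact_imp_bounded bounded_iff image_eqI real_norm_def)
  have P0: "P \<ge> 0" using P[of 0] by (meson abs_ge_zero atLeastAtMost_iff le_minus_one_simps(1) order_trans zero_le_one)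
  define C where "C = P * fact (k + 2)"
  have "\<bar>bump p k x\<bar> \<le> C * (1 - x\<^sup>2)\<^sup>2" for x
  proof (cases "\<bar>x\<bar> < 1")
    case True
    define y where "y = 1 - x\<^sup>2"
    have y: "y > 0" using True by (simp add: y_def abs_square_less_1)
    have "\<bar>bump p k x\<bar> = \<bar>poly p x\<bar> * (exp (- 1 / y) / y ^ k)"
      using True y by (simp add: bump_def abs_mult y_def[symmetric])
    also have "\<dots> \<le> P * (fact (k + 2) * y ^ (k + 2) / y ^ k)"
      using y P0 exp_minus_inverse_le[OF y, of "k + 2"] P[of x] True
      by (intro mult_mono divide_right_mono) (auto simp: abs_less_iff)
    also have "\<dots> = C * y\<^sup>2" using y by (simp add: C_def power_add power2_eq_square)
    finally show ?thesis by (simp add: y_def)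
  qed (simp add: bump_def C_def P0)
  with that[of C] P0 show ?thesis by (simp add: C_def)
qed

text \<open>Differentiating raises the exponent of the denominator by two and replaces the
  polynomial, so the functions \<open>bump p k\<close> form a family closed under differentiation.
  Carrying \<open>p\<close> and \<open>k\<close> as parameters makes smoothness a matter of one
  first-order computation.\<close>

lemma bump_has_derivative:
  "\<exists>q. \<forall>x. (bump p k has_real_derivative bump q (k + 2) x) (at x)"
proof -
  define y where "y = [:1, 0, -1::real:]"
  \<comment> \<open>Numerator of the quotient rule over the common denominator y^(k + 2), where y =
    1 - x^2 and y' = -2 x.\<close>
  define q where "q = pderiv p * y ^ 2 + smult (2 * real k) ([:0, 1:] * p * y) - smult 2 ([:0, 1:] * p)"
  have y: "poly y x = 1 - x\<^sup>2" for x by (simp add: y_def power2_eq_square)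
  have "(bump p k has_real_derivative bump q (k + 2) x) (at x)" for x
  proof -
    consider "\<bar>x\<bar> < 1" | "\<bar>x\<bar> > 1" | "\<bar>x\<bar> = 1" by linarith
    then show ?thesis
    proof cases
      case 1
      define g where "g = (\<lambda>x. poly p x / (1 - x\<^sup>2) ^ k * exp (- 1 / (1 - x\<^sup>2)))"
      have pos: "1 - x\<^sup>2 > 0" using 1 by (simp add: abs_square_less_1)
      define d where "d = 1 - x\<^sup>2"
      have yd: "poly y x = d" by (simp add: y d_def)
      have dpos: "d > 0" using pos d_def by simp
      have "(g has_real_derivative
          (poly p x / d ^ k * (exp (- 1 / d) * (- 2 * x / d\<^sup>2)) +
           (poly (pderiv p) x * d ^ k - poly p x * (real k * d ^ (k - 1) * (- 2 * x))) / (d ^ k * d ^ k) * exp (- 1 / d))) (at x)"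
        unfolding g_def d_def
      proof (rule DERIV_mult')
        show "((\<lambda>x. poly p x / (1 - x\<^sup>2) ^ k) has_real_derivative
          (poly (pderiv p) x * (1 - x\<^sup>2) ^ k - poly p x * (real k * (1 - x\<^sup>2) ^ (k - 1) * (- 2 * x)))
            / ((1 - x\<^sup>2) ^ k * (1 - x\<^sup>2) ^ k)) (at x)"
          using pos by (auto intro!: derivative_eq_intros poly_DERIV)
        show "((\<lambda>x. exp (- 1 / (1 - x\<^sup>2))) has_real_derivative exp (- 1 / (1 - x\<^sup>2)) * (- 2 * x / (1 - x\<^sup>2)\<^sup>2)) (at x)"
          using pos by (auto intro!: derivative_eq_intros simp: power2_eq_square)
      qed
      also have "poly p x / d ^ k * (exp (- 1 / d) * (- 2 * x / d\<^sup>2)) +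
           (poly (pderiv p) x * d ^ k - poly p x * (real k * d ^ (k - 1) * (- 2 * x))) / (d ^ k * d ^ k) * exp (- 1 / d)
           = poly q x / d ^ (k + 2) * exp (- 1 / d)"
      proof (cases k)
        case 0
        then show ?thesis using dpos
          by (simp add: q_def yd field_simps power2_eq_square)
      next
        case (Suc j)
        then show ?thesis using dpos
          by (simp add: q_def yd field_simps power2_eq_square)
      qed
      finally have "(g has_real_derivative bump q (k + 2) x) (at x)"
        using 1 by (simp add: bump_def d_def)
      moreover have "\<forall>\<^sub>F z in nhds x. g z = bump p k z"
        by (rule eventually_mono[OF eventually_nhds_in_open[of "{-1<..<1}" x]])
           (use 1 in \<open>auto simp: g_def bump_def abs_less_iff\<close>)
      ultimately show ?thesis using DERIV_cong_ev by (metis (no_types))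
    next
      case 2
      have "\<forall>\<^sub>F z in nhds x. bump p k z = 0"
        by (rule eventually_mono[OF eventually_nhds_in_open[of "- {-1..1}" x]])
           (use 2 in \<open>auto simp: bump_def abs_less_iff\<close>)
      then have "(bump p k has_real_derivative 0) (at x)"
        using DERIV_cong_ev[of x x "\<lambda>_. 0" "bump p k" 0 0] by (auto simp: eventually_mono)
      with 2 show ?thesis by (simp add: bump_def)
    next
      case 3
      obtain C where C: "C \<ge> 0" "\<And>x. \<bar>bump p k x\<bar> \<le> C * (1 - x\<^sup>2)\<^sup>2"
        using bump_bound by metis
      have sq: "x\<^sup>2 = 1" using 3 by (simp add: abs_square_eq_1)
      \<comment> \<open>Since x^2 = 1, the bound factors as (1 - z^2)^2 = (z - x)^2 (z + x)^2, and
        |z + x| <= 3 near x. One factor |z - x| is spent on the quotient, the other sends it to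
        0.\<close>
      have le: "\<bar>(bump p k z - bump p k x) / (z - x)\<bar> \<le> 9 * C * \<bar>z - x\<bar>" if "dist z x < 1" "z \<noteq> x" for z
      proof -
        have "(1 - z\<^sup>2)\<^sup>2 = (z - x)\<^sup>2 * (z + x)\<^sup>2"
          using sq by (simp add: power_mult_distrib[symmetric] algebra_simps power2_eq_square)
        moreover have "(z + x)\<^sup>2 \<le> 3\<^sup>2"
          by (rule power2_le_iff_abs_le[THEN iffD2]) (use that 3 in \<open>auto simp: dist_real_def\<close>)
        ultimately have "(1 - z\<^sup>2)\<^sup>2 \<le> (z - x)\<^sup>2 * 9" by (simp add: mult_left_mono)
        then have "C * (1 - z\<^sup>2)\<^sup>2 \<le> C * ((z - x)\<^sup>2 * 9)" using C(1) by (rule mult_left_mono)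
        with C(2)[of z] have "\<bar>bump p k z\<bar> \<le> C * ((z - x)\<^sup>2 * 9)" by linarith
        also have "(z - x)\<^sup>2 = \<bar>z - x\<bar> * \<bar>z - x\<bar>" by (simp add: power2_eq_square)
        finally have "\<bar>bump p k z\<bar> \<le> 9 * C * \<bar>z - x\<bar> * \<bar>z - x\<bar>" by (simp only: mult_ac)
        moreover have "bump p k x = 0" using 3 by (simp add: bump_def)
        ultimately show ?thesis using that
          by (simp add: abs_divide divide_le_eq)
      qed
      have "((\<lambda>z. (bump p k z - bump p k x) / (z - x)) \<longlongrightarrow> 0) (at x)"
      proof (rule Lim_null_comparison)
        show "\<forall>\<^sub>F z in at x. norm ((bump p k z - bump p k x) / (z - x)) \<le> 9 * C * \<bar>z - x\<bar>"
          using le unfolding eventually_at by (intro exI[of _ 1]) auto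
        show "((\<lambda>z. 9 * C * \<bar>z - x\<bar>) \<longlongrightarrow> 0) (at x)"
          by (rule tendsto_eq_intros | simp)+
      qed
      then have "(bump p k has_real_derivative 0) (at x)"
        by (simp add: has_field_derivative_iff)
      with 3 show ?thesis by (simp add: bump_def)
    qed
  qed
  then show ?thesis by blast
qed

text \<open>Induction inside a family closed under differentiation: each iterate of
  \<open>deriv\<close> stays in \<open>F\<close>, so no formula for higher derivatives has to be
  found.\<close>

lemma higher_deriv_differentiable:
  fixes f :: "real \<Rightarrow> real"
  assumes "f \<in> F" and step: "\<And>f. f \<in> F \<Longrightarrow> \<exists>g\<in>F. \<forall>x. (f has_real_derivative g x) (at x)"
  shows "(deriv ^^ n) f field_differentiable at x"
proof -
  have "(deriv ^^ n) f \<in> F" for n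
  proof (induction n)
    case (Suc n)
    from step[OF this] obtain g where "g \<in> F" "\<forall>x. ((deriv ^^ n) f has_real_derivative g x) (at x)"
      by blast
    then have "deriv ((deriv ^^ n) f) = g" by (auto intro!: DERIV_imp_deriv)
    with \<open>g \<in> F\<close> show ?case by simp
  qed (use assms in simp)
  from step[OF this] show ?thesis by (auto simp: field_differentiable_def)
qed

lemma bump_continuous: "continuous_on A (bump p k)"
  using bump_has_derivative[of p k] DERIV_continuous_on
  by (metis continuous_on_subset has_field_derivative_at_within subset_UNIV)

text \<open>The normalised primitive of a bump. Its derivative \<open>r\<close> is returned as a
  member of the bump family, so that the smoothness of rescaled steps can be read off from closure
  under differentiation.\<close>

lemma smooth_step_exists:
  obtains R r :: "real \<Rightarrow> real" and p k where
    "r = bump p k" "\<And>x. (R has_real_derivative r x) (at x)" "\<And>x. r x \<ge> 0"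
    "\<And>x. x \<le> -1 \<Longrightarrow> R x = 0" "\<And>x. x \<ge> 1 \<Longrightarrow> R x = 1" "\<And>x. 0 \<le> R x \<and> R x \<le> 1"
proof -
  define b where "b = bump 1 0"
  have b0: "b x \<ge> 0" for x by (simp add: b_def bump_def)
  have bz: "b x = 0" if "\<bar>x\<bar> \<ge> 1" for x using that by (simp add: b_def bump_def)
  have bc: "continuous_on A b" for A unfolding b_def by (rule bump_continuous)
  have bi: "b integrable_on {u..w}" for u w by (rule integrable_continuous_real[OF bc])
  define m where "m = integral {-1..1} b"
  have "m \<noteq> 0"
  proof
    assume "m = 0"
    have "b 0 = 0"
      using integral_eq_0_iff[of "-1" 1 b] bc b0 \<open>m = 0\<close> by (auto simp: m_def)
    then show False by (simp add: b_def bump_def)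
  qed
  moreover have "m \<ge> 0" unfolding m_def by (rule integral_nonneg) (auto intro: bi b0)
  ultimately have m: "m > 0" by simp
  \<comment> \<open>The lower limit only has to lie left of x and of the support. \<open>Bn\<close>
    shows that any such choice gives the same value, so near a given point a common lower limit can
    be used for differentiation.\<close>
  define B where "B x = integral {-1-\<bar>x\<bar>..x} b" for x
  have Bn: "B x = integral {-n..x} b" if "n \<ge> 1 + \<bar>x\<bar>" for n x
  proof -
    have "integral {-n..x} b = integral {-n..-1-\<bar>x\<bar>} b + integral {-1-\<bar>x\<bar>..x} b"
      by (rule Henstock_Kurzweil_Integration.integral_combine[symmetric]) (use that bi in auto)
    moreover have "integral {-n..-1-\<bar>x\<bar>} b = integral {-n..-1-\<bar>x\<bar>} (\<lambda>_. 0)"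
      by (rule integral_cong) (auto intro!: bz)
    ultimately show ?thesis by (simp add: B_def)
  qed
  have dB: "(B has_real_derivative b x) (at x)" for x
  proof -
    define n where "n = \<bar>x\<bar> + 3"
    have "((\<lambda>x. integral {-n..x} b) has_real_derivative b x) (at x within {-n..n})"
      by (rule integral_has_real_derivative[OF bc]) (auto simp: n_def)
    then have "((\<lambda>x. integral {-n..x} b) has_real_derivative b x) (at x)"
      by (subst (asm) at_within_interior) (auto simp: n_def)
    moreover have "\<forall>\<^sub>F z in nhds x. integral {-n..z} b = B z"
    proof (rule eventually_mono[OF eventually_nhds_in_open[of "ball x 1" x]])
      show "integral {-n..z} b = B z" if "z \<in> ball x 1" for z
        using that by (intro Bn[symmetric]) (auto simp: n_def dist_real_def)
    qed auto
    ultimately show ?thesis using DERIV_cong_ev by (metis (no_types))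
  qed
  have Bm: "B x \<le> B y" if "x \<le> y" for x y
    using DERIV_nonneg_imp_nondecreasing[OF that] dB b0 by blast
  have B0: "B x = 0" if "x \<le> -1" for x
  proof -
    have "B x = integral {-1-\<bar>x\<bar>..x} (\<lambda>_. 0)"
      unfolding B_def by (rule integral_cong) (use that in \<open>auto intro!: bz\<close>)
    then show ?thesis by simp
  qed
  have B1: "B x = m" if "x \<ge> 1" for x
  proof -
    have "B x = integral {-1-\<bar>x\<bar>..-1} b + integral {-1..x} b"
      unfolding B_def by (rule Henstock_Kurzweil_Integration.integral_combine[symmetric]) (use that bi in auto)
    moreover have "integral {-1..x} b = m + integral {1..x} b"
      unfolding m_def by (rule Henstock_Kurzweil_Integration.integral_combine[symmetric]) (use that bi in auto)
    moreover have "integral {-1-\<bar>x\<bar>..-1} b = integral {-1-\<bar>x\<bar>..-1} (\<lambda>_. 0)" "integral {1..x} b = integral {1..x} (\<lambda>_. 0)"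
      by (rule integral_cong; auto intro!: bz)+
    ultimately show ?thesis by simp
  qed
  show ?thesis
  proof (rule that[of "\<lambda>x. b x / m" "[:1/m:]" 0 "\<lambda>x. B x / m"])
    show "(\<lambda>x. b x / m) = bump [:1 / m:] 0" by (auto simp: b_def bump_def)
    show "((\<lambda>x. B x / m) has_real_derivative b x / m) (at x)" for x
      by (rule DERIV_cdivide[OF dB])
    show "0 \<le> B x / m \<and> B x / m \<le> 1" for x
    proof -
      have "0 \<le> B x" using Bm[of "-1" x] B0[of "-1"] B0[of x] by (cases "x \<le> -1") auto
      moreover have "B x \<le> m" using Bm[of x 1] B1[of 1] B1[of x] by (cases "x \<le> 1") auto
      ultimately show ?thesis using m by simp
    qed
  qed (use m b0 B0 B1 in auto)
qed

section \<open>The fundamental theorem for weak derivatives\<close>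

lemma inverse_less_of_inverse_less:
  fixes m x :: real
  assumes "m > 0" "1 / m < x"
  shows "x > 0" "1 / x < m"
proof -
  show "x > 0" using assms by (meson less_trans zero_less_divide_1_iff)
  then show "1 / x < m" using assms by (simp add: field_simps)
qed

lemma integral_lebesgue_on_compact_support:
  fixes f :: "real \<Rightarrow> real"
  assumes "K \<subseteq> S" "K \<in> sets lebesgue" "S \<in> sets lebesgue" "\<And>x. x \<notin> K \<Longrightarrow> f x = 0"
  shows "integral\<^sup>L (lebesgue_on S) f = integral\<^sup>L (lebesgue_on K) f"
proof -
  have "f = (\<lambda>x. if x \<in> K then f x else 0)" using assms(4) by auto
  then show ?thesis using integral_restrict[OF assms(1-3), of f] by simp
qed

lemma integral_lebesgue_on_continuous:
  fixes f :: "real \<Rightarrow> real"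
  assumes "continuous_on {a..b} f"
  shows "integral\<^sup>L (lebesgue_on {a..b}) f = integral {a..b} f"
  by (rule lebesgue_integral_eq_integral[OF continuous_imp_integrable_real[OF assms]]) simp

lemma set_integrable_iff_integrable_lebesgue_on:
  fixes f :: "real \<Rightarrow> real"
  assumes "S \<in> sets lebesgue"
  shows "set_integrable lebesgue S f \<longleftrightarrow> integrable (lebesgue_on S) f"
  using set_integrable_eq[of S lebesgue f] assms by simp

text \<open>A smooth plateau over [a, b] whose ramps have half-width 1 / n. Its derivative is an
  approximate identity at a minus one at b, the form in which \<open>weak_deriv_FTC\<close> uses
  it.\<close>

lemma smooth_cutoff_test_function:
  fixes R r :: "real \<Rightarrow> real" and n a b :: real
  assumes r: "r = bump p k" and R: "\<And>x. (R has_real_derivative r x) (at x)"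
    and R0: "\<And>x. x \<le> -1 \<Longrightarrow> R x = 0" and R1: "\<And>x. x \<ge> 1 \<Longrightarrow> R x = 1"
    and n: "n > 0" and ab: "a \<le> b" and S: "{a - 1 / n..b + 1 / n} \<subseteq> S"
  defines "\<psi> \<equiv> \<lambda>x. R (n * (x - a)) - R (n * (x - b))"
  shows "\<psi> \<in> test_functions S" and "deriv \<psi> x = n * r (n * (x - a)) - n * r (n * (x - b))"
    and "x \<notin> {a - 1 / n..b + 1 / n} \<Longrightarrow> \<psi> x = 0"
proof -
  have der: "(\<psi> has_real_derivative n * r (n * (x - a)) - n * r (n * (x - b))) (at x)" for x
    unfolding \<psi>_def by (rule derivative_eq_intros DERIV_chain2[OF R] | simp)+
  show "deriv \<psi> x = n * r (n * (x - a)) - n * r (n * (x - b))"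
    by (rule DERIV_imp_deriv[OF der])
  \<comment> \<open>\<open>\<psi>\<close> itself is a difference of steps, while all its derivatives
    are differences of rescaled bumps; the two kinds together are closed under
    differentiation.\<close>
  define F where "F = insert \<psi> {\<lambda>x. m * bump q l (n * (x - a)) - m * bump q l (n * (x - b)) | m q l. True}"
  have "\<exists>g\<in>F. \<forall>x. (f has_real_derivative g x) (at x)" if "f \<in> F" for f
    using that unfolding F_def
  proof (elim insertE)
    assume "f = \<psi>"
    then show "\<exists>g\<in>insert \<psi> {\<lambda>x. m * bump q l (n * (x - a)) - m * bump q l (n * (x - b)) | m q l. True}. \<forall>x. (f has_real_derivative g x) (at x)"
      using der unfolding r
      by (intro bexI[of _ "\<lambda>x. n * bump p k (n * (x - a)) - n * bump p k (n * (x - b))"]) auto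
  next
    assume "f \<in> {\<lambda>x. m * bump q l (n * (x - a)) - m * bump q l (n * (x - b)) | m q l. True}"
    then obtain m q l where f: "f = (\<lambda>x. m * bump q l (n * (x - a)) - m * bump q l (n * (x - b)))" by blast
    obtain q' where q': "\<And>x. (bump q l has_real_derivative bump q' (l + 2) x) (at x)"
      using bump_has_derivative by blast
    have "(f has_real_derivative (m * n) * bump q' (l + 2) (n * (x - a)) - (m * n) * bump q' (l + 2) (n * (x - b))) (at x)" for x
      unfolding f by (rule derivative_eq_intros DERIV_chain2[OF q'] | simp)+
    then show "\<exists>g\<in>insert \<psi> {\<lambda>x. m * bump q l (n * (x - a)) - m * bump q l (n * (x - b)) | m q l. True}. \<forall>x. (f has_real_derivative g x) (at x)"
      by (intro bexI[of _ "\<lambda>x. (m * n) * bump q' (l + 2) (n * (x - a)) - (m * n) * bump q' (l + 2) (n * (x - b))"]) blast+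
  qed
  then have smooth: "(deriv ^^ n) \<psi> field_differentiable at x" for n x
    by (intro higher_deriv_differentiable[of \<psi> F]) (auto simp: F_def)
  show zero: "\<psi> x = 0" if "x \<notin> {a - 1 / n..b + 1 / n}" for x
  proof -
    from that consider "x < a - 1 / n" | "x > b + 1 / n" by fastforce
    then show ?thesis
    proof cases
      case 1
      then have "x < b - 1 / n" using ab by linarith
      with 1 n have "n * (x - a) \<le> -1" "n * (x - b) \<le> -1"
        by (auto simp: field_simps)
      then show ?thesis by (simp add: \<psi>_def R0)
    next
      case 2
      then have "x > a + 1 / n" using ab by linarith
      with 2 n have "n * (x - a) \<ge> 1" "n * (x - b) \<ge> 1"
        by (auto simp: field_simps)
      then show ?thesis by (simp add: \<psi>_def R1)
    qed
  qed
  then have "{x. \<psi> x \<noteq> 0} \<subseteq> {a - 1 / n..b + 1 / n}" by blast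
  then have cl: "closure {x. \<psi> x \<noteq> 0} \<subseteq> {a - 1 / n..b + 1 / n}"
    by (intro closure_minimal) auto
  then have "compact (closure {x. \<psi> x \<noteq> 0})"
    by (meson bounded_closed_interval bounded_subset closed_closure compact_eq_bounded_closed)
  with smooth cl S show "\<psi> \<in> test_functions S"
    unfolding test_functions_def by blast
qed

text \<open>The kernel is the derivative of R (n (x - c)), so its mass over {a..b} is exactly one as
  soon as its support fits in. With positivity, only the oscillation of g on a shrinking
  neighbourhood of c remains.\<close>

lemma mollifier_tendsto:
  fixes R r g :: "real \<Rightarrow> real"
  assumes r: "r = bump p k" and R: "\<And>x. (R has_real_derivative r x) (at x)" and rpos: "\<And>x. r x \<ge> 0"
    and R0: "\<And>x. x \<le> -1 \<Longrightarrow> R x = 0" and R1: "\<And>x. x \<ge> 1 \<Longrightarrow> R x = 1"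
    and g: "continuous_on {a..b} g" and c: "c \<in> {a<..<b}"
  shows "(\<lambda>n. integral {a..b} (\<lambda>x. g x * (real n * r (real n * (x - c))))) \<longlonglongrightarrow> g c"
proof (rule LIMSEQ_I)
  fix e :: real assume e: "e > 0"
  have "continuous (at c within {a..b}) g" using g c by (auto simp: continuous_on_eq_continuous_within)
  then obtain d where d: "d > 0" "\<And>x. x \<in> {a..b} \<Longrightarrow> \<bar>x - c\<bar> < d \<Longrightarrow> \<bar>g x - g c\<bar> < e / 2"
    unfolding continuous_within_eps_delta using e by (metis dist_real_def half_gt_zero)
  define m where "m = Min {d, c - a, b - c}"
  have m: "m > 0" "m \<le> d" "m \<le> c - a" "m \<le> b - c" using c d by (auto simp: m_def)
  obtain N where N: "real N > 1 / m" using reals_Archimedean2 by blast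
  have rc: "continuous_on A r" for A unfolding r by (rule bump_continuous)
  show "\<exists>no. \<forall>n\<ge>no. norm (integral {a..b} (\<lambda>x. g x * (real n * r (real n * (x - c)))) - g c) < e"
  proof (intro exI[of _ N] allI impI)
    fix n assume "n \<ge> N"
    with N have "real n > 1 / m" by linarith
    then have n: "real n > 0" "1 / real n < m" using inverse_less_of_inverse_less[OF m(1)] by blast+
    define \<rho> where "\<rho> = (\<lambda>x. real n * r (real n * (x - c)))"
    have \<rho>c: "continuous_on A \<rho>" for A unfolding \<rho>_def
      by (intro continuous_intros continuous_on_compose2[OF rc[of UNIV]]) auto
    have \<rho>0: "\<rho> x \<ge> 0" for x using rpos by (simp add: \<rho>_def)
    have \<rho>z: "\<rho> x = 0" if "\<bar>x - c\<bar> \<ge> m" for x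
    proof -
      have "real n * \<bar>x - c\<bar> \<ge> real n * m" using that by (simp add: mult_left_mono)
      moreover have "real n * m > 1" using n by (simp add: field_simps)
      ultimately have "\<bar>real n * (x - c)\<bar> \<ge> 1" by (simp add: abs_mult)
      then show ?thesis by (simp add: \<rho>_def r bump_def)
    qed
    have "(\<rho> has_integral R (real n * (b - c)) - R (real n * (a - c))) {a..b}"
    proof (rule fundamental_theorem_of_calculus)
      show "a \<le> b" using c by simp
      have "((\<lambda>x. R (real n * (x - c))) has_real_derivative r (real n * (x - c)) * real n) (at x)" for x
        by (rule DERIV_chain2[OF R]) (auto intro!: derivative_eq_intros)
      from has_field_derivative_at_within[OF this] show "((\<lambda>x. R (real n * (x - c))) has_vector_derivative \<rho> x) (at x within {a..b})" for x
        unfolding has_real_derivative_iff_has_vector_derivative[symmetric] \<rho>_def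
        by (simp add: mult.commute)
    qed
    moreover have "R (real n * (b - c)) = 1" "R (real n * (a - c)) = 0"
    proof -
      have "real n * m > 1" using n by (simp add: field_simps)
      moreover have "real n * m \<le> real n * (b - c)" "real n * m \<le> real n * (c - a)"
        using m by (auto intro!: mult_left_mono)
      ultimately have "real n * (b - c) \<ge> 1" "real n * (a - c) \<le> -1" by (auto simp: algebra_simps)
      then show "R (real n * (b - c)) = 1" "R (real n * (a - c)) = 0" using R0 R1 by auto
    qed
    ultimately have int1: "(\<rho> has_integral 1) {a..b}" by simp
    have "integral {a..b} (\<lambda>x. g x * \<rho> x) - g c = integral {a..b} (\<lambda>x. (g x - g c) * \<rho> x)"
      using int1 g by (subst left_diff_distrib, subst integral_diff)
        (auto intro!: integrable_continuous_real continuous_intros \<rho>c simp: integral_unique)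
    also have "norm \<dots> \<le> integral {a..b} (\<lambda>x. e / 2 * \<rho> x)"
    proof (rule integral_norm_bound_integral)
      show "(\<lambda>x. (g x - g c) * \<rho> x) integrable_on {a..b}" "(\<lambda>x. e / 2 * \<rho> x) integrable_on {a..b}"
        using g by (auto intro!: integrable_continuous_real continuous_intros \<rho>c)
      show "norm ((g x - g c) * \<rho> x) \<le> e / 2 * \<rho> x" if "x \<in> {a..b}" for x
      proof (cases "\<bar>x - c\<bar> < m")
        case True
        then have "\<bar>g x - g c\<bar> \<le> e / 2" using d(2)[OF that] m by simp
        then have "\<bar>g x - g c\<bar> * \<rho> x \<le> e / 2 * \<rho> x" using \<rho>0[of x] by (rule mult_right_mono)
        then show ?thesis using \<rho>0[of x] by (simp add: abs_mult)
      qed (use \<rho>z[of x] in simp)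
    qed
    also have "\<dots> = e / 2" using int1 by (simp add: integral_unique)
    finally show "norm (integral {a..b} (\<lambda>x. g x * (real n * r (real n * (x - c)))) - g c) < e"
      using e by (simp add: \<rho>_def)
  qed
qed

text \<open>Test with smooth plateaus over [a, b]. Their derivatives are mollifiers, which recover g
  a - g b by continuity of g, while the plateaus converge boundedly to the indicator of [a, b] and
  recover the integral of h.\<close>

lemma weak_deriv_FTC:
  fixes g h :: "real \<Rightarrow> real"
  assumes wd: "has_weak_deriv {A<..<B} g h" and g: "continuous_on {A<..<B} g"
    and ab: "A < a" "a \<le> b" "b < B"
  shows "set_integrable lebesgue {a..b} h" "g b - g a = integral {a..b} h"
proof -
  have li: "locally_integrable {A<..<B} h"
    and test: "\<And>\<psi>. \<psi> \<in> test_functions {A<..<B} \<Longrightarrow>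
        (LINT x|lebesgue_on {A<..<B}. g x * deriv \<psi> x) = - (LINT x|lebesgue_on {A<..<B}. h x * \<psi> x)"
    using wd by (auto simp: has_weak_deriv_def)
  have hi: "set_integrable lebesgue {u..v} h" if "A < u" "v < B" for u v
  proof -
    have "{u..v} \<subseteq> {A<..<B}" using that by auto
    then show ?thesis using li unfolding locally_integrable_def by (metis compact_Icc)
  qed
  show "set_integrable lebesgue {a..b} h" using hi ab by blast
  show "g b - g a = integral {a..b} h"
  proof (cases "a = b")
    case False
    then have ab': "a < b" using ab by simp
    obtain R r p k where Rr: "r = bump p k" "\<And>x. (R has_real_derivative r x) (at x)" "\<And>x. r x \<ge> 0"
      "\<And>x. x \<le> -1 \<Longrightarrow> R x = 0" "\<And>x. x \<ge> 1 \<Longrightarrow> R x = 1" "\<And>x. 0 \<le> R x \<and> R x \<le> 1"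
      using smooth_step_exists by metis
    \<comment> \<open>Half the distance to the ends: all plateaus with 1 / n < m are supported in
      the compact \<open>K\<close>, on which h is integrable and can dominate.\<close>
    define m where "m = min (a - A) (B - b) / 2"
    have m: "m > 0" "A < a - m" "b + m < B" using ab by (auto simp: m_def min_def field_simps)
    obtain N where N: "real N > 1 / m" using reals_Archimedean2 by blast
    define K where "K = {a - m..b + m}"
    have K: "K \<subseteq> {A<..<B}" using m by (auto simp: K_def)
    define \<psi> where "\<psi> n = (\<lambda>x. R (real n * (x - a)) - R (real n * (x - b)))" for n
    have big: "real n > 0" "{a - 1 / real n..b + 1 / real n} \<subseteq> K" if "n \<ge> N" for n
    proof -
      have "real n > 1 / m" using N that by linarith
      then have "real n > 0" "1 / real n < m" using inverse_less_of_inverse_less[OF m(1)] by blast+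
      then show "real n > 0" "{a - 1 / real n..b + 1 / real n} \<subseteq> K" by (auto simp: K_def)
    qed
    have \<psi>: "\<psi> n \<in> test_functions {A<..<B}"
      "deriv (\<psi> n) x = real n * r (real n * (x - a)) - real n * r (real n * (x - b))"
      "x \<notin> K \<Longrightarrow> \<psi> n x = 0" if "n \<ge> N" for n x
    proof -
      have sub: "{a - 1 / real n..b + 1 / real n} \<subseteq> {A<..<B}" using big(2)[OF that] K by blast
      show "\<psi> n \<in> test_functions {A<..<B}" unfolding \<psi>_def
        by (rule smooth_cutoff_test_function(1)[OF Rr(1,2)], erule Rr(4), erule Rr(5),
            rule big(1)[OF that], rule ab(2), rule sub)
      show "deriv (\<psi> n) x = real n * r (real n * (x - a)) - real n * r (real n * (x - b))" unfolding \<psi>_def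
        by (rule smooth_cutoff_test_function(2)[OF Rr(1,2)], erule Rr(4), erule Rr(5),
            rule big(1)[OF that], rule ab(2), rule sub)
      assume "x \<notin> K"
      then have x: "x \<notin> {a - 1 / real n..b + 1 / real n}" using big(2)[OF that] by blast
      show "\<psi> n x = 0" unfolding \<psi>_def
        by (rule smooth_cutoff_test_function(3)[OF Rr(1,2)], erule Rr(4), erule Rr(5),
            rule big(1)[OF that], rule ab(2), rule sub, rule x)
    qed
    have gK: "continuous_on {a - m..b + m} g" using continuous_on_subset[OF g K] by (simp add: K_def)
    have rc: "continuous_on X r" for X unfolding Rr(1) by (rule bump_continuous)
    have rzero: "r (real n * (x - a)) = 0" "r (real n * (x - b)) = 0" if "n \<ge> N" "x \<notin> K" for n x
    proof -
      have "x \<notin> {a - 1 / real n..b + 1 / real n}" using big that by blast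
      then have "1 \<le> \<bar>real n * (x - a)\<bar> \<and> 1 \<le> \<bar>real n * (x - b)\<bar>"
      proof (cases "x < a - 1 / real n")
        case True
        then have "x < b - 1 / real n" using ab by linarith
        then have "real n * (x - a) \<le> -1" "real n * (x - b) \<le> -1"
          using True big(1)[OF that(1)] by (auto simp: field_simps)
        then show ?thesis by simp
      next
        case False
        then have x: "x > b + 1 / real n" using \<open>x \<notin> {a - 1 / real n..b + 1 / real n}\<close> by simp
        then have "x > a + 1 / real n" using ab by linarith
        then have "real n * (x - a) \<ge> 1" "real n * (x - b) \<ge> 1"
          using x big(1)[OF that(1)] by (auto simp: field_simps)
        then show ?thesis by simp
      qed
      then show "r (real n * (x - a)) = 0" "r (real n * (x - b)) = 0" by (auto simp: Rr(1) bump_def)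
    qed
    have lhs: "(\<lambda>n. LINT x|lebesgue_on {A<..<B}. g x * deriv (\<psi> n) x) \<longlonglongrightarrow> g a - g b"
    proof -
      have lim: "(\<lambda>n. integral {a - m..b + m} (\<lambda>x. g x * (real n * r (real n * (x - a))))
          - integral {a - m..b + m} (\<lambda>x. g x * (real n * r (real n * (x - b))))) \<longlonglongrightarrow> g a - g b"
        using m ab' by (intro tendsto_diff mollifier_tendsto[OF Rr(1-5) gK]) auto
      have eq: "(LINT x|lebesgue_on {A<..<B}. g x * deriv (\<psi> n) x) =
          integral {a - m..b + m} (\<lambda>x. g x * (real n * r (real n * (x - a))))
          - integral {a - m..b + m} (\<lambda>x. g x * (real n * r (real n * (x - b))))" if "n \<ge> N" for n
      proof -
        have rcc: "continuous_on X (\<lambda>x. r (real n * (x - c)))" for X c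
          by (intro continuous_on_compose2[OF rc[of UNIV]] continuous_intros) auto
        have "(LINT x|lebesgue_on {A<..<B}. g x * deriv (\<psi> n) x) = (LINT x|lebesgue_on K. g x * deriv (\<psi> n) x)"
          by (rule integral_lebesgue_on_compact_support[OF K])
             (auto simp: \<psi>(2)[OF that] rzero that K_def)
        also have "\<dots> = integral {a - m..b + m} (\<lambda>x. g x * deriv (\<psi> n) x)"
          unfolding K_def \<psi>(2)[OF that]
          by (intro integral_lebesgue_on_continuous continuous_intros gK rcc)
        also have "\<dots> = integral {a - m..b + m} (\<lambda>x. g x * (real n * r (real n * (x - a))) - g x * (real n * r (real n * (x - b))))"
          unfolding \<psi>(2)[OF that] by (simp add: algebra_simps)
        also have "\<dots> = integral {a - m..b + m} (\<lambda>x. g x * (real n * r (real n * (x - a))))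
          - integral {a - m..b + m} (\<lambda>x. g x * (real n * r (real n * (x - b))))"
          by (intro integral_diff integrable_continuous_real continuous_intros gK rcc)
        finally show ?thesis .
      qed
      show ?thesis
        by (rule Lim_transform_eventually[OF lim], unfold eventually_sequentially, intro exI[of _ N] allI impI)
           (rule eq[symmetric])
    qed
    have hK: "integrable (lebesgue_on K) h"
      using hi[of "a - m" "b + m"] m by (simp add: K_def set_integrable_iff_integrable_lebesgue_on)
    have rhs: "(\<lambda>n. LINT x|lebesgue_on {A<..<B}. h x * \<psi> n x) \<longlonglongrightarrow> integral {a..b} h"
    proof -
      have "(\<lambda>n. LINT x|lebesgue_on K. h x * \<psi> n x) \<longlonglongrightarrow> (LINT x|lebesgue_on K. h x * indicat_real {a..b} x)"
      proof (rule integral_dominated_convergence[where w="\<lambda>x. 2 * \<bar>h x\<bar>"])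
        have Rc: "continuous_on UNIV R" using DERIV_isCont[OF Rr(2)] by (simp add: continuous_at_imp_continuous_on)
        have "continuous_on X (\<psi> n)" for X n unfolding \<psi>_def
          by (intro continuous_intros continuous_on_compose2[OF Rc]) auto
        then have "\<psi> n \<in> borel_measurable (lebesgue_on K)" for n
          by (intro continuous_imp_measurable_on_sets_lebesgue) (auto simp: K_def)
        then show "(\<lambda>x. h x * \<psi> n x) \<in> borel_measurable (lebesgue_on K)" for n
          using hK by auto
        show "(\<lambda>x. h x * indicat_real {a..b} x) \<in> borel_measurable (lebesgue_on K)"
        proof (rule borel_measurable_times)
          show "h \<in> borel_measurable (lebesgue_on K)" using hK by auto
          show "indicat_real {a..b} \<in> borel_measurable (lebesgue_on K)"
            by (rule borel_measurable_indicator) (simp add: sets_restrict_space_iff K_def m less_imp_le)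
        qed
        show "AE x in lebesgue_on K. norm (h x * \<psi> n x) \<le> 2 * \<bar>h x\<bar>" for n
        proof (rule AE_I2)
          fix x
          have "\<bar>\<psi> n x\<bar> \<le> 2" using Rr(6)[of "real n * (x - a)"] Rr(6)[of "real n * (x - b)"] unfolding \<psi>_def abs_le_iff by linarith
          then have "\<bar>h x\<bar> * \<bar>\<psi> n x\<bar> \<le> \<bar>h x\<bar> * 2" by (intro mult_left_mono) auto
          then show "norm (h x * \<psi> n x) \<le> 2 * \<bar>h x\<bar>" by (simp add: abs_mult)
        qed
        \<comment> \<open>At a and b the plateaus converge to R 0 and 1 - R 0, which need not match
          the indicator, so these two points are discarded.\<close>
        have "AE x in lebesgue. x \<notin> {a, b}"
          by (intro AE_not_in) (simp add: negligible_iff_null_sets[symmetric])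
        then have "AE x in lebesgue. x \<noteq> a \<and> x \<noteq> b" by simp
        then have "AE x in lebesgue_on K. x \<noteq> a \<and> x \<noteq> b"
          by (subst AE_restrict_space_iff) (auto simp: K_def)
        then show "AE x in lebesgue_on K. (\<lambda>n. h x * \<psi> n x) \<longlonglongrightarrow> h x * indicat_real {a..b} x"
        proof (rule AE_mp, intro AE_I2 impI)
          fix x assume x: "x \<noteq> a \<and> x \<noteq> b"
          have Rlim: "(\<lambda>n. R (real n * (x - c))) \<longlonglongrightarrow> (if x < c then 0 else 1)" if "x \<noteq> c" for c
          proof (rule tendsto_eventually)
            obtain M where M: "real M > 1 / \<bar>x - c\<bar>" using reals_Archimedean2 by blast
            have "R (real n * (x - c)) = (if x < c then 0 else 1)" if "n \<ge> M" for n
            proof -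
              have "real n > 1 / \<bar>x - c\<bar>" using that M by linarith
              then have *: "real n * \<bar>x - c\<bar> > 1" using \<open>x \<noteq> c\<close> by (simp add: field_simps)
              show ?thesis
              proof (cases "x < c")
                case True
                then have "real n * (x - c) \<le> -1" using * by (simp add: algebra_simps)
                then show ?thesis using True Rr(4) by simp
              next
                case False
                then have "real n * (x - c) \<ge> 1" using * by simp
                then show ?thesis using False Rr(5) by simp
              qed
            qed
            then show "\<forall>\<^sub>F n in sequentially. R (real n * (x - c)) = (if x < c then 0 else 1)"
              unfolding eventually_sequentially by blast
          qed
          have "(\<lambda>n. \<psi> n x) \<longlonglongrightarrow> (if x < a then 0 else 1) - (if x < b then 0 else 1)"
            unfolding \<psi>_def using x by (intro tendsto_diff Rlim) auto
          moreover have "(if x < a then 0 else 1) - (if x < b then 0 else 1) = indicat_real {a..b} x"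
            using x ab' by (auto simp: indicator_def)
          ultimately show "(\<lambda>n. h x * \<psi> n x) \<longlonglongrightarrow> h x * indicat_real {a..b} x"
            by (intro tendsto_mult tendsto_const) simp
        qed
      qed (use hK in auto)
      moreover have "(LINT x|lebesgue_on K. h x * indicat_real {a..b} x) = integral {a..b} h"
      proof -
        have "(LINT x|lebesgue_on K. h x * indicat_real {a..b} x) = (LINT x|lebesgue_on K. (if x \<in> {a..b} then h x else 0))"
          by (intro Bochner_Integration.integral_cong) (auto simp: indicator_def)
        also have "\<dots> = integral\<^sup>L (lebesgue_on {a..b}) h"
          by (intro integral_restrict) (use m in \<open>auto simp: K_def\<close>)
        also have "\<dots> = integral {a..b} h"
          using hi[of a b] ab by (intro lebesgue_integral_eq_integral) (auto simp: set_integrable_iff_integrable_lebesgue_on)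
        finally show ?thesis .
      qed
      ultimately have lim: "(\<lambda>n. LINT x|lebesgue_on K. h x * \<psi> n x) \<longlonglongrightarrow> integral {a..b} h"
        by simp
      have eq: "(LINT x|lebesgue_on {A<..<B}. h x * \<psi> n x) = (LINT x|lebesgue_on K. h x * \<psi> n x)" if "n \<ge> N" for n
        by (rule integral_lebesgue_on_compact_support[OF K]) (auto simp: \<psi>(3)[OF that] K_def)
      show ?thesis
        by (rule Lim_transform_eventually[OF lim], unfold eventually_sequentially, intro exI[of _ N] allI impI)
           (rule eq[symmetric])
    qed
    have "(\<lambda>n. LINT x|lebesgue_on {A<..<B}. g x * deriv (\<psi> n) x) \<longlonglongrightarrow> - integral {a..b} h"
    proof (rule Lim_transform_eventually[OF tendsto_minus[OF rhs]])
      show "\<forall>\<^sub>F n in sequentially. - (LINT x|lebesgue_on {A<..<B}. h x * \<psi> n x) = (LINT x|lebesgue_on {A<..<B}. g x * deriv (\<psi> n) x)"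
        unfolding eventually_sequentially by (intro exI[of _ N] allI impI) (simp add: test \<psi>(1))
    qed
    with lhs have "g a - g b = - integral {a..b} h" using LIMSEQ_unique by blast
    then show ?thesis by simp
  qed simp
qed

section \<open>Square integrable functions\<close>

definition square_integrable :: "'a measure \<Rightarrow> ('a \<Rightarrow> real) set" where
  "square_integrable M = {f \<in> borel_measurable M. integrable M (\<lambda>x. (f x)\<^sup>2)}"

definition L2_norm_on :: "'a measure \<Rightarrow> ('a \<Rightarrow> real) \<Rightarrow> real" where
  "L2_norm_on M f = sqrt (LINT x|M. (f x)\<^sup>2)"

lemma abs_powr_2: "\<bar>x::real\<bar> powr 2 = x\<^sup>2"
  by (cases "x = 0") auto

lemma Lp_space_2: "Lp_space 2 S = square_integrable (lebesgue_on S)"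
  by (auto simp: Lp_space_def square_integrable_def abs_powr_2)

lemma Lp_norm_2: "Lp_norm 2 S f = L2_norm_on (lebesgue_on S) f"
  by (simp add: Lp_norm_def L2_norm_on_def abs_powr_2 powr_half_sqrt integral_nonneg_AE)

lemma square_integrableD:
  assumes "f \<in> square_integrable M"
  shows "f \<in> borel_measurable M" "integrable M (\<lambda>x. (f x)\<^sup>2)"
  using assms by (auto simp: square_integrable_def)

lemma square_integrable_mult:
  assumes "f \<in> square_integrable M" "g \<in> square_integrable M"
  shows "integrable M (\<lambda>x. f x * g x)"
proof (rule Bochner_Integration.integrable_bound)
  show "integrable M (\<lambda>x. (f x)\<^sup>2 + (g x)\<^sup>2)"
    using assms by (auto simp: square_integrable_def)
  show "(\<lambda>x. f x * g x) \<in> borel_measurable M"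
    using assms by (auto simp: square_integrable_def)
  have "\<bar>a * b\<bar> \<le> a\<^sup>2 + b\<^sup>2" for a b :: real
  proof -
    have "2 * (\<bar>a\<bar> * \<bar>b\<bar>) \<le> a\<^sup>2 + b\<^sup>2"
      using sum_squares_bound[of "\<bar>a\<bar>" "\<bar>b\<bar>"] by (simp add: mult.assoc)
    moreover have "0 \<le> \<bar>a\<bar> * \<bar>b\<bar>" by simp
    ultimately show ?thesis unfolding abs_mult by linarith
  qed
  then show "AE x in M. norm (f x * g x) \<le> norm ((f x)\<^sup>2 + (g x)\<^sup>2)"
    by (auto simp: real_norm_def intro!: order_trans[OF _ abs_ge_self])
qed

lemma square_integrable_add:
  assumes "f \<in> square_integrable M" "g \<in> square_integrable M"
  shows "(\<lambda>x. f x + g x) \<in> square_integrable M"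
  using assms square_integrable_mult[OF assms]
  by (auto simp: square_integrable_def power2_sum mult.assoc)

lemma square_integrable_cmult:
  assumes "f \<in> square_integrable M"
  shows "(\<lambda>x. c * f x) \<in> square_integrable M"
  using assms by (auto simp: square_integrable_def power_mult_distrib)

lemma square_integrable_diff:
  assumes "f \<in> square_integrable M" "g \<in> square_integrable M"
  shows "(\<lambda>x. f x - g x) \<in> square_integrable M" "f - g \<in> square_integrable M"
proof -
  show "(\<lambda>x. f x - g x) \<in> square_integrable M"
    using square_integrable_add[OF assms(1) square_integrable_cmult[OF assms(2), of "-1"]] by simp
  then show "f - g \<in> square_integrable M" by (simp add: fun_diff_def)
qed

lemma square_integrable_zero: "(\<lambda>_. 0) \<in> square_integrable M"
  by (simp add: square_integrable_def)

lemma L2_norm_on_nonneg: "L2_norm_on M f \<ge> 0"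
  by (simp add: L2_norm_on_def integral_nonneg_AE)

lemma L2_norm_on_sq: "(L2_norm_on M f)\<^sup>2 = (LINT x|M. (f x)\<^sup>2)"
  by (simp add: L2_norm_on_def integral_nonneg_AE)

lemma L2_Cauchy_Schwarz:
  assumes "f \<in> square_integrable M" "g \<in> square_integrable M"
  shows "\<bar>LINT x|M. f x * g x\<bar> \<le> L2_norm_on M f * L2_norm_on M g"
proof -
  define a b c where "a = (LINT x|M. (f x)\<^sup>2)" and "b = (LINT x|M. f x * g x)" and "c = (LINT x|M. (g x)\<^sup>2)"
  have quad: "0 \<le> a - 2 * t * b + t\<^sup>2 * c" for t
  proof -
    have "(LINT x|M. (f x - t * g x)\<^sup>2) = (LINT x|M. (f x)\<^sup>2 - 2 * t * (f x * g x) + t\<^sup>2 * (g x)\<^sup>2)"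
      by (intro Bochner_Integration.integral_cong) (auto simp: power2_eq_square algebra_simps)
    also have "\<dots> = a - 2 * t * b + t\<^sup>2 * c"
      unfolding a_def b_def c_def using assms square_integrable_mult[OF assms]
      by (simp add: square_integrableD)
    finally show ?thesis using integral_nonneg_AE[where M=M and f="\<lambda>x. (f x - t * g x)\<^sup>2"] by simp
  qed
  have c: "c \<ge> 0" unfolding c_def by (simp add: integral_nonneg_AE)
  have "b\<^sup>2 \<le> a * c"
  proof (cases "c = 0")
    case True
    have "b = 0"
    proof (rule ccontr)
      assume "b \<noteq> 0"
      \<comment> \<open>For c = 0 the quadratic is affine in t; a nonzero slope is refuted at the t
        where the value would be -1.\<close>
      then have "a - 2 * ((a + 1) / (2 * b)) * b = - 1" by (simp add: field_simps)
      with quad[of "(a + 1) / (2 * b)"] True show False by simp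
    qed
    then show ?thesis using True by simp
  next
    case False
    then have "0 \<le> (a - 2 * (b / c) * b + (b / c)\<^sup>2 * c) * c" using quad[of "b / c"] c by simp
    also have "\<dots> = a * c - b\<^sup>2" using False by (simp add: field_simps power2_eq_square)
    finally show ?thesis by simp
  qed
  then have "sqrt (b\<^sup>2) \<le> sqrt (a * c)" by (rule real_sqrt_le_mono)
  then show ?thesis by (simp add: L2_norm_on_def real_sqrt_mult a_def b_def c_def)
qed

lemma L2_norm_on_triangle:
  assumes "f \<in> square_integrable M" "g \<in> square_integrable M"
  shows "L2_norm_on M (\<lambda>x. f x + g x) \<le> L2_norm_on M f + L2_norm_on M g"
proof -
  have "(L2_norm_on M (\<lambda>x. f x + g x))\<^sup>2 = (LINT x|M. (f x)\<^sup>2 + (g x)\<^sup>2 + 2 * (f x * g x))"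
    unfolding L2_norm_on_sq by (simp add: power2_sum mult.assoc)
  also have "\<dots> = (L2_norm_on M f)\<^sup>2 + (L2_norm_on M g)\<^sup>2 + 2 * (LINT x|M. f x * g x)"
    unfolding L2_norm_on_sq using assms square_integrable_mult[OF assms] by (simp add: square_integrableD)
  also have "\<dots> \<le> (L2_norm_on M f)\<^sup>2 + (L2_norm_on M g)\<^sup>2 + 2 * (L2_norm_on M f * L2_norm_on M g)"
    using L2_Cauchy_Schwarz[OF assms] by simp
  also have "\<dots> = (L2_norm_on M f + L2_norm_on M g)\<^sup>2" by (simp add: power2_sum)
  finally show ?thesis
    by (rule power2_le_imp_le) (simp add: L2_norm_on_nonneg)
qed

lemma L2_norm_on_triangle_diff:
  assumes "f \<in> square_integrable M" "g \<in> square_integrable M"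
  shows "\<bar>L2_norm_on M f - L2_norm_on M g\<bar> \<le> L2_norm_on M (\<lambda>x. f x - g x)"
proof -
  have sym: "L2_norm_on M (\<lambda>x. g x - f x) = L2_norm_on M (\<lambda>x. f x - g x)"
    unfolding L2_norm_on_def by (simp add: power2_commute)
  show ?thesis
    using L2_norm_on_triangle[OF square_integrable_diff(1)[OF assms] assms(2)]
      L2_norm_on_triangle[OF square_integrable_diff(1)[OF assms(2,1)] assms(1)]
    by (simp add: sym)
qed

lemma L2_norm_on_cong_AE:
  assumes "AE x in M. f x = g x" "f \<in> borel_measurable M" "g \<in> borel_measurable M"
  shows "L2_norm_on M f = L2_norm_on M g"
  unfolding L2_norm_on_def using assms
  by (intro arg_cong[where f=sqrt] integral_cong_AE) auto

text \<open>Completeness of Lebesgue measure, passed to the restriction by extending with zero. Weak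
  derivatives are known only up to null sets, so their measurability has to be inherited from a
  measurable representative.\<close>

lemma borel_measurable_lebesgue_on_AE:
  fixes f g :: "real \<Rightarrow> real"
  assumes f: "f \<in> borel_measurable (lebesgue_on S)" and S: "S \<in> sets lebesgue"
    and eq: "AE x in lebesgue_on S. f x = g x"
  shows "g \<in> borel_measurable (lebesgue_on S)"
proof -
  have "(\<lambda>x. if x \<in> S then f x else 0) \<in> borel_measurable lebesgue"
    using f S by (simp add: borel_measurable_if)
  moreover have "AE x in lebesgue. (if x \<in> S then f x else 0) = (if x \<in> S then g x else 0)"
    using eq S by (subst (asm) AE_restrict_space_iff) auto
  ultimately have "(\<lambda>x. if x \<in> S then g x else 0) \<in> borel_measurable lebesgue"
    by (rule borel_measurable_AE)
  then show ?thesis using S by (simp add: borel_measurable_if)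
qed

lemma borel_measurable_lebesgue_on_LIMSEQ_AE:
  fixes f :: "nat \<Rightarrow> real \<Rightarrow> real"
  assumes f: "\<And>n. f n \<in> borel_measurable (lebesgue_on S)" and S: "S \<in> sets lebesgue"
    and lim: "AE x in lebesgue_on S. (\<lambda>n. f n x) \<longlonglongrightarrow> g x"
  shows "g \<in> borel_measurable (lebesgue_on S)"
proof (rule borel_measurable_lebesgue_on_AE[OF _ S])
  show "(\<lambda>x. lim (\<lambda>n. f n x)) \<in> borel_measurable (lebesgue_on S)"
    using f by (rule borel_measurable_lim_metric)
  show "AE x in lebesgue_on S. lim (\<lambda>n. f n x) = g x"
    using lim by (rule AE_mp) (auto intro!: AE_I2 limI)
qed

text \<open>Half-lines form an intersection-stable generator of the Borel sets, so vanishing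
  integrals over them spread to all Borel sets, and a density with vanishing integrals is zero
  almost everywhere. The detour through a Borel version \<open>G\<close> is taken because the
  Lebesgue sets are not generated by half-lines.\<close>

lemma AE_zero_of_interval_integrals:
  fixes f :: "real \<Rightarrow> real"
  assumes f: "set_integrable lebesgue {a..b} f"
    and zero: "\<And>d. a \<le> d \<Longrightarrow> d \<le> b \<Longrightarrow> integral {a..d} f = 0"
  shows "AE x in lebesgue. x \<in> {a..b} \<longrightarrow> f x = 0"
proof (cases "a \<le> b")
  case True
  define F where "F = (\<lambda>x. indicat_real {a..b} x * f x)"
  have F: "integrable lebesgue F" using f by (simp add: F_def set_integrable_def)
  then obtain G where G: "G \<in> borel_measurable lborel" "AE x in lborel. F x = G x"
    using completion_ex_borel_measurable_real by blast
  have AE: "AE x in lebesgue. F x = G x" by (rule AE_completion[OF G(2)])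
  have Gl: "G \<in> borel_measurable lebesgue" using G(1) by (rule measurable_completion)
  have "integrable lebesgue G"
    using F AE Gl by (subst integrable_cong_AE[of G lebesgue F]) auto
  then have Gi: "integrable lborel G" using integrable_completion G(1) by blast
  have eqF: "(LINT x:A|lborel. G x) = (LINT x:A|lebesgue. F x)" if "A \<in> sets borel" for A
  proof -
    have "(LINT x:A|lborel. G x) = (LINT x:A|lebesgue. G x)"
      unfolding set_lebesgue_integral_def using that G(1)
      by (intro integral_completion[symmetric] borel_measurable_scaleR) auto
    also have "\<dots> = (LINT x:A|lebesgue. F x)"
    proof -
      have ind: "indicat_real A \<in> borel_measurable lebesgue"
        by (rule borel_measurable_indicator) (use that in simp)
      have "F \<in> borel_measurable lebesgue" using F by simp
      with ind Gl AE show ?thesis unfolding set_lebesgue_integral_def real_scaleR_def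
        by (intro integral_cong_AE borel_measurable_times) auto
    qed
    finally show ?thesis .
  qed
  have half: "(LINT x:{..d}|lborel. G x) = 0" for d
  proof -
    have "(LINT x:{..d}|lborel. G x) = (LINT x:{..d}|lebesgue. F x)" by (rule eqF) simp
    also have "\<dots> = (LINT x:{a..min b d}|lebesgue. f x)"
      unfolding set_lebesgue_integral_def
      by (intro Bochner_Integration.integral_cong) (auto simp: F_def indicator_def)
    also have "\<dots> = 0"
    proof (cases "a \<le> d")
      case True
      then show ?thesis
        using zero[of "min b d"] \<open>a \<le> b\<close>
        by (subst set_lebesgue_integral_eq_integral) (auto intro: set_integrable_subset[OF f])
    qed (simp add: set_lebesgue_integral_def)
    finally show ?thesis .
  qed
  have Gs: "set_integrable lborel A G" if "A \<in> sets borel" for A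
    unfolding set_integrable_def by (rule integrable_mult_indicator[OF _ Gi]) (use that in simp)
  \<comment> \<open>The total integral must vanish for the complement step of the induction over the
    generated sigma-algebra.\<close>
  have tot: "(LINT x:UNIV|lborel. G x) = 0"
  proof -
    have "(LINT x:UNIV|lborel. G x) = (LINT x:{..b}|lborel. G x)"
      using eqF[of UNIV] eqF[of "{..b}"] unfolding set_lebesgue_integral_def
      by (auto intro!: Bochner_Integration.integral_cong simp: F_def indicator_def)
    then show ?thesis using half by simp
  qed
  have "(LINT x:A|lborel. G x) = 0" if "A \<in> sets lborel" for A
  proof -
    have "Int_stable (range (atMost :: real \<Rightarrow> _))"
      by (auto simp: Int_stable_def)
    moreover have "range (atMost :: real \<Rightarrow> _) \<subseteq> Pow UNIV" by simp
    moreover have "A \<in> sigma_sets UNIV (range atMost)"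
      using that by (simp add: borel_eq_atMost)
    ultimately show ?thesis
    proof (induction rule: sigma_sets_induct_disjoint)
      case (compl A)
      then have A: "A \<in> sets borel" by (simp add: borel_eq_atMost)
      have "(LINT x:UNIV|lborel. G x) = (LINT x:A \<union> (UNIV - A)|lborel. G x)" by simp
      also have "\<dots> = (LINT x:A|lborel. G x) + (LINT x:UNIV - A|lborel. G x)"
        using A by (intro set_integral_Un Gs) auto
      finally show ?case using tot compl by simp
    next
      case (union A)
      then have A: "A i \<in> sets borel" for i by (auto simp: borel_eq_atMost)
      have "(LINT x:(\<Union>i. A i)|lborel. G x) = (\<Sum>i. (LINT x:(A i)|lborel. G x))"
        using A union(1) by (intro lebesgue_integral_countable_add Gs) (auto simp: disjoint_family_on_def)
      then show ?case using union by simp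
    next
      case empty
      show ?case by (simp add: set_lebesgue_integral_def)
    qed (auto simp: half)
  qed
  then have "AE x in lborel. G x = 0" by (rule sigma_finite_measure.density_zero[OF lborel.sigma_finite_measure_axioms Gi])
  then have "AE x in lebesgue. G x = 0" by (rule AE_completion)
  with AE show ?thesis by eventually_elim (auto simp: F_def)
qed simp

text \<open>Increments bounded by e times those of one fixed V sum up, over a fine partition, to e
  (V b - V a), for every e. This replaces differentiation almost everywhere in the product rules
  below: there V is the primitive of an integrable majorant, and f is a product minus the primitive
  of its expected derivative.\<close>

lemma constant_of_small_increments:
  fixes f V :: "real \<Rightarrow> real"
  assumes ab: "a \<le> b"
    and small: "\<And>e. e > 0 \<Longrightarrow> \<exists>d>0. \<forall>x\<in>{a..b}. \<forall>y\<in>{a..b}. x \<le> y \<and> y - x < d \<longrightarrow> \<bar>f y - f x\<bar> \<le> e * (V y - V x)"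
  shows "f b = f a"
proof (rule ccontr)
  assume ne: "f b \<noteq> f a"
  have "0 < \<bar>V b - V a\<bar> + 1" by (rule add_nonneg_pos) auto
  then have pos: "0 < 2 * (\<bar>V b - V a\<bar> + 1)" by (rule mult_pos_pos[rotated]) simp
  \<comment> \<open>Chosen so that |f b - f a| = 2 e (|V b - V a| + 1), which strictly exceeds the
    bound e (V b - V a) obtained from the partition.\<close>
  define e where "e = \<bar>f b - f a\<bar> / (2 * (\<bar>V b - V a\<bar> + 1))"
  have e: "e > 0" unfolding e_def using ne pos by (intro divide_pos_pos) auto
  from small[OF this] obtain d where d: "d > 0"
    "\<And>x y. x \<in> {a..b} \<Longrightarrow> y \<in> {a..b} \<Longrightarrow> x \<le> y \<Longrightarrow> y - x < d \<Longrightarrow> \<bar>f y - f x\<bar> \<le> e * (V y - V x)"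
    by blast
  obtain n :: nat where n: "real n > (b - a) / d" using reals_Archimedean2 by blast
  have npos: "real n > 0" using n ab d by (smt (verit) divide_nonneg_pos)
  define h where "h = (b - a) / real n"
  define x where "x i = a + real i * h" for i
  have h0: "h \<ge> 0" using ab npos by (simp add: h_def)
  have step: "x (Suc i) - x i = h" for i
    by (simp add: x_def distrib_right)
  have small': "h < d" using n d npos by (simp add: h_def field_simps)
  have mem: "x i \<in> {a..b}" if "i \<le> n" for i
  proof -
    have "real i * h \<le> real n * h"
      using that h0 by (intro mult_right_mono) auto
    then have "real i * h \<le> b - a" using npos by (simp add: h_def)
    then show ?thesis using h0 by (simp add: x_def)
  qed
  have "\<bar>f (x k) - f (x 0)\<bar> \<le> e * (V (x k) - V (x 0))" if "k \<le> n" for k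
    using that
  proof (induction k)
    case (Suc k)
    have "\<bar>f (x (Suc k)) - f (x k)\<bar> \<le> e * (V (x (Suc k)) - V (x k))"
      using mem[of k] mem[of "Suc k"] Suc.prems step[of k] small' h0
      by (intro d(2)) auto
    with Suc show ?case by (simp add: algebra_simps)
  qed simp
  from this[of n] have "\<bar>f b - f a\<bar> \<le> e * (V b - V a)" using npos by (simp add: x_def h_def)
  also have "\<dots> \<le> e * \<bar>V b - V a\<bar>" using e by (intro mult_left_mono) auto
  also have "\<dots> < e * (2 * (\<bar>V b - V a\<bar> + 1))" using e by (intro mult_strict_left_mono) auto
  also have "\<dots> = \<bar>f b - f a\<bar>" by (metis pos e_def nonzero_eq_divide_eq less_irrefl)
  finally show False by simp
qed

section \<open>Uniqueness of weak derivatives\<close>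

lemma test_function_support:
  assumes \<psi>: "\<psi> \<in> test_functions {A<..<B}" and AB: "A < B"
  obtains a b where "A < a" "a < b" "b < B" "\<And>x. x \<notin> {a<..<b} \<Longrightarrow> \<psi> x = 0" "\<And>x. x \<notin> {a<..<b} \<Longrightarrow> deriv \<psi> x = 0"
proof -
  \<comment> \<open>The midpoint keeps \<open>K\<close> nonempty even when \<open>\<psi>\<close> is
    zero.\<close>
  define K where "K = insert ((A + B) / 2) (closure {x. \<psi> x \<noteq> 0})"
  have K: "compact K" "K \<noteq> {}" "K \<subseteq> {A<..<B}"
    using \<psi> AB by (auto simp: test_functions_def K_def)
  obtain m where m: "m \<in> K" "\<And>x. x \<in> K \<Longrightarrow> m \<le> x" using compact_attains_inf[OF K(1,2)] by blast
  obtain n where n: "n \<in> K" "\<And>x. x \<in> K \<Longrightarrow> x \<le> n" using compact_attains_sup[OF K(1,2)] by blast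
  \<comment> \<open>The gap to the support puts every x outside (a, b) into an open set on which
    \<open>\<psi>\<close> is zero, so the derivative is zero there as well.\<close>
  define a b where "a = (A + m) / 2" and "b = (n + B) / 2"
  have mn: "A < m" "m \<le> n" "n < B" using m n K(3) by auto
  have z: "\<psi> x = 0" if "x \<notin> {m..n}" for x
  proof (rule ccontr)
    assume "\<psi> x \<noteq> 0"
    then have "x \<in> closure {x. \<psi> x \<noteq> 0}" using closure_subset[of "{x. \<psi> x \<noteq> 0}"] by auto
    then have "x \<in> K" by (simp add: K_def)
    with m n that show False by auto
  qed
  have "deriv \<psi> x = 0" if "x \<notin> {a<..<b}" for x
  proof -
    have "x \<in> - {m..n}" using that mn by (auto simp: a_def b_def)
    then have "\<forall>\<^sub>F y in nhds x. \<psi> y = (\<lambda>_. 0) y"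
      by (intro eventually_mono[OF eventually_nhds_in_open[of "- {m..n}" x]]) (auto simp: z)
    then have "deriv \<psi> x = deriv (\<lambda>_. 0) x" by (rule deriv_cong_ev) simp
    then show ?thesis by simp
  qed
  with z mn show ?thesis by (intro that[of a b]) (auto simp: a_def b_def)
qed

lemma test_function_derivative:
  assumes "\<psi> \<in> test_functions S"
  shows "(\<psi> has_real_derivative deriv \<psi> x) (at x)" "continuous_on X (deriv \<psi>)" "continuous_on X \<psi>"
proof -
  have *: "(deriv ^^ n) \<psi> field_differentiable at x" for n x using assms by (simp add: test_functions_def)
  from *[of 0] show "(\<psi> has_real_derivative deriv \<psi> x) (at x)"
    by (simp add: DERIV_deriv_iff_field_differentiable)
  from *[of 1] have "isCont (deriv \<psi>) x" for x
    by (simp add: field_differentiable_imp_continuous_at)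
  then show "continuous_on X (deriv \<psi>)" by (simp add: continuous_at_imp_continuous_on)
  from *[of 0] have "isCont \<psi> x" for x
    by (simp add: field_differentiable_imp_continuous_at)
  then show "continuous_on X \<psi>" by (simp add: continuous_at_imp_continuous_on)
qed

lemma locally_integrable_mult_integrable:
  assumes f: "locally_integrable {A<..<B} f" and ab: "A < a" "b < B"
    and h: "continuous_on {a..b} h" "\<And>x. x \<notin> {a<..<b} \<Longrightarrow> h x = 0"
  shows "integrable (lebesgue_on {A<..<B}) (\<lambda>x. f x * h x)"
proof -
  have "{a..b} \<subseteq> {A<..<B}" using ab by auto
  then have fi: "set_integrable lebesgue {a..b} f" using f by (auto simp: locally_integrable_def)
  have "(\<lambda>x. h x * f x) absolutely_integrable_on {a..b}"
  proof (rule absolutely_integrable_bounded_measurable_product_real[OF _ _ _ fi])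
    show "h \<in> borel_measurable (lebesgue_on {a..b})"
      by (intro continuous_imp_measurable_on_sets_lebesgue h) simp
    show "bounded (h ` {a..b})"
      by (intro compact_imp_bounded compact_continuous_image h) simp
  qed simp
  moreover have "(\<lambda>x. indicat_real {a..b} x *\<^sub>R (h x * f x)) = (\<lambda>x. indicat_real {A<..<B} x *\<^sub>R (f x * h x))"
  proof
    fix x
    show "indicat_real {a..b} x *\<^sub>R (h x * f x) = indicat_real {A<..<B} x *\<^sub>R (f x * h x)"
      by (cases "x \<in> {a<..<b}") (use ab h(2)[of x] in \<open>auto simp: indicator_def\<close>)
  qed
  ultimately have "set_integrable lebesgue {A<..<B} (\<lambda>x. f x * h x)"
    by (simp only: set_integrable_def)
  then show ?thesis by (simp add: set_integrable_iff_integrable_lebesgue_on)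
qed

lemma integrable_imp_locally_integrable:
  assumes f: "integrable (lebesgue_on S) f" and S: "S \<in> sets lebesgue"
  shows "locally_integrable S f"
  unfolding locally_integrable_def
proof (intro allI impI)
  fix K assume K: "compact K \<and> K \<subseteq> S"
  have "set_integrable lebesgue S f" using f S by (simp add: set_integrable_iff_integrable_lebesgue_on)
  then show "set_integrable lebesgue K f"
    by (rule set_integrable_subset) (use K in \<open>auto intro: lmeasurable_compact fmeasurableD\<close>)
qed

lemma continuous_imp_locally_integrable:
  assumes f: "continuous_on S (f :: real \<Rightarrow> real)"
  shows "locally_integrable S f"
  unfolding locally_integrable_def
proof (intro allI impI)
  fix K assume K: "compact K \<and> K \<subseteq> S"
  then have cf: "continuous_on K f" using f continuous_on_subset by blast
  have Kl: "K \<in> lmeasurable" using K lmeasurable_compact by blast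
  have "f \<in> borel_measurable (lebesgue_on K)"
    using cf Kl by (intro continuous_imp_measurable_on_sets_lebesgue) auto
  moreover have "bounded (f ` K)" using K cf compact_continuous_image compact_imp_bounded by blast
  moreover have "(\<lambda>_. 1::real) absolutely_integrable_on K"
    using Kl by (simp add: absolutely_integrable_on_const)
  ultimately have "(\<lambda>x. f x * 1) absolutely_integrable_on K"
    using absolutely_integrable_bounded_measurable_product_real[of f K "\<lambda>_. 1"] fmeasurableD[OF Kl] by blast
  then show "set_integrable lebesgue K f" by simp
qed

text \<open>Integration by parts on a compact interval around the support; the boundary terms vanish
  with the test function. This is how the constructed flow enters the weak setting.\<close>

lemma has_weak_deriv_continuous_derivative:
  assumes AB: "A < B" and u: "\<And>x. x \<in> {A<..<B} \<Longrightarrow> (u has_real_derivative g x) (at x)"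
    and g: "continuous_on {A<..<B} g"
  shows "has_weak_deriv {A<..<B} u g"
  unfolding has_weak_deriv_def
proof (intro conjI ballI)
  have uc: "continuous_on {A<..<B} u"
    by (intro continuous_at_imp_continuous_on ballI) (rule DERIV_isCont[OF u])
  show "locally_integrable {A<..<B} u" "locally_integrable {A<..<B} g"
    using uc g by (auto intro: continuous_imp_locally_integrable)
  fix \<psi> assume \<psi>: "\<psi> \<in> test_functions {A<..<B}"
  obtain a b where ab: "A < a" "a < b" "b < B" and z: "\<And>x. x \<notin> {a<..<b} \<Longrightarrow> \<psi> x = 0"
    "\<And>x. x \<notin> {a<..<b} \<Longrightarrow> deriv \<psi> x = 0"
    using test_function_support[OF \<psi> AB] by metis
  have sub: "{a..b} \<subseteq> {A<..<B}" using ab by auto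
  have c: "continuous_on {a..b} u" "continuous_on {a..b} g" "continuous_on {a..b} \<psi>" "continuous_on {a..b} (deriv \<psi>)"
    using uc g continuous_on_subset sub test_function_derivative[OF \<psi>] by blast+
  have "((\<lambda>x. u x * deriv \<psi> x + g x * \<psi> x) has_integral u b * \<psi> b - u a * \<psi> a) {a..b}"
  proof (rule fundamental_theorem_of_calculus)
    fix x assume x: "x \<in> {a..b}"
    have "((\<lambda>x. u x * \<psi> x) has_real_derivative u x * deriv \<psi> x + g x * \<psi> x) (at x)"
      using u[of x] test_function_derivative(1)[OF \<psi>, of x] x ab
      by (auto intro!: derivative_eq_intros)
    then show "((\<lambda>x. u x * \<psi> x) has_vector_derivative u x * deriv \<psi> x + g x * \<psi> x) (at x within {a..b})"
      unfolding has_real_derivative_iff_has_vector_derivative[symmetric] by (rule has_field_derivative_at_within)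
  qed (use ab in simp)
  then have "integral {a..b} (\<lambda>x. u x * deriv \<psi> x + g x * \<psi> x) = 0"
    using z(1)[of a] z(1)[of b] by (simp add: integral_unique)
  moreover have "integral {a..b} (\<lambda>x. u x * deriv \<psi> x + g x * \<psi> x) =
      integral {a..b} (\<lambda>x. u x * deriv \<psi> x) + integral {a..b} (\<lambda>x. g x * \<psi> x)"
    by (intro Henstock_Kurzweil_Integration.integral_add integrable_continuous_real continuous_intros c)
  moreover have "(LINT x|lebesgue_on {A<..<B}. u x * deriv \<psi> x) = integral {a..b} (\<lambda>x. u x * deriv \<psi> x)"
    by (subst integral_lebesgue_on_compact_support[OF sub])
       (auto intro!: z integral_lebesgue_on_continuous continuous_intros c)
  moreover have "(LINT x|lebesgue_on {A<..<B}. g x * \<psi> x) = integral {a..b} (\<lambda>x. g x * \<psi> x)"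
    by (subst integral_lebesgue_on_compact_support[OF sub])
       (auto intro!: z integral_lebesgue_on_continuous continuous_intros c)
  ultimately show "(LINT x|lebesgue_on {A<..<B}. u x * deriv \<psi> x) = - (LINT x|lebesgue_on {A<..<B}. g x * \<psi> x)"
    by simp
qed

lemma has_weak_deriv_linear:
  assumes AB: "A < B" and f: "has_weak_deriv {A<..<B} f f'" and g: "has_weak_deriv {A<..<B} g g'"
  shows "has_weak_deriv {A<..<B} (\<lambda>x. f x + c * g x) (\<lambda>x. f' x + c * g' x)"
  unfolding has_weak_deriv_def
proof (intro conjI ballI)
  have li: "locally_integrable {A<..<B} f" "locally_integrable {A<..<B} g" "locally_integrable {A<..<B} f'" "locally_integrable {A<..<B} g'"
    using f g by (auto simp: has_weak_deriv_def)
  show "locally_integrable {A<..<B} (\<lambda>x. f x + c * g x)" "locally_integrable {A<..<B} (\<lambda>x. f' x + c * g' x)"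
    using li unfolding locally_integrable_def by (auto intro!: set_integral_add set_integrable_mult_right)
  fix \<psi> assume \<psi>: "\<psi> \<in> test_functions {A<..<B}"
  obtain a b where ab: "A < a" "a < b" "b < B" and z: "\<And>x. x \<notin> {a<..<b} \<Longrightarrow> \<psi> x = 0"
    "\<And>x. x \<notin> {a<..<b} \<Longrightarrow> deriv \<psi> x = 0"
    using test_function_support[OF \<psi> AB] by metis
  have i: "integrable (lebesgue_on {A<..<B}) (\<lambda>x. h x * \<psi> x)" "integrable (lebesgue_on {A<..<B}) (\<lambda>x. h x * deriv \<psi> x)"
    if "locally_integrable {A<..<B} h" for h
    using locally_integrable_mult_integrable[OF that ab(1,3)] test_function_derivative[OF \<psi>] z by blast+
  have "(LINT x|lebesgue_on {A<..<B}. (f x + c * g x) * deriv \<psi> x) =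
      (LINT x|lebesgue_on {A<..<B}. f x * deriv \<psi> x + c * (g x * deriv \<psi> x))"
    by (simp add: algebra_simps)
  also have "\<dots> = (LINT x|lebesgue_on {A<..<B}. f x * deriv \<psi> x) + c * (LINT x|lebesgue_on {A<..<B}. g x * deriv \<psi> x)"
    using i li by simp
  also have "\<dots> = - ((LINT x|lebesgue_on {A<..<B}. f' x * \<psi> x) + c * (LINT x|lebesgue_on {A<..<B}. g' x * \<psi> x))"
    using f g \<psi> by (simp add: has_weak_deriv_def)
  also have "\<dots> = - (LINT x|lebesgue_on {A<..<B}. f' x * \<psi> x + c * (g' x * \<psi> x))"
    using i li by simp
  also have "\<dots> = - (LINT x|lebesgue_on {A<..<B}. (f' x + c * g' x) * \<psi> x)"
    by (simp add: algebra_simps)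
  finally show "(LINT x|lebesgue_on {A<..<B}. (f x + c * g x) * deriv \<psi> x) = - (LINT x|lebesgue_on {A<..<B}. (f' x + c * g' x) * \<psi> x)" .
qed

text \<open>Weak derivatives are only locally integrable, so statements about them come on compact
  subintervals first; countably many of these exhaust the open interval.\<close>

lemma AE_open_interval_exhaustion:
  assumes "\<And>a b. A < a \<Longrightarrow> b < B \<Longrightarrow> AE x in lebesgue. x \<in> {a..b} \<longrightarrow> P x"
  shows "AE x in lebesgue_on {A<..<B::real}. P x"
proof -
  have "AE x in lebesgue. \<forall>n::nat. x \<in> {A + 1 / real (Suc n)..B - 1 / real (Suc n)} \<longrightarrow> P x"
    unfolding AE_all_countable by (intro allI assms) auto
  then have "AE x in lebesgue. x \<in> {A<..<B} \<longrightarrow> P x"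
  proof (rule AE_mp, intro AE_I2 impI)
    fix x assume all: "\<forall>n::nat. x \<in> {A + 1 / real (Suc n)..B - 1 / real (Suc n)} \<longrightarrow> P x" and x: "x \<in> {A<..<B}"
    obtain n where n: "1 / real (Suc n) < min (x - A) (B - x)"
      using reals_Archimedean[of "min (x - A) (B - x)"] x by (auto simp: inverse_eq_divide)
    then have "x \<in> {A + 1 / real (Suc n)..B - 1 / real (Suc n)}" unfolding min_less_iff_conj by simp
    with all show "P x" by blast
  qed
  then show ?thesis by (subst AE_restrict_space_iff) auto
qed

text \<open>The difference g - h is a weak derivative of the constant 0, so by
  \<open>weak_deriv_FTC\<close> all its interval integrals vanish.\<close>

lemma has_weak_deriv_unique:
  assumes AB: "A < B" and g: "has_weak_deriv {A<..<B} f g" and h: "has_weak_deriv {A<..<B} f h"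
  shows "AE x in lebesgue_on {A<..<B}. g x = h x"
proof -
  have wd: "has_weak_deriv {A<..<B} (\<lambda>x. 0) (\<lambda>x. g x - h x)"
    using has_weak_deriv_linear[OF AB g h, of "-1"] by simp
  have "AE x in lebesgue_on {A<..<B}. g x - h x = 0"
  proof (rule AE_open_interval_exhaustion)
    fix a b assume ab: "A < a" "b < B"
    show "AE x in lebesgue. x \<in> {a..b} \<longrightarrow> g x - h x = 0"
    proof (cases "a \<le> b")
      case True
      show ?thesis
        by (rule AE_zero_of_interval_integrals)
           (use weak_deriv_FTC[OF wd continuous_on_const] ab True in auto)
    qed simp
  qed
  then show ?thesis by simp
qed

lemma weak_deriv_AE:
  assumes "A < B" "has_weak_deriv {A<..<B} f g"
  shows "has_weak_deriv {A<..<B} f (weak_deriv {A<..<B} f)"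
    "AE x in lebesgue_on {A<..<B}. weak_deriv {A<..<B} f x = g x"
proof -
  show *: "has_weak_deriv {A<..<B} f (weak_deriv {A<..<B} f)"
    unfolding weak_deriv_def by (rule someI[of _ g]) (rule assms)
  show "AE x in lebesgue_on {A<..<B}. weak_deriv {A<..<B} f x = g x"
    by (rule has_weak_deriv_unique[OF assms(1) * assms(2)])
qed

section \<open>The heat semigroup as a Gaussian expectation\<close>

definition gauss :: "real measure" where
  "gauss = density lborel (\<lambda>y. ennreal (std_normal_density y))"

lemma prob_space_gauss: "prob_space gauss"
  unfolding gauss_def by (rule prob_space_normal_density) simp

interpretation gauss: prob_space gauss
  by (rule prob_space_gauss)

lemma sets_gauss [measurable_cong, simp]: "sets gauss = sets borel"
  by (simp add: gauss_def)

lemma space_gauss [simp]: "space gauss = UNIV"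
  by (simp add: gauss_def)

lemma measure_gauss_UNIV [simp]: "measure gauss UNIV = 1"
  using gauss.prob_space by simp

lemma integrable_gauss_iff:
  assumes "f \<in> borel_measurable borel"
  shows "integrable gauss f \<longleftrightarrow> integrable lborel (\<lambda>y. std_normal_density y * f y)"
  unfolding gauss_def using assms by (subst integrable_density) auto

lemma integral_gauss:
  fixes f :: "real \<Rightarrow> real"
  assumes "f \<in> borel_measurable borel"
  shows "(LINT y|gauss. f y) = (LINT y|lborel. std_normal_density y * f y)"
  unfolding gauss_def using assms by (subst integral_density) auto

lemma gauss_moments:
  "integrable gauss (\<lambda>y. y)" "integrable gauss (\<lambda>y. \<bar>y\<bar>)" "integrable gauss (\<lambda>y. y\<^sup>2)"
  "(LINT y|gauss. y) = 0" "(LINT y|gauss. y\<^sup>2) = 1"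
proof -
  show "integrable gauss (\<lambda>y. y)"
    using integrable_std_normal_moment[of 1] by (subst integrable_gauss_iff) auto
  show "integrable gauss (\<lambda>y. \<bar>y\<bar>)"
    using integrable_std_normal_moment_abs[of 1] by (subst integrable_gauss_iff) auto
  show "integrable gauss (\<lambda>y. y\<^sup>2)"
    using integrable_std_normal_moment[of 2] by (subst integrable_gauss_iff) auto
  show "(LINT y|gauss. y) = 0"
    using integral_std_normal_moment_odd[of 0] by (subst integral_gauss) auto
  show "(LINT y|gauss. y\<^sup>2) = 1"
    using integral_std_normal_moment_even[of 1] by (subst integral_gauss) auto
qed

lemma gauss_integrable_bounded_by:
  fixes f :: "real \<Rightarrow> real"
  assumes "continuous_on UNIV f" "\<And>y. \<bar>f y\<bar> \<le> w y" "integrable gauss w"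
  shows "integrable gauss f"
proof (rule Bochner_Integration.integrable_bound[OF assms(3)])
  have "f \<in> borel_measurable borel" using assms(1) by (rule borel_measurable_continuous_onI)
  then show "f \<in> borel_measurable gauss" by simp
  show "AE y in gauss. norm (f y) \<le> norm (w y)"
  proof (rule AE_I2)
    fix y
    show "norm (f y) \<le> norm (w y)" using assms(2)[of y] by simp
  qed
qed

lemma gauss_continuous:
  fixes f :: "'a::metric_space \<Rightarrow> real \<Rightarrow> real"
  assumes f: "continuous_on UNIV (\<lambda>(p, y). f p y)" and b: "\<And>p y. \<bar>f p y\<bar> \<le> w y" and w: "integrable gauss w"
  shows "continuous_on UNIV (\<lambda>p. LINT y|gauss. f p y)"
  unfolding continuous_on_sequentially
proof (intro allI ballI impI)
  fix x :: "nat \<Rightarrow> 'a" and a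
  assume "(\<forall>n. x n \<in> UNIV) \<and> x \<longlonglongrightarrow> a"
  then have x: "x \<longlonglongrightarrow> a" by simp
  have "continuous_on UNIV (\<lambda>y. case (p, y) of (p, y) \<Rightarrow> f p y)" for p
    by (rule continuous_on_compose2[OF f]) (auto intro!: continuous_on_Pair continuous_on_id continuous_on_const)
  then have fy: "continuous_on UNIV (f p)" for p by simp
  have "continuous_on UNIV (\<lambda>p. case (p, y) of (p, y) \<Rightarrow> f p y)" for y
    by (rule continuous_on_compose2[OF f]) (auto intro!: continuous_on_Pair continuous_on_id continuous_on_const)
  then have fp: "continuous_on UNIV (\<lambda>p. f p y)" for y by simp
  have m: "f p \<in> borel_measurable gauss" for p
    using borel_measurable_continuous_onI[OF fy] by simp
  have "(\<lambda>n. LINT y|gauss. f (x n) y) \<longlonglongrightarrow> (LINT y|gauss. f a y)"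
  proof (rule integral_dominated_convergence[where w=w])
    show "AE y in gauss. (\<lambda>n. f (x n) y) \<longlonglongrightarrow> f a y"
    proof (rule AE_I2)
      fix y
      show "(\<lambda>n. f (x n) y) \<longlonglongrightarrow> f a y"
        using continuous_on_tendsto_compose[OF fp x] by simp
    qed
  qed (use m b w in auto)
  then show "((\<lambda>p. LINT y|gauss. f p y) \<circ> x) \<longlonglongrightarrow> (LINT y|gauss. f a y)"
    by (simp add: comp_def)
qed

text \<open>Dominated convergence of the difference quotients, whose majorant comes from the mean
  value inequality.\<close>

lemma gauss_derivative:
  fixes f f' :: "real \<Rightarrow> real \<Rightarrow> real"
  assumes d: "\<And>x y. ((\<lambda>x. f x y) has_real_derivative f' x y) (at x)"
    and c: "\<And>x. continuous_on UNIV (f x)" and c': "\<And>x. continuous_on UNIV (f' x)"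
    and i: "\<And>x. integrable gauss (f x)" and b: "\<And>x y. \<bar>f' x y\<bar> \<le> w y" and w: "integrable gauss w"
  shows "((\<lambda>x. LINT y|gauss. f x y) has_real_derivative (LINT y|gauss. f' x y)) (at x)"
  unfolding has_field_derivative_iff tendsto_at_iff_sequentially comp_def
proof (intro allI impI)
  fix X :: "nat \<Rightarrow> real" assume X: "\<forall>i. X i \<in> UNIV - {x}" "X \<longlonglongrightarrow> x"
  have m: "f x \<in> borel_measurable gauss" "f' x \<in> borel_measurable gauss" for x
    using borel_measurable_continuous_onI[OF c] borel_measurable_continuous_onI[OF c'] by auto
  have "(\<lambda>n. LINT y|gauss. (f (X n) y - f x y) / (X n - x)) \<longlonglongrightarrow> (LINT y|gauss. f' x y)"
  proof (rule integral_dominated_convergence[where w=w])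
    show "AE y in gauss. (\<lambda>n. (f (X n) y - f x y) / (X n - x)) \<longlonglongrightarrow> f' x y"
    proof (rule AE_I2)
      fix y
      have "((\<lambda>z. (f z y - f x y) / (z - x)) \<longlongrightarrow> f' x y) (at x)"
        using d[of y x] unfolding has_field_derivative_iff .
      then show "(\<lambda>n. (f (X n) y - f x y) / (X n - x)) \<longlonglongrightarrow> f' x y"
        using X unfolding tendsto_at_iff_sequentially comp_def by blast
    qed
    show "AE y in gauss. norm ((f (X n) y - f x y) / (X n - x)) \<le> w y" for n
    proof (rule AE_I2)
      fix y
      have "norm (f (X n) y - f x y) \<le> w y * norm (X n - x)"
        by (rule field_differentiable_bound[of UNIV _ "\<lambda>x. f' x y"]) (use d b in auto)
      moreover have "X n \<noteq> x" using X by auto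
      ultimately show "norm ((f (X n) y - f x y) / (X n - x)) \<le> w y"
        by (simp add: divide_le_eq)
    qed
  qed (use m w in auto)
  then show "(\<lambda>n. ((LINT y|gauss. f (X n) y) - (LINT y|gauss. f x y)) / (X n - x)) \<longlonglongrightarrow> (LINT y|gauss. f' x y)"
    using i by simp
qed

lemma gauss_Stein:
  fixes g g' :: "real \<Rightarrow> real"
  assumes d: "\<And>y. (g has_real_derivative g' y) (at y)" and c: "continuous_on UNIV g'"
    and b: "\<And>y. \<bar>g' y\<bar> \<le> B" and growth: "\<And>y. \<bar>g y\<bar> \<le> C * (1 + \<bar>y\<bar>)"
  shows "(LINT y|gauss. y * g y) = (LINT y|gauss. g' y)"
proof -
  let ?n = std_normal_density
  have gc: "continuous_on UNIV g"
    by (intro continuous_at_imp_continuous_on ballI) (rule DERIV_isCont[OF d])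
  have C: "C \<ge> 0" using growth[of 0] by (auto intro: order_trans[OF abs_ge_zero])
  have i1: "integrable gauss g'"
    by (rule gauss_integrable_bounded_by[OF c b]) simp
  have i2: "integrable gauss (\<lambda>y. y * g y)"
  proof (rule gauss_integrable_bounded_by)
    show "integrable gauss (\<lambda>y. C * (\<bar>y\<bar> + y\<^sup>2))" using gauss_moments by auto
    fix y
    have "\<bar>y * g y\<bar> \<le> \<bar>y\<bar> * (C * (1 + \<bar>y\<bar>))"
      unfolding abs_mult by (intro mult_left_mono growth) simp
    also have "\<dots> = C * (\<bar>y\<bar> + y\<^sup>2)" by (simp add: algebra_simps power2_eq_square)
    finally show "\<bar>y * g y\<bar> \<le> C * (\<bar>y\<bar> + y\<^sup>2)" .
  qed (intro continuous_intros gc)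
  define h where "h = (\<lambda>y. ?n y * (y * g y) - ?n y * g' y)"
  have mg: "g \<in> borel_measurable borel" "g' \<in> borel_measurable borel"
    using gc c by (auto intro: borel_measurable_continuous_onI)
  have hi: "integrable lborel h" unfolding h_def
    using i1 i2 mg by (intro Bochner_Integration.integrable_diff) (auto simp: integrable_gauss_iff[symmetric])
  \<comment> \<open>From exp (- y^2 / 2) <= 2 / y^2 together with |g y| <= 2 C |y| for |y| >=
    1.\<close>
  have nbound: "norm (?n y * g y) \<le> 4 * C / \<bar>y\<bar>" if "\<bar>y\<bar> \<ge> 1" for y
  proof -
    have y2: "y\<^sup>2 / 2 > 0" using that by auto
    have "exp (- y\<^sup>2 / 2) \<le> 2 / y\<^sup>2"
    proof -
      have "y\<^sup>2 / 2 \<le> exp (y\<^sup>2 / 2)" using exp_ge_add_one_self[of "y\<^sup>2 / 2"] by linarith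
      then have "inverse (exp (y\<^sup>2 / 2)) \<le> inverse (y\<^sup>2 / 2)" using y2 by (rule le_imp_inverse_le)
      then show ?thesis by (simp add: exp_minus)
    qed
    moreover have "1 / sqrt (2 * pi) \<le> 1"
    proof -
      have "1 \<le> 2 * pi" using pi_gt3 by linarith
      then have "1 \<le> sqrt (2 * pi)" by simp
      then show ?thesis by simp
    qed
    ultimately have "?n y \<le> 1 * (2 / y\<^sup>2)"
      unfolding std_normal_density_def by (intro mult_mono) auto
    then have "?n y * \<bar>g y\<bar> \<le> 2 / y\<^sup>2 * (C * (1 + \<bar>y\<bar>))"
      using growth[of y] by (intro mult_mono) auto
    also have "\<dots> \<le> 2 / y\<^sup>2 * (C * (2 * \<bar>y\<bar>))"
      using that C by (intro mult_left_mono) auto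
    also have "\<dots> = 4 * C / \<bar>y\<bar>" using that by (simp add: field_simps power2_eq_square)
    finally show ?thesis by (simp add: abs_mult)
  qed
  have lim0: "((\<lambda>y. - (?n y * g y)) \<longlongrightarrow> 0) at_top" "((\<lambda>y. - (?n y * g y)) \<longlongrightarrow> 0) at_bot"
  proof -
    have l: "((\<lambda>y::real. 4 * C / \<bar>y\<bar>) \<longlongrightarrow> 0) at_top" "((\<lambda>y::real. 4 * C / \<bar>y\<bar>) \<longlongrightarrow> 0) at_bot"
    proof -
      have "filterlim (\<lambda>y::real. \<bar>y\<bar>) at_top at_top" "filterlim (\<lambda>y::real. \<bar>y\<bar>) at_top at_bot"
        using filterlim_abs_real by (simp_all add: filterlim_at_bot_mirror)
      then show "((\<lambda>y::real. 4 * C / \<bar>y\<bar>) \<longlongrightarrow> 0) at_top" "((\<lambda>y::real. 4 * C / \<bar>y\<bar>) \<longlongrightarrow> 0) at_bot"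
        by (auto intro: tendsto_divide_0[OF tendsto_const] filterlim_at_top_imp_at_infinity)
    qed
    show "((\<lambda>y. - (?n y * g y)) \<longlongrightarrow> 0) at_top"
    proof (rule Lim_null_comparison[OF _ l(1)])
      show "\<forall>\<^sub>F y in at_top. norm (- (?n y * g y)) \<le> 4 * C / \<bar>y\<bar>"
        using eventually_ge_at_top[of 1]
      proof eventually_elim
        fix y :: real assume "1 \<le> y"
        then have "\<bar>y\<bar> \<ge> 1" by simp
        then show "norm (- (?n y * g y)) \<le> 4 * C / \<bar>y\<bar>" unfolding norm_minus_cancel by (rule nbound)
      qed
    qed
    show "((\<lambda>y. - (?n y * g y)) \<longlongrightarrow> 0) at_bot"
    proof (rule Lim_null_comparison[OF _ l(2)])
      show "\<forall>\<^sub>F y in at_bot. norm (- (?n y * g y)) \<le> 4 * C / \<bar>y\<bar>"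
        using eventually_le_at_bot[of "-1"]
      proof eventually_elim
        fix y :: real assume "y \<le> -1"
        then have "\<bar>y\<bar> \<ge> 1" by simp
        then show "norm (- (?n y * g y)) \<le> 4 * C / \<bar>y\<bar>" unfolding norm_minus_cancel by (rule nbound)
      qed
    qed
  qed
  have "(LBINT y=-\<infinity>..\<infinity>. h y) = 0 - 0"
  proof (rule interval_integral_FTC_integrable[where F="\<lambda>y. - (?n y * g y)"])
    fix y :: real
    have "((\<lambda>y. c * exp (- y\<^sup>2 / 2)) has_real_derivative - y * (c * exp (- y\<^sup>2 / 2))) (at y)" for c
      by (auto intro!: derivative_eq_intros)
    from this[of "1 / sqrt (2 * pi)"] have "(?n has_real_derivative - y * ?n y) (at y)"
      by (simp only: std_normal_density_def[abs_def])
    then have "((\<lambda>y. - (?n y * g y)) has_real_derivative h y) (at y)"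
      unfolding h_def by (auto intro!: derivative_eq_intros d)
    then show "((\<lambda>y. - (?n y * g y)) has_vector_derivative h y) (at y)"
      by (simp add: has_real_derivative_iff_has_vector_derivative)
    have nc: "continuous_on UNIV ?n"
      unfolding std_normal_density_def[abs_def] by (intro continuous_intros) auto
    have "continuous_on UNIV h" unfolding h_def by (intro continuous_intros nc gc c)
    then show "isCont h y" by (simp add: continuous_on_eq_continuous_at)
  next
    show "set_integrable lborel (einterval (-\<infinity>) \<infinity>) h"
      using hi by (simp add: set_integrable_def)
  qed (use lim0 in \<open>simp_all add: ereal_tendsto_simps\<close>)
  then have "(LINT y|lborel. h y) = 0"
    by (simp add: interval_lebesgue_integral_def set_lebesgue_integral_def)
  then have "(LINT y|lborel. ?n y * (y * g y)) = (LINT y|lborel. ?n y * g' y)"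
    unfolding h_def using i1 i2 mg by (subst (asm) Bochner_Integration.integral_diff) (auto simp: integrable_gauss_iff[symmetric])
  then show ?thesis using mg by (simp add: integral_gauss)
qed

text \<open>The heat semigroup at time x^2 / 2, so that u_t = u_ss is solved with x = sqrt (2 t).
  With the standard deviation as parameter, the dependence on x is differentiable up to x = 0 for
  data with a bounded continuous derivative.\<close>

definition heat :: "real \<Rightarrow> (real \<Rightarrow> real) \<Rightarrow> real \<Rightarrow> real" where
  "heat x f s = (LINT y|gauss. f (s + x * y))"

text \<open>Serves twice: it is the x-derivative of \<open>heat\<close> applied to a bounded
  primitive of f, and it is x times the s-derivative of \<open>heat x f\<close>.\<close>

definition heatY :: "real \<Rightarrow> (real \<Rightarrow> real) \<Rightarrow> real \<Rightarrow> real" where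
  "heatY x f s = (LINT y|gauss. y * f (s + x * y))"

lemma heat_0 [simp]: "heat 0 f s = f s"
  by (simp add: heat_def gauss.prob_space)

lemma heat_integrable:
  assumes "continuous_on UNIV f" "\<And>z. \<bar>f z\<bar> \<le> B"
  shows "integrable gauss (\<lambda>y. f (s + x * y))" "integrable gauss (\<lambda>y. y * f (s + x * y))"
proof -
  have c: "continuous_on UNIV (\<lambda>y. f (s + x * y))"
    by (intro continuous_on_compose2[OF assms(1)] continuous_intros) auto
  show "integrable gauss (\<lambda>y. f (s + x * y))"
    by (rule gauss_integrable_bounded_by[OF c assms(2)]) simp
  show "integrable gauss (\<lambda>y. y * f (s + x * y))"
  proof (rule gauss_integrable_bounded_by)
    show "integrable gauss (\<lambda>y. \<bar>y\<bar> * B)" using gauss_moments by auto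
    show "\<bar>y * f (s + x * y)\<bar> \<le> \<bar>y\<bar> * B" for y
      unfolding abs_mult by (intro mult_left_mono assms) simp
  qed (intro continuous_intros c)
qed

lemma heat_bound:
  assumes "continuous_on UNIV f" "\<And>z. \<bar>f z\<bar> \<le> B"
  shows "\<bar>heat x f s\<bar> \<le> B"
proof -
  have "\<bar>heat x f s\<bar> \<le> (LINT y|gauss. \<bar>f (s + x * y)\<bar>)" unfolding heat_def by (rule integral_abs_bound)
  also have "\<dots> \<le> (LINT y|gauss. B)"
    using heat_integrable(1)[OF assms] assms(2) by (intro integral_mono) auto
  finally show ?thesis by (simp add: gauss.prob_space)
qed

lemma heat_derivatives:
  assumes d: "\<And>z. (f has_real_derivative g z) (at z)" and g: "continuous_on UNIV g" "\<And>z. \<bar>g z\<bar> \<le> B"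
    and f: "\<And>z. \<bar>f z\<bar> \<le> C"
  shows "(heat x f has_real_derivative heat x g s) (at s)"
    and "((\<lambda>x. heat x f s) has_real_derivative heatY x g s) (at x)"
proof -
  have fc: "continuous_on UNIV f"
    by (intro continuous_at_imp_continuous_on ballI) (rule DERIV_isCont[OF d])
  have c: "continuous_on UNIV (\<lambda>y. f (s + x * y))" "continuous_on UNIV (\<lambda>y. g (s + x * y))" for s x
    by (intro continuous_on_compose2[OF fc] continuous_on_compose2[OF g(1)] continuous_intros; simp)+
  have "((\<lambda>s. LINT y|gauss. f (s + x * y)) has_real_derivative (LINT y|gauss. g (s + x * y))) (at s)"
  proof (rule gauss_derivative[where w="\<lambda>_. B"])
    show "((\<lambda>s. f (s + x * y)) has_real_derivative g (s + x * y)) (at s)" for s y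
    proof -
      have "((\<lambda>s. s + x * y) has_real_derivative 1) (at s)" by (auto intro!: derivative_eq_intros)
      from DERIV_chain2[OF d this] show ?thesis by simp
    qed
  qed (use c g heat_integrable[OF fc f] in auto)
  then show "(heat x f has_real_derivative heat x g s) (at s)" by (simp add: heat_def[abs_def])
  have "((\<lambda>x. LINT y|gauss. f (s + x * y)) has_real_derivative (LINT y|gauss. y * g (s + x * y))) (at x)"
  proof (rule gauss_derivative[where w="\<lambda>y. \<bar>y\<bar> * B"])
    show "((\<lambda>x. f (s + x * y)) has_real_derivative y * g (s + x * y)) (at x)" for x y
    proof -
      have "((\<lambda>x. s + x * y) has_real_derivative y) (at x)" by (auto intro!: derivative_eq_intros)
      from DERIV_chain2[OF d this] show ?thesis by (simp add: mult.commute)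
    qed
    show "\<bar>y * g (s + x * y)\<bar> \<le> \<bar>y\<bar> * B" for x y
      unfolding abs_mult by (intro mult_left_mono g) simp
    show "integrable gauss (\<lambda>y. \<bar>y\<bar> * B)" using gauss_moments by auto
  qed (use c heat_integrable[OF fc f] in \<open>auto intro!: continuous_intros\<close>)
  then show "((\<lambda>x. heat x f s) has_real_derivative heatY x g s) (at x)" by (simp add: heat_def[abs_def] heatY_def)
qed

lemma continuous_antiderivative_exists:
  fixes f :: "real \<Rightarrow> real"
  assumes f: "continuous_on UNIV f"
  obtains F where "\<And>z. (F has_real_derivative f z) (at z)"
proof -
  have "\<exists>F. \<forall>x. -\<infinity> < ereal x \<longrightarrow> ereal x < \<infinity> \<longrightarrow> (F has_vector_derivative f x) (at x)"
    by (rule einterval_antiderivative) (use f in \<open>auto simp: continuous_on_eq_continuous_at\<close>)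
  with that show ?thesis by (auto simp: has_real_derivative_iff_has_vector_derivative)
qed

text \<open>Stein's identity rewrites x E f (s + x Y) as E (Y F (s + x Y)) with F a primitive of f.
  In that form the s-derivative falls on F, so bounded continuous f suffice. Keeping the factor x on
  the left avoids a division at x = 0.\<close>

lemma heat_smoothing_derivative:
  assumes f: "continuous_on UNIV f" "\<And>z. \<bar>f z\<bar> \<le> B"
  shows "((\<lambda>s. x * heat x f s) has_real_derivative heatY x f s) (at s)"
proof -
  obtain F where F: "\<And>z. (F has_real_derivative f z) (at z)"
    using continuous_antiderivative_exists[OF f(1)] by blast
  have Fc: "continuous_on UNIV F"
    by (intro continuous_at_imp_continuous_on ballI) (rule DERIV_isCont[OF F])
  have FB: "\<bar>F z - F s\<bar> \<le> B * \<bar>z - s\<bar>" for z s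
    using field_differentiable_bound[of UNIV F f B z s] F f(2) by auto
  have B: "B \<ge> 0" using f(2)[of 0] by (auto intro: order_trans[OF abs_ge_zero])
  have c: "continuous_on UNIV (\<lambda>y. F (s + x * y))" "continuous_on UNIV (\<lambda>y. f (s + x * y))" for s x
    by (intro continuous_on_compose2[OF Fc] continuous_on_compose2[OF f(1)] continuous_intros; simp)+
  have growth: "\<bar>F (s + x * y)\<bar> \<le> (\<bar>F s\<bar> + B * \<bar>x\<bar>) * (1 + \<bar>y\<bar>)" for s x y
  proof -
    have "\<bar>F (s + x * y)\<bar> \<le> \<bar>F s\<bar> + B * (\<bar>x\<bar> * \<bar>y\<bar>)"
      using FB[of "s + x * y" s] by (simp add: abs_mult)
    also have "\<dots> \<le> (\<bar>F s\<bar> + B * \<bar>x\<bar>) * (1 + \<bar>y\<bar>)"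
      using B by (simp add: algebra_simps)
    finally show ?thesis .
  qed
  have stein: "x * heat x f s = (LINT y|gauss. y * F (s + x * y))" for s
  proof -
    have "(LINT y|gauss. y * F (s + x * y)) = (LINT y|gauss. x * f (s + x * y))"
    proof (rule gauss_Stein[OF _ _ _ growth, where B="\<bar>x\<bar> * B"])
      show "((\<lambda>y. F (s + x * y)) has_real_derivative x * f (s + x * y)) (at y)" for y
      proof -
        have "((\<lambda>y. s + x * y) has_real_derivative x) (at y)" by (auto intro!: derivative_eq_intros)
        from DERIV_chain2[OF F this] show ?thesis by (simp add: mult.commute)
      qed
      show "\<bar>x * f (s + x * y)\<bar> \<le> \<bar>x\<bar> * B" for y
        unfolding abs_mult by (intro mult_left_mono f) simp
    qed (intro continuous_intros c)
    then show ?thesis by (simp add: heat_def)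
  qed
  have "((\<lambda>s. LINT y|gauss. y * F (s + x * y)) has_real_derivative (LINT y|gauss. y * f (s + x * y))) (at s)"
  proof (rule gauss_derivative[where w="\<lambda>y. \<bar>y\<bar> * B"])
    show "((\<lambda>s. y * F (s + x * y)) has_real_derivative y * f (s + x * y)) (at s)" for s y
    proof -
      have "((\<lambda>s. F (s + x * y)) has_real_derivative f (s + x * y)) (at s)"
      proof -
        have "((\<lambda>s. s + x * y) has_real_derivative 1) (at s)" by (auto intro!: derivative_eq_intros)
        from DERIV_chain2[OF F this] show ?thesis by simp
      qed
      then show ?thesis by (rule DERIV_cmult)
    qed
    show "\<bar>y * f (s + x * y)\<bar> \<le> \<bar>y\<bar> * B" for s y
      unfolding abs_mult by (intro mult_left_mono f) simp
    show "integrable gauss (\<lambda>y. \<bar>y\<bar> * B)" using gauss_moments by auto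
    show "integrable gauss (\<lambda>y. y * F (s + x * y))" for s
    proof (rule gauss_integrable_bounded_by)
      show "\<bar>y * F (s + x * y)\<bar> \<le> (\<bar>F s\<bar> + B * \<bar>x\<bar>) * (\<bar>y\<bar> + y\<^sup>2)" for y
      proof -
        have "\<bar>y * F (s + x * y)\<bar> \<le> \<bar>y\<bar> * ((\<bar>F s\<bar> + B * \<bar>x\<bar>) * (1 + \<bar>y\<bar>))"
          unfolding abs_mult by (intro mult_left_mono growth) simp
        also have "\<dots> = (\<bar>F s\<bar> + B * \<bar>x\<bar>) * (\<bar>y\<bar> + \<bar>y\<bar> * \<bar>y\<bar>)" by (simp only: algebra_simps)
        also have "\<bar>y\<bar> * \<bar>y\<bar> = y\<^sup>2" by (simp add: power2_eq_square)
        finally show ?thesis .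
      qed
      show "integrable gauss (\<lambda>y. (\<bar>F s\<bar> + B * \<bar>x\<bar>) * (\<bar>y\<bar> + y\<^sup>2))" using gauss_moments by auto
    qed (intro continuous_intros c)
  qed (intro continuous_intros c)+
  then show ?thesis by (simp add: stein heatY_def)
qed

section \<open>The Duhamel integral\<close>

definition bounded_continuous2 :: "real \<Rightarrow> (real \<Rightarrow> real \<Rightarrow> real) \<Rightarrow> bool" where
  "bounded_continuous2 B F \<longleftrightarrow> continuous_on UNIV (\<lambda>(t, s). F t s) \<and> (\<forall>t s. \<bar>F t s\<bar> \<le> B)"

lemma bounded_continuous2_compose:
  assumes "bounded_continuous2 B F" "continuous_on X f" "continuous_on X g"
  shows "continuous_on X (\<lambda>p. F (f p) (g p))"
proof -
  have "continuous_on UNIV (\<lambda>(t, s). F t s)" using assms by (simp add: bounded_continuous2_def)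
  from continuous_on_compose2[OF this continuous_on_Pair[OF assms(2,3)]] show ?thesis by simp
qed

lemma bounded_continuous2_slice:
  assumes "bounded_continuous2 B F"
  shows "continuous_on X (F t)" "\<bar>F t s\<bar> \<le> B"
  using bounded_continuous2_compose[OF assms, of X "\<lambda>_. t" "\<lambda>s. s"] assms
  by (auto simp: bounded_continuous2_def)

lemma heat_continuous:
  assumes F: "bounded_continuous2 B F"
    and c: "continuous_on X f" "continuous_on X g" "continuous_on X (h :: 'a::topological_space \<Rightarrow> real)"
  shows "continuous_on X (\<lambda>p. heat (f p) (F (g p)) (h p))" "continuous_on X (\<lambda>p. heatY (f p) (F (g p)) (h p))"
proof -
  have "continuous_on UNIV (\<lambda>(p, y). F (fst (snd p)) (snd (snd p) + fst p * y))"
    unfolding split_beta by (intro bounded_continuous2_compose[OF F] continuous_intros)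
  from gauss_continuous[OF this, of "\<lambda>_. B"]
  have 1: "continuous_on UNIV (\<lambda>p :: real \<times> real \<times> real. heat (fst p) (F (fst (snd p))) (snd (snd p)))"
    using F by (simp add: heat_def bounded_continuous2_def)
  have "continuous_on UNIV (\<lambda>(p, y). y * F (fst (snd p)) (snd (snd p) + fst p * y))"
    unfolding split_beta by (intro continuous_intros bounded_continuous2_compose[OF F])
  from gauss_continuous[OF this, of "\<lambda>y. \<bar>y\<bar> * B"]
  have 2: "continuous_on UNIV (\<lambda>p :: real \<times> real \<times> real. heatY (fst p) (F (fst (snd p))) (snd (snd p)))"
    using F gauss_moments(2) by (simp add: heatY_def bounded_continuous2_def abs_mult mult_left_mono)
  have "continuous_on X (\<lambda>p. (f p, g p, h p))" by (intro continuous_on_Pair c)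
  from continuous_on_compose2[OF 1 this] continuous_on_compose2[OF 2 this]
  show "continuous_on X (\<lambda>p. heat (f p) (F (g p)) (h p))" "continuous_on X (\<lambda>p. heatY (f p) (F (g p)) (h p))"
    by simp_all
qed

text \<open>The integral of \<open>heat (sqrt (2 * (t - \<tau>))) (F \<tau>) s\<close> over \<tau>
  in {0..t}, after the substitution \<open>\<tau> = t * (1 - \<xi>\<^sup>2)\<close>. The domain
  becomes fixed, and the factor \<xi> is the one that \<open>heat_smoothing_derivative\<close> asks
  for, so the singularity of order -1/2 in the space derivative disappears from
  \<open>duhamelY\<close>.\<close>

definition duhamel :: "(real \<Rightarrow> real \<Rightarrow> real) \<Rightarrow> real \<Rightarrow> real \<Rightarrow> real" where
  "duhamel F t s = 2 * t * integral {0..1} (\<lambda>\<xi>. \<xi> * heat (sqrt (2 * t) * \<xi>) (F (t * (1 - \<xi>\<^sup>2))) s)"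

definition duhamelY :: "(real \<Rightarrow> real \<Rightarrow> real) \<Rightarrow> real \<Rightarrow> real \<Rightarrow> real" where
  "duhamelY F t s = sqrt (2 * t) * integral {0..1} (\<lambda>\<xi>. heatY (sqrt (2 * t) * \<xi>) (F (t * (1 - \<xi>\<^sup>2))) s)"

lemma duhamel_0 [simp]: "duhamel F 0 s = 0"
  by (simp add: duhamel_def)

lemma integral_continuous_on_param_real:
  fixes f :: "'a::topological_space \<Rightarrow> real \<Rightarrow> real"
  assumes "continuous_on (U \<times> {a..b}) (\<lambda>p. f (fst p) (snd p))"
  shows "continuous_on U (\<lambda>x. integral {a..b} (f x))"
  using integral_continuous_on_param[of U a b f] assms by (simp add: split_beta)

lemma duhamel_continuous:
  assumes F: "bounded_continuous2 B F"
  shows "continuous_on X (\<lambda>p. duhamel F (fst p) (snd p))" "continuous_on X (\<lambda>p. duhamelY F (fst p) (snd p))"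
  unfolding duhamel_def duhamelY_def
  by (intro continuous_intros integral_continuous_on_param_real heat_continuous[OF F])+

lemma duhamel_integrand_continuous:
  assumes F: "bounded_continuous2 B F"
  shows "continuous_on X (\<lambda>\<xi>. \<xi> * heat (sqrt (2 * t) * \<xi>) (F (t * (1 - \<xi>\<^sup>2))) s)"
    "continuous_on X (\<lambda>\<xi>. heatY (sqrt (2 * t) * \<xi>) (F (t * (1 - \<xi>\<^sup>2))) s)"
  by (intro continuous_intros heat_continuous[OF F])+

lemma duhamel_derivative:
  assumes F: "bounded_continuous2 B F" and G: "bounded_continuous2 C G"
    and d: "\<And>t s. (F t has_real_derivative G t s) (at s)"
  shows "(duhamel F t has_real_derivative duhamel G t s) (at s)"
proof -
  have "((\<lambda>s. integral (cbox 0 1) (\<lambda>\<xi>. \<xi> * heat (sqrt (2 * t) * \<xi>) (F (t * (1 - \<xi>\<^sup>2))) s))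
      has_real_derivative integral (cbox 0 1) (\<lambda>\<xi>. \<xi> * heat (sqrt (2 * t) * \<xi>) (G (t * (1 - \<xi>\<^sup>2))) s)) (at s within UNIV)"
  proof (rule leibniz_rule_field_derivative)
    fix s \<xi> :: real
    show "((\<lambda>s. \<xi> * heat (sqrt (2 * t) * \<xi>) (F (t * (1 - \<xi>\<^sup>2))) s) has_real_derivative
        \<xi> * heat (sqrt (2 * t) * \<xi>) (G (t * (1 - \<xi>\<^sup>2))) s) (at s within UNIV)"
      by (intro DERIV_cmult heat_derivatives(1)[where B=C and C=B] d)
         (use bounded_continuous2_slice[OF F] bounded_continuous2_slice[OF G] in auto)
    show "(\<lambda>\<xi>. \<xi> * heat (sqrt (2 * t) * \<xi>) (F (t * (1 - \<xi>\<^sup>2))) s) integrable_on cbox 0 1"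
      by (intro integrable_continuous duhamel_integrand_continuous[OF F])
    show "continuous_on (UNIV \<times> cbox 0 1) (\<lambda>(s, \<xi>). \<xi> * heat (sqrt (2 * t) * \<xi>) (G (t * (1 - \<xi>\<^sup>2))) s)"
      unfolding split_beta by (intro continuous_intros heat_continuous[OF G])
  qed auto
  then show ?thesis unfolding duhamel_def[abs_def] by (intro DERIV_cmult) simp
qed

text \<open>One space derivative is gained: of the prefactor 2 t, one sqrt (2 t) joins \<xi> to form
  the factor x of \<open>heat_smoothing_derivative\<close>, and the other stays in front.\<close>

lemma duhamel_smoothing_derivative:
  assumes G: "bounded_continuous2 B G" and t: "t \<ge> 0"
  shows "(duhamel G t has_real_derivative duhamelY G t s) (at s)"
proof -
  have "((\<lambda>s. integral (cbox 0 1) (\<lambda>\<xi>. (sqrt (2 * t) * \<xi>) * heat (sqrt (2 * t) * \<xi>) (G (t * (1 - \<xi>\<^sup>2))) s))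
      has_real_derivative integral (cbox 0 1) (\<lambda>\<xi>. heatY (sqrt (2 * t) * \<xi>) (G (t * (1 - \<xi>\<^sup>2))) s)) (at s within UNIV)"
  proof (rule leibniz_rule_field_derivative)
    fix s \<xi> :: real
    show "((\<lambda>s. (sqrt (2 * t) * \<xi>) * heat (sqrt (2 * t) * \<xi>) (G (t * (1 - \<xi>\<^sup>2))) s) has_real_derivative
        heatY (sqrt (2 * t) * \<xi>) (G (t * (1 - \<xi>\<^sup>2))) s) (at s within UNIV)"
      by (rule heat_smoothing_derivative[OF bounded_continuous2_slice[OF G]])
    show "(\<lambda>\<xi>. (sqrt (2 * t) * \<xi>) * heat (sqrt (2 * t) * \<xi>) (G (t * (1 - \<xi>\<^sup>2))) s) integrable_on cbox 0 1"
      by (intro integrable_continuous continuous_intros heat_continuous[OF G])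
    show "continuous_on (UNIV \<times> cbox 0 1) (\<lambda>(s, \<xi>). heatY (sqrt (2 * t) * \<xi>) (G (t * (1 - \<xi>\<^sup>2))) s)"
      unfolding split_beta by (intro continuous_intros heat_continuous[OF G])
  qed auto
  then have "((\<lambda>s. sqrt (2 * t) * integral {0..1} (\<lambda>\<xi>. (sqrt (2 * t) * \<xi>) * heat (sqrt (2 * t) * \<xi>) (G (t * (1 - \<xi>\<^sup>2))) s))
      has_real_derivative duhamelY G t s) (at s)"
    unfolding duhamelY_def by (intro DERIV_cmult) simp
  moreover have "duhamel G t = (\<lambda>s. sqrt (2 * t) * integral {0..1} (\<lambda>\<xi>. (sqrt (2 * t) * \<xi>) * heat (sqrt (2 * t) * \<xi>) (G (t * (1 - \<xi>\<^sup>2))) s))"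
  proof
    fix s
    have "sqrt (2 * t) * integral {0..1} (\<lambda>\<xi>. (sqrt (2 * t) * \<xi>) * heat (sqrt (2 * t) * \<xi>) (G (t * (1 - \<xi>\<^sup>2))) s)
        = sqrt (2 * t) * (sqrt (2 * t) * integral {0..1} (\<lambda>\<xi>. \<xi> * heat (sqrt (2 * t) * \<xi>) (G (t * (1 - \<xi>\<^sup>2))) s))"
      by (simp only: mult.assoc integral_mult_right)
    also have "\<dots> = duhamel G t s" using t by (simp add: duhamel_def mult.assoc[symmetric] real_sqrt_mult[symmetric])
    finally show "duhamel G t s = sqrt (2 * t) * integral {0..1} (\<lambda>\<xi>. (sqrt (2 * t) * \<xi>) * heat (sqrt (2 * t) * \<xi>) (G (t * (1 - \<xi>\<^sup>2))) s)" by simp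
  qed
  ultimately show ?thesis by simp
qed

lemma duhamel_time_form:
  assumes F: "bounded_continuous2 B F" and t: "t \<ge> 0"
  shows "duhamel F t s = integral {0..t} (\<lambda>\<tau>. heat (sqrt (2 * (t - \<tau>))) (F \<tau>) s)"
proof -
  let ?\<phi> = "\<lambda>\<tau>. heat (sqrt (2 * (t - \<tau>))) (F \<tau>) s"
  have c: "continuous_on X ?\<phi>" for X by (intro continuous_intros heat_continuous[OF F])
  have "((\<lambda>\<xi>. (- 2 * t * \<xi>) *\<^sub>R ?\<phi> (t * (1 - \<xi>\<^sup>2))) has_integral
      (integral {t * (1 - 0\<^sup>2)..t * (1 - 1\<^sup>2)} ?\<phi> - integral {t * (1 - 1\<^sup>2)..t * (1 - 0\<^sup>2)} ?\<phi>)) {0..1}"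
  proof (rule has_integral_substitution_general[where s="{}" and c=0 and d=t])
    show "(\<lambda>\<xi>. t * (1 - \<xi>\<^sup>2)) ` {0..1} \<subseteq> {0..t}"
      using t by (auto intro!: mult_left_le mult_nonneg_nonneg simp: power_le_one)
    show "((\<lambda>\<xi>. t * (1 - \<xi>\<^sup>2)) has_real_derivative - 2 * t * \<xi>) (at \<xi> within {0..1})" for \<xi>
      by (auto intro!: derivative_eq_intros)
    show "continuous_on {0..1} (\<lambda>\<xi>. t * (1 - \<xi>\<^sup>2))" by (intro continuous_intros)
  qed (use c in auto)
  then have "((\<lambda>\<xi>. (- 2 * t * \<xi>) * ?\<phi> (t * (1 - \<xi>\<^sup>2))) has_integral
      (integral {t..0} ?\<phi> - integral {0..t} ?\<phi>)) {0..1}" by simp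
  moreover have "integral {t..0} ?\<phi> = 0" using t by (cases "t = 0") auto
  ultimately have "((\<lambda>\<xi>. (- 2 * t * \<xi>) * ?\<phi> (t * (1 - \<xi>\<^sup>2))) has_integral - integral {0..t} ?\<phi>) {0..1}"
    by simp
  from has_integral_neg[OF this]
  have h: "((\<lambda>\<xi>. 2 * t * (\<xi> * ?\<phi> (t * (1 - \<xi>\<^sup>2)))) has_integral integral {0..t} ?\<phi>) {0..1}"
    by (simp add: mult.assoc)
  have "((\<lambda>\<xi>. 2 * t * (\<xi> * heat (sqrt (2 * t) * \<xi>) (F (t * (1 - \<xi>\<^sup>2))) s)) has_integral integral {0..t} ?\<phi>) {0..1}"
  proof (rule has_integral_eq[OF _ h])
    fix \<xi> :: real assume \<xi>: "\<xi> \<in> {0..1}"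
    have "t - t * (1 - \<xi>\<^sup>2) = t * \<xi>\<^sup>2" by (simp add: algebra_simps)
    then have "sqrt (2 * (t - t * (1 - \<xi>\<^sup>2))) = sqrt (2 * t * \<xi>\<^sup>2)" by (simp add: mult.assoc)
    also have "\<dots> = sqrt (2 * t) * \<xi>" using \<xi> by (simp add: real_sqrt_mult)
    finally show "2 * t * (\<xi> * ?\<phi> (t * (1 - \<xi>\<^sup>2))) = 2 * t * (\<xi> * heat (sqrt (2 * t) * \<xi>) (F (t * (1 - \<xi>\<^sup>2))) s)"
      by simp
  qed
  then have "integral {0..1} (\<lambda>\<xi>. 2 * t * (\<xi> * heat (sqrt (2 * t) * \<xi>) (F (t * (1 - \<xi>\<^sup>2))) s)) = integral {0..t} ?\<phi>"
    by (rule integral_unique)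
  then show ?thesis by (simp add: duhamel_def)
qed

lemma duhamelY_space_form:
  assumes F: "bounded_continuous2 B F" and t: "t \<ge> 0"
  shows "duhamelY F t s = integral {0..sqrt (2 * t)} (\<lambda>x. heatY x (F (t - x\<^sup>2 / 2)) s)"
proof -
  let ?\<phi> = "\<lambda>x. heatY x (F (t - x\<^sup>2 / 2)) s"
  have c: "continuous_on X ?\<phi>" for X by (intro continuous_intros heat_continuous[OF F]) auto
  have "((\<lambda>\<xi>. sqrt (2 * t) *\<^sub>R ?\<phi> (sqrt (2 * t) * \<xi>)) has_integral
      (integral {sqrt (2 * t) * 0..sqrt (2 * t) * 1} ?\<phi> - integral {sqrt (2 * t) * 1..sqrt (2 * t) * 0} ?\<phi>)) {0..1}"
  proof (rule has_integral_substitution_general[where s="{}" and c=0 and d="sqrt (2 * t)"])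
    show "(\<lambda>\<xi>. sqrt (2 * t) * \<xi>) ` {0..1} \<subseteq> {0..sqrt (2 * t)}"
      using t by (auto intro!: mult_left_le)
    show "((\<lambda>\<xi>. sqrt (2 * t) * \<xi>) has_real_derivative sqrt (2 * t)) (at \<xi> within {0..1})" for \<xi>
      by (auto intro!: derivative_eq_intros)
    show "continuous_on {0..1} (\<lambda>\<xi>. sqrt (2 * t) * \<xi>)" by (intro continuous_intros)
  qed (use c in auto)
  moreover have "integral {sqrt (2 * t)..0} ?\<phi> = 0" using t by (cases "t = 0") auto
  ultimately have h: "((\<lambda>\<xi>. sqrt (2 * t) * ?\<phi> (sqrt (2 * t) * \<xi>)) has_integral integral {0..sqrt (2 * t)} ?\<phi>) {0..1}"
    by simp
  have sq: "(sqrt (2 * t) * \<xi>)\<^sup>2 = 2 * t * \<xi>\<^sup>2" for \<xi>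
    unfolding power_mult_distrib by (subst real_sqrt_pow2) (use t in auto)
  have "t - (sqrt (2 * t) * \<xi>)\<^sup>2 / 2 = t * (1 - \<xi>\<^sup>2)" for \<xi> unfolding sq by (simp add: algebra_simps)
  with h have "((\<lambda>\<xi>. sqrt (2 * t) * heatY (sqrt (2 * t) * \<xi>) (F (t * (1 - \<xi>\<^sup>2))) s) has_integral integral {0..sqrt (2 * t)} ?\<phi>) {0..1}"
    by simp
  from integral_unique[OF this] show ?thesis by (simp add: duhamelY_def)
qed

section \<open>Time derivative of the Duhamel integral\<close>

lemma integrable_indicator_compact_pair:
  fixes k :: "real \<Rightarrow> real \<Rightarrow> real"
  assumes "compact D" "continuous_on UNIV (\<lambda>p. k (fst p) (snd p))"
  shows "integrable (lborel \<Otimes>\<^sub>M lborel) (\<lambda>(x, y). indicat_real D (x, y) * k x y)"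
proof -
  have "integrable lborel (\<lambda>p. indicat_real D p *\<^sub>R k (fst p) (snd p))"
    using borel_integrable_compact[OF assms(1) continuous_on_subset[OF assms(2) subset_UNIV]]
    by (simp add: set_integrable_def)
  moreover have "(\<lambda>(x, y). indicat_real D (x, y) * k x y) = (\<lambda>p. indicat_real D p *\<^sub>R k (fst p) (snd p))"
    by (auto simp: fun_eq_iff)
  ultimately show ?thesis by (simp only: lborel_prod)
qed

text \<open>Both sides integrate over a region bounded by a parabola. For fixed x the shift r = tau
  + x^2 / 2 carries \<open>D1\<close> to \<open>D2\<close>, and Fubini before and after makes the
  shifted variable the inner one.\<close>

lemma parabola_Fubini:
  fixes k :: "real \<Rightarrow> real \<Rightarrow> real"
  assumes k: "continuous_on UNIV (\<lambda>p. k (fst p) (snd p))" and t: "t \<ge> 0"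
  shows "integral {0..t} (\<lambda>\<tau>. integral {0..sqrt (2 * (t - \<tau>))} (\<lambda>x. k x \<tau>)) =
    integral {0..t} (\<lambda>r. integral {0..sqrt (2 * r)} (\<lambda>x. k x (r - x\<^sup>2 / 2)))"
proof -
  define D1 where "D1 = {p :: real \<times> real. 0 \<le> fst p \<and> 0 \<le> snd p \<and> snd p + (fst p)\<^sup>2 / 2 \<le> t}"
  define D2 where "D2 = {p :: real \<times> real. 0 \<le> fst p \<and> (fst p)\<^sup>2 / 2 \<le> snd p \<and> snd p \<le> t}"
  define f1 where "f1 x \<tau> = indicat_real D1 (x, \<tau>) * k x \<tau>" for x \<tau>
  define f2 where "f2 x r = indicat_real D2 (x, r) * k x (r - x\<^sup>2 / 2)" for x r
  have le: "x \<le> sqrt (2 * a) \<longleftrightarrow> x\<^sup>2 / 2 \<le> a" if "0 \<le> x" for x a :: real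
    using that real_le_rsqrt[of x "2 * a"] real_sqrt_le_iff[of "x\<^sup>2" "2 * a"] by auto
  have sub: "D1 \<subseteq> cbox (0, 0) (sqrt (2 * t), t)" "D2 \<subseteq> cbox (0, 0) (sqrt (2 * t), t)"
  proof -
    have box: "p \<in> cbox (0, 0) (sqrt (2 * t), t)" if "0 \<le> fst p" "(fst p)\<^sup>2 / 2 \<le> t" "0 \<le> snd p" "snd p \<le> t" for p
      using le[of "fst p" t] that by (cases p) simp
    have sq: "0 \<le> (fst p)\<^sup>2 / 2" for p :: "real \<times> real" by simp
    show "D1 \<subseteq> cbox (0, 0) (sqrt (2 * t), t)"
    proof
      fix p assume "p \<in> D1"
      then have "0 \<le> fst p" "0 \<le> snd p" "snd p + (fst p)\<^sup>2 / 2 \<le> t" by (simp_all add: D1_def)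
      with sq[of p] show "p \<in> cbox (0, 0) (sqrt (2 * t), t)" by (intro box) linarith+
    qed
    show "D2 \<subseteq> cbox (0, 0) (sqrt (2 * t), t)"
    proof
      fix p assume "p \<in> D2"
      then have "0 \<le> fst p" "(fst p)\<^sup>2 / 2 \<le> snd p" "snd p \<le> t" by (simp_all add: D2_def)
      with sq[of p] show "p \<in> cbox (0, 0) (sqrt (2 * t), t)" by (intro box) linarith+
    qed
  qed
  have c1: "compact D1" unfolding compact_eq_bounded_closed
  proof
    show "bounded D1" using sub bounded_cbox bounded_subset by blast
    show "closed D1" unfolding D1_def by (intro closed_Collect_conj closed_Collect_le continuous_intros) auto
  qed
  have c2: "compact D2" unfolding compact_eq_bounded_closed
  proof
    show "bounded D2" using sub bounded_cbox bounded_subset by blast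
    show "closed D2" unfolding D2_def by (intro closed_Collect_conj closed_Collect_le continuous_intros) auto
  qed
  have k': "continuous_on UNIV (\<lambda>p. k (fst p) (snd p - (fst p)\<^sup>2 / 2))"
    using continuous_on_compose2[OF k, of UNIV "\<lambda>p. (fst p, snd p - (fst p)\<^sup>2 / 2)"]
    by (simp add: continuous_on_Pair continuous_intros)
  have i1: "integrable (lborel \<Otimes>\<^sub>M lborel) (\<lambda>(x, \<tau>). f1 x \<tau>)"
    using integrable_indicator_compact_pair[OF c1 k] by (simp add: f1_def)
  have i2: "integrable (lborel \<Otimes>\<^sub>M lborel) (\<lambda>(x, r). f2 x r)"
    using integrable_indicator_compact_pair[OF c2 k'] by (simp add: f2_def)
  have kx: "continuous_on X (\<lambda>x. k x a)" "continuous_on X (\<lambda>x. k x (a - x\<^sup>2 / 2))" for a X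
    using continuous_on_compose2[OF k, of X "\<lambda>x. (x, a)"] continuous_on_compose2[OF k, of X "\<lambda>x. (x, a - x\<^sup>2 / 2)"]
    by (simp_all add: continuous_on_Pair continuous_intros)
  have in1: "(LINT x|lborel. f1 x \<tau>) = indicat_real {0..t} \<tau> * integral {0..sqrt (2 * (t - \<tau>))} (\<lambda>x. k x \<tau>)" for \<tau>
  proof (cases "\<tau> \<in> {0..t}")
    case True
    then have "f1 x \<tau> = indicat_real {0..sqrt (2 * (t - \<tau>))} x * k x \<tau>" for x
      using le[of x "t - \<tau>"] by (cases "0 \<le> x") (auto simp: f1_def D1_def indicator_def)
    then have "(LINT x|lborel. f1 x \<tau>) = (LBINT x:{0..sqrt (2 * (t - \<tau>))}. k x \<tau>)"
      by (simp add: set_lebesgue_integral_def)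
    also have "\<dots> = integral {0..sqrt (2 * (t - \<tau>))} (\<lambda>x. k x \<tau>)"
      by (intro set_borel_integral_eq_integral(2) borel_integrable_atLeastAtMost' kx)
    finally show ?thesis using True by simp
  next
    case False
    then have "f1 x \<tau> = 0" for x
    proof -
      have "(x, \<tau>) \<notin> D1"
      proof
        assume "(x, \<tau>) \<in> D1"
        then have "0 \<le> \<tau>" "\<tau> + x\<^sup>2 / 2 \<le> t" by (simp_all add: D1_def)
        moreover have "0 \<le> x\<^sup>2 / 2" by simp
        ultimately have "0 \<le> \<tau>" "\<tau> \<le> t" by linarith+
        with False show False by simp
      qed
      then show ?thesis by (simp add: f1_def)
    qed
    then show ?thesis using False by simp
  qed
  have in2: "(LINT x|lborel. f2 x r) = indicat_real {0..t} r * integral {0..sqrt (2 * r)} (\<lambda>x. k x (r - x\<^sup>2 / 2))" for r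
  proof (cases "r \<in> {0..t}")
    case True
    then have "f2 x r = indicat_real {0..sqrt (2 * r)} x * k x (r - x\<^sup>2 / 2)" for x
      using le[of x r] by (cases "0 \<le> x") (auto simp: f2_def D2_def indicator_def)
    then have "(LINT x|lborel. f2 x r) = (LBINT x:{0..sqrt (2 * r)}. k x (r - x\<^sup>2 / 2))"
      by (simp add: set_lebesgue_integral_def)
    also have "\<dots> = integral {0..sqrt (2 * r)} (\<lambda>x. k x (r - x\<^sup>2 / 2))"
      by (intro set_borel_integral_eq_integral(2) borel_integrable_atLeastAtMost' kx)
    finally show ?thesis using True by simp
  next
    case False
    then have "f2 x r = 0" for x
    proof -
      have "(x, r) \<notin> D2"
      proof
        assume "(x, r) \<in> D2"
        then have "x\<^sup>2 / 2 \<le> r" "r \<le> t" by (simp_all add: D2_def)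
        moreover have "0 \<le> x\<^sup>2 / 2" by simp
        ultimately have "0 \<le> r" "r \<le> t" by linarith+
        with False show False by simp
      qed
      then show ?thesis by (simp add: f2_def)
    qed
    then show ?thesis using False by simp
  qed
  have s1: "integral {0..t} (\<lambda>\<tau>. integral {0..sqrt (2 * (t - \<tau>))} (\<lambda>x. k x \<tau>)) = (LINT \<tau>|lborel. LINT x|lborel. f1 x \<tau>)"
    using lborel_pair.integrable_snd[OF i1] unfolding in1
    by (subst set_borel_integral_eq_integral(2)[symmetric]) (auto simp: set_integrable_def set_lebesgue_integral_def)
  have s2: "integral {0..t} (\<lambda>r. integral {0..sqrt (2 * r)} (\<lambda>x. k x (r - x\<^sup>2 / 2))) = (LINT r|lborel. LINT x|lborel. f2 x r)"
    using lborel_pair.integrable_snd[OF i2] unfolding in2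
    by (subst set_borel_integral_eq_integral(2)[symmetric]) (auto simp: set_integrable_def set_lebesgue_integral_def)
  have shift: "(LINT \<tau>|lborel. f1 x \<tau>) = (LINT r|lborel. f2 x r)" for x
  proof -
    have "f2 x r = f1 x (- (x\<^sup>2 / 2) + 1 * r)" for r
      by (auto simp: f1_def f2_def D1_def D2_def indicator_def)
    then show ?thesis using lborel_integral_real_affine[of 1 "f1 x" "- (x\<^sup>2 / 2)"] by simp
  qed
  show ?thesis unfolding s1 s2 lborel_pair.Fubini_integral[OF i1] lborel_pair.Fubini_integral[OF i2] shift ..
qed

text \<open>The integrated form of z_t = F + z_ss for z = \<open>duhamel F\<close>. Only one space
  derivative G of F is at hand: heat x F - F is the integral of \<open>heatY\<close> applied to G
  over {0..x}, and \<open>parabola_Fubini\<close> turns the resulting double integral into the time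
  integral of \<open>duhamelY G\<close>, which is z_ss.\<close>

lemma duhamel_time_integral:
  assumes F: "bounded_continuous2 B F" and G: "bounded_continuous2 C G"
    and d: "\<And>t s. (F t has_real_derivative G t s) (at s)" and t: "t \<ge> 0"
  shows "duhamel F t s = integral {0..t} (\<lambda>r. F r s + duhamelY G r s)"
proof -
  have h: "heat x (F \<tau>) s = F \<tau> s + integral {0..x} (\<lambda>\<rho>. heatY \<rho> (G \<tau>) s)" if "x \<ge> 0" for x \<tau>
  proof -
    have "((\<lambda>\<rho>. heatY \<rho> (G \<tau>) s) has_integral heat x (F \<tau>) s - heat 0 (F \<tau>) s) {0..x}"
    proof (rule fundamental_theorem_of_calculus[OF that])
      fix \<rho>
      have "((\<lambda>x. heat x (F \<tau>) s) has_real_derivative heatY \<rho> (G \<tau>) s) (at \<rho>)"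
        by (rule heat_derivatives(2)[OF d bounded_continuous2_slice[OF G] bounded_continuous2_slice(2)[OF F]])
      from has_field_derivative_at_within[OF this]
      show "((\<lambda>x. heat x (F \<tau>) s) has_vector_derivative heatY \<rho> (G \<tau>) s) (at \<rho> within {0..x})"
        by (simp add: has_real_derivative_iff_has_vector_derivative)
    qed
    from integral_unique[OF this] show ?thesis by simp
  qed
  have cF: "continuous_on X (\<lambda>r. F r s)" for X
    by (intro bounded_continuous2_compose[OF F] continuous_intros)
  have kc: "continuous_on X (\<lambda>p :: real \<times> real. heatY (fst p) (G (snd p)) s)" for X
    by (intro heat_continuous[OF G] continuous_intros)
  have cY: "continuous_on X (\<lambda>r. duhamelY G r s)" for X
    using continuous_on_compose2[OF duhamel_continuous(2)[OF G, of UNIV], of X "\<lambda>r. (r, s)"]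
    by (simp add: continuous_on_Pair continuous_intros)
  have ch: "continuous_on X (\<lambda>\<tau>. heat (sqrt (2 * (t - \<tau>))) (F \<tau>) s)" for X
    by (intro heat_continuous[OF F] continuous_intros)
  have "duhamel F t s = integral {0..t} (\<lambda>\<tau>. F \<tau> s + (heat (sqrt (2 * (t - \<tau>))) (F \<tau>) s - F \<tau> s))"
    unfolding duhamel_time_form[OF F t] by simp
  also have "\<dots> = integral {0..t} (\<lambda>\<tau>. F \<tau> s) + integral {0..t} (\<lambda>\<tau>. heat (sqrt (2 * (t - \<tau>))) (F \<tau>) s - F \<tau> s)"
    by (intro Henstock_Kurzweil_Integration.integral_add integrable_continuous_real continuous_intros cF ch)
  also have "integral {0..t} (\<lambda>\<tau>. heat (sqrt (2 * (t - \<tau>))) (F \<tau>) s - F \<tau> s) =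
      integral {0..t} (\<lambda>\<tau>. integral {0..sqrt (2 * (t - \<tau>))} (\<lambda>x. heatY x (G \<tau>) s))"
    by (intro integral_cong) (simp add: h)
  also have "\<dots> = integral {0..t} (\<lambda>r. integral {0..sqrt (2 * r)} (\<lambda>x. heatY x (G (r - x\<^sup>2 / 2)) s))"
    by (rule parabola_Fubini[OF kc t])
  also have "\<dots> = integral {0..t} (\<lambda>r. duhamelY G r s)"
    by (intro integral_cong) (simp add: duhamelY_space_form[OF G])
  also have "integral {0..t} (\<lambda>\<tau>. F \<tau> s) + integral {0..t} (\<lambda>r. duhamelY G r s) = integral {0..t} (\<lambda>r. F r s + duhamelY G r s)"
    by (intro Henstock_Kurzweil_Integration.integral_add[symmetric] integrable_continuous_real cF cY)
  finally show ?thesis .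
qed

text \<open>In the norm weighted by exp (- K t) the Duhamel operator has size 1 / K, so a large K
  turns a Lipschitz source into a contraction on the whole of {0..T} at once.\<close>

lemma duhamel_weighted_bound:
  assumes F: "bounded_continuous2 B F" and t: "t \<ge> 0" and K: "K > 0" and b: "b \<ge> 0"
    and le: "\<And>\<tau> s. \<tau> \<in> {0..t} \<Longrightarrow> \<bar>F \<tau> s\<bar> \<le> b * exp (K * \<tau>)"
  shows "\<bar>duhamel F t s\<bar> \<le> b * exp (K * t) / K"
proof -
  have e: "((\<lambda>\<tau>. b * exp (K * \<tau>)) has_integral (b * exp (K * t) / K - b * exp (K * 0) / K)) {0..t}"
  proof (rule fundamental_theorem_of_calculus[OF t])
    fix \<tau>
    have "((\<lambda>\<tau>. b * exp (K * \<tau>) / K) has_real_derivative b * exp (K * \<tau>)) (at \<tau> within {0..t})"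
      using K by (auto intro!: derivative_eq_intros)
    then show "((\<lambda>\<tau>. b * exp (K * \<tau>) / K) has_vector_derivative b * exp (K * \<tau>)) (at \<tau> within {0..t})"
      by (simp add: has_real_derivative_iff_has_vector_derivative)
  qed
  have "norm (duhamel F t s) \<le> integral {0..t} (\<lambda>\<tau>. b * exp (K * \<tau>))"
    unfolding duhamel_time_form[OF F t]
  proof (rule integral_norm_bound_integral)
    show "(\<lambda>\<tau>. heat (sqrt (2 * (t - \<tau>))) (F \<tau>) s) integrable_on {0..t}"
      by (intro integrable_continuous_real heat_continuous[OF F] continuous_intros)
    show "norm (heat (sqrt (2 * (t - \<tau>))) (F \<tau>) s) \<le> b * exp (K * \<tau>)" if "\<tau> \<in> {0..t}" for \<tau>
      unfolding real_norm_def by (intro heat_bound bounded_continuous2_slice[OF F] le that)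
  qed (use e in \<open>rule has_integral_integrable\<close>)
  also have "\<dots> = b * exp (K * t) / K - b / K" using integral_unique[OF e] by simp
  also have "\<dots> \<le> b * exp (K * t) / K" using b K by simp
  finally show ?thesis by simp
qed

lemma heat_diff:
  assumes "continuous_on UNIV f" "\<And>z. \<bar>f z\<bar> \<le> B" "continuous_on UNIV g" "\<And>z. \<bar>g z\<bar> \<le> C"
  shows "heat x f s - heat x g s = heat x (\<lambda>z. f z - g z) s"
  unfolding heat_def by (intro Bochner_Integration.integral_diff[symmetric] heat_integrable[OF assms(1,2)] heat_integrable[OF assms(3,4)])

lemma bounded_continuous2_diff:
  assumes F: "bounded_continuous2 B F" and G: "bounded_continuous2 C G"
  shows "bounded_continuous2 (B + C) (\<lambda>t s. F t s - G t s)"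
proof -
  have "continuous_on UNIV (\<lambda>(t, s). F t s - G t s)"
    using F G unfolding bounded_continuous2_def split_beta by (intro continuous_intros) auto
  moreover have "\<bar>F t s - G t s\<bar> \<le> B + C" for t s
    using bounded_continuous2_slice(2)[OF F, of t s] bounded_continuous2_slice(2)[OF G, of t s] by linarith
  ultimately show ?thesis by (simp add: bounded_continuous2_def)
qed

lemma duhamel_diff:
  assumes F: "bounded_continuous2 B F" and G: "bounded_continuous2 C G"
  shows "duhamel F t s - duhamel G t s = duhamel (\<lambda>t s. F t s - G t s) t s"
proof -
  have "integral {0..1} (\<lambda>\<xi>. \<xi> * heat (sqrt (2 * t) * \<xi>) (F (t * (1 - \<xi>\<^sup>2))) s) -
      integral {0..1} (\<lambda>\<xi>. \<xi> * heat (sqrt (2 * t) * \<xi>) (G (t * (1 - \<xi>\<^sup>2))) s) =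
      integral {0..1} (\<lambda>\<xi>. \<xi> * heat (sqrt (2 * t) * \<xi>) (F (t * (1 - \<xi>\<^sup>2))) s - \<xi> * heat (sqrt (2 * t) * \<xi>) (G (t * (1 - \<xi>\<^sup>2))) s)"
    by (intro Henstock_Kurzweil_Integration.integral_diff[symmetric] integrable_continuous_real duhamel_integrand_continuous[OF F] duhamel_integrand_continuous[OF G])
  also have "\<dots> = integral {0..1} (\<lambda>\<xi>. \<xi> * heat (sqrt (2 * t) * \<xi>) (\<lambda>s. F (t * (1 - \<xi>\<^sup>2)) s - G (t * (1 - \<xi>\<^sup>2)) s) s)"
    by (simp add: right_diff_distrib[symmetric] heat_diff[OF bounded_continuous2_slice[OF F] bounded_continuous2_slice[OF G]])
  finally show ?thesis unfolding duhamel_def by (simp add: right_diff_distrib[symmetric])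
qed

lemma heat_periodic:
  assumes "\<And>z. f (z + L) = f z"
  shows "heat x f (s + L) = heat x f s" "heatY x f (s + L) = heatY x f s"
proof -
  have "f (s + L + x * y) = f (s + x * y)" for y
    using assms[of "s + x * y"] by (simp add: algebra_simps)
  then show "heat x f (s + L) = heat x f s" "heatY x f (s + L) = heatY x f s"
    by (simp_all add: heat_def heatY_def)
qed

lemma duhamel_periodic:
  assumes "\<And>t z. F t (z + L) = F t z"
  shows "duhamel F t (s + L) = duhamel F t s" "duhamelY F t (s + L) = duhamelY F t s"
  unfolding duhamel_def duhamelY_def heat_periodic[of "F _" L, OF assms] by (rule refl)+

text \<open>Since Y has mean zero, f s can be subtracted inside the expectation, and Hoelder
  continuity leaves H sqrt x times the mean of |Y|^(3/2). Bounding |y|^(3/2) by 1 + y^2, whose mean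
  is 2, gives the constant.\<close>

lemma heatY_Hoelder_bound:
  assumes f: "continuous_on UNIV f" "\<And>z. \<bar>f z\<bar> \<le> B"
    and H: "\<And>z z'. \<bar>f z - f z'\<bar> \<le> H * sqrt \<bar>z - z'\<bar>" and x: "x \<ge> 0"
  shows "\<bar>heatY x f s\<bar> \<le> 2 * H * sqrt x"
proof -
  have H0: "H \<ge> 0" using H[of 1 0] by (auto intro: order_trans[OF abs_ge_zero])
  have c: "continuous_on UNIV (\<lambda>y. y * (f (s + x * y) - f s))"
    by (intro continuous_intros continuous_on_compose2[OF f(1)]) auto
  have b: "\<bar>y * (f (s + x * y) - f s)\<bar> \<le> H * sqrt x * (1 + y\<^sup>2)" for y
  proof -
    have *: "\<bar>y\<bar> * sqrt \<bar>y\<bar> \<le> 1 + y\<^sup>2"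
    proof (cases "\<bar>y\<bar> \<le> 1")
      case True
      then have "\<bar>y\<bar> * sqrt \<bar>y\<bar> \<le> 1 * 1" by (intro mult_mono) auto
      then show ?thesis using zero_le_power2[of y] by linarith
    next
      case False
      then have "\<bar>y\<bar> * 1 \<le> \<bar>y\<bar> * \<bar>y\<bar>" by (intro mult_left_mono) auto
      then have "\<bar>y\<bar> \<le> \<bar>y\<bar>\<^sup>2" by (simp only: power2_eq_square mult_1_right)
      then have "sqrt \<bar>y\<bar> \<le> \<bar>y\<bar>" by (intro real_le_lsqrt) auto
      then have "\<bar>y\<bar> * sqrt \<bar>y\<bar> \<le> \<bar>y\<bar> * \<bar>y\<bar>" by (intro mult_left_mono) auto
      then show ?thesis by (simp add: power2_eq_square)
    qed
    have "\<bar>f (s + x * y) - f s\<bar> \<le> H * (sqrt x * sqrt \<bar>y\<bar>)"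
      using H[of "s + x * y" s] x by (simp add: abs_mult real_sqrt_mult)
    then have "\<bar>y * (f (s + x * y) - f s)\<bar> \<le> \<bar>y\<bar> * (H * (sqrt x * sqrt \<bar>y\<bar>))"
      unfolding abs_mult by (intro mult_left_mono) auto
    also have "\<dots> = H * sqrt x * (\<bar>y\<bar> * sqrt \<bar>y\<bar>)" by simp
    also have "\<dots> \<le> H * sqrt x * (1 + y\<^sup>2)" using * H0 x by (intro mult_left_mono) auto
    finally show ?thesis .
  qed
  have wi: "integrable gauss (\<lambda>y. H * sqrt x * (1 + y\<^sup>2))" using gauss_moments by auto
  have "heatY x f s = (LINT y|gauss. y * f (s + x * y)) - (LINT y|gauss. y * f s)"
    using gauss_moments by (simp add: heatY_def)
  also have "\<dots> = (LINT y|gauss. y * (f (s + x * y) - f s))"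
    using heat_integrable(2)[OF f] gauss_moments(1) by (simp add: right_diff_distrib)
  finally have "\<bar>heatY x f s\<bar> \<le> (LINT y|gauss. \<bar>y * (f (s + x * y) - f s)\<bar>)"
    using integral_abs_bound by metis
  also have "\<dots> \<le> (LINT y|gauss. H * sqrt x * (1 + y\<^sup>2))"
    using gauss_integrable_bounded_by[OF c b wi] wi b by (intro integral_mono) auto
  also have "\<dots> = 2 * H * sqrt x" using gauss_moments by simp
  finally show ?thesis .
qed

lemma heat_sqrt_time_derivative:
  assumes d: "\<And>z. (f has_real_derivative g z) (at z)" and g: "continuous_on UNIV g" "\<And>z. \<bar>g z\<bar> \<le> B"
    and f: "\<And>z. \<bar>f z\<bar> \<le> C" and t: "t > 0"
  shows "((\<lambda>t. heat (sqrt (2 * t)) f s) has_real_derivative heatY (sqrt (2 * t)) g s / sqrt (2 * t)) (at t)"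
proof -
  have "((\<lambda>t. sqrt (2 * t)) has_real_derivative 1 / sqrt (2 * t)) (at t)"
    using t by (auto intro!: derivative_eq_intros simp: field_simps)
  from DERIV_chain2[OF heat_derivatives(2)[OF d g f] this] show ?thesis by simp
qed

section \<open>Mild solutions\<close>

definition jointly_continuous :: "(real \<Rightarrow> real \<Rightarrow> real) \<Rightarrow> bool" where
  "jointly_continuous u \<longleftrightarrow> continuous_on UNIV (\<lambda>(t, s). u t s)"

lemma jointly_continuous_compose:
  assumes "jointly_continuous F" "continuous_on X f" "continuous_on X g"
  shows "continuous_on X (\<lambda>p. F (f p) (g p))"
proof -
  have "continuous_on UNIV (\<lambda>(t, s). F t s)" using assms by (simp add: jointly_continuous_def)
  from continuous_on_compose2[OF this continuous_on_Pair[OF assms(2,3)]] show ?thesis by simp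
qed

lemma jointly_continuousI:
  assumes "continuous_on UNIV (\<lambda>p. F (fst p) (snd p))"
  shows "jointly_continuous F"
  using assms by (simp add: jointly_continuous_def split_beta)

lemma bounded_continuous2_iff: "bounded_continuous2 B F \<longleftrightarrow> jointly_continuous F \<and> (\<forall>t s. \<bar>F t s\<bar> \<le> B)"
  by (simp add: bounded_continuous2_def jointly_continuous_def)

lemma norm_Pair_le_sum: "norm (a, b) \<le> \<bar>a\<bar> + \<bar>b\<bar>" for a b :: real
  using norm_Pair_le[of a b] by simp

text \<open>Needed for closedness of the set in which the fixed point is sought: uniform convergence
  of the v-components preserves u_s = v - c in the limit.\<close>

lemma DERIV_uniform_limit:
  fixes f f' :: "nat \<Rightarrow> real \<Rightarrow> real"
  assumes d: "\<And>n x. (f n has_real_derivative f' n x) (at x)"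
    and lim: "\<And>x. (\<lambda>n. f n x) \<longlonglongrightarrow> g x"
    and unif: "\<And>n x. \<bar>f' n x - g' x\<bar> \<le> e n" and e: "e \<longlonglongrightarrow> 0"
  shows "(g has_real_derivative g' x) (at x)"
proof -
  have "\<exists>h. \<forall>x\<in>UNIV. (\<lambda>n. f n x) \<longlonglongrightarrow> h x \<and> (h has_derivative (\<lambda>y. g' x * y)) (at x within UNIV)"
  proof (rule has_derivative_sequence[where f'="\<lambda>n x y. f' n x * y" and ?x0.0=0 and l="g 0"])
    show "(f n has_derivative (*) (f' n x)) (at x)" for n x
      using d[of n x] by (simp add: has_field_derivative_def)
    fix r :: real assume "r > 0"
    with e have "\<forall>\<^sub>F n in sequentially. dist (e n) 0 < r" by (rule tendstoD)
    then show "\<forall>\<^sub>F n in sequentially. \<forall>x\<in>UNIV. \<forall>y. norm (f' n x * y - g' x * y) \<le> r * norm y"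
    proof eventually_elim
      case (elim n)
      show ?case
      proof (intro ballI allI)
        fix x y
        have "norm (f' n x * y - g' x * y) = \<bar>f' n x - g' x\<bar> * norm y"
          by (simp add: left_diff_distrib[symmetric] abs_mult)
        also have "\<dots> \<le> r * norm y" using unif[of n x] elim by (intro mult_right_mono) auto
        finally show "norm (f' n x * y - g' x * y) \<le> r * norm y" .
      qed
    qed
  qed (use lim in auto)
  then obtain h where h: "\<And>x. (\<lambda>n. f n x) \<longlonglongrightarrow> h x" "\<And>x. (h has_derivative (\<lambda>y. g' x * y)) (at x)"
    by auto
  have "h = g" using h(1) lim LIMSEQ_unique by blast
  with h(2)[of x] show ?thesis by (simp add: has_field_derivative_def)
qed

text \<open>Banach's fixed point theorem for the pair (u, v). The Lipschitz constant depends on a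
  bound for v, so the iteration is kept in a set \<open>S\<close> of pairs with a growth bound on v,
  which is invariant because |GG u v| <= \<Lambda> |v|. \<open>S\<close> also contains periodicity
  and the relation u_s = v - c; \<open>FG_deriv\<close> is what carries this relation through one
  iteration step, the Duhamel term of FF having that of GG as its derivative.\<close>

theorem mild_solution_exists:
  fixes FF GG :: "(real \<Rightarrow> real) \<Rightarrow> (real \<Rightarrow> real) \<Rightarrow> real \<Rightarrow> real" and u0 v0 :: "real \<Rightarrow> real" and T L c \<Lambda> :: real
  assumes T: "T \<ge> 0" and \<Lambda>: "\<Lambda> > 0"
    and u0: "\<And>s. (u0 has_real_derivative v0 s - c) (at s)" "\<And>s. \<bar>u0 s\<bar> \<le> U0" "\<And>s. u0 (s + L) = u0 s"
    and v0: "continuous_on UNIV v0" "\<And>s. \<bar>v0 s\<bar> \<le> V0" "\<And>s. v0 (s + L) = v0 s"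
    and FG_cont: "\<And>u v. jointly_continuous u \<Longrightarrow> jointly_continuous v \<Longrightarrow>
        jointly_continuous (\<lambda>t. FF (u t) (v t)) \<and> jointly_continuous (\<lambda>t. GG (u t) (v t))"
    and F_bound: "\<And>u v s. continuous_on UNIV u \<Longrightarrow> continuous_on UNIV v \<Longrightarrow> \<bar>FF u v s\<bar> \<le> \<Lambda>"
    and G_bound: "\<And>u v s. continuous_on UNIV u \<Longrightarrow> continuous_on UNIV v \<Longrightarrow> \<bar>GG u v s\<bar> \<le> \<Lambda> * \<bar>v s\<bar>"
    and Lip: "\<And>M. \<exists>C. \<forall>u v u' v' d s. continuous_on UNIV u \<longrightarrow> continuous_on UNIV v \<longrightarrow>
        continuous_on UNIV u' \<longrightarrow> continuous_on UNIV v' \<longrightarrow>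
        (\<forall>s. \<bar>v s\<bar> \<le> M \<and> \<bar>v' s\<bar> \<le> M \<and> \<bar>u s - u' s\<bar> \<le> d \<and> \<bar>v s - v' s\<bar> \<le> d) \<longrightarrow>
        \<bar>FF u v s - FF u' v' s\<bar> \<le> C * d \<and> \<bar>GG u v s - GG u' v' s\<bar> \<le> C * d"
    and FG_deriv: "\<And>u v s. continuous_on UNIV v \<Longrightarrow> (\<And>s. (u has_real_derivative v s - c) (at s)) \<Longrightarrow>
        (FF u v has_real_derivative GG u v s) (at s)"
    and FG_per: "\<And>u v s. (\<And>s. u (s + L) = u s) \<Longrightarrow> (\<And>s. v (s + L) = v s) \<Longrightarrow>
        FF u v (s + L) = FF u v s \<and> GG u v (s + L) = GG u v s"
  obtains u v B where "jointly_continuous u" "jointly_continuous v"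
    "bounded_continuous2 \<Lambda> (\<lambda>t. FF (u t) (v t))" "bounded_continuous2 B (\<lambda>t. GG (u t) (v t))"
    "\<And>t s. t \<in> {0..T} \<Longrightarrow> u t s = heat (sqrt (2 * t)) u0 s + duhamel (\<lambda>t. FF (u t) (v t)) t s"
    "\<And>t s. t \<in> {0..T} \<Longrightarrow> v t s = heat (sqrt (2 * t)) v0 s + duhamel (\<lambda>t. GG (u t) (v t)) t s"
    "\<And>t s. (u t has_real_derivative v t s - c) (at s)"
    "\<And>t s. u t (s + L) = u t s" "\<And>t s. v t (s + L) = v t s"
proof -
  \<comment> \<open>With this V the bound V exp (2 \<Lambda> t) reproduces itself: the initial data
    contribute V0 = V / 2, and the Duhamel term contributes V / 2 times the exponential.\<close>
  define V where "V = 2 * V0"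
  have V0: "V0 \<ge> 0" using v0(2)[of 0] by linarith
  define M where "M = V * exp (2 * \<Lambda> * T)"
  obtain C0 where C0: "\<And>u v u' v' d s. continuous_on UNIV u \<Longrightarrow> continuous_on UNIV v \<Longrightarrow>
        continuous_on UNIV u' \<Longrightarrow> continuous_on UNIV v' \<Longrightarrow>
        (\<And>s. \<bar>v s\<bar> \<le> M \<and> \<bar>v' s\<bar> \<le> M \<and> \<bar>u s - u' s\<bar> \<le> d \<and> \<bar>v s - v' s\<bar> \<le> d) \<Longrightarrow>
        \<bar>FF u v s - FF u' v' s\<bar> \<le> C0 * d \<and> \<bar>GG u v s - GG u' v' s\<bar> \<le> C0 * d"
    using Lip[of M] by metis
  define C where "C = max C0 1"
  have C: "C > 0" "C0 \<le> C" by (auto simp: C_def)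
  \<comment> \<open>Each component then contracts by C / K = 1 / 4, hence the pair by 1 / 2.\<close>
  define K where "K = 4 * C"
  have K: "K > 0" using C by (simp add: K_def)
  \<comment> \<open>Time is clamped to {0..T}, so that the complete space of bounded continuous
    functions on the whole plane can be used; all functions below depend on t through
    \<open>cl t\<close> only.\<close>
  define cl where "cl t = max 0 (min T t)" for t
  have cl: "cl t \<in> {0..T}" "cl (cl t) = cl t" for t using T by (auto simp: cl_def)
  have cl_id: "cl t = t" if "t \<in> {0..T}" for t using that by (auto simp: cl_def)
  have clc: "continuous_on X (\<lambda>p. cl (f p))" if "continuous_on X f" for X and f :: "real \<times> real \<Rightarrow> real"
    unfolding cl_def by (intro continuous_intros that)
  \<comment> \<open>\<open>Z\<close> stores the weighted pair exp (- K t) (u, v), so its plain sup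
    norm is the weighted norm of (u, v).\<close>
  define uZ where "uZ Z t s = exp (K * cl t) * fst (apply_bcontfun Z (cl t, s))" for Z :: "(real \<times> real) \<Rightarrow>\<^sub>C (real \<times> real)" and t s
  define vZ where "vZ Z t s = exp (K * cl t) * snd (apply_bcontfun Z (cl t, s))" for Z :: "(real \<times> real) \<Rightarrow>\<^sub>C (real \<times> real)" and t s
  have app: "continuous_on X (\<lambda>p. apply_bcontfun Z (f p))" if "continuous_on X f"
    for X and Z :: "(real \<times> real) \<Rightarrow>\<^sub>C (real \<times> real)" and f :: "real \<times> real \<Rightarrow> real \<times> real"
    by (rule continuous_on_compose2[OF continuous_on_apply_bcontfun that]) auto
  have jc: "jointly_continuous (uZ Z)" "jointly_continuous (vZ Z)" for Z
    unfolding uZ_def vZ_def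
    by (intro jointly_continuousI continuous_intros clc app continuous_on_Pair)+
  have slice: "continuous_on X (uZ Z t)" "continuous_on X (vZ Z t)" for Z t X
    using jointly_continuous_compose[OF jc(1), of X "\<lambda>_. t" "\<lambda>s. s" Z]
      jointly_continuous_compose[OF jc(2), of X "\<lambda>_. t" "\<lambda>s. s" Z] by simp_all
  define FZ where "FZ Z t = FF (uZ Z t) (vZ Z t)" for Z t
  define GZ where "GZ Z t = GG (uZ Z t) (vZ Z t)" for Z t
  have bF: "bounded_continuous2 \<Lambda> (FZ Z)" for Z
    unfolding bounded_continuous2_iff FZ_def using FG_cont jc F_bound slice by blast
  have exp_le: "exp (K * cl t) \<le> exp (K * T)" for t using cl(1)[of t] K by simp
  have vZ_le: "\<bar>vZ Z t s\<bar> \<le> exp (K * T) * norm Z" for Z t s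
  proof -
    have "\<bar>snd (apply_bcontfun Z (cl t, s))\<bar> \<le> norm (apply_bcontfun Z (cl t, s))"
      using norm_snd_le[of "snd (apply_bcontfun Z (cl t, s))" "fst (apply_bcontfun Z (cl t, s))"] by simp
    also have "\<dots> \<le> norm Z" by (rule norm_bounded)
    finally show ?thesis unfolding vZ_def abs_mult using exp_le by (intro mult_mono) auto
  qed
  \<comment> \<open>This bound depends on \<open>Z\<close>; it makes the Duhamel integrals available
    before membership in \<open>S\<close> is used for uniform estimates.\<close>
  have bG: "bounded_continuous2 (\<Lambda> * (exp (K * T) * norm Z)) (GZ Z)" for Z
    unfolding bounded_continuous2_iff
  proof (intro conjI allI)
    show "jointly_continuous (GZ Z)" unfolding GZ_def using FG_cont jc by blast
    fix t s
    have "\<bar>GZ Z t s\<bar> \<le> \<Lambda> * \<bar>vZ Z t s\<bar>" unfolding GZ_def by (intro G_bound slice)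
    also have "\<dots> \<le> \<Lambda> * (exp (K * T) * norm Z)" using vZ_le \<Lambda> by (intro mult_left_mono) auto
    finally show "\<bar>GZ Z t s\<bar> \<le> \<Lambda> * (exp (K * T) * norm Z)" .
  qed
  have u0c: "continuous_on UNIV u0"
    by (intro continuous_at_imp_continuous_on ballI) (rule DERIV_isCont[OF u0(1)])
  have b0: "bounded_continuous2 U0 (\<lambda>_. u0)" "bounded_continuous2 V0 (\<lambda>_. v0)"
    unfolding bounded_continuous2_def split_beta
    using u0(2) v0(2) by (auto intro!: continuous_on_compose2[OF u0c] continuous_on_compose2[OF v0(1)] continuous_on_snd continuous_on_id)
  define P where "P Z t s = heat (sqrt (2 * cl t)) u0 s + duhamel (FZ Z) (cl t) s" for Z t s
  define Q where "Q Z t s = heat (sqrt (2 * cl t)) v0 s + duhamel (GZ Z) (cl t) s" for Z t s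
  define \<Phi>0 where "\<Phi>0 Z p = (exp (- K * cl (fst p)) * P Z (fst p) (snd p), exp (- K * cl (fst p)) * Q Z (fst p) (snd p))" for Z and p :: "real \<times> real"
  have duh_bound: "\<bar>duhamel F (cl t) s\<bar> \<le> B * exp (1 * cl t)" if "bounded_continuous2 B F" for F B t s
  proof -
    have "\<bar>F 0 0\<bar> \<le> B" by (rule bounded_continuous2_slice(2)[OF that])
    then have B: "B \<ge> 0" by linarith
    have "\<bar>duhamel F (cl t) s\<bar> \<le> B * exp (1 * cl t) / 1"
    proof (rule duhamel_weighted_bound[OF that])
      fix \<tau> s assume "\<tau> \<in> {0..cl t}"
      then have "B * 1 \<le> B * exp (1 * \<tau>)" using B by (intro mult_left_mono) auto
      then show "\<bar>F \<tau> s\<bar> \<le> B * exp (1 * \<tau>)" using bounded_continuous2_slice(2)[OF that, of \<tau> s] by linarith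
    qed (use cl B in auto)
    then show ?thesis by simp
  qed
  have duh_c: "continuous_on X (\<lambda>p. duhamel F (cl (fst p)) (snd p))" if "bounded_continuous2 B F" for F B and X :: "(real \<times> real) set"
  proof -
    have "continuous_on X (\<lambda>p. (cl (fst p), snd p))" by (intro continuous_on_Pair clc continuous_intros)
    from continuous_on_compose2[OF duhamel_continuous(1)[OF that] this subset_UNIV] show ?thesis by simp
  qed
  have PQc: "continuous_on X (\<lambda>p. P Z (fst p) (snd p))" "continuous_on X (\<lambda>p. Q Z (fst p) (snd p))" for Z and X :: "(real \<times> real) set"
    unfolding P_def Q_def
    by (intro continuous_intros heat_continuous[OF b0(1), of X _ "\<lambda>_. 0"] heat_continuous[OF b0(2), of X _ "\<lambda>_. 0"]
        clc duh_c[OF bF] duh_c[OF bG])+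
  have \<Phi>0: "\<Phi>0 Z \<in> bcontfun" for Z
  proof (rule bcontfun_normI)
    show "continuous_on UNIV (\<Phi>0 Z)" unfolding \<Phi>0_def
      by (intro continuous_on_Pair continuous_intros clc PQc)
    fix p :: "real \<times> real"
    have e1: "exp (- K * cl (fst p)) \<le> 1" using cl(1)[of "fst p"] K by (simp add: mult_nonneg_nonneg)
    have eT: "exp (1 * cl (fst p)) \<le> exp T" using cl(1)[of "fst p"] by simp
    have nn: "0 \<le> \<Lambda>" "0 \<le> \<Lambda> * (exp (K * T) * norm Z)" using \<Lambda> by auto
    have "\<bar>P Z (fst p) (snd p)\<bar> \<le> U0 + \<Lambda> * exp T"
      unfolding P_def using heat_bound[OF u0c u0(2), of "sqrt (2 * cl (fst p))" "snd p"]
        duh_bound[OF bF, of Z "fst p" "snd p"] mult_left_mono[OF eT nn(1)] by linarith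
    moreover have "\<bar>Q Z (fst p) (snd p)\<bar> \<le> V0 + \<Lambda> * (exp (K * T) * norm Z) * exp T"
      unfolding Q_def using heat_bound[OF v0(1,2), of "sqrt (2 * cl (fst p))" "snd p"]
        duh_bound[OF bG, of Z "fst p" "snd p"] mult_left_mono[OF eT nn(2)] by linarith
    moreover have "\<bar>exp (- K * cl (fst p)) * x\<bar> \<le> \<bar>x\<bar>" for x
      unfolding abs_mult using e1 by (intro mult_left_le_one_le) auto
    ultimately show "norm (\<Phi>0 Z p) \<le> (U0 + \<Lambda> * exp T) + (V0 + \<Lambda> * (exp (K * T) * norm Z) * exp T)"
      unfolding \<Phi>0_def by (intro order_trans[OF norm_Pair_le_sum] add_mono) (meson order_trans)+
  qed
  define \<Phi> where "\<Phi> Z = Bcontfun (\<Phi>0 Z)" for Z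
  have app\<Phi>: "apply_bcontfun (\<Phi> Z) = \<Phi>0 Z" for Z
    unfolding \<Phi>_def by (rule Bcontfun_inverse[OF \<Phi>0])
  have u\<Phi>: "uZ (\<Phi> Z) t s = P Z t s" "vZ (\<Phi> Z) t s = Q Z t s" for Z t s
    unfolding uZ_def vZ_def app\<Phi> \<Phi>0_def P_def Q_def by (simp_all add: cl(2) exp_minus)
  define S where "S = {Z. (\<forall>t s. \<bar>vZ Z t s\<bar> \<le> V * exp (2 * \<Lambda> * cl t)) \<and>
      (\<forall>t s. (uZ Z t has_real_derivative vZ Z t s - c) (at s)) \<and>
      (\<forall>t s. uZ Z t (s + L) = uZ Z t s \<and> vZ Z t (s + L) = vZ Z t s)}"
  have closeness: "\<bar>uZ Z t s - uZ Z' t s\<bar> \<le> exp (K * cl t) * dist Z Z'" "\<bar>vZ Z t s - vZ Z' t s\<bar> \<le> exp (K * cl t) * dist Z Z'" for Z Z' t s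
  proof -
    let ?a = "apply_bcontfun Z (cl t, s)" and ?b = "apply_bcontfun Z' (cl t, s)"
    have d: "dist ?a ?b \<le> dist Z Z'" by (rule dist_bounded)
    have "\<bar>fst ?a - fst ?b\<bar> \<le> dist ?a ?b" "\<bar>snd ?a - snd ?b\<bar> \<le> dist ?a ?b"
      using dist_fst_le[of ?a ?b] dist_snd_le[of ?a ?b] by (simp_all add: dist_real_def)
    with d have "\<bar>fst ?a - fst ?b\<bar> \<le> dist Z Z'" "\<bar>snd ?a - snd ?b\<bar> \<le> dist Z Z'" by linarith+
    then show "\<bar>uZ Z t s - uZ Z' t s\<bar> \<le> exp (K * cl t) * dist Z Z'" "\<bar>vZ Z t s - vZ Z' t s\<bar> \<le> exp (K * cl t) * dist Z Z'"
      by (simp_all add: uZ_def vZ_def right_diff_distrib[symmetric] abs_mult)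
  qed
  have "closed S" unfolding closed_sequential_limits
  proof (intro allI impI, elim conjE)
    fix Zn Z assume Zn: "\<forall>n. Zn n \<in> S" and lim: "Zn \<longlonglongrightarrow> Z"
    have dl: "(\<lambda>n. dist (Zn n) Z) \<longlonglongrightarrow> 0" by (rule tendsto_dist_iff[THEN iffD1, OF lim])
    have el: "(\<lambda>n. exp (K * cl t) * dist (Zn n) Z) \<longlonglongrightarrow> 0" for t
      by (rule tendsto_mult_right_zero[OF dl])
    have ul: "(\<lambda>n. uZ (Zn n) t s) \<longlonglongrightarrow> uZ Z t s" and vl: "(\<lambda>n. vZ (Zn n) t s) \<longlonglongrightarrow> vZ Z t s" for t s
      by (rule LIM_zero_cancel, rule Lim_null_comparison[OF always_eventually el[of t]], use closeness in simp)+
    show "Z \<in> S" unfolding S_def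
    proof (intro CollectI conjI allI)
      fix t s
      show "\<bar>vZ Z t s\<bar> \<le> V * exp (2 * \<Lambda> * cl t)"
        by (rule LIMSEQ_le_const2[OF tendsto_rabs[OF vl]]) (use Zn in \<open>auto simp: S_def\<close>)
      show "(uZ Z t has_real_derivative vZ Z t s - c) (at s)"
      proof (rule DERIV_uniform_limit[OF _ ul])
        show "(uZ (Zn n) t has_real_derivative vZ (Zn n) t x - c) (at x)" for n x using Zn by (simp add: S_def)
        show "\<bar>vZ (Zn n) t x - c - (vZ Z t x - c)\<bar> \<le> exp (K * cl t) * dist (Zn n) Z" for n x
          using closeness(2)[of "Zn n" t x Z] by simp
      qed (rule el)
      have "(\<lambda>n. uZ (Zn n) t (s + L)) = (\<lambda>n. uZ (Zn n) t s)" "(\<lambda>n. vZ (Zn n) t (s + L)) = (\<lambda>n. vZ (Zn n) t s)"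
        using Zn by (auto simp: S_def)
      then show "uZ Z t (s + L) = uZ Z t s" "vZ Z t (s + L) = vZ Z t s"
        using ul[of t "s + L"] ul[of t s] vl[of t "s + L"] vl[of t s] LIMSEQ_unique by metis+
    qed
  qed
  then have complete: "complete S" by (simp add: complete_eq_closed)
  have maps: "\<Phi> Z \<in> S" if Z: "Z \<in> S" for Z
    unfolding S_def
  proof (intro CollectI conjI allI)
    fix t s
    have vb: "\<bar>vZ Z t s\<bar> \<le> V * exp (2 * \<Lambda> * cl t)" for t s using Z by (simp add: S_def)
    have "\<bar>duhamel (GZ Z) (cl t) s\<bar> \<le> (\<Lambda> * V) * exp (2 * \<Lambda> * cl t) / (2 * \<Lambda>)"
    proof (rule duhamel_weighted_bound[OF bG])
      fix \<tau> s assume \<tau>: "\<tau> \<in> {0..cl t}"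
      then have "cl \<tau> = \<tau>" using cl(1)[of t] by (intro cl_id) auto
      have "\<bar>GZ Z \<tau> s\<bar> \<le> \<Lambda> * \<bar>vZ Z \<tau> s\<bar>" unfolding GZ_def by (intro G_bound slice)
      also have "\<dots> \<le> \<Lambda> * (V * exp (2 * \<Lambda> * \<tau>))" using vb[of \<tau> s] \<Lambda> \<open>cl \<tau> = \<tau>\<close> by (intro mult_left_mono) auto
      finally show "\<bar>GZ Z \<tau> s\<bar> \<le> \<Lambda> * V * exp (2 * \<Lambda> * \<tau>)" by simp
    qed (use cl \<Lambda> V0 in \<open>auto simp: V_def\<close>)
    also have "\<dots> = V0 * exp (2 * \<Lambda> * cl t)" using \<Lambda> by (simp add: V_def)
    finally have "\<bar>Q Z t s\<bar> \<le> V0 + V0 * exp (2 * \<Lambda> * cl t)"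
      unfolding Q_def using heat_bound[OF v0(1,2), of "sqrt (2 * cl t)" s] by linarith
    moreover have "V0 * 1 \<le> V0 * exp (2 * \<Lambda> * cl t)"
      using V0 \<Lambda> cl(1)[of t] by (intro mult_left_mono) auto
    ultimately show "\<bar>vZ (\<Phi> Z) t s\<bar> \<le> V * exp (2 * \<Lambda> * cl t)" by (simp add: u\<Phi> V_def)
    have FGd: "(FZ Z t has_real_derivative GZ Z t s) (at s)" for t s
      unfolding FZ_def GZ_def using Z by (intro FG_deriv slice) (simp add: S_def)
    have v0c: "continuous_on UNIV (\<lambda>s. v0 s - c)" by (intro continuous_intros v0)
    have v0c_le: "\<bar>v0 s - c\<bar> \<le> V0 + \<bar>c\<bar>" for s using v0(2)[of s] by linarith
    \<comment> \<open>The Gaussian has mass one, so averaging commutes with subtracting the constant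
      c.\<close>
    have "heat x (\<lambda>s. v0 s - c) s = heat x v0 s - c" for x s
      using heat_diff[OF v0(1,2), of "\<lambda>_. c" "\<bar>c\<bar>" x s] by (simp add: heat_def)
    with heat_derivatives(1)[OF u0(1) v0c v0c_le u0(2)]
    have hd: "(heat x u0 has_real_derivative heat x v0 s - c) (at s)" for x s by simp
    have "((\<lambda>s. heat (sqrt (2 * cl t)) u0 s + duhamel (FZ Z) (cl t) s) has_real_derivative
        (heat (sqrt (2 * cl t)) v0 s - c) + duhamel (GZ Z) (cl t) s) (at s)"
      by (intro DERIV_add hd duhamel_derivative[OF bF bG FGd])
    then have "((\<lambda>s. P Z t s) has_real_derivative Q Z t s - c) (at s)"
      unfolding P_def Q_def by (rule DERIV_cong) simp
    moreover have "uZ (\<Phi> Z) t = (\<lambda>s. P Z t s)" by (rule ext) (rule u\<Phi>)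
    ultimately show "(uZ (\<Phi> Z) t has_real_derivative vZ (\<Phi> Z) t s - c) (at s)"
      by (simp only: u\<Phi>(2))
    have "FZ Z t (z + L) = FZ Z t z" "GZ Z t (z + L) = GZ Z t z" for t z
      unfolding FZ_def GZ_def using Z FG_per[of "uZ Z t" "vZ Z t"] by (simp_all add: S_def)
    then show "uZ (\<Phi> Z) t (s + L) = uZ (\<Phi> Z) t s" "vZ (\<Phi> Z) t (s + L) = vZ (\<Phi> Z) t s"
      unfolding u\<Phi> P_def Q_def using heat_periodic(1)[of u0 L, OF u0(3)] heat_periodic(1)[of v0 L, OF v0(3)]
        duhamel_periodic(1)[of "FZ Z" L] duhamel_periodic(1)[of "GZ Z" L] by simp_all
  qed
  have contr: "dist (\<Phi> Z) (\<Phi> Z') \<le> 1 / 2 * dist Z Z'" if Z: "Z \<in> S" "Z' \<in> S" for Z Z'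
  proof (rule dist_bound)
    fix p :: "real \<times> real"
    let ?D = "dist Z Z'"
    define t s where "t = fst p" and "s = snd p"
    have FGdiff: "\<bar>FZ Z \<tau> s - FZ Z' \<tau> s\<bar> \<le> C * ?D * exp (K * \<tau>)" "\<bar>GZ Z \<tau> s - GZ Z' \<tau> s\<bar> \<le> C * ?D * exp (K * \<tau>)"
      if \<tau>: "\<tau> \<in> {0..cl t}" for \<tau> s
    proof -
      have \<tau>': "cl \<tau> = \<tau>" using \<tau> cl(1)[of t] by (intro cl_id) auto
      have "\<bar>vZ W \<tau> s\<bar> \<le> M" if "W \<in> S" for W s
      proof -
        have "\<bar>vZ W \<tau> s\<bar> \<le> V * exp (2 * \<Lambda> * cl \<tau>)" using that by (simp add: S_def)
        also have "\<dots> \<le> M" unfolding M_def using V0 \<Lambda> cl(1)[of \<tau>] by (intro mult_left_mono) (auto simp: V_def)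
        finally show ?thesis .
      qed
      then have "\<bar>FZ Z \<tau> s - FZ Z' \<tau> s\<bar> \<le> C0 * (exp (K * cl \<tau>) * ?D) \<and> \<bar>GZ Z \<tau> s - GZ Z' \<tau> s\<bar> \<le> C0 * (exp (K * cl \<tau>) * ?D)"
        unfolding FZ_def GZ_def using Z closeness by (intro C0 slice) auto
      moreover have "C0 * (exp (K * cl \<tau>) * ?D) \<le> C * (exp (K * cl \<tau>) * ?D)" using C by (intro mult_right_mono) auto
      ultimately show "\<bar>FZ Z \<tau> s - FZ Z' \<tau> s\<bar> \<le> C * ?D * exp (K * \<tau>)" "\<bar>GZ Z \<tau> s - GZ Z' \<tau> s\<bar> \<le> C * ?D * exp (K * \<tau>)"
        unfolding \<tau>' by (simp_all add: mult_ac)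
    qed
    have "\<bar>P Z t s - P Z' t s\<bar> \<le> C * ?D * exp (K * cl t) / K"
      unfolding P_def add_diff_cancel_left duhamel_diff[OF bF bF]
      by (rule duhamel_weighted_bound[OF bounded_continuous2_diff[OF bF bF]]) (use cl K C FGdiff in auto)
    moreover have "\<bar>Q Z t s - Q Z' t s\<bar> \<le> C * ?D * exp (K * cl t) / K"
      unfolding Q_def add_diff_cancel_left duhamel_diff[OF bG bG]
      by (rule duhamel_weighted_bound[OF bounded_continuous2_diff[OF bG bG]]) (use cl K C FGdiff in auto)
    moreover have "exp (- K * cl t) * (C * ?D * exp (K * cl t) / K) = ?D / 4"
      using C by (simp add: K_def exp_minus)
    ultimately have le: "\<bar>exp (- K * cl t) * P Z t s - exp (- K * cl t) * P Z' t s\<bar> \<le> ?D / 4"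
      "\<bar>exp (- K * cl t) * Q Z t s - exp (- K * cl t) * Q Z' t s\<bar> \<le> ?D / 4"
      unfolding right_diff_distrib[symmetric] abs_mult abs_exp_cancel
      by (metis exp_ge_zero mult_left_mono)+
    have "dist (\<Phi>0 Z p) (\<Phi>0 Z' p) = norm (exp (- K * cl t) * P Z t s - exp (- K * cl t) * P Z' t s,
        exp (- K * cl t) * Q Z t s - exp (- K * cl t) * Q Z' t s)"
      unfolding dist_norm \<Phi>0_def t_def s_def by simp
    also have "\<dots> \<le> ?D / 4 + ?D / 4" by (intro order_trans[OF norm_Pair_le_sum] add_mono le)
    finally show "dist (apply_bcontfun (\<Phi> Z) p) (apply_bcontfun (\<Phi> Z') p) \<le> 1 / 2 * ?D" unfolding app\<Phi> by simp
  qed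
  have "S \<noteq> {}"
  proof -
    \<comment> \<open>The initial data frozen in time belong to \<open>S\<close>, since V0 <=
      V.\<close>
    define Z0 where "Z0 p = (exp (- K * cl (fst p)) * u0 (snd p), exp (- K * cl (fst p)) * v0 (snd p))" for p :: "real \<times> real"
    have "Z0 \<in> bcontfun"
    proof (rule bcontfun_normI)
      show "continuous_on UNIV Z0" unfolding Z0_def
        by (intro continuous_on_Pair continuous_intros clc continuous_on_compose2[OF u0c] continuous_on_compose2[OF v0(1)]) auto
      fix p :: "real \<times> real"
      have e1: "exp (- K * cl (fst p)) \<le> 1" using cl(1)[of "fst p"] K by (simp add: mult_nonneg_nonneg)
      have "\<bar>exp (- K * cl (fst p)) * x\<bar> \<le> \<bar>x\<bar>" for x
        unfolding abs_mult using e1 by (intro mult_left_le_one_le) auto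
      then show "norm (Z0 p) \<le> U0 + V0"
        unfolding Z0_def using u0(2) v0(2) by (intro order_trans[OF norm_Pair_le_sum] add_mono) (meson order_trans)+
    qed
    then have a: "apply_bcontfun (Bcontfun Z0) = Z0" by (rule Bcontfun_inverse)
    have uv: "uZ (Bcontfun Z0) t = u0" "vZ (Bcontfun Z0) t = v0" for t
      unfolding uZ_def vZ_def a by (simp_all add: Z0_def fun_eq_iff cl(2) exp_minus)
    have "\<bar>v0 s\<bar> \<le> V * exp (2 * \<Lambda> * cl t)" for s t
    proof -
      have "V * 1 \<le> V * exp (2 * \<Lambda> * cl t)" using V0 \<Lambda> cl(1)[of t] by (intro mult_left_mono) (auto simp: V_def)
      then show ?thesis using v0(2)[of s] V0 unfolding V_def by linarith
    qed
    then have "Bcontfun Z0 \<in> S" using u0 v0 by (simp add: S_def uv)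
    then show ?thesis by blast
  qed
  with complete have "\<exists>!Z\<in>S. \<Phi> Z = Z"
    by (rule Banach_fix[where c="1/2"]) (use maps contr in auto)
  then obtain Z where Z: "Z \<in> S" "\<Phi> Z = Z" by blast
  show ?thesis
  proof (rule that[of "uZ Z" "vZ Z" "\<Lambda> * (exp (K * T) * norm Z)"])
    show "jointly_continuous (uZ Z)" "jointly_continuous (vZ Z)" by (rule jc)+
    show "bounded_continuous2 \<Lambda> (\<lambda>t. FF (uZ Z t) (vZ Z t))" using bF[of Z] by (simp add: FZ_def[abs_def])
    show "bounded_continuous2 (\<Lambda> * (exp (K * T) * norm Z)) (\<lambda>t. GG (uZ Z t) (vZ Z t))" using bG[of Z] by (simp add: GZ_def[abs_def])
    fix t s
    show "uZ Z t s = heat (sqrt (2 * t)) u0 s + duhamel (\<lambda>t. FF (uZ Z t) (vZ Z t)) t s" if "t \<in> {0..T}"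
      using u\<Phi>(1)[of Z t s] unfolding Z(2) P_def cl_id[OF that] FZ_def[abs_def] .
    show "vZ Z t s = heat (sqrt (2 * t)) v0 s + duhamel (\<lambda>t. GG (uZ Z t) (vZ Z t)) t s" if "t \<in> {0..T}"
      using u\<Phi>(2)[of Z t s] unfolding Z(2) Q_def cl_id[OF that] GZ_def[abs_def] .
    show "(uZ Z t has_real_derivative vZ Z t s - c) (at s)" "uZ Z t (s + L) = uZ Z t s" "vZ Z t (s + L) = vZ Z t s"
      using Z(1) by (simp_all add: S_def)
  qed
qed

section \<open>Truncated multipliers\<close>

definition int_sin2 :: "real \<Rightarrow> (real \<Rightarrow> real) \<Rightarrow> real" where
  "int_sin2 L \<theta> = integral {0..L} (\<lambda>s. (sin (\<theta> s))\<^sup>2)"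

definition int_cos2 :: "real \<Rightarrow> (real \<Rightarrow> real) \<Rightarrow> real" where
  "int_cos2 L \<theta> = integral {0..L} (\<lambda>s. (cos (\<theta> s))\<^sup>2)"

definition int_sincos :: "real \<Rightarrow> (real \<Rightarrow> real) \<Rightarrow> real" where
  "int_sincos L \<theta> = integral {0..L} (\<lambda>s. sin (\<theta> s) * cos (\<theta> s))"

definition moment_cos :: "real \<Rightarrow> (real \<Rightarrow> real) \<Rightarrow> (real \<Rightarrow> real) \<Rightarrow> real" where
  "moment_cos L \<theta> v = integral {0..L} (\<lambda>s. (v s)\<^sup>2 * cos (\<theta> s))"

definition moment_sin :: "real \<Rightarrow> (real \<Rightarrow> real) \<Rightarrow> (real \<Rightarrow> real) \<Rightarrow> real" where
  "moment_sin L \<theta> v = integral {0..L} (\<lambda>s. (v s)\<^sup>2 * sin (\<theta> s))"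

definition energy :: "real \<Rightarrow> (real \<Rightarrow> real) \<Rightarrow> real" where
  "energy L v = integral {0..L} (\<lambda>s. (v s)\<^sup>2)"

definition detA :: "real \<Rightarrow> (real \<Rightarrow> real) \<Rightarrow> real" where
  "detA L \<theta> = int_sin2 L \<theta> * int_cos2 L \<theta> - (int_sincos L \<theta>)\<^sup>2"

text \<open>The multipliers with the factor \<open>1 / det A\<close> replaced by a bounded, globally Lipschitz one;
  the two agree where the energy is at most \<open>N\<^sub>0\<close> and the determinant at least \<open>\<delta>\<close>.\<close>

definition trunc_factor :: "real \<Rightarrow> real \<Rightarrow> real \<Rightarrow> (real \<Rightarrow> real) \<Rightarrow> (real \<Rightarrow> real) \<Rightarrow> real" where
  "trunc_factor L N0 \<delta> \<theta> v = N0 * (1 / max N0 (energy L v)) * (1 / max \<delta> (detA L \<theta>))"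

definition lam1 :: "real \<Rightarrow> real \<Rightarrow> real \<Rightarrow> (real \<Rightarrow> real) \<Rightarrow> (real \<Rightarrow> real) \<Rightarrow> real" where
  "lam1 L N0 \<delta> \<theta> v = (moment_cos L \<theta> v * int_cos2 L \<theta> + moment_sin L \<theta> v * int_sincos L \<theta>) * trunc_factor L N0 \<delta> \<theta> v"

definition lam2 :: "real \<Rightarrow> real \<Rightarrow> real \<Rightarrow> (real \<Rightarrow> real) \<Rightarrow> (real \<Rightarrow> real) \<Rightarrow> real" where
  "lam2 L N0 \<delta> \<theta> v = (moment_cos L \<theta> v * int_sincos L \<theta> + moment_sin L \<theta> v * int_sin2 L \<theta>) * trunc_factor L N0 \<delta> \<theta> v"

section \<open>Lipschitz calculus for functionals of the profile\<close>

definition profile_close :: "real \<Rightarrow> (real \<Rightarrow> real) \<Rightarrow> (real \<Rightarrow> real) \<Rightarrow> (real \<Rightarrow> real) \<Rightarrow> (real \<Rightarrow> real) \<Rightarrow> real \<Rightarrow> bool" where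
  "profile_close M \<theta> v \<theta>' v' d \<longleftrightarrow> continuous_on UNIV \<theta> \<and> continuous_on UNIV v \<and>
    continuous_on UNIV \<theta>' \<and> continuous_on UNIV v' \<and>
    (\<forall>s. \<bar>v s\<bar> \<le> M \<and> \<bar>v' s\<bar> \<le> M \<and> \<bar>\<theta> s - \<theta>' s\<bar> \<le> d \<and> \<bar>v s - v' s\<bar> \<le> d)"

text \<open>Bounds are part of the predicate because products of Lipschitz functionals are Lipschitz
  on bounded ranges only. The argument s lets pointwise expressions and integrals, which ignore it,
  be combined by the same rules.\<close>

definition profile_Lipschitz :: "real \<Rightarrow> ((real \<Rightarrow> real) \<Rightarrow> (real \<Rightarrow> real) \<Rightarrow> real \<Rightarrow> real) \<Rightarrow> bool" where
  "profile_Lipschitz M Q \<longleftrightarrow> (\<exists>A C. \<forall>\<theta> v \<theta>' v' d s. profile_close M \<theta> v \<theta>' v' d \<longrightarrow>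
     \<bar>Q \<theta> v s\<bar> \<le> A \<and> \<bar>Q \<theta>' v' s\<bar> \<le> A \<and> \<bar>Q \<theta> v s - Q \<theta>' v' s\<bar> \<le> C * d)"

lemma profile_LipschitzI:
  assumes "\<And>\<theta> v \<theta>' v' d s. profile_close M \<theta> v \<theta>' v' d \<Longrightarrow>
     \<bar>Q \<theta> v s\<bar> \<le> A \<and> \<bar>Q \<theta>' v' s\<bar> \<le> A \<and> \<bar>Q \<theta> v s - Q \<theta>' v' s\<bar> \<le> C * d"
  shows "profile_Lipschitz M Q"
  unfolding profile_Lipschitz_def using assms by blast

lemma profile_LipschitzE:
  assumes "profile_Lipschitz M Q"
  obtains A C where "\<And>\<theta> v \<theta>' v' d s. profile_close M \<theta> v \<theta>' v' d \<Longrightarrow> \<bar>Q \<theta> v s\<bar> \<le> A"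
    "\<And>\<theta> v \<theta>' v' d s. profile_close M \<theta> v \<theta>' v' d \<Longrightarrow> \<bar>Q \<theta>' v' s\<bar> \<le> A"
    "\<And>\<theta> v \<theta>' v' d s. profile_close M \<theta> v \<theta>' v' d \<Longrightarrow> \<bar>Q \<theta> v s - Q \<theta>' v' s\<bar> \<le> C * d"
  using assms unfolding profile_Lipschitz_def by blast

lemma abs_sin_diff_le: "\<bar>sin a - sin b\<bar> \<le> \<bar>a - b\<bar>" for a b :: real
  using field_differentiable_bound[of UNIV sin cos 1 a b] by (auto intro: derivative_eq_intros)

lemma abs_cos_diff_le: "\<bar>cos a - cos b\<bar> \<le> \<bar>a - b\<bar>" for a b :: real
  using field_differentiable_bound[of UNIV cos "\<lambda>x. - sin x" 1 a b] by (auto intro: derivative_eq_intros)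

lemma profile_Lipschitz_sin: "profile_Lipschitz M (\<lambda>\<theta> v s. sin (\<theta> s))"
  by (rule profile_LipschitzI[where A=1 and C=1])
     (auto simp: profile_close_def intro: order_trans[OF abs_sin_diff_le])

lemma profile_Lipschitz_cos: "profile_Lipschitz M (\<lambda>\<theta> v s. cos (\<theta> s))"
  by (rule profile_LipschitzI[where A=1 and C=1])
     (auto simp: profile_close_def intro: order_trans[OF abs_cos_diff_le])

lemma profile_Lipschitz_snd: "profile_Lipschitz M (\<lambda>\<theta> v s. v s)"
  by (rule profile_LipschitzI[where A=M and C=1]) (auto simp: profile_close_def)

lemma profile_Lipschitz_const: "profile_Lipschitz M (\<lambda>\<theta> v s. k)"
  by (rule profile_LipschitzI[where A="\<bar>k\<bar>" and C=0]) auto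

lemma profile_Lipschitz_add:
  assumes "profile_Lipschitz M P" "profile_Lipschitz M Q"
  shows "profile_Lipschitz M (\<lambda>\<theta> v s. P \<theta> v s + Q \<theta> v s)"
proof -
  obtain A C where 1: "\<And>\<theta> v \<theta>' v' d s. profile_close M \<theta> v \<theta>' v' d \<Longrightarrow> \<bar>P \<theta> v s\<bar> \<le> A"
    "\<And>\<theta> v \<theta>' v' d s. profile_close M \<theta> v \<theta>' v' d \<Longrightarrow> \<bar>P \<theta>' v' s\<bar> \<le> A"
    "\<And>\<theta> v \<theta>' v' d s. profile_close M \<theta> v \<theta>' v' d \<Longrightarrow> \<bar>P \<theta> v s - P \<theta>' v' s\<bar> \<le> C * d"
    using profile_LipschitzE[OF assms(1)] by blast
  obtain A' C' where 2: "\<And>\<theta> v \<theta>' v' d s. profile_close M \<theta> v \<theta>' v' d \<Longrightarrow> \<bar>Q \<theta> v s\<bar> \<le> A'"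
    "\<And>\<theta> v \<theta>' v' d s. profile_close M \<theta> v \<theta>' v' d \<Longrightarrow> \<bar>Q \<theta>' v' s\<bar> \<le> A'"
    "\<And>\<theta> v \<theta>' v' d s. profile_close M \<theta> v \<theta>' v' d \<Longrightarrow> \<bar>Q \<theta> v s - Q \<theta>' v' s\<bar> \<le> C' * d"
    using profile_LipschitzE[OF assms(2)] by blast
  show ?thesis
  proof (rule profile_LipschitzI[where A="A + A'" and C="C + C'"])
    fix \<theta> v \<theta>' v' d s assume pc: "profile_close M \<theta> v \<theta>' v' d"
    show "\<bar>P \<theta> v s + Q \<theta> v s\<bar> \<le> A + A' \<and> \<bar>P \<theta>' v' s + Q \<theta>' v' s\<bar> \<le> A + A' \<and>
       \<bar>P \<theta> v s + Q \<theta> v s - (P \<theta>' v' s + Q \<theta>' v' s)\<bar> \<le> (C + C') * d"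
      unfolding distrib_right using 1[OF pc, of s] 2[OF pc, of s] by (intro conjI) linarith+
  qed
qed

lemma profile_Lipschitz_mult:
  assumes "profile_Lipschitz M P" "profile_Lipschitz M Q"
  shows "profile_Lipschitz M (\<lambda>\<theta> v s. P \<theta> v s * Q \<theta> v s)"
proof -
  obtain A C where 1: "\<And>\<theta> v \<theta>' v' d s. profile_close M \<theta> v \<theta>' v' d \<Longrightarrow> \<bar>P \<theta> v s\<bar> \<le> A"
    "\<And>\<theta> v \<theta>' v' d s. profile_close M \<theta> v \<theta>' v' d \<Longrightarrow> \<bar>P \<theta>' v' s\<bar> \<le> A"
    "\<And>\<theta> v \<theta>' v' d s. profile_close M \<theta> v \<theta>' v' d \<Longrightarrow> \<bar>P \<theta> v s - P \<theta>' v' s\<bar> \<le> C * d"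
    using profile_LipschitzE[OF assms(1)] by blast
  obtain A' C' where 2: "\<And>\<theta> v \<theta>' v' d s. profile_close M \<theta> v \<theta>' v' d \<Longrightarrow> \<bar>Q \<theta> v s\<bar> \<le> A'"
    "\<And>\<theta> v \<theta>' v' d s. profile_close M \<theta> v \<theta>' v' d \<Longrightarrow> \<bar>Q \<theta>' v' s\<bar> \<le> A'"
    "\<And>\<theta> v \<theta>' v' d s. profile_close M \<theta> v \<theta>' v' d \<Longrightarrow> \<bar>Q \<theta> v s - Q \<theta>' v' s\<bar> \<le> C' * d"
    using profile_LipschitzE[OF assms(2)] by blast
  show ?thesis
  proof (rule profile_LipschitzI[where A="A * A'" and C="A * C' + C * A'"])
    fix \<theta> v \<theta>' v' d s assume pc: "profile_close M \<theta> v \<theta>' v' d"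
    note p = 1[OF pc, of s] and q = 2[OF pc, of s]
    have nn: "0 \<le> A" "0 \<le> C * d" using p by linarith+
    have "P \<theta> v s * Q \<theta> v s - P \<theta>' v' s * Q \<theta>' v' s = P \<theta> v s * (Q \<theta> v s - Q \<theta>' v' s) + (P \<theta> v s - P \<theta>' v' s) * Q \<theta>' v' s"
      by (simp add: algebra_simps)
    also have "\<bar>\<dots>\<bar> \<le> A * (C' * d) + (C * d) * A'"
      by (rule order_trans[OF abs_triangle_ineq], unfold abs_mult, intro add_mono mult_mono p q nn abs_ge_zero)
    also have "\<dots> = (A * C' + C * A') * d" by (simp add: algebra_simps)
    finally have "\<bar>P \<theta> v s * Q \<theta> v s - P \<theta>' v' s * Q \<theta>' v' s\<bar> \<le> (A * C' + C * A') * d" .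
    moreover have "\<bar>P \<theta> v s * Q \<theta> v s\<bar> \<le> A * A'" "\<bar>P \<theta>' v' s * Q \<theta>' v' s\<bar> \<le> A * A'"
      unfolding abs_mult by (intro mult_mono p q nn abs_ge_zero)+
    ultimately show "\<bar>P \<theta> v s * Q \<theta> v s\<bar> \<le> A * A' \<and> \<bar>P \<theta>' v' s * Q \<theta>' v' s\<bar> \<le> A * A' \<and>
       \<bar>P \<theta> v s * Q \<theta> v s - P \<theta>' v' s * Q \<theta>' v' s\<bar> \<le> (A * C' + C * A') * d" by blast
  qed
qed

lemma profile_Lipschitz_diff:
  assumes "profile_Lipschitz M P" "profile_Lipschitz M Q"
  shows "profile_Lipschitz M (\<lambda>\<theta> v s. P \<theta> v s - Q \<theta> v s)"
  using profile_Lipschitz_add[OF assms(1) profile_Lipschitz_mult[OF profile_Lipschitz_const[of M "-1"] assms(2)]] by simp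

text \<open>On [m, \<infinity>) the reciprocal has Lipschitz constant 1 / m^2, and cutting with
  \<open>max\<close> does not increase distances. This is the reason for truncating the denominators
  of the multipliers with \<open>max\<close>.\<close>

lemma profile_Lipschitz_inverse_max:
  assumes "profile_Lipschitz M Q" and m: "m > 0"
  shows "profile_Lipschitz M (\<lambda>\<theta> v s. 1 / max m (Q \<theta> v s))"
proof -
  obtain A C where 1: "\<And>\<theta> v \<theta>' v' d s. profile_close M \<theta> v \<theta>' v' d \<Longrightarrow> \<bar>Q \<theta> v s - Q \<theta>' v' s\<bar> \<le> C * d"
    using profile_LipschitzE[OF assms(1)] by metis
  show ?thesis
  proof (rule profile_LipschitzI[where A="1 / m" and C="C / m\<^sup>2"])
    fix \<theta> v \<theta>' v' d s assume pc: "profile_close M \<theta> v \<theta>' v' d"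
    let ?a = "max m (Q \<theta> v s)" and ?b = "max m (Q \<theta>' v' s)"
    have ab: "?a \<ge> m" "?b \<ge> m" by auto
    have "\<bar>1 / ?a\<bar> \<le> 1 / m" "\<bar>1 / ?b\<bar> \<le> 1 / m" using ab m by (auto intro!: divide_left_mono)
    moreover have "\<bar>1 / ?a - 1 / ?b\<bar> \<le> C / m\<^sup>2 * d"
    proof -
      have pos: "?a > 0" "?b > 0" using ab m by linarith+
      then have "\<bar>1 / ?a - 1 / ?b\<bar> = \<bar>?b - ?a\<bar> / (?a * ?b)"
        by (simp add: diff_frac_eq abs_divide abs_mult)
      also have "\<bar>?b - ?a\<bar> \<le> \<bar>Q \<theta> v s - Q \<theta>' v' s\<bar>" by (auto simp: max_def abs_if)
      also have "\<dots> \<le> C * d" by (rule 1[OF pc])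
      finally have "\<bar>1 / ?a - 1 / ?b\<bar> \<le> C * d / (?a * ?b)" using pos by (simp add: divide_right_mono)
      also have "\<dots> \<le> C * d / m\<^sup>2"
      proof (rule divide_left_mono)
        show "m\<^sup>2 \<le> ?a * ?b" unfolding power2_eq_square using ab m by (intro mult_mono) auto
        show "0 \<le> C * d" using 1[OF pc, of s] by linarith
        show "0 < ?a * ?b * m\<^sup>2" using pos m by simp
      qed
      finally show ?thesis by simp
    qed
    ultimately show "\<bar>1 / ?a\<bar> \<le> 1 / m \<and> \<bar>1 / ?b\<bar> \<le> 1 / m \<and> \<bar>1 / ?a - 1 / ?b\<bar> \<le> C / m\<^sup>2 * d" by blast
  qed
qed

lemma profile_Lipschitz_integral:
  assumes Q: "profile_Lipschitz M Q" and L: "L \<ge> 0"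
    and c: "\<And>\<theta> v. continuous_on UNIV \<theta> \<Longrightarrow> continuous_on UNIV v \<Longrightarrow> continuous_on {0..L} (Q \<theta> v)"
  shows "profile_Lipschitz M (\<lambda>\<theta> v s. integral {0..L} (Q \<theta> v))"
proof -
  obtain A C where 1: "\<And>\<theta> v \<theta>' v' d s. profile_close M \<theta> v \<theta>' v' d \<Longrightarrow> \<bar>Q \<theta> v s\<bar> \<le> A"
    "\<And>\<theta> v \<theta>' v' d s. profile_close M \<theta> v \<theta>' v' d \<Longrightarrow> \<bar>Q \<theta>' v' s\<bar> \<le> A"
    "\<And>\<theta> v \<theta>' v' d s. profile_close M \<theta> v \<theta>' v' d \<Longrightarrow> \<bar>Q \<theta> v s - Q \<theta>' v' s\<bar> \<le> C * d"
    using profile_LipschitzE[OF Q] by blast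
  have bound: "\<bar>integral {0..L} f\<bar> \<le> L * b" if "continuous_on {0..L} f" "\<And>s. \<bar>f s\<bar> \<le> b" for f b
    using integral_bound[OF L that(1), of b] that(2) by (simp add: mult.commute)
  show ?thesis
  proof (rule profile_LipschitzI[where A="L * A" and C="L * C"])
    fix \<theta> v \<theta>' v' d s assume pc: "profile_close M \<theta> v \<theta>' v' d"
    have qc: "continuous_on {0..L} (Q \<theta> v)" "continuous_on {0..L} (Q \<theta>' v')"
      using pc by (auto simp: profile_close_def intro: c)
    have "integral {0..L} (Q \<theta> v) - integral {0..L} (Q \<theta>' v') = integral {0..L} (\<lambda>s. Q \<theta> v s - Q \<theta>' v' s)"
      by (intro Henstock_Kurzweil_Integration.integral_diff[symmetric] integrable_continuous_real qc)
    also have "\<bar>\<dots>\<bar> \<le> L * (C * d)" by (intro bound continuous_intros qc 1(3)[OF pc])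
    finally show "\<bar>integral {0..L} (Q \<theta> v)\<bar> \<le> L * A \<and> \<bar>integral {0..L} (Q \<theta>' v')\<bar> \<le> L * A \<and>
        \<bar>integral {0..L} (Q \<theta> v) - integral {0..L} (Q \<theta>' v')\<bar> \<le> L * C * d"
      using bound[OF qc(1) 1(1)[OF pc]] bound[OF qc(2) 1(2)[OF pc]] by (simp add: mult.assoc)
  qed
qed

text \<open>Unfolded, the multipliers are built from sine, cosine and v by sums, products, integrals
  and cut reciprocals, so the rules above apply one by one.\<close>

lemma lam_profile_Lipschitz:
  assumes L: "L \<ge> 0" and pos: "N0 > 0" "\<delta> > 0"
  shows "profile_Lipschitz M (\<lambda>\<theta> v s. lam1 L N0 \<delta> \<theta> v)" "profile_Lipschitz M (\<lambda>\<theta> v s. lam2 L N0 \<delta> \<theta> v)"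
  unfolding lam1_def lam2_def trunc_factor_def detA_def moment_cos_def moment_sin_def energy_def
    int_sin2_def int_cos2_def int_sincos_def power2_eq_square
  by (intro profile_Lipschitz_mult profile_Lipschitz_add profile_Lipschitz_diff profile_Lipschitz_inverse_max
      profile_Lipschitz_integral profile_Lipschitz_const profile_Lipschitz_sin profile_Lipschitz_cos
      profile_Lipschitz_snd L pos continuous_intros; erule continuous_on_subset; simp)+

text \<open>The moments are at most the energy, and the energy times N0 / max N0 energy is at most
  N0; so the bound is uniform in v. The fixed point argument draws from it a bound for FF and the
  linear bound |GG| <= const |v|.\<close>

lemma lam_bound:
  assumes L: "L \<ge> 0" and pos: "N0 > 0" "\<delta> > 0"
    and c: "continuous_on UNIV \<theta>" "continuous_on UNIV v"
  shows "\<bar>lam1 L N0 \<delta> \<theta> v\<bar> \<le> 2 * L * N0 / \<delta>" "\<bar>lam2 L N0 \<delta> \<theta> v\<bar> \<le> 2 * L * N0 / \<delta>"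
proof -
  have c': "continuous_on {0..L} \<theta>" "continuous_on {0..L} v" using c by (auto intro: continuous_on_subset)
  have ib: "\<bar>integral {0..L} f\<bar> \<le> L" if "continuous_on {0..L} f" "\<And>s. \<bar>f s\<bar> \<le> 1" for f
    using integral_bound[OF L that(1), of 1] that(2) by simp
  have "\<bar>int_sin2 L \<theta>\<bar> \<le> L" "\<bar>int_cos2 L \<theta>\<bar> \<le> L" "\<bar>int_sincos L \<theta>\<bar> \<le> L"
    unfolding int_sin2_def int_cos2_def int_sincos_def
    by (intro ib continuous_intros c'; simp add: abs_square_le_1 abs_mult mult_le_one)+
  note i = this
  let ?N = "energy L v"
  have mb: "\<bar>integral {0..L} (\<lambda>s. (v s)\<^sup>2 * f s)\<bar> \<le> ?N" if f: "continuous_on {0..L} f" "\<And>s. \<bar>f s\<bar> \<le> 1" for f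
  proof -
    have "norm (integral {0..L} (\<lambda>s. (v s)\<^sup>2 * f s)) \<le> ?N" unfolding energy_def
    proof (rule integral_norm_bound_integral)
      show "norm ((v s)\<^sup>2 * f s) \<le> (v s)\<^sup>2" for s
        using mult_left_mono[OF f(2)[of s], of "(v s)\<^sup>2"] by (simp add: abs_mult)
    qed (intro integrable_continuous_real continuous_intros c' f)+
    then show ?thesis by simp
  qed
  have m: "\<bar>moment_cos L \<theta> v\<bar> \<le> ?N" "\<bar>moment_sin L \<theta> v\<bar> \<le> ?N"
    unfolding moment_cos_def moment_sin_def by (intro mb continuous_intros c'; simp)+
  have N: "?N \<ge> 0" using m by linarith
  have tf: "trunc_factor L N0 \<delta> \<theta> v \<ge> 0" unfolding trunc_factor_def using pos by simp
  have ntf: "?N * trunc_factor L N0 \<delta> \<theta> v \<le> N0 / \<delta>"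
  proof -
    have "?N * (1 / max N0 ?N) \<le> 1" using pos N by (simp add: divide_le_eq)
    then have "N0 * (?N * (1 / max N0 ?N)) * (1 / max \<delta> (detA L \<theta>)) \<le> N0 * 1 * (1 / \<delta>)"
      using pos N by (intro mult_mono divide_left_mono) auto
    then show ?thesis by (simp add: trunc_factor_def mult_ac)
  qed
  have key: "\<bar>(a * p + b * q) * trunc_factor L N0 \<delta> \<theta> v\<bar> \<le> 2 * L * N0 / \<delta>"
    if "\<bar>a\<bar> \<le> ?N" "\<bar>b\<bar> \<le> ?N" "\<bar>p\<bar> \<le> L" "\<bar>q\<bar> \<le> L" for a b p q
  proof -
    have "\<bar>a * p + b * q\<bar> \<le> ?N * L + ?N * L"
      by (rule order_trans[OF abs_triangle_ineq], unfold abs_mult, intro add_mono mult_mono that N abs_ge_zero)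
    then have "\<bar>(a * p + b * q) * trunc_factor L N0 \<delta> \<theta> v\<bar> \<le> (?N * L + ?N * L) * trunc_factor L N0 \<delta> \<theta> v"
      unfolding abs_mult using tf by (intro mult_mono) auto
    also have "\<dots> = 2 * L * (?N * trunc_factor L N0 \<delta> \<theta> v)" by (simp add: algebra_simps)
    also have "\<dots> \<le> 2 * L * (N0 / \<delta>)" using ntf L by (intro mult_left_mono) auto
    finally show ?thesis by simp
  qed
  show "\<bar>lam1 L N0 \<delta> \<theta> v\<bar> \<le> 2 * L * N0 / \<delta>" "\<bar>lam2 L N0 \<delta> \<theta> v\<bar> \<le> 2 * L * N0 / \<delta>"
    unfolding lam1_def lam2_def by (intro key m i)+
qed

lemma lam_continuous:
  assumes pos: "N0 > 0" "\<delta> > 0"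
    and c: "jointly_continuous \<theta>" "jointly_continuous v" and f: "continuous_on X (f :: 'a::topological_space \<Rightarrow> real)"
  shows "continuous_on X (\<lambda>p. lam1 L N0 \<delta> (\<theta> (f p)) (v (f p)))" "continuous_on X (\<lambda>p. lam2 L N0 \<delta> (\<theta> (f p)) (v (f p)))"
proof -
  have nz: "max N0 a \<noteq> 0" "max \<delta> a \<noteq> 0" for a using pos by (auto simp: max_def)
  have j: "continuous_on (UNIV \<times> {0..L}) (\<lambda>p. \<theta> (fst p) (snd p))" "continuous_on (UNIV \<times> {0..L}) (\<lambda>p. v (fst p) (snd p))"
    by (intro jointly_continuous_compose[OF c(1)] jointly_continuous_compose[OF c(2)] continuous_intros)+
  have "continuous_on UNIV (\<lambda>t. lam1 L N0 \<delta> (\<theta> t) (v t))" "continuous_on UNIV (\<lambda>t. lam2 L N0 \<delta> (\<theta> t) (v t))"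
    unfolding lam1_def lam2_def trunc_factor_def detA_def moment_cos_def moment_sin_def energy_def
      int_sin2_def int_cos2_def int_sincos_def
    by (intro continuous_intros integral_continuous_on_param_real j; use nz in simp)+
  from continuous_on_compose2[OF this(1) f] continuous_on_compose2[OF this(2) f]
  show "continuous_on X (\<lambda>p. lam1 L N0 \<delta> (\<theta> (f p)) (v (f p)))" "continuous_on X (\<lambda>p. lam2 L N0 \<delta> (\<theta> (f p)) (v (f p)))"
    by simp_all
qed

section \<open>Periodic functions\<close>

lemma sin_cos_plus_nat_periods:
  "sin (x + 2 * pi * real n) = sin x" "cos (x + 2 * pi * real n) = cos x"
proof (induction n)
  case (Suc n)
  {
    case 1
    have "x + 2 * pi * real (Suc n) = (x + 2 * pi * real n) + 2 * pi" by (simp add: algebra_simps)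
    then show ?case using Suc by (simp only: sin_periodic)
  next
    case 2
    have "x + 2 * pi * real (Suc n) = (x + 2 * pi * real n) + 2 * pi" by (simp add: algebra_simps)
    then show ?case using Suc by (simp only: cos_periodic)
  }
qed simp_all

lemma periodic_int_shift:
  fixes f :: "real \<Rightarrow> real"
  assumes "\<And>s. f (s + L) = f s"
  shows "f (s + of_int k * L) = f s"
proof (induction k rule: int_induct[where k=0])
  case (step1 i)
  have "s + of_int (i + 1) * L = (s + of_int i * L) + L" by (simp add: algebra_simps)
  then have "f (s + of_int (i + 1) * L) = f ((s + of_int i * L) + L)" by (simp only:)
  also have "\<dots> = f (s + of_int i * L)" by (rule assms)
  finally show ?case using step1 by simp
next
  case (step2 i)
  have "f (s + of_int (i - 1) * L) = f (s + of_int (i - 1) * L + L)" by (rule assms[symmetric])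
  also have "s + of_int (i - 1) * L + L = s + of_int i * L" by (simp add: algebra_simps)
  finally show ?case using step2 by simp
qed simp

lemma real_period_decomposition:
  fixes L s :: real
  assumes "L > 0"
  obtains r k where "r \<in> {0..<L}" "s = r + of_int k * L"
proof
  define k where "k = \<lfloor>s / L\<rfloor>"
  show "s = (s - of_int k * L) + of_int k * L" by simp
  have "of_int k \<le> s / L" "s / L < of_int k + 1" by (auto simp: k_def)
  then show "s - of_int k * L \<in> {0..<L}" using assms by (auto simp: field_simps)
qed

text \<open>\<open>C_per\<close> quantifies over one closed period and all integer shifts; reducing
  a point to its residue in [0, L) gives periodicity on the whole line.\<close>

lemma C_per_iff:
  assumes L: "L > 0"
  shows "u \<in> C_per L \<longleftrightarrow> continuous_on UNIV u \<and> (\<forall>s. u (s + L) = u s)"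
proof (intro iffI conjI allI)
  assume u: "u \<in> C_per L"
  then show "continuous_on UNIV u" by (simp add: C_per_def)
  fix s
  obtain r k where rk: "r \<in> {0..<L}" "s = r + of_int k * L" using real_period_decomposition[OF L] by blast
  have per: "u (r + of_int k * L) = u r" for k using u rk(1) by (simp add: C_per_def)
  have "s + L = r + of_int (k + 1) * L" using rk(2) by (simp add: algebra_simps)
  then have "u (s + L) = u (r + of_int (k + 1) * L)" by (simp only:)
  then show "u (s + L) = u s" using per[of "k + 1"] per[of k] rk(2) by (simp only:)
next
  assume "continuous_on UNIV u \<and> (\<forall>s. u (s + L) = u s)"
  then show "u \<in> C_per L" using periodic_int_shift[of u L] by (auto simp: C_per_def)
qed

lemma periodic_continuous_bounded:
  fixes f :: "real \<Rightarrow> real"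
  assumes L: "L > 0" and f: "continuous_on UNIV f" "\<And>s. f (s + L) = f s"
  obtains B where "\<And>s. \<bar>f s\<bar> \<le> B"
proof -
  have "compact (f ` {0..L})" by (intro compact_continuous_image continuous_on_subset[OF f(1)]) auto
  then obtain B where B: "\<And>s. s \<in> {0..L} \<Longrightarrow> \<bar>f s\<bar> \<le> B"
    by (metis compact_imp_bounded bounded_iff image_eqI real_norm_def)
  have "\<bar>f s\<bar> \<le> B" for s
  proof -
    obtain r k where rk: "r \<in> {0..<L}" "s = r + of_int k * L" using real_period_decomposition[OF L] by blast
    then show ?thesis using periodic_int_shift[of f L r k] f(2) B[of r] by simp
  qed
  then show ?thesis by (rule that)
qed

lemma jointly_continuous_periodic_bounded:
  assumes L: "L > 0" and u: "jointly_continuous u" "\<And>t s. u t (s + L) = u t s"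
  obtains B where "\<And>t s. t \<in> {0..T} \<Longrightarrow> \<bar>u t s\<bar> \<le> B"
proof -
  have "compact ((\<lambda>p. u (fst p) (snd p)) ` ({0..T} \<times> {0..L}))"
    by (intro compact_continuous_image jointly_continuous_compose[OF u(1)] continuous_intros compact_Times) auto
  then obtain B where B: "\<And>p. p \<in> {0..T} \<times> {0..L} \<Longrightarrow> \<bar>u (fst p) (snd p)\<bar> \<le> B"
    by (metis (no_types, lifting) compact_imp_bounded bounded_iff image_eqI real_norm_def)
  have "\<bar>u t s\<bar> \<le> B" if "t \<in> {0..T}" for t s
  proof -
    obtain r k where rk: "r \<in> {0..<L}" "s = r + of_int k * L" using real_period_decomposition[OF L] by blast
    then show ?thesis using periodic_int_shift[of "u t" L r k] u(2) B[of "(t, r)"] that by simp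
  qed
  then show ?thesis by (rule that)
qed

text \<open>FF is the forcing of the equation and GG its s-derivative once theta_s = v. Derivatives
  beyond those of the mild solution exist only for t > 0; the last bound records the size of w = v_s
  near t = 0, where the singular part is \<open>heatY\<close> of v0 divided by sqrt (2 t).\<close>

lemma truncated_flow_exists:
  fixes u0 v0 :: "real \<Rightarrow> real" and L T c N0 \<delta> H :: real and \<eta> :: nat
  assumes L: "L > 0" and T: "T > 0" and pos: "N0 > 0" "\<delta> > 0" and cL: "c * L = 2 * pi * real \<eta>"
    and u0: "\<And>s. (u0 has_real_derivative v0 s - c) (at s)" "\<And>s. u0 (s + L) = u0 s"
    and v0: "continuous_on UNIV v0" "\<And>s. v0 (s + L) = v0 s" "\<And>z z'. \<bar>v0 z - v0 z'\<bar> \<le> H * sqrt \<bar>z - z'\<bar>"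
  obtains u v w l1 l2 C where "jointly_continuous u" "jointly_continuous v"
    "u 0 = u0" "v 0 = v0"
    "\<And>t s. (u t has_real_derivative v t s - c) (at s)"
    "\<And>t s. u t (s + L) = u t s" "\<And>t s. v t (s + L) = v t s"
    "\<And>t. l1 t = lam1 L N0 \<delta> (\<lambda>s. u t s + c * s) (v t)" "\<And>t. l2 t = lam2 L N0 \<delta> (\<lambda>s. u t s + c * s) (v t)"
    "continuous_on UNIV l1" "continuous_on UNIV l2"
    "\<And>t s. t \<in> {0<..T} \<Longrightarrow> (v t has_real_derivative w t s) (at s)"
    "continuous_on ({0<..} \<times> UNIV) (\<lambda>p. w (fst p) (snd p))"
    "\<And>t s. w t (s + L) = w t s"
    "\<And>t s. t \<in> {0<..<T} \<Longrightarrow> ((\<lambda>t. u t s) has_real_derivative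
        w t s + l1 t * sin (u t s + c * s) - l2 t * cos (u t s + c * s)) (at t)"
    "\<And>t s. t \<in> {0<..T} \<Longrightarrow> (w t s)\<^sup>2 \<le> C / sqrt t"
proof -
  let ?th = "\<lambda>u s. u s + c * s :: real"
  define FF where "FF u v s = lam1 L N0 \<delta> (?th u) v * sin (?th u s) - lam2 L N0 \<delta> (?th u) v * cos (?th u s)" for u v s
  define GG where "GG u v s = (lam1 L N0 \<delta> (?th u) v * cos (?th u s) + lam2 L N0 \<delta> (?th u) v * sin (?th u s)) * v s" for u v s
  define b where "b = 2 * L * N0 / \<delta>"
  have b: "b > 0" using L pos by (simp add: b_def)
  have lb: "\<bar>lam1 L N0 \<delta> (?th u) v\<bar> \<le> b" "\<bar>lam2 L N0 \<delta> (?th u) v\<bar> \<le> b"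
    if "continuous_on UNIV u" "continuous_on UNIV v" for u v
    unfolding b_def using L pos that by (intro lam_bound continuous_intros; simp)+
  have comb: "\<bar>p * x + q * y\<bar> \<le> 2 * b" if "\<bar>p\<bar> \<le> b" "\<bar>q\<bar> \<le> b" "\<bar>x\<bar> \<le> 1" "\<bar>y\<bar> \<le> 1" for p q x y :: real
  proof -
    have "\<bar>p * x + q * y\<bar> \<le> b * 1 + b * 1"
      by (rule order_trans[OF abs_triangle_ineq], unfold abs_mult, intro add_mono mult_mono that) (use b in auto)
    then show ?thesis by simp
  qed
  have jth: "jointly_continuous (\<lambda>t. ?th (u t))" if "jointly_continuous u" for u
    by (intro jointly_continuousI continuous_intros jointly_continuous_compose[OF that])
  obtain U0 where U0: "\<And>s. \<bar>u0 s\<bar> \<le> U0"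
  proof (rule periodic_continuous_bounded[of L u0, OF L _ u0(2)])
    show "continuous_on UNIV u0"
      by (intro continuous_at_imp_continuous_on ballI) (rule DERIV_isCont[OF u0(1)])
  qed blast
  obtain V0 where V0: "\<And>s. \<bar>v0 s\<bar> \<le> V0" using periodic_continuous_bounded[of L v0, OF L v0(1,2)] by blast
  have sub: "\<bar>p * x - q * y\<bar> = \<bar>p * x + q * (- y)\<bar>" for p q x y :: real by simp
  have thL: "sin (?th u (s + L)) = sin (?th u s)" "cos (?th u (s + L)) = cos (?th u s)" if "u (s + L) = u s" for u s
  proof -
    have "?th u (s + L) = ?th u s + 2 * pi * real \<eta>" using that cL by (simp add: algebra_simps)
    then show "sin (?th u (s + L)) = sin (?th u s)" "cos (?th u (s + L)) = cos (?th u s)"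
      by (simp_all only: sin_cos_plus_nat_periods)
  qed
  have FG_deriv: "(FF u v has_real_derivative GG u v s) (at s)"
    if "\<And>s. (u has_real_derivative v s - c) (at s)" for u v s
  proof -
    have th: "(?th u has_real_derivative v s) (at s)"
      using that[of s] by (auto intro!: derivative_eq_intros)
    have "((\<lambda>s. p * sin (?th u s) - q * cos (?th u s)) has_real_derivative (p * cos (?th u s) + q * sin (?th u s)) * v s) (at s)" for p q
      by (rule derivative_eq_intros th refl)+ (simp add: algebra_simps)
    then show ?thesis unfolding FF_def[abs_def] GG_def .
  qed
  obtain u v B where sol: "jointly_continuous u" "jointly_continuous v"
    "bounded_continuous2 (2 * b) (\<lambda>t. FF (u t) (v t))" "bounded_continuous2 B (\<lambda>t. GG (u t) (v t))"
    "\<And>t s. t \<in> {0..T} \<Longrightarrow> u t s = heat (sqrt (2 * t)) u0 s + duhamel (\<lambda>t. FF (u t) (v t)) t s"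
    "\<And>t s. t \<in> {0..T} \<Longrightarrow> v t s = heat (sqrt (2 * t)) v0 s + duhamel (\<lambda>t. GG (u t) (v t)) t s"
    "\<And>t s. (u t has_real_derivative v t s - c) (at s)"
    "\<And>t s. u t (s + L) = u t s" "\<And>t s. v t (s + L) = v t s"
  \<comment> \<open>The value 2 b arises because each of the two multipliers is at most b, and sine
    and cosine are at most one.\<close>
  proof (rule mild_solution_exists[where T=T and \<Lambda>="2 * b" and FF=FF and GG=GG, OF _ _ u0(1) U0 u0(2) v0(1) V0 v0(2)])
    show "T \<ge> 0" "2 * b > 0" using T b by auto
    show "jointly_continuous (\<lambda>t. FF (u t) (v t)) \<and> jointly_continuous (\<lambda>t. GG (u t) (v t))"
      if u: "jointly_continuous u" and v: "jointly_continuous v" for u v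
      unfolding FF_def GG_def
      by (intro conjI jointly_continuousI continuous_intros lam_continuous[OF pos jth[OF u] v]
          jointly_continuous_compose[OF u] jointly_continuous_compose[OF v])
    show "\<bar>FF u v s\<bar> \<le> 2 * b" if "continuous_on UNIV u" "continuous_on UNIV v" for u v s
      unfolding FF_def sub by (intro comb lb that) auto
    show "\<bar>GG u v s\<bar> \<le> 2 * b * \<bar>v s\<bar>" if "continuous_on UNIV u" "continuous_on UNIV v" for u v s
      unfolding GG_def abs_mult[of _ "v s"] by (intro mult_right_mono comb lb that) auto
    show "\<exists>C. \<forall>u v u' v' d s. continuous_on UNIV u \<longrightarrow> continuous_on UNIV v \<longrightarrow>
        continuous_on UNIV u' \<longrightarrow> continuous_on UNIV v' \<longrightarrow>
        (\<forall>s. \<bar>v s\<bar> \<le> M \<and> \<bar>v' s\<bar> \<le> M \<and> \<bar>u s - u' s\<bar> \<le> d \<and> \<bar>v s - v' s\<bar> \<le> d) \<longrightarrow>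
        \<bar>FF u v s - FF u' v' s\<bar> \<le> C * d \<and> \<bar>GG u v s - GG u' v' s\<bar> \<le> C * d" for M
    proof -
      have PL: "profile_Lipschitz M (\<lambda>\<theta> v s. lam1 L N0 \<delta> \<theta> v * sin (\<theta> s) - lam2 L N0 \<delta> \<theta> v * cos (\<theta> s))"
        "profile_Lipschitz M (\<lambda>\<theta> v s. (lam1 L N0 \<delta> \<theta> v * cos (\<theta> s) + lam2 L N0 \<delta> \<theta> v * sin (\<theta> s)) * v s)"
        using L pos by (intro profile_Lipschitz_mult profile_Lipschitz_add profile_Lipschitz_diff lam_profile_Lipschitz
            profile_Lipschitz_sin profile_Lipschitz_cos profile_Lipschitz_snd; simp)+
      obtain C1 where
        C1: "\<And>\<theta> v \<theta>' v' d s. profile_close M \<theta> v \<theta>' v' d \<Longrightarrow> \<bar>lam1 L N0 \<delta> \<theta> v * sin (\<theta> s) - lam2 L N0 \<delta> \<theta> v * cos (\<theta> s) -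
          (lam1 L N0 \<delta> \<theta>' v' * sin (\<theta>' s) - lam2 L N0 \<delta> \<theta>' v' * cos (\<theta>' s))\<bar> \<le> C1 * d"
        using profile_LipschitzE[OF PL(1)] by metis
      obtain C2 where
        C2: "\<And>\<theta> v \<theta>' v' d s. profile_close M \<theta> v \<theta>' v' d \<Longrightarrow> \<bar>(lam1 L N0 \<delta> \<theta> v * cos (\<theta> s) + lam2 L N0 \<delta> \<theta> v * sin (\<theta> s)) * v s -
          (lam1 L N0 \<delta> \<theta>' v' * cos (\<theta>' s) + lam2 L N0 \<delta> \<theta>' v' * sin (\<theta>' s)) * v' s\<bar> \<le> C2 * d"
        using profile_LipschitzE[OF PL(2)] by metis
      show ?thesis
      proof (intro exI[of _ "max C1 C2"] allI impI)
        fix u v u' v' :: "real \<Rightarrow> real" and d s :: real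
        assume "continuous_on UNIV u" "continuous_on UNIV v" "continuous_on UNIV u'" "continuous_on UNIV v'"
          and cl: "\<forall>s. \<bar>v s\<bar> \<le> M \<and> \<bar>v' s\<bar> \<le> M \<and> \<bar>u s - u' s\<bar> \<le> d \<and> \<bar>v s - v' s\<bar> \<le> d"
        then have pc: "profile_close M (?th u) v (?th u') v' d"
          unfolding profile_close_def by (auto intro!: continuous_intros)
        have d: "d \<ge> 0" using cl by (meson abs_ge_zero order_trans)
        have "C1 * d \<le> max C1 C2 * d" "C2 * d \<le> max C1 C2 * d" using d by (auto intro!: mult_right_mono)
        with C1[OF pc, of s] C2[OF pc, of s]
        show "\<bar>FF u v s - FF u' v' s\<bar> \<le> max C1 C2 * d \<and> \<bar>GG u v s - GG u' v' s\<bar> \<le> max C1 C2 * d"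
          unfolding FF_def GG_def by linarith
      qed
    qed
    show "(FF u v has_real_derivative GG u v s) (at s)" if "\<And>s. (u has_real_derivative v s - c) (at s)" for u v s
      by (rule FG_deriv[OF that])
    show "FF u v (s + L) = FF u v s \<and> GG u v (s + L) = GG u v s" if "\<And>s. u (s + L) = u s" "\<And>s. v (s + L) = v s" for u v s
      unfolding FF_def GG_def thL[of u s, OF that(1)] that(2) by simp
  qed blast
  define F where "F t = FF (u t) (v t)" for t
  define G where "G t = GG (u t) (v t)" for t
  have bF: "bounded_continuous2 (2 * b) F" and bG: "bounded_continuous2 B G"
    using sol(3,4) by (simp_all add: F_def[abs_def] G_def[abs_def])
  have dFG: "(F t has_real_derivative G t s) (at s)" for t s unfolding F_def G_def by (rule FG_deriv[OF sol(7)])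
  have perG: "G t (s + L) = G t s" for t s unfolding G_def GG_def thL[of "u t" s, OF sol(8)] sol(9) ..
  \<comment> \<open>The s-derivative of the mild formula for v: the Gaussian smooths the initial
    part at the cost of 1 / sqrt (2 t), and the Duhamel integral smooths the source.\<close>
  define w where "w t s = heatY (sqrt (2 * t)) v0 s / sqrt (2 * t) + duhamelY G t s" for t s
  define l1 where "l1 t = lam1 L N0 \<delta> (?th (u t)) (v t)" for t
  define l2 where "l2 t = lam2 L N0 \<delta> (?th (u t)) (v t)" for t
  have bv0: "bounded_continuous2 V0 (\<lambda>_. v0)"
    unfolding bounded_continuous2_def split_beta
    using V0 by (auto intro!: continuous_on_compose2[OF v0(1)] continuous_on_snd continuous_on_id)
  have cdY: "continuous_on UNIV (\<lambda>p. duhamelY G (fst p) (snd p))" by (rule duhamel_continuous(2)[OF bG])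
  have perY: "duhamelY G t (s + L) = duhamelY G t s" for t s by (rule duhamel_periodic(2)[of G L, OF perG])
  have "jointly_continuous (duhamelY G)" using cdY by (rule jointly_continuousI)
  then obtain D where D: "\<And>t s. t \<in> {0..T} \<Longrightarrow> \<bar>duhamelY G t s\<bar> \<le> D"
    using jointly_continuous_periodic_bounded[of L "duhamelY G" T, OF L _ perY] by blast
  show ?thesis
  \<comment> \<open>From (p + q)^2 <= 2 p^2 + 2 q^2: the heat part of w gives 2 times 4 H^2 / sqrt
    t, the bounded part gives 2 D^2, enlarged by the factor sqrt T / sqrt t >= 1.\<close>
  proof (rule that[of u v l1 l2 w "4 * H\<^sup>2 + 4 * H\<^sup>2 + 2 * D\<^sup>2 * sqrt T"])
    show "u 0 = u0" "v 0 = v0"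
      using sol(5)[of 0] sol(6)[of 0] T by (auto simp: fun_eq_iff)
    show "continuous_on UNIV l1" "continuous_on UNIV l2" unfolding l1_def l2_def
      by (intro lam_continuous[OF pos jth[OF sol(1)] sol(2)] continuous_intros)+
    show "(v t has_real_derivative w t s) (at s)" if t: "t \<in> {0<..T}" for t s
    proof -
      have nz: "sqrt (2 * t) \<noteq> 0" using t by simp
      have "((\<lambda>s. sqrt (2 * t) * heat (sqrt (2 * t)) v0 s / sqrt (2 * t)) has_real_derivative heatY (sqrt (2 * t)) v0 s / sqrt (2 * t)) (at s)"
        by (rule DERIV_cdivide[OF heat_smoothing_derivative[OF v0(1) V0]])
      moreover have "(\<lambda>s. sqrt (2 * t) * heat (sqrt (2 * t)) v0 s / sqrt (2 * t)) = heat (sqrt (2 * t)) v0"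
        by (intro ext nonzero_mult_div_cancel_left nz)
      ultimately have "((\<lambda>s. heat (sqrt (2 * t)) v0 s) has_real_derivative heatY (sqrt (2 * t)) v0 s / sqrt (2 * t)) (at s)"
        by (simp only:)
      then have "((\<lambda>s. heat (sqrt (2 * t)) v0 s + duhamel G t s) has_real_derivative w t s) (at s)"
        unfolding w_def using t by (intro DERIV_add duhamel_smoothing_derivative[OF bG]) auto
      moreover have "v t = (\<lambda>s. heat (sqrt (2 * t)) v0 s + duhamel G t s)"
        using sol(6)[of t] t by (auto simp: G_def[abs_def] fun_eq_iff)
      ultimately show ?thesis by simp
    qed
    show "continuous_on ({0<..} \<times> UNIV) (\<lambda>p. w (fst p) (snd p))"
      unfolding w_def
      by (intro continuous_intros heat_continuous(2)[OF bv0, of _ _ "\<lambda>_. 0"] continuous_on_subset[OF cdY]) auto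
    show "w t (s + L) = w t s" for t s
      unfolding w_def perY using heat_periodic(2)[of v0 L, OF v0(2)] by simp
    show "((\<lambda>t. u t s) has_real_derivative w t s + l1 t * sin (u t s + c * s) - l2 t * cos (u t s + c * s)) (at t)"
      if t: "t \<in> {0<..<T}" for t s
    proof -
      have v0c: "continuous_on UNIV (\<lambda>s. v0 s - c)" by (intro continuous_intros v0)
      have v0c_le: "\<bar>v0 s - c\<bar> \<le> V0 + \<bar>c\<bar>" for s using V0[of s] by linarith
      \<comment> \<open>Y has mean zero, so constants are invisible to \<open>heatY\<close>.\<close>
      have "heatY x (\<lambda>s. v0 s - c) s = heatY x v0 s" for x
        using heat_integrable(2)[OF v0(1) V0, of s x] gauss_moments(1,4)
        by (simp add: heatY_def right_diff_distrib)
      with heat_sqrt_time_derivative[OF u0(1) v0c v0c_le U0, of t s] t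
      have 1: "((\<lambda>t. heat (sqrt (2 * t)) u0 s) has_real_derivative heatY (sqrt (2 * t)) v0 s / sqrt (2 * t)) (at t)" by simp
      have cI: "continuous_on {0..T} (\<lambda>r. F r s + duhamelY G r s)"
      proof (intro continuous_intros bounded_continuous2_compose[OF bF])
        have "continuous_on {0..T} (\<lambda>r. (r, s))" by (intro continuous_intros)
        from continuous_on_compose2[OF cdY this] show "continuous_on {0..T} (\<lambda>r. duhamelY G r s)" by simp
      qed
      have "((\<lambda>t. integral {0..t} (\<lambda>r. F r s + duhamelY G r s)) has_real_derivative F t s + duhamelY G t s) (at t within {0..T})"
        by (rule integral_has_real_derivative[OF cI]) (use t in auto)
      then have 2: "((\<lambda>t. integral {0..t} (\<lambda>r. F r s + duhamelY G r s)) has_real_derivative F t s + duhamelY G t s) (at t)"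
        using t by (subst (asm) at_within_interior) auto
      \<comment> \<open>Transferring the derivative needs the mild formula on a neighbourhood of t,
        hence the open interval (0, T).\<close>
      have 3: "\<forall>\<^sub>F z in nhds t. heat (sqrt (2 * z)) u0 s + integral {0..z} (\<lambda>r. F r s + duhamelY G r s) = u z s"
      proof (rule eventually_mono[OF eventually_nhds_in_open[of "{0<..<T}" t]])
        fix z assume z: "z \<in> {0<..<T}"
        then show "heat (sqrt (2 * z)) u0 s + integral {0..z} (\<lambda>r. F r s + duhamelY G r s) = u z s"
          using sol(5)[of z s] duhamel_time_integral[OF bF bG dFG, of z s] by (simp add: F_def[abs_def])
      qed (use t in auto)
      have eq: "heatY (sqrt (2 * t)) v0 s / sqrt (2 * t) + (F t s + duhamelY G t s) =
          w t s + l1 t * sin (u t s + c * s) - l2 t * cos (u t s + c * s)"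
        by (simp add: w_def F_def FF_def l1_def l2_def)
      show ?thesis using DERIV_cong_ev[OF refl 3 eq] DERIV_add[OF 1 2] by blast
    qed
    show "(w t s)\<^sup>2 \<le> (4 * H\<^sup>2 + 4 * H\<^sup>2 + 2 * D\<^sup>2 * sqrt T) / sqrt t" if t: "t \<in> {0<..T}" for t s
    proof -
      define x where "x = sqrt (2 * t)"
      have x: "x > 0" using t by (simp add: x_def)
      have "\<bar>heatY x v0 s\<bar> \<le> 2 * H * sqrt x" using x by (intro heatY_Hoelder_bound[OF v0(1) V0 v0(3)]) auto
      then have "(heatY x v0 s)\<^sup>2 \<le> (2 * H * sqrt x)\<^sup>2" by (rule abs_le_square_iff[THEN iffD1, OF order_trans]) simp
      also have "\<dots> = 4 * H\<^sup>2 * x" using x by (simp add: power_mult_distrib)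
      finally have "(heatY x v0 s / x)\<^sup>2 \<le> 4 * H\<^sup>2 * x / x\<^sup>2" unfolding power_divide by (rule divide_right_mono) simp
      also have "\<dots> = 4 * H\<^sup>2 / x" using x by (simp add: power2_eq_square)
      also have "\<dots> \<le> 4 * H\<^sup>2 / sqrt t" using t by (intro divide_left_mono) (auto simp: x_def)
      finally have 1: "(heatY x v0 s / x)\<^sup>2 \<le> 4 * H\<^sup>2 / sqrt t" .
      have "\<bar>duhamelY G t s\<bar> \<le> \<bar>D\<bar>" using D[of t s] t by auto
      then have "(duhamelY G t s)\<^sup>2 \<le> D\<^sup>2" by (rule abs_le_square_iff[THEN iffD1])
      also have "D\<^sup>2 \<le> D\<^sup>2 * sqrt T / sqrt t"
      proof -
        have "sqrt t \<le> sqrt T" using t by simp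
        then have "D\<^sup>2 * sqrt t \<le> D\<^sup>2 * sqrt T" by (intro mult_left_mono) auto
        then show ?thesis using t by (simp add: pos_le_divide_eq)
      qed
      finally have 2: "(duhamelY G t s)\<^sup>2 \<le> D\<^sup>2 * sqrt T / sqrt t" .
      have "(p + q)\<^sup>2 \<le> 2 * p\<^sup>2 + 2 * q\<^sup>2" for p q :: real
        using zero_le_power2[of "p - q"] by (simp add: power2_eq_square algebra_simps)
      from this[of "heatY x v0 s / x" "duhamelY G t s"]
      have "(w t s)\<^sup>2 \<le> 2 * (4 * H\<^sup>2 / sqrt t) + 2 * (D\<^sup>2 * sqrt T / sqrt t)"
        using 1 2 unfolding w_def x_def by linarith
      also have "\<dots> = (4 * H\<^sup>2 + 4 * H\<^sup>2 + 2 * D\<^sup>2 * sqrt T) / sqrt t" by (simp add: add_divide_distrib)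
      finally show ?thesis .
    qed
  qed (use sol in \<open>auto simp: l1_def l2_def\<close>)
qed

section \<open>Energy decay and conservation of the constraint\<close>

lemma integral_derivative:
  fixes P :: "real \<Rightarrow> real"
  assumes "a \<le> b" "\<And>s. (P has_real_derivative p s) (at s)"
  shows "integral {a..b} p = P b - P a" "(p has_integral P b - P a) {a..b}"
proof -
  show "(p has_integral P b - P a) {a..b}"
    by (rule fundamental_theorem_of_calculus[OF assms(1)])
       (simp add: has_real_derivative_iff_has_vector_derivative[symmetric] has_field_derivative_at_within[OF assms(2)])
  then show "integral {a..b} p = P b - P a" by (rule integral_unique)
qed

text \<open>The integral over a moving period has derivative f (a + L) - f a = 0 in a.\<close>

lemma integral_periodic_shift:
  fixes f :: "real \<Rightarrow> real"
  assumes f: "continuous_on UNIV f" "\<And>s. f (s + L) = f s" and L: "L \<ge> 0"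
  shows "integral {a..a + L} f = integral {0..L} f"
proof -
  obtain F where F: "\<And>z. (F has_real_derivative f z) (at z)" using continuous_antiderivative_exists[OF f(1)] by blast
  have d: "((\<lambda>a. F (a + L) - F a) has_real_derivative 0) (at a)" for a
  proof -
    have "((\<lambda>a. F (a + L)) has_real_derivative f (a + L)) (at a)" using F[of "a + L"] by (simp only: DERIV_shift)
    from DERIV_diff[OF this F[of a]] f(2) show ?thesis by simp
  qed
  have "F (a + L) - F a = F (0 + L) - F 0" by (rule DERIV_isconst_all) (use d in blast)
  then show ?thesis using integral_derivative(1)[OF _ F, of a "a + L"] integral_derivative(1)[OF _ F, of 0 L] L by simp
qed

text \<open>Nonnegativity of the variance of v, with m its mean over [a, b].\<close>

lemma integral_square_bound:
  fixes v :: "real \<Rightarrow> real"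
  assumes v: "continuous_on {a..b} v" and ab: "a < b"
  shows "(integral {a..b} v)\<^sup>2 \<le> (b - a) * integral {a..b} (\<lambda>s. (v s)\<^sup>2)"
proof -
  define m where "m = integral {a..b} v / (b - a)"
  have I: "integral {a..b} v = m * (b - a)" using ab by (simp add: m_def)
  have "0 \<le> integral {a..b} (\<lambda>s. (v s - m)\<^sup>2)"
    by (intro integral_nonneg integrable_continuous_real continuous_intros v) simp
  also have "\<dots> = integral {a..b} (\<lambda>s. (v s)\<^sup>2 - 2 * m * v s + m\<^sup>2)"
    by (simp add: power2_eq_square algebra_simps)
  also have "\<dots> = integral {a..b} (\<lambda>s. (v s)\<^sup>2) - 2 * m * integral {a..b} v + m\<^sup>2 * (b - a)"
  proof -
    have "((\<lambda>_. m\<^sup>2) has_integral m\<^sup>2 * (b - a)) {a..b}"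
      using has_integral_const_real[of "m\<^sup>2" a b] ab by (simp add: mult.commute)
    then show ?thesis
      by (intro integral_unique has_integral_add has_integral_diff has_integral_mult_right integrable_integral
          integrable_continuous_real continuous_intros v)
  qed
  also have "\<dots> = integral {a..b} (\<lambda>s. (v s)\<^sup>2) - m\<^sup>2 * (b - a)" unfolding I by (simp add: power2_eq_square)
  finally have "m\<^sup>2 * (b - a) \<le> integral {a..b} (\<lambda>s. (v s)\<^sup>2)" by simp
  then have "(b - a) * (m\<^sup>2 * (b - a)) \<le> (b - a) * integral {a..b} (\<lambda>s. (v s)\<^sup>2)" using ab by (intro mult_left_mono) auto
  then show ?thesis unfolding I by (simp add: power2_eq_square mult_ac)
qed

text \<open>Lagrange's identity \<open>2 det A = \<integral>\<integral> sin\<^sup>2 (\<theta>(s) - \<theta>(r)) dr ds\<close>; since \<open>\<theta>\<close> winds around at least once,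
  for each \<open>s\<close> it takes the value \<open>\<theta>(s) + \<pi> / 2\<close>, near which it stays for a length controlled by
  the energy.\<close>

lemma detA_lower_bound:
  fixes \<theta> v :: "real \<Rightarrow> real" and \<eta> :: nat
  assumes L: "L > 0" and \<eta>: "\<eta> \<ge> 1" and N0: "N0 > 0"
    and d: "\<And>s. (\<theta> has_real_derivative v s) (at s)" and v: "continuous_on UNIV v"
    and wind: "\<And>s. \<theta> (s + L) = \<theta> s + 2 * pi * real \<eta>" and vper: "\<And>s. v (s + L) = v s"
    and E: "energy L v \<le> N0"
  shows "L * min L (pi\<^sup>2 / (16 * N0)) / 4 \<le> detA L \<theta>"
proof -
  \<comment> \<open>A length over which theta moves by at most pi / 4, since the square of its
    increment is at most length times energy; it is capped by L so that the window fits into one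
    period.\<close>
  define \<rho> where "\<rho> = min L (pi\<^sup>2 / (16 * N0))"
  have \<rho>: "\<rho> > 0" "\<rho> \<le> L" "N0 * \<rho> \<le> (pi / 4)\<^sup>2"
  proof -
    show "\<rho> > 0" "\<rho> \<le> L" using L N0 by (auto simp: \<rho>_def)
    have "N0 * \<rho> \<le> N0 * (pi\<^sup>2 / (16 * N0))" using N0 by (intro mult_left_mono) (auto simp: \<rho>_def)
    then show "N0 * \<rho> \<le> (pi / 4)\<^sup>2" using N0 by (simp add: power_divide)
  qed
  have \<theta>c: "continuous_on X \<theta>" for X
    by (intro continuous_at_imp_continuous_on ballI) (rule DERIV_isCont[OF d])
  have vc: "continuous_on X v" for X using v by (rule continuous_on_subset) simp
  have m: "\<rho> / 2 \<le> integral {0..L} (\<lambda>r. (sin (\<theta> r - \<theta> s))\<^sup>2)" for s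
  proof -
    have "\<theta> s + pi / 2 \<le> \<theta> (s + L)"
    proof -
      have "pi * 1 \<le> pi * (2 * real \<eta>)" by (rule mult_left_mono) (use \<eta> in auto)
      then have "pi \<le> 2 * pi * real \<eta>" by (simp add: mult_ac)
      then show ?thesis unfolding wind using pi_gt_zero by linarith
    qed
    then obtain r1 where r1: "\<theta> r1 = \<theta> s + pi / 2"
      using IVT'[of \<theta> s "\<theta> s + pi / 2" "s + L"] \<theta>c L pi_ge_zero by auto
    \<comment> \<open>Here sin^2 equals cos^2 of the deviation e from the quarter turn, and |e| <=
      pi / 4 makes this at least 1 / 2.\<close>
    have near: "1 / 2 \<le> (sin (\<theta> r - \<theta> s))\<^sup>2" if r: "r \<in> {r1..r1 + \<rho>}" for r
    proof -
      define e where "e = \<theta> r - \<theta> r1"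
      have "e\<^sup>2 \<le> (pi / 4)\<^sup>2"
      proof (cases "r = r1")
        case False
        then have lt: "r1 < r" using r by simp
        have "e = integral {r1..r} v" using integral_derivative(1)[OF _ d, of r1 r] lt by (simp add: e_def)
        then have "e\<^sup>2 \<le> (r - r1) * integral {r1..r} (\<lambda>s. (v s)\<^sup>2)" using integral_square_bound[OF vc lt] by simp
        also have "integral {r1..r} (\<lambda>s. (v s)\<^sup>2) \<le> integral {r1..r1 + L} (\<lambda>s. (v s)\<^sup>2)"
          using r \<rho> by (intro integral_subset_le integrable_continuous_real continuous_intros vc) auto
        also have "integral {r1..r1 + L} (\<lambda>s. (v s)\<^sup>2) = energy L v"
          unfolding energy_def using L vper by (intro integral_periodic_shift continuous_intros vc) auto
        finally have "e\<^sup>2 \<le> (r - r1) * energy L v" using lt by (simp add: mult_left_mono)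
        also have "\<dots> \<le> \<rho> * N0" using r lt E N0 by (intro mult_mono) (auto simp: energy_def intro!: integral_nonneg integrable_continuous_real continuous_intros vc)
        finally show ?thesis using \<rho>(3) by (simp add: mult.commute)
      qed (simp add: e_def)
      then have "\<bar>e\<bar> \<le> pi / 4" using abs_le_square_iff[of e "pi / 4"] by simp
      then have "cos (pi / 4) \<le> cos \<bar>e\<bar>" using pi_gt_zero by (intro cos_monotone_0_pi_le) auto
      then have "(cos (pi / 4))\<^sup>2 \<le> (cos \<bar>e\<bar>)\<^sup>2" by (intro power_mono) (auto simp: cos_45)
      moreover have "\<theta> r - \<theta> s = pi / 2 + e" using r1 by (simp add: e_def)
      ultimately show ?thesis by (simp add: cos_45 sin_add power_divide)
    qed
    have sc: "continuous_on X (\<lambda>r. (sin (\<theta> r - \<theta> s))\<^sup>2)" for X by (intro continuous_intros \<theta>c)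
    have per: "(sin (\<theta> (r + L) - \<theta> s))\<^sup>2 = (sin (\<theta> r - \<theta> s))\<^sup>2" for r
    proof -
      have "\<theta> (r + L) - \<theta> s = (\<theta> r - \<theta> s) + 2 * pi * real \<eta>" using wind by simp
      then show ?thesis by (simp only: sin_cos_plus_nat_periods)
    qed
    have "\<rho> / 2 = integral {r1..r1 + \<rho>} (\<lambda>_. 1 / 2)" using \<rho> by simp
    also have "\<dots> \<le> integral {r1..r1 + \<rho>} (\<lambda>r. (sin (\<theta> r - \<theta> s))\<^sup>2)"
      by (intro integral_le integrable_continuous_real sc near) auto
    also have "\<dots> \<le> integral {r1..r1 + L} (\<lambda>r. (sin (\<theta> r - \<theta> s))\<^sup>2)"
      using \<rho> by (intro integral_subset_le integrable_continuous_real sc) auto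
    also have "\<dots> = integral {0..L} (\<lambda>r. (sin (\<theta> r - \<theta> s))\<^sup>2)"
      using L by (intro integral_periodic_shift sc per) auto
    finally show ?thesis .
  qed
  have ii: "integral {0..L} (\<lambda>r. p * (sin (\<theta> r))\<^sup>2 + q * (cos (\<theta> r))\<^sup>2 - k * (sin (\<theta> r) * cos (\<theta> r))) =
      p * int_sin2 L \<theta> + q * int_cos2 L \<theta> - k * int_sincos L \<theta>" for p q k
    unfolding int_sin2_def int_cos2_def int_sincos_def
    by (intro integral_unique has_integral_add has_integral_diff has_integral_mult_right integrable_integral
        integrable_continuous_real continuous_intros \<theta>c)
  have inner: "integral {0..L} (\<lambda>r. (sin (\<theta> r - \<theta> s))\<^sup>2) =
      int_cos2 L \<theta> * (sin (\<theta> s))\<^sup>2 + int_sin2 L \<theta> * (cos (\<theta> s))\<^sup>2 - 2 * int_sincos L \<theta> * (sin (\<theta> s) * cos (\<theta> s))" for s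
  proof -
    have "(sin (\<theta> r - \<theta> s))\<^sup>2 = (cos (\<theta> s))\<^sup>2 * (sin (\<theta> r))\<^sup>2 + (sin (\<theta> s))\<^sup>2 * (cos (\<theta> r))\<^sup>2 - (2 * (sin (\<theta> s) * cos (\<theta> s))) * (sin (\<theta> r) * cos (\<theta> r))" for r
      unfolding sin_diff by (simp add: power2_eq_square algebra_simps)
    then show ?thesis by (simp only: ii) (simp add: algebra_simps)
  qed
  \<comment> \<open>Integrating the pointwise lower bound over s gives L rho / 2 <= 2 det A, whence
    the constant L rho / 4.\<close>
  have "L * (\<rho> / 2) = integral {0..L} (\<lambda>s. \<rho> / 2)" using L by simp
  also have "\<dots> \<le> integral {0..L} (\<lambda>s. integral {0..L} (\<lambda>r. (sin (\<theta> r - \<theta> s))\<^sup>2))"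
    unfolding inner using m[unfolded inner] by (intro integral_le integrable_continuous_real continuous_intros \<theta>c) auto
  also have "\<dots> = 2 * detA L \<theta>" unfolding inner ii detA_def by (simp add: power2_eq_square)
  finally show ?thesis by (simp add: \<rho>_def)
qed

text \<open>The conclusions of \<open>truncated_flow_exists\<close> together with the two choices
  that make the truncation inactive: \<open>N0\<close> bounds the initial energy, and
  \<open>\<delta>\<close> is the determinant bound that this energy level implies.\<close>

locale truncated_flow =
  fixes L T c N0 \<delta> C :: real and \<eta> :: nat and u v w :: "real \<Rightarrow> real \<Rightarrow> real" and l1 l2 :: "real \<Rightarrow> real"
  assumes L: "L > 0" and T: "T > 0" and \<eta>: "\<eta> \<ge> 1" and pos: "N0 > 0" "\<delta> > 0" and cL: "c * L = 2 * pi * real \<eta>"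
    and E0: "energy L (v 0) \<le> N0" and \<delta>: "\<delta> = L * min L (pi\<^sup>2 / (16 * N0)) / 4"
    and uc: "jointly_continuous u" and vc: "jointly_continuous v"
    and du: "\<And>t s. (u t has_real_derivative v t s - c) (at s)"
    and uper: "\<And>t s. u t (s + L) = u t s" and vper: "\<And>t s. v t (s + L) = v t s"
    and l1: "\<And>t. l1 t = lam1 L N0 \<delta> (\<lambda>s. u t s + c * s) (v t)"
    and l2: "\<And>t. l2 t = lam2 L N0 \<delta> (\<lambda>s. u t s + c * s) (v t)"
    and l1c: "continuous_on UNIV l1" and l2c: "continuous_on UNIV l2"
    and dv: "\<And>t s. t \<in> {0<..T} \<Longrightarrow> (v t has_real_derivative w t s) (at s)"
    and wc: "continuous_on ({0<..} \<times> UNIV) (\<lambda>p. w (fst p) (snd p))"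
    and wper: "\<And>t s. w t (s + L) = w t s"
    and dt: "\<And>t s. t \<in> {0<..<T} \<Longrightarrow> ((\<lambda>t. u t s) has_real_derivative
        w t s + l1 t * sin (u t s + c * s) - l2 t * cos (u t s + c * s)) (at t)"
    and wC: "\<And>t s. t \<in> {0<..T} \<Longrightarrow> (w t s)\<^sup>2 \<le> C / sqrt t"
begin

definition \<theta> :: "real \<Rightarrow> real \<Rightarrow> real" where "\<theta> t s = u t s + c * s"

text \<open>The time derivative of u on (0, T); it later serves as the weak time derivative.\<close>

definition ut :: "real \<Rightarrow> real \<Rightarrow> real" where "ut t s = w t s + l1 t * sin (\<theta> t s) - l2 t * cos (\<theta> t s)"

lemma d\<theta>: "(\<theta> t has_real_derivative v t s) (at s)"
  unfolding \<theta>_def[abs_def] using du[of t s] by (auto intro!: derivative_eq_intros)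

lemma \<theta>c: "jointly_continuous \<theta>"
  unfolding \<theta>_def by (intro jointly_continuousI continuous_intros jointly_continuous_compose[OF uc])

lemma slices: "continuous_on X (u t)" "continuous_on X (v t)" "continuous_on X (\<theta> t)"
  using jointly_continuous_compose[OF uc, of X "\<lambda>_. t" "\<lambda>s. s"] jointly_continuous_compose[OF vc, of X "\<lambda>_. t" "\<lambda>s. s"]
    jointly_continuous_compose[OF \<theta>c, of X "\<lambda>_. t" "\<lambda>s. s"] by auto

lemma w_compose:
  assumes "continuous_on X f" "continuous_on X g" "\<And>p. p \<in> X \<Longrightarrow> f p > 0"
  shows "continuous_on X (\<lambda>p. w (f p) (g p))"
proof -
  have "continuous_on X (\<lambda>p. (f p, g p))" by (intro continuous_on_Pair assms)
  from continuous_on_compose2[OF wc this] assms(3) show ?thesis by auto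
qed

lemma ut_compose:
  fixes f g :: "'a::t2_space \<Rightarrow> real"
  assumes "continuous_on X f" "continuous_on X g" "\<And>p. p \<in> X \<Longrightarrow> f p > 0"
  shows "continuous_on X (\<lambda>p. ut (f p) (g p))"
  unfolding ut_def
  by (intro continuous_intros w_compose assms jointly_continuous_compose[OF \<theta>c]
      continuous_on_compose2[OF l1c assms(1)] continuous_on_compose2[OF l2c assms(1)]) auto

lemma w_slice: "t > 0 \<Longrightarrow> continuous_on X (w t)" "t > 0 \<Longrightarrow> continuous_on X (ut t)"
  using w_compose[of X "\<lambda>_. t" "\<lambda>s. s"] ut_compose[of X "\<lambda>_. t" "\<lambda>s. s"] by auto

lemma \<theta>wind: "\<theta> t (s + L) = \<theta> t s + 2 * pi * real \<eta>"
  unfolding \<theta>_def uper using cL by (simp add: algebra_simps)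

lemma trig_per: "sin (\<theta> t (s + L)) = sin (\<theta> t s)" "cos (\<theta> t (s + L)) = cos (\<theta> t s)"
  unfolding \<theta>wind by (rule sin_cos_plus_nat_periods)+

lemma integral_derivative_periodic:
  assumes "\<And>s. (P has_real_derivative p s) (at s)" "P L = P 0"
  shows "integral {0..L} p = 0"
  using integral_derivative(1)[OF _ assms(1), of 0 L] L assms(2) by simp

text \<open>Integrate the s-derivatives of v sin theta and v cos theta over a period. This turns
  pairings with v_s into the moments that occur in the multipliers.\<close>

lemma w_moments:
  assumes t: "t \<in> {0<..T}"
  shows "integral {0..L} (\<lambda>s. w t s * sin (\<theta> t s)) = - moment_cos L (\<theta> t) (v t)"
    "integral {0..L} (\<lambda>s. w t s * cos (\<theta> t s)) = moment_sin L (\<theta> t) (v t)"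
proof -
  have wcs: "continuous_on {0..L} (w t)" using t by (intro w_slice) auto
  have "integral {0..L} (\<lambda>s. w t s * sin (\<theta> t s) + (v t s)\<^sup>2 * cos (\<theta> t s)) = 0"
  proof (rule integral_derivative_periodic)
    show "((\<lambda>s. v t s * sin (\<theta> t s)) has_real_derivative w t s * sin (\<theta> t s) + (v t s)\<^sup>2 * cos (\<theta> t s)) (at s)" for s
      using dv[OF t, of s] d\<theta>[of t s] by (auto intro!: derivative_eq_intros simp: power2_eq_square)
    show "v t L * sin (\<theta> t L) = v t 0 * sin (\<theta> t 0)" using vper[of t 0] trig_per[of t 0] by simp
  qed
  moreover have "integral {0..L} (\<lambda>s. w t s * sin (\<theta> t s) + (v t s)\<^sup>2 * cos (\<theta> t s)) =
      integral {0..L} (\<lambda>s. w t s * sin (\<theta> t s)) + moment_cos L (\<theta> t) (v t)"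
    unfolding moment_cos_def
    by (intro Henstock_Kurzweil_Integration.integral_add integrable_continuous_real continuous_intros slices wcs)
  ultimately show "integral {0..L} (\<lambda>s. w t s * sin (\<theta> t s)) = - moment_cos L (\<theta> t) (v t)" by simp
  have "integral {0..L} (\<lambda>s. w t s * cos (\<theta> t s) - (v t s)\<^sup>2 * sin (\<theta> t s)) = 0"
  proof (rule integral_derivative_periodic)
    show "((\<lambda>s. v t s * cos (\<theta> t s)) has_real_derivative w t s * cos (\<theta> t s) - (v t s)\<^sup>2 * sin (\<theta> t s)) (at s)" for s
      using dv[OF t, of s] d\<theta>[of t s] by (auto intro!: derivative_eq_intros simp: power2_eq_square)
    show "v t L * cos (\<theta> t L) = v t 0 * cos (\<theta> t 0)" using vper[of t 0] trig_per[of t 0] by simp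
  qed
  moreover have "integral {0..L} (\<lambda>s. w t s * cos (\<theta> t s) - (v t s)\<^sup>2 * sin (\<theta> t s)) =
      integral {0..L} (\<lambda>s. w t s * cos (\<theta> t s)) - moment_sin L (\<theta> t) (v t)"
    unfolding moment_sin_def
    by (intro Henstock_Kurzweil_Integration.integral_diff integrable_continuous_real continuous_intros slices wcs)
  ultimately show "integral {0..L} (\<lambda>s. w t s * cos (\<theta> t s)) = moment_sin L (\<theta> t) (v t)" by simp
qed

text \<open>Let W be the integral of w^2, D the determinant, kappa the truncated factor and B the
  nonnegative quadratic form in the moments. The integral of the square of \<open>ut\<close> is W -
  2 kappa B + kappa^2 D B, and kappa D <= 1 reduces its nonnegativity to W - kappa B >= 0, which is
  the claim. For kappa = 1 / D the multiplier terms project w orthogonally; a truncated kappa only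
  damps them.\<close>

lemma dissipation_nonneg:
  assumes t: "t \<in> {0<..T}"
  shows "0 \<le> integral {0..L} (\<lambda>s. ut t s * w t s)"
proof -
  have wcs: "continuous_on {0..L} (w t)" using t by (intro w_slice) auto
  define S where "S = int_sin2 L (\<theta> t)"
  define K where "K = int_cos2 L (\<theta> t)"
  define X where "X = int_sincos L (\<theta> t)"
  define p where "p = moment_cos L (\<theta> t) (v t)"
  define q where "q = moment_sin L (\<theta> t) (v t)"
  define \<kappa> where "\<kappa> = trunc_factor L N0 \<delta> (\<theta> t) (v t)"
  define W where "W = integral {0..L} (\<lambda>s. (w t s)\<^sup>2)"
  define B where "B = p\<^sup>2 * K + 2 * p * q * X + q\<^sup>2 * S"
  have l: "l1 t = (p * K + q * X) * \<kappa>" "l2 t = (p * X + q * S) * \<kappa>"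
    unfolding l1 l2 lam1_def lam2_def S_def K_def X_def p_def q_def \<kappa>_def \<theta>_def[abs_def] by simp_all
  \<comment> \<open>One expansion for two uses: a = 0 shows that B is nonnegative, and a = 1 gives
    the square of \<open>ut\<close>.\<close>
  have quad: "integral {0..L} (\<lambda>s. (a * w t s + f * sin (\<theta> t s) - g * cos (\<theta> t s))\<^sup>2) =
      a\<^sup>2 * W + f\<^sup>2 * S + g\<^sup>2 * K - 2 * a * f * p - 2 * a * g * q - 2 * f * g * X" for a f g
  proof -
    have "integral {0..L} (\<lambda>s. (a * w t s + f * sin (\<theta> t s) - g * cos (\<theta> t s))\<^sup>2) =
      integral {0..L} (\<lambda>s. a\<^sup>2 * (w t s)\<^sup>2 + f\<^sup>2 * (sin (\<theta> t s))\<^sup>2 + g\<^sup>2 * (cos (\<theta> t s))\<^sup>2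
        + 2 * a * f * (w t s * sin (\<theta> t s)) - 2 * a * g * (w t s * cos (\<theta> t s)) - 2 * f * g * (sin (\<theta> t s) * cos (\<theta> t s)))"
      by (simp add: power2_eq_square algebra_simps)
    also have "\<dots> = a\<^sup>2 * W + f\<^sup>2 * S + g\<^sup>2 * K + 2 * a * f * integral {0..L} (\<lambda>s. w t s * sin (\<theta> t s))
        - 2 * a * g * integral {0..L} (\<lambda>s. w t s * cos (\<theta> t s)) - 2 * f * g * X"
      unfolding W_def S_def K_def X_def int_sin2_def int_cos2_def int_sincos_def
    by (intro integral_unique has_integral_add has_integral_diff has_integral_mult_right integrable_integral
        integrable_continuous_real continuous_intros slices wcs)
    finally show ?thesis unfolding w_moments[OF t] p_def q_def by simp
  qed
  have nn: "0 \<le> integral {0..L} (\<lambda>s. (a * w t s + f * sin (\<theta> t s) - g * cos (\<theta> t s))\<^sup>2)" for a f g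
    by (intro integral_nonneg integrable_continuous_real continuous_intros slices wcs) simp
  have B0: "0 \<le> B" using nn[of 0 q "- p"] unfolding quad B_def by (simp add: algebra_simps)
  have main: "0 \<le> W - 2 * \<kappa> * B + \<kappa>\<^sup>2 * (S * K - X\<^sup>2) * B"
    using nn[of 1 "l1 t" "l2 t"] unfolding quad l B_def by (simp add: power2_eq_square algebra_simps)
  have \<kappa>0: "\<kappa> \<ge> 0" unfolding \<kappa>_def trunc_factor_def using pos by simp
  have \<kappa>d: "\<kappa> * (S * K - X\<^sup>2) \<le> 1"
  proof -
    let ?D = "S * K - X\<^sup>2"
    have D: "?D = detA L (\<theta> t)" by (simp add: detA_def S_def K_def X_def)
    have a: "0 \<le> N0 * (1 / max N0 (energy L (v t)))" "N0 * (1 / max N0 (energy L (v t))) \<le> 1" using pos by (auto simp: divide_le_eq)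
    have b: "1 / max \<delta> ?D * ?D \<le> 1" using pos by (simp add: divide_le_eq max_def)
    show ?thesis
    proof (cases "?D \<ge> 0")
      case True
      then have "0 \<le> 1 / max \<delta> ?D * ?D" using pos by (simp add: max_def)
      then have "N0 * (1 / max N0 (energy L (v t))) * (1 / max \<delta> ?D * ?D) \<le> 1 * 1" using a b by (intro mult_mono) auto
      then show ?thesis unfolding \<kappa>_def trunc_factor_def D by (simp only: mult.assoc)
    next
      case False
      then have "\<kappa> * ?D \<le> 0" using \<kappa>0 by (simp add: mult_nonneg_nonpos)
      then show ?thesis by linarith
    qed
  qed
  have "\<kappa>\<^sup>2 * (S * K - X\<^sup>2) * B = (\<kappa> * (S * K - X\<^sup>2)) * (\<kappa> * B)" by (simp add: power2_eq_square)
  also have "\<dots> \<le> 1 * (\<kappa> * B)" using \<kappa>d \<kappa>0 B0 by (intro mult_right_mono) auto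
  finally have WB: "0 \<le> W - \<kappa> * B" using main by linarith
  have "integral {0..L} (\<lambda>s. ut t s * w t s) =
      integral {0..L} (\<lambda>s. (w t s)\<^sup>2 + l1 t * (w t s * sin (\<theta> t s)) - l2 t * (w t s * cos (\<theta> t s)))"
    unfolding ut_def by (simp add: power2_eq_square algebra_simps)
  also have "\<dots> = W + l1 t * integral {0..L} (\<lambda>s. w t s * sin (\<theta> t s)) - l2 t * integral {0..L} (\<lambda>s. w t s * cos (\<theta> t s))"
    unfolding W_def
    by (intro integral_unique has_integral_add has_integral_diff has_integral_mult_right integrable_integral
        integrable_continuous_real continuous_intros slices wcs)
  also have "\<dots> = W - \<kappa> * B"
    unfolding w_moments[OF t] l p_def[symmetric] q_def[symmetric] B_def by (simp add: power2_eq_square algebra_simps)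
  finally show ?thesis using WB by simp
qed

lemma u_increment:
  assumes t: "t \<in> {0<..<T}" and z: "z \<in> {0<..<T}"
  shows "u z s - u t s = (z - t) * integral {0..1} (\<lambda>\<xi>. ut (t + \<xi> * (z - t)) s)"
proof -
  have mem: "t + \<xi> * (z - t) \<in> {0<..<T}" if "\<xi> \<in> {0..1}" for \<xi>
  proof -
    have "(1 - \<xi>) *\<^sub>R t + \<xi> *\<^sub>R z \<in> {0<..<T}"
      by (rule convexD_alt[OF convex_real_interval(8) t z]) (use that in auto)
    then show ?thesis by (simp add: algebra_simps)
  qed
  have "((\<lambda>\<xi>. ut (t + \<xi> * (z - t)) s * (z - t)) has_integral u (t + 1 * (z - t)) s - u (t + 0 * (z - t)) s) {0..1}"
  proof (rule fundamental_theorem_of_calculus)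
    fix \<xi> :: real assume \<xi>: "\<xi> \<in> {0..1}"
    have 1: "((\<lambda>\<xi>. t + \<xi> * (z - t)) has_real_derivative z - t) (at \<xi>)" by (auto intro!: derivative_eq_intros)
    have 2: "((\<lambda>t. u t s) has_real_derivative ut (t + \<xi> * (z - t)) s) (at (t + \<xi> * (z - t)))"
      using dt[OF mem[OF \<xi>], of s] by (simp add: ut_def \<theta>_def)
    from has_field_derivative_at_within[OF DERIV_chain2[OF 2 1]]
    show "((\<lambda>\<xi>. u (t + \<xi> * (z - t)) s) has_vector_derivative ut (t + \<xi> * (z - t)) s * (z - t)) (at \<xi> within {0..1})"
      by (simp add: has_real_derivative_iff_has_vector_derivative)
  qed simp
  from integral_unique[OF this] show ?thesis by (simp add: mult.commute)
qed

text \<open>By \<open>u_increment\<close>, the average of \<open>ut\<close> between t and z is the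
  difference quotient of u for z \<noteq> t; it extends the quotient to z = t. Its joint continuity
  takes the place of differentiation under the integral sign.\<close>

lemma difference_quotient_continuous:
  assumes t: "t > 0"
  shows "continuous_on ({0<..} \<times> UNIV) (\<lambda>p. integral {0..1} (\<lambda>\<xi>. ut (t + \<xi> * (fst p - t)) (snd p)))"
proof (intro integral_continuous_on_param_real ut_compose continuous_intros)
  fix p :: "(real \<times> real) \<times> real" assume p: "p \<in> ({0<..} \<times> UNIV) \<times> {0..1}"
  then have "(1 - snd p) *\<^sub>R t + snd p *\<^sub>R fst (fst p) \<in> {0<..}"
    using t by (intro convexD_alt[OF convex_real_interval(3)]) auto
  then show "0 < t + snd p * (fst (fst p) - t)" by (simp add: algebra_simps)
qed

text \<open>v has no known time derivative, so the integrand of the energy is not differentiated.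
  With subscripts for times, the s-derivative of (u_z - u_t) (v_z + v_t) integrates to zero over a
  period, which expresses the energy increment through u_z - u_t and w_z + w_t. After division by z
  - t everything is continuous in z.\<close>

lemma energy_derivative:
  assumes t: "t \<in> {0<..<T}"
  shows "((\<lambda>t. energy L (v t)) has_real_derivative - 2 * integral {0..L} (\<lambda>s. ut t s * w t s)) (at t)"
proof -
  define Q where "Q z s = integral {0..1} (\<lambda>\<xi>. ut (t + \<xi> * (z - t)) s)" for z s
  have Qc: "continuous_on ({0<..} \<times> UNIV) (\<lambda>p. Q (fst p) (snd p))"
    unfolding Q_def by (rule difference_quotient_continuous) (use t in simp)
  have Qsl: "continuous_on ({0<..} \<times> X) (\<lambda>p. Q (fst p) (snd p))" "z > 0 \<Longrightarrow> continuous_on X (Q z)" for X z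
  proof -
    show "continuous_on ({0<..} \<times> X) (\<lambda>p. Q (fst p) (snd p))" using Qc by (rule continuous_on_subset) auto
    assume "z > 0"
    then show "continuous_on X (Q z)"
      using continuous_on_compose2[OF Qc, of X "\<lambda>s. (z, s)"] by (auto simp: continuous_on_Pair)
  qed
  \<comment> \<open>\<open>H\<close> extends the difference quotient of the energy continuously to z
    = t, where its value is the derivative.\<close>
  define H where "H z = - integral {0..L} (\<lambda>s. Q z s * (w z s + w t s))" for z
  have quot: "(energy L (v z) - energy L (v t)) / (z - t) = H z" if z: "z \<in> {0<..<T}" "z \<noteq> t" for z
  proof -
    have tz: "t \<in> {0<..T}" "z \<in> {0<..T}" using t z by auto
    have cs: "continuous_on {0..L} (w t)" "continuous_on {0..L} (w z)" using tz by (auto intro: w_slice)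
    have qc: "continuous_on {0..L} (Q z)" using z by (intro Qsl) auto
    have "integral {0..L} (\<lambda>s. ((v z s)\<^sup>2 - (v t s)\<^sup>2) + (u z s - u t s) * (w z s + w t s)) = 0"
    proof (rule integral_derivative_periodic)
      show "((\<lambda>s. (u z s - u t s) * (v z s + v t s)) has_real_derivative ((v z s)\<^sup>2 - (v t s)\<^sup>2) + (u z s - u t s) * (w z s + w t s)) (at s)" for s
        using du[of z s] du[of t s] dv[OF tz(1), of s] dv[OF tz(2), of s]
        by (auto intro!: derivative_eq_intros simp: power2_eq_square algebra_simps)
      show "(u z L - u t L) * (v z L + v t L) = (u z 0 - u t 0) * (v z 0 + v t 0)"
        using uper[of z 0] uper[of t 0] vper[of z 0] vper[of t 0] by simp
    qed
    moreover have "(u z s - u t s) * (w z s + w t s) = (z - t) * (Q z s * (w z s + w t s))" for s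
      using t z u_increment[of t z s] by (simp add: Q_def)
    ultimately have "integral {0..L} (\<lambda>s. ((v z s)\<^sup>2 - (v t s)\<^sup>2) + (z - t) * (Q z s * (w z s + w t s))) = 0" by simp
    moreover have "integral {0..L} (\<lambda>s. ((v z s)\<^sup>2 - (v t s)\<^sup>2) + (z - t) * (Q z s * (w z s + w t s))) =
        (energy L (v z) - energy L (v t)) + (z - t) * integral {0..L} (\<lambda>s. Q z s * (w z s + w t s))"
      unfolding energy_def
    by (intro integral_unique has_integral_add has_integral_diff has_integral_mult_right integrable_integral
        integrable_continuous_real continuous_intros slices cs qc)
    ultimately have "energy L (v z) - energy L (v t) = (z - t) * H z" by (simp add: H_def)
    then show ?thesis using z by simp
  qed
  have "continuous_on {0<..} H" unfolding H_def
    by (intro continuous_intros integral_continuous_on_param_real Qsl w_compose) (use t in auto)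
  then have "isCont H t" using t by (simp add: continuous_on_eq_continuous_at)
  then have lim: "(H \<longlongrightarrow> H t) (at t)" by (simp add: isCont_def)
  have Ht: "H t = - 2 * integral {0..L} (\<lambda>s. ut t s * w t s)"
  proof -
    have "Q t s * (w t s + w t s) = 2 * (ut t s * w t s)" for s by (simp add: Q_def)
    then show ?thesis unfolding H_def by (simp only: integral_mult_right)
  qed
  show ?thesis unfolding has_field_derivative_iff Ht[symmetric]
  proof (rule Lim_transform_eventually[OF lim])
    show "\<forall>\<^sub>F z in at t. H z = (energy L (v z) - energy L (v t)) / (z - t)"
      unfolding eventually_at_filter
      by (rule eventually_mono[OF eventually_nhds_in_open[of "{0<..<T}" t]]) (use t quot in auto)
  qed
qed

text \<open>The derivative is available only for t > 0; continuity of the energy up to t = 0 closes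
  the gap.\<close>

lemma energy_le:
  assumes t: "t \<in> {0..T}"
  shows "energy L (v t) \<le> N0"
proof -
  have "energy L (v t) \<le> energy L (v 0)"
  proof (rule DERIV_nonpos_imp_decreasing_open[where f="\<lambda>t. energy L (v t)" and a=0 and b=t])
    show "0 \<le> t" using t by simp
    show "continuous_on {0..t} (\<lambda>t. energy L (v t))" unfolding energy_def
      by (intro integral_continuous_on_param_real continuous_intros jointly_continuous_compose[OF vc])
    fix x assume "0 < x" "x < t"
    then have x: "x \<in> {0<..<T}" "x \<in> {0<..T}" using t by auto
    show "\<exists>y. ((\<lambda>t. energy L (v t)) has_real_derivative y) (at x) \<and> y \<le> 0"
      using energy_derivative[OF x(1)] dissipation_nonneg[OF x(2)] by force
  qed
  then show ?thesis using E0 by simp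
qed

text \<open>The energy bound forces the determinant above \<open>\<delta>\<close>, so both cuts drop
  out and the multipliers are those of Cramer's rule. In view of \<open>w_moments\<close>, the
  equations say that \<open>ut\<close> is orthogonal to sin theta and cos theta.\<close>

lemma multiplier_equations:
  assumes t: "t \<in> {0..T}"
  shows "l1 t * int_sin2 L (\<theta> t) - l2 t * int_sincos L (\<theta> t) = moment_cos L (\<theta> t) (v t)"
    "l1 t * int_sincos L (\<theta> t) - l2 t * int_cos2 L (\<theta> t) = - moment_sin L (\<theta> t) (v t)"
proof -
  have det: "\<delta> \<le> detA L (\<theta> t)" unfolding \<delta>
    by (rule detA_lower_bound[OF L \<eta> pos(1) d\<theta> slices(2) \<theta>wind vper energy_le[OF t]])
  then have \<kappa>: "trunc_factor L N0 \<delta> (\<theta> t) (v t) = 1 / detA L (\<theta> t)"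
    unfolding trunc_factor_def using energy_le[OF t] pos by (simp add: max_absorb1 max_absorb2)
  have dnz: "detA L (\<theta> t) \<noteq> 0" using det pos by simp
  have l: "l1 t = (moment_cos L (\<theta> t) (v t) * int_cos2 L (\<theta> t) + moment_sin L (\<theta> t) (v t) * int_sincos L (\<theta> t)) / detA L (\<theta> t)"
    "l2 t = (moment_cos L (\<theta> t) (v t) * int_sincos L (\<theta> t) + moment_sin L (\<theta> t) (v t) * int_sin2 L (\<theta> t)) / detA L (\<theta> t)"
    unfolding l1 l2 lam1_def lam2_def \<theta>_def[symmetric, abs_def] \<kappa> by simp_all
  have "l1 t * int_sin2 L (\<theta> t) - l2 t * int_sincos L (\<theta> t) = moment_cos L (\<theta> t) (v t) * detA L (\<theta> t) / detA L (\<theta> t)"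
    unfolding l times_divide_eq_left diff_divide_distrib[symmetric] by (simp add: detA_def power2_eq_square algebra_simps)
  then show "l1 t * int_sin2 L (\<theta> t) - l2 t * int_sincos L (\<theta> t) = moment_cos L (\<theta> t) (v t)" using dnz by simp
  have "l1 t * int_sincos L (\<theta> t) - l2 t * int_cos2 L (\<theta> t) = - moment_sin L (\<theta> t) (v t) * detA L (\<theta> t) / detA L (\<theta> t)"
    unfolding l times_divide_eq_left diff_divide_distrib[symmetric] by (simp add: detA_def power2_eq_square algebra_simps)
  then show "l1 t * int_sincos L (\<theta> t) - l2 t * int_cos2 L (\<theta> t) = - moment_sin L (\<theta> t) (v t)" using dnz by simp
qed

text \<open>By the multiplier equations \<open>ut\<close> is orthogonal to sin theta and cos theta,
  so both integrals have zero derivative on (0, T). What is shown is constancy; closedness itself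
  comes from the initial curve.\<close>

lemma constraint_conserved:
  assumes t: "t \<in> {0..T}"
  shows "integral {0..L} (\<lambda>s. cos (\<theta> t s)) = integral {0..L} (\<lambda>s. cos (\<theta> 0 s))"
    "integral {0..L} (\<lambda>s. sin (\<theta> t s)) = integral {0..L} (\<lambda>s. sin (\<theta> 0 s))"
proof -
  have orth: "integral {0..L} (\<lambda>s. sin (\<theta> t s) * ut t s) = 0" "integral {0..L} (\<lambda>s. cos (\<theta> t s) * ut t s) = 0"
    if t: "t \<in> {0<..<T}" for t
  proof -
    have tt: "t \<in> {0<..T}" "t \<in> {0..T}" using t by auto
    have wcs: "continuous_on {0..L} (w t)" using t by (intro w_slice) auto
    have "integral {0..L} (\<lambda>s. sin (\<theta> t s) * ut t s) =
        integral {0..L} (\<lambda>s. w t s * sin (\<theta> t s) + l1 t * (sin (\<theta> t s))\<^sup>2 - l2 t * (sin (\<theta> t s) * cos (\<theta> t s)))"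
      unfolding ut_def by (simp add: power2_eq_square algebra_simps)
    also have "\<dots> = integral {0..L} (\<lambda>s. w t s * sin (\<theta> t s)) + l1 t * int_sin2 L (\<theta> t) - l2 t * int_sincos L (\<theta> t)"
      unfolding int_sin2_def int_sincos_def
    by (intro integral_unique has_integral_add has_integral_diff has_integral_mult_right integrable_integral
        integrable_continuous_real continuous_intros slices wcs)
    also have "\<dots> = 0" using w_moments(1)[OF tt(1)] multiplier_equations(1)[OF tt(2)] by linarith
    finally show "integral {0..L} (\<lambda>s. sin (\<theta> t s) * ut t s) = 0" .
    have "integral {0..L} (\<lambda>s. cos (\<theta> t s) * ut t s) =
        integral {0..L} (\<lambda>s. w t s * cos (\<theta> t s) + l1 t * (sin (\<theta> t s) * cos (\<theta> t s)) - l2 t * (cos (\<theta> t s))\<^sup>2)"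
      unfolding ut_def by (simp add: power2_eq_square algebra_simps)
    also have "\<dots> = integral {0..L} (\<lambda>s. w t s * cos (\<theta> t s)) + l1 t * int_sincos L (\<theta> t) - l2 t * int_cos2 L (\<theta> t)"
      unfolding int_cos2_def int_sincos_def
    by (intro integral_unique has_integral_add has_integral_diff has_integral_mult_right integrable_integral
        integrable_continuous_real continuous_intros slices wcs)
    also have "\<dots> = 0" using w_moments(2)[OF tt(1)] multiplier_equations(2)[OF tt(2)] by linarith
    finally show "integral {0..L} (\<lambda>s. cos (\<theta> t s) * ut t s) = 0" .
  qed
  have d\<theta>t: "((\<lambda>t. \<theta> t s) has_real_derivative ut t s) (at t)" if "t \<in> {0<..<T}" for t s
    using dt[OF that, of s] unfolding \<theta>_def ut_def by (auto intro!: derivative_eq_intros)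
  have const: "integral {0..L} (\<lambda>s. g (\<theta> t s)) = integral {0..L} (\<lambda>s. g (\<theta> 0 s))"
    if g: "\<And>x. (g has_real_derivative g' x) (at x)" "continuous_on UNIV g'"
      and z: "\<And>t. t \<in> {0<..<T} \<Longrightarrow> integral {0..L} (\<lambda>s. g' (\<theta> t s) * ut t s) = 0" for g g' :: "real \<Rightarrow> real"
  proof (cases "t = 0")
    case False
    have gc: "continuous_on UNIV g"
      by (intro continuous_at_imp_continuous_on ballI) (rule DERIV_isCont[OF g(1)])
    show ?thesis
    proof (rule DERIV_isconst2[where a=0 and b=t])
      show "continuous_on {0..t} (\<lambda>t. integral {0..L} (\<lambda>s. g (\<theta> t s)))"
        by (intro integral_continuous_on_param_real continuous_on_compose2[OF gc] jointly_continuous_compose[OF \<theta>c] continuous_intros) auto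
      fix x assume "0 < x" "x < t"
      then have x: "x \<in> {0<..<T}" using t by auto
      have "((\<lambda>t. integral (cbox 0 L) (\<lambda>s. g (\<theta> t s))) has_real_derivative integral (cbox 0 L) (\<lambda>s. g' (\<theta> x s) * ut x s)) (at x within {0<..<T})"
      proof (rule leibniz_rule_field_derivative)
        show "continuous_on ({0<..<T} \<times> cbox 0 L) (\<lambda>(r, s). g' (\<theta> r s) * ut r s)"
          unfolding split_beta
          by (intro continuous_intros continuous_on_compose2[OF g(2)] jointly_continuous_compose[OF \<theta>c] ut_compose) auto
        fix r s assume "r \<in> {0<..<T}"
        from DERIV_chain2[OF g(1) d\<theta>t[OF this]]
        show "((\<lambda>t. g (\<theta> t s)) has_real_derivative g' (\<theta> r s) * ut r s) (at r within {0<..<T})"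
          by (rule has_field_derivative_at_within)
        show "(\<lambda>s. g (\<theta> r s)) integrable_on cbox 0 L"
          by (intro integrable_continuous continuous_on_compose2[OF gc] slices) auto
      qed (use x in auto)
      then show "((\<lambda>t. integral {0..L} (\<lambda>s. g (\<theta> t s))) has_real_derivative 0) (at x)"
        using x z[OF x] by (subst (asm) at_within_open) auto
    qed (use t False in auto)
  qed simp
  show "integral {0..L} (\<lambda>s. sin (\<theta> t s)) = integral {0..L} (\<lambda>s. sin (\<theta> 0 s))"
    by (rule const[of sin cos]) (auto intro: DERIV_sin continuous_intros orth)
  show "integral {0..L} (\<lambda>s. cos (\<theta> t s)) = integral {0..L} (\<lambda>s. cos (\<theta> 0 s))"
    by (rule const[of cos "\<lambda>x. - sin x"], rule DERIV_cos, intro continuous_intros, simp add: orth)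
qed

end

section \<open>Bochner spaces\<close>

lemma continuous_square_integrable:
  fixes f :: "real \<Rightarrow> real"
  assumes "continuous_on {a..b} f"
  shows "f \<in> square_integrable (lebesgue_on {a<..<b})" "integrable (lebesgue_on {a<..<b}) f"
    "(LINT s|lebesgue_on {a<..<b}. f s) = integral {a..b} f"
proof -
  have int: "integrable (lebesgue_on {a<..<b}) g" if "continuous_on {a..b} g" for g :: "real \<Rightarrow> real"
  proof -
    have "set_integrable lebesgue {a..b} g"
      using continuous_imp_integrable_real[OF that] by (simp add: set_integrable_iff_integrable_lebesgue_on)
    then have "set_integrable lebesgue {a<..<b} g" by (rule set_integrable_subset) auto
    then show ?thesis by (simp add: set_integrable_iff_integrable_lebesgue_on)
  qed
  show i: "integrable (lebesgue_on {a<..<b}) f" by (rule int[OF assms])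
  have "integrable (lebesgue_on {a<..<b}) (\<lambda>x. (f x)\<^sup>2)" by (intro int continuous_intros assms)
  with i show "f \<in> square_integrable (lebesgue_on {a<..<b})" by (simp add: square_integrable_def)
  show "(LINT s|lebesgue_on {a<..<b}. f s) = integral {a..b} f"
    using lebesgue_integral_eq_integral[OF i] by (simp add: integral_open_interval_real)
qed

lemma finite_measure_lebesgue_on_interval: "finite_measure (lebesgue_on {a<..<b::real})"
  by (rule finite_measureI) (cases "a \<le> b"; simp add: emeasure_restrict_space)

lemma square_integrable_interval_integrable:
  assumes "f \<in> square_integrable (lebesgue_on {a<..<b::real})"
  shows "integrable (lebesgue_on {a<..<b}) f" "set_integrable lebesgue {a..b} f"
proof -
  show i: "integrable (lebesgue_on {a<..<b}) f"
    by (rule finite_measure.square_integrable_imp_integrable[OF finite_measure_lebesgue_on_interval])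
       (use assms in \<open>simp_all add: square_integrable_def\<close>)
  then have "f absolutely_integrable_on {a<..<b}" by (simp add: set_integrable_iff_integrable_lebesgue_on)
  then show "set_integrable lebesgue {a..b} f"
    by (rule absolutely_integrable_spike_set)
       (auto intro: negligible_subset[of "{a, b}"])
qed

lemma W1p_perD:
  assumes f: "f \<in> W1p_per 2 L" and L: "L > 0"
  shows "f \<in> C_per L" "f \<in> square_integrable (lebesgue_on {0<..<L})"
    "has_weak_deriv {0<..<L} f (weak_deriv {0<..<L} f)"
    "weak_deriv {0<..<L} f \<in> square_integrable (lebesgue_on {0<..<L})"
proof -
  show "f \<in> C_per L" "f \<in> square_integrable (lebesgue_on {0<..<L})"
    using f by (auto simp: W1p_per_def W1p_def Lp_space_2)
  obtain g where g: "g \<in> square_integrable (lebesgue_on {0<..<L})" "has_weak_deriv {0<..<L} f g"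
    using f by (auto simp: W1p_per_def W1p_def Lp_space_2)
  note w = weak_deriv_AE[OF L g(2)]
  show "has_weak_deriv {0<..<L} f (weak_deriv {0<..<L} f)" by (rule w)
  have AE: "AE x in lebesgue_on {0<..<L}. g x = weak_deriv {0<..<L} f x" using w(2) by auto
  have m: "weak_deriv {0<..<L} f \<in> borel_measurable (lebesgue_on {0<..<L})"
    by (rule borel_measurable_lebesgue_on_AE[OF square_integrableD(1)[OF g(1)] _ AE]) simp
  have "integrable (lebesgue_on {0<..<L}) (\<lambda>x. (weak_deriv {0<..<L} f x)\<^sup>2)"
    by (rule integrable_cong_AE_imp[OF square_integrableD(2)[OF g(1)]]) (use m w(2) in auto)
  with m show "weak_deriv {0<..<L} f \<in> square_integrable (lebesgue_on {0<..<L})"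
    by (simp add: square_integrable_def)
qed

lemma W1p_perI:
  assumes "f \<in> C_per L" "has_weak_deriv {0<..<L} f g" "g \<in> square_integrable (lebesgue_on {0<..<L})"
  shows "f \<in> W1p_per 2 L"
proof -
  have "continuous_on {0..L} f" using assms(1) by (auto simp: C_per_def intro: continuous_on_subset)
  then have "f \<in> square_integrable (lebesgue_on {0<..<L})" by (rule continuous_square_integrable)
  then show ?thesis using assms by (auto simp: W1p_per_def W1p_def Lp_space_2)
qed

lemma W1p_per_linear:
  assumes f: "f \<in> W1p_per 2 L" and g: "g \<in> W1p_per 2 L" and L: "L > 0"
  shows "(\<lambda>x. f x + c * g x) \<in> W1p_per 2 L"
    "AE x in lebesgue_on {0<..<L}. weak_deriv {0<..<L} (\<lambda>x. f x + c * g x) x = weak_deriv {0<..<L} f x + c * weak_deriv {0<..<L} g x"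
proof -
  have wd: "has_weak_deriv {0<..<L} (\<lambda>x. f x + c * g x) (\<lambda>x. weak_deriv {0<..<L} f x + c * weak_deriv {0<..<L} g x)"
    by (rule has_weak_deriv_linear[OF L W1p_perD(3)[OF f L] W1p_perD(3)[OF g L]])
  have "(\<lambda>x. f x + c * g x) \<in> C_per L"
    using W1p_perD(1)[OF f L] W1p_perD(1)[OF g L] unfolding C_per_def by (auto intro!: continuous_intros)
  then show "(\<lambda>x. f x + c * g x) \<in> W1p_per 2 L"
    using wd by (rule W1p_perI) (intro square_integrable_add square_integrable_cmult W1p_perD(4)[OF f L] W1p_perD(4)[OF g L])
  show "AE x in lebesgue_on {0<..<L}. weak_deriv {0<..<L} (\<lambda>x. f x + c * g x) x = weak_deriv {0<..<L} f x + c * weak_deriv {0<..<L} g x"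
    by (rule weak_deriv_AE(2)[OF L wd])
qed

lemma W1p_per_diff:
  assumes f: "f \<in> W1p_per 2 L" and g: "g \<in> W1p_per 2 L" and L: "L > 0"
  shows "f - g \<in> W1p_per 2 L"
    "AE x in lebesgue_on {0<..<L}. weak_deriv {0<..<L} (f - g) x = weak_deriv {0<..<L} f x - weak_deriv {0<..<L} g x"
proof -
  have eq: "(\<lambda>x. f x + (-1) * g x) = f - g" by (auto simp: fun_eq_iff)
  show "f - g \<in> W1p_per 2 L" using W1p_per_linear(1)[OF f g L, of "-1"] unfolding eq .
  show "AE x in lebesgue_on {0<..<L}. weak_deriv {0<..<L} (f - g) x = weak_deriv {0<..<L} f x - weak_deriv {0<..<L} g x"
    using W1p_per_linear(2)[OF f g L, of "-1"] unfolding eq by simp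
qed

lemma W1p_norm_2:
  "W1p_norm 2 {0<..<L} f = sqrt ((L2_norm_on (lebesgue_on {0<..<L}) f)\<^sup>2 + (L2_norm_on (lebesgue_on {0<..<L}) (weak_deriv {0<..<L} f))\<^sup>2)"
  by (simp add: W1p_norm_def abs_powr_2 L2_norm_on_sq powr_half_sqrt integral_nonneg_AE)

lemma W1p_norm_ge:
  "L2_norm_on (lebesgue_on {0<..<L}) f \<le> W1p_norm 2 {0<..<L} f"
  "L2_norm_on (lebesgue_on {0<..<L}) (weak_deriv {0<..<L} f) \<le> W1p_norm 2 {0<..<L} f"
  unfolding W1p_norm_2 by (auto intro!: real_le_rsqrt)

lemma W1p_norm_le:
  "W1p_norm 2 {0<..<L} f \<le> L2_norm_on (lebesgue_on {0<..<L}) f + L2_norm_on (lebesgue_on {0<..<L}) (weak_deriv {0<..<L} f)"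
  unfolding W1p_norm_2 by (rule sqrt_sum_squares_le_sum) (rule L2_norm_on_nonneg)+

section \<open>Measurability of paths and of their pairings\<close>

lemma tendsto_zero_mono:
  fixes a b :: "nat \<Rightarrow> real"
  assumes "b \<longlonglongrightarrow> 0" "\<And>n. 0 \<le> a n" "\<And>n. a n \<le> b n"
  shows "a \<longlonglongrightarrow> 0"
  using tendsto_sandwich[of "\<lambda>_. 0" a sequentially b 0] assms by auto

lemma L2_inner_tendsto:
  assumes f: "\<And>n. fn n \<in> square_integrable M" "f \<in> square_integrable M" "(\<lambda>n. L2_norm_on M (\<lambda>x. fn n x - f x)) \<longlonglongrightarrow> 0"
    and g: "\<And>n. gn n \<in> square_integrable M" "g \<in> square_integrable M" "(\<lambda>n. L2_norm_on M (\<lambda>x. gn n x - g x)) \<longlonglongrightarrow> 0"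
  shows "(\<lambda>n. LINT x|M. fn n x * gn n x) \<longlonglongrightarrow> (LINT x|M. f x * g x)"
proof (rule LIM_zero_cancel, rule tendsto_rabs_zero_cancel)
  have gl: "(\<lambda>n. L2_norm_on M (gn n)) \<longlonglongrightarrow> L2_norm_on M g"
    by (rule LIM_zero_cancel, rule tendsto_rabs_zero_cancel, rule tendsto_zero_mono[OF g(3)])
       (use L2_norm_on_triangle_diff[OF g(1,2)] in auto)
  have b: "(\<lambda>n. L2_norm_on M (\<lambda>x. fn n x - f x) * L2_norm_on M (gn n) + L2_norm_on M f * L2_norm_on M (\<lambda>x. gn n x - g x)) \<longlonglongrightarrow> 0 * L2_norm_on M g + L2_norm_on M f * 0"
    by (intro tendsto_intros f g gl)
  show "(\<lambda>n. \<bar>(LINT x|M. fn n x * gn n x) - (LINT x|M. f x * g x)\<bar>) \<longlonglongrightarrow> 0"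
  proof (rule tendsto_zero_mono)
    fix n
    have df: "(\<lambda>x. fn n x - f x) \<in> square_integrable M" "(\<lambda>x. gn n x - g x) \<in> square_integrable M"
      using f g by (auto intro: square_integrable_diff)
    have "(LINT x|M. fn n x * gn n x) - (LINT x|M. f x * g x) = (LINT x|M. fn n x * gn n x - f x * g x)"
      by (intro Bochner_Integration.integral_diff[symmetric] square_integrable_mult f g)
    also have "\<dots> = (LINT x|M. (fn n x - f x) * gn n x + f x * (gn n x - g x))"
      by (simp add: algebra_simps)
    also have "\<dots> = (LINT x|M. (fn n x - f x) * gn n x) + (LINT x|M. f x * (gn n x - g x))"
      by (intro Bochner_Integration.integral_add square_integrable_mult df f g)
    finally show "\<bar>(LINT x|M. fn n x * gn n x) - (LINT x|M. f x * g x)\<bar> \<le>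
        L2_norm_on M (\<lambda>x. fn n x - f x) * L2_norm_on M (gn n) + L2_norm_on M f * L2_norm_on M (\<lambda>x. gn n x - g x)"
      using L2_Cauchy_Schwarz[OF df(1) g(1)[of n]] L2_Cauchy_Schwarz[OF f(2) df(2)] by linarith
  qed (use b in auto)
qed

text \<open>Composed with simple approximations, \<open>\<Phi>\<close> gives simple, hence
  measurable, functions, and sequential continuity in the seminorms passes to the limit. The form
  with two arguments covers the inner product of L2 and the pairing of gradients.\<close>

lemma bochner_measurable_compose2:
  fixes \<Phi> :: "'b::minus \<Rightarrow> 'c::minus \<Rightarrow> real"
  assumes f: "bochner_measurable J V N f" and g: "bochner_measurable J V' N' g" and J: "J \<in> sets lebesgue"
    and cont: "\<And>a an b bn. a \<in> V \<Longrightarrow> (\<And>n. an n \<in> V) \<Longrightarrow> (\<lambda>n. N (an n - a)) \<longlonglongrightarrow> 0 \<Longrightarrow>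
       b \<in> V' \<Longrightarrow> (\<And>n. bn n \<in> V') \<Longrightarrow> (\<lambda>n. N' (bn n - b)) \<longlonglongrightarrow> 0 \<Longrightarrow> (\<lambda>n. \<Phi> (an n) (bn n)) \<longlonglongrightarrow> \<Phi> a b"
  shows "(\<lambda>t. \<Phi> (f t) (g t)) \<in> borel_measurable (lebesgue_on J)"
proof -
  obtain \<sigma> where \<sigma>: "\<And>n. simple_function (lebesgue_on J) (\<sigma> n)" "\<And>n. \<sigma> n ` J \<subseteq> V"
    "AE t in lebesgue_on J. f t \<in> V \<and> (\<lambda>n. N (\<sigma> n t - f t)) \<longlonglongrightarrow> 0"
    using f unfolding bochner_measurable_def by blast
  obtain \<tau> where \<tau>: "\<And>n. simple_function (lebesgue_on J) (\<tau> n)" "\<And>n. \<tau> n ` J \<subseteq> V'"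
    "AE t in lebesgue_on J. g t \<in> V' \<and> (\<lambda>n. N' (\<tau> n t - g t)) \<longlonglongrightarrow> 0"
    using g unfolding bochner_measurable_def by blast
  show ?thesis
  proof (rule borel_measurable_lebesgue_on_LIMSEQ_AE[OF _ J])
    show "(\<lambda>t. \<Phi> (\<sigma> n t) (\<tau> n t)) \<in> borel_measurable (lebesgue_on J)" for n
      by (rule borel_measurable_simple_function) (rule simple_function_compose2[OF \<sigma>(1) \<tau>(1)])
    show "AE t in lebesgue_on J. (\<lambda>n. \<Phi> (\<sigma> n t) (\<tau> n t)) \<longlonglongrightarrow> \<Phi> (f t) (g t)"
      using \<sigma>(3) \<tau>(3) AE_space
    proof eventually_elim
      case (elim t)
      then have "t \<in> J" by simp
      then have "\<sigma> n t \<in> V" "\<tau> n t \<in> V'" for n using \<sigma>(2) \<tau>(2) by blast+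
      then show ?case using elim by (intro cont) auto
    qed
  qed
qed

text \<open>A path whose values at nearby times are close is approximated by its values at the grid points
  to the right; this only uses the values on \<open>(0, T]\<close>.\<close>

lemma bochner_measurable_path:
  fixes f :: "real \<Rightarrow> 'b::minus"
  assumes T: "T > 0" and V: "\<And>t. t \<in> {0<..T} \<Longrightarrow> f t \<in> V"
    and cont: "\<And>t x. t \<in> {0<..<T} \<Longrightarrow> (\<And>n. x n \<in> {0<..T}) \<Longrightarrow> x \<longlonglongrightarrow> t \<Longrightarrow> (\<lambda>n. N (f (x n) - f t)) \<longlonglongrightarrow> 0"
  shows "bochner_measurable {0<..<T} V N f"
proof -
  \<comment> \<open>The grid is rounded up, so the sample times lie in (0, T] and never touch 0,
    where \<open>ut\<close> may be singular.\<close>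
  define p where "p n t = min T ((of_int \<lfloor>real (Suc n) * t\<rfloor> + 1) / real (Suc n))" for n t
  have pin: "p n t \<in> {0<..T}" if "t \<in> {0<..<T}" for n t
  proof -
    have "0 \<le> real (Suc n) * t" using that by simp
    then have "0 \<le> \<lfloor>real (Suc n) * t\<rfloor>" by simp
    then have "0 < (of_int \<lfloor>real (Suc n) * t\<rfloor> + 1) / real (Suc n)" by (intro divide_pos_pos) linarith+
    then show ?thesis using T by (simp add: p_def)
  qed
  have pnear: "\<bar>p n t - t\<bar> \<le> 1 / real (Suc n)" if "t \<in> {0<..<T}" for n t
  proof -
    define q where "q = (of_int \<lfloor>real (Suc n) * t\<rfloor> + 1) / real (Suc n)"
    have "of_int \<lfloor>real (Suc n) * t\<rfloor> \<le> real (Suc n) * t" "real (Suc n) * t < of_int \<lfloor>real (Suc n) * t\<rfloor> + 1" by linarith+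
    then have "t * real (Suc n) \<le> of_int \<lfloor>real (Suc n) * t\<rfloor> + 1" "of_int \<lfloor>real (Suc n) * t\<rfloor> \<le> t * real (Suc n)"
      by (simp_all only: mult.commute less_imp_le)
    then have "t \<le> q" "of_int \<lfloor>real (Suc n) * t\<rfloor> / real (Suc n) \<le> t"
      unfolding q_def by (simp_all only: pos_le_divide_eq pos_divide_le_eq of_nat_0_less_iff zero_less_Suc)
    then have "t \<le> q" "q \<le> t + 1 / real (Suc n)" unfolding q_def add_divide_distrib by simp_all
    moreover have "p n t = min T q" by (simp add: p_def q_def)
    ultimately show ?thesis using that by auto
  qed
  have ps: "simple_function (lebesgue_on {0<..<T}) (p n)" for n
    unfolding simple_function_iff_borel_measurable
  proof
    have "p n ` {0<..<T} \<subseteq> (\<lambda>k. min T ((of_int k + 1) / real (Suc n))) ` {0..\<lfloor>real (Suc n) * T\<rfloor>}"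
    proof
      fix y assume "y \<in> p n ` {0<..<T}"
      then obtain t where t: "t \<in> {0<..<T}" "y = p n t" by blast
      have "0 \<le> real (Suc n) * t" "real (Suc n) * t \<le> real (Suc n) * T" using t by (auto intro!: mult_left_mono)
      then have "\<lfloor>real (Suc n) * t\<rfloor> \<in> {0..\<lfloor>real (Suc n) * T\<rfloor>}" by (auto intro: floor_mono)
      then show "y \<in> (\<lambda>k. min T ((of_int k + 1) / real (Suc n))) ` {0..\<lfloor>real (Suc n) * T\<rfloor>}"
        unfolding t(2) p_def by blast
    qed
    then have "finite (p n ` {0<..<T})" by (rule finite_subset) simp
    then show "finite (p n ` space (lebesgue_on {0<..<T}))" by simp
    have "p n \<in> borel_measurable borel" unfolding p_def by measurable
    then have "p n \<in> borel_measurable lebesgue" by (simp add: measurable_completion)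
    then show "p n \<in> borel_measurable (lebesgue_on {0<..<T})" by (rule measurable_restrict_space1)
  qed
  show ?thesis unfolding bochner_measurable_def
  proof (intro exI[of _ "\<lambda>n t. f (p n t)"] conjI allI)
    show "simple_function (lebesgue_on {0<..<T}) (\<lambda>t. f (p n t))" for n
      using simple_function_compose[OF ps, of f] by (simp add: comp_def)
    show "(\<lambda>t. f (p n t)) ` {0<..<T} \<subseteq> V" for n using pin V by blast
    show "AE t in lebesgue_on {0<..<T}. f t \<in> V \<and> (\<lambda>n. N (f (p n t) - f t)) \<longlonglongrightarrow> 0"
    proof (rule AE_I2)
      fix t assume "t \<in> space (lebesgue_on {0<..<T})"
      then have t: "t \<in> {0<..<T}" by simp
      have "(\<lambda>n. p n t) \<longlonglongrightarrow> t"
      proof (rule LIM_zero_cancel, rule tendsto_rabs_zero_cancel, rule tendsto_zero_mono)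
        show "(\<lambda>n. 1 / real (Suc n)) \<longlonglongrightarrow> 0" using LIMSEQ_inverse_real_of_nat by (simp add: inverse_eq_divide)
      qed (use pnear[OF t] in auto)
      then show "f t \<in> V \<and> (\<lambda>n. N (f (p n t) - f t)) \<longlonglongrightarrow> 0"
        using t V[of t] by (intro conjI cont pin) auto
    qed
  qed
qed

lemma L2L2_iff:
  "f \<in> L2L2 J S \<longleftrightarrow> bochner_measurable J (square_integrable (lebesgue_on S)) (L2_norm_on (lebesgue_on S)) f \<and>
     integrable (lebesgue_on J) (\<lambda>t. (L2_norm_on (lebesgue_on S) (f t))\<^sup>2)"
  by (simp add: bochner_L2_def Lp_space_2 Lp_norm_2[abs_def])

lemma bochner_measurable_AE: "bochner_measurable J V N f \<Longrightarrow> AE t in lebesgue_on J. f t \<in> V"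
  unfolding bochner_measurable_def by (blast intro: AE_mp AE_I2)

lemma L2L2_inner_integrable:
  assumes f: "f \<in> L2L2 J S" and g: "g \<in> L2L2 J S" and J: "J \<in> sets lebesgue"
  shows "integrable (lebesgue_on J) (\<lambda>t. LINT s|lebesgue_on S. f t s * g t s)"
proof (rule Bochner_Integration.integrable_bound)
  note f' = f[unfolded L2L2_iff] and g' = g[unfolded L2L2_iff]
  show "integrable (lebesgue_on J) (\<lambda>t. (L2_norm_on (lebesgue_on S) (f t))\<^sup>2 + (L2_norm_on (lebesgue_on S) (g t))\<^sup>2)"
    using f' g' by auto
  show "(\<lambda>t. LINT s|lebesgue_on S. f t s * g t s) \<in> borel_measurable (lebesgue_on J)"
    by (rule bochner_measurable_compose2[where \<Phi>="\<lambda>a b. LINT s|lebesgue_on S. a s * b s", OF conjunct1[OF f'] conjunct1[OF g'] J])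
       (auto intro!: L2_inner_tendsto simp: fun_diff_def)
  show "AE t in lebesgue_on J. norm (LINT s|lebesgue_on S. f t s * g t s) \<le>
      norm ((L2_norm_on (lebesgue_on S) (f t))\<^sup>2 + (L2_norm_on (lebesgue_on S) (g t))\<^sup>2)"
    using bochner_measurable_AE[OF conjunct1[OF f']] bochner_measurable_AE[OF conjunct1[OF g']]
  proof eventually_elim
    case (elim t)
    let ?a = "L2_norm_on (lebesgue_on S) (f t)" and ?b = "L2_norm_on (lebesgue_on S) (g t)"
    have "0 \<le> ?a * ?b" by (intro mult_nonneg_nonneg L2_norm_on_nonneg)
    then have "?a * ?b \<le> ?a\<^sup>2 + ?b\<^sup>2" using sum_squares_bound[of ?a ?b] by linarith
    with L2_Cauchy_Schwarz[OF elim] have "\<bar>LINT s|lebesgue_on S. f t s * g t s\<bar> \<le> ?a\<^sup>2 + ?b\<^sup>2" by linarith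
    then show ?case by simp
  qed
qed

section \<open>Weak time derivatives\<close>

lemma L2L2_const:
  assumes "\<omega> \<in> square_integrable (lebesgue_on S)"
  shows "(\<lambda>_. \<omega>) \<in> L2L2 {a<..<b} S"
proof -
  have "L2_norm_on (lebesgue_on S) (\<omega> - \<omega>) = 0" by (simp add: L2_norm_on_def)
  then have "bochner_measurable {a<..<b} (square_integrable (lebesgue_on S)) (L2_norm_on (lebesgue_on S)) (\<lambda>_. \<omega>)"
    unfolding bochner_measurable_def using assms by (intro exI[of _ "\<lambda>_ _. \<omega>"]) auto
  moreover have "integrable (lebesgue_on {a<..<b}) (\<lambda>_. (L2_norm_on (lebesgue_on S) \<omega>)\<^sup>2)"
    by (rule finite_measure.integrable_const[OF finite_measure_lebesgue_on_interval])
  ultimately show ?thesis by (simp add: L2L2_iff)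
qed

text \<open>Pairing with a fixed \<open>\<omega>\<close> reduces the vector-valued time derivative
  to a scalar weak derivative, to which \<open>weak_deriv_FTC\<close> and
  \<open>has_weak_deriv_unique\<close> apply.\<close>

lemma has_weak_time_deriv_inner:
  assumes u: "has_weak_time_deriv {a<..<b} S u v" and \<omega>: "\<omega> \<in> square_integrable (lebesgue_on S)"
  shows "has_weak_deriv {a<..<b} (\<lambda>t. LINT s|lebesgue_on S. u t s * \<omega> s) (\<lambda>t. LINT s|lebesgue_on S. v t s * \<omega> s)"
  unfolding has_weak_deriv_def
proof (intro conjI ballI)
  have uv: "u \<in> L2L2 {a<..<b} S" "v \<in> L2L2 {a<..<b} S" using u by (auto simp: has_weak_time_deriv_def)
  show "locally_integrable {a<..<b} (\<lambda>t. LINT s|lebesgue_on S. u t s * \<omega> s)"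
    "locally_integrable {a<..<b} (\<lambda>t. LINT s|lebesgue_on S. v t s * \<omega> s)"
    by (intro integrable_imp_locally_integrable L2L2_inner_integrable uv L2L2_const \<omega>; simp)+
  fix \<psi> assume "\<psi> \<in> test_functions {a<..<b}"
  then show "(LINT t|lebesgue_on {a<..<b}. (LINT s|lebesgue_on S. u t s * \<omega> s) * deriv \<psi> t) =
      - (LINT t|lebesgue_on {a<..<b}. (LINT s|lebesgue_on S. v t s * \<omega> s) * \<psi> t)"
    using u \<omega> by (simp add: has_weak_time_deriv_def Lp_space_2 mult.commute)
qed

text \<open>The primitive of f is continuous and vanishes on a dense set, hence everywhere. A
  countable family of conditions is what survives when each of them holds only for almost every
  time.\<close>

lemma AE_zero_of_rational_integrals:
  fixes f :: "real \<Rightarrow> real"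
  assumes f: "set_integrable lebesgue {a..b} f"
    and zero: "\<And>d. d \<in> \<rat> \<Longrightarrow> a < d \<Longrightarrow> d < b \<Longrightarrow> integral {a..d} f = 0"
  shows "AE x in lebesgue_on {a<..<b}. f x = 0"
proof (cases "a < b")
  case True
  have fi: "f integrable_on {a..b}" using f by (rule set_lebesgue_integral_eq_integral(1))
  have cont: "continuous_on {a..b} (\<lambda>x. integral {a..x} f)" by (rule indefinite_integral_continuous_1[OF fi])
  have "integral {a..d} f = 0" if d: "d \<in> {a..b}" for d
  proof (rule continuous_constant_on_closure[where S="\<rat> \<inter> {a<..<b}" and f="\<lambda>x. integral {a..x} f" and a=0 and x=d])
    have cl: "closure (\<rat> \<inter> {a<..<b}) = {a..b}"
    proof -
      have "closure ({a<..<b} \<inter> \<rat>) = closure {a<..<b}"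
        by (rule closure_open_Int_superset) (simp_all add: Rats_closure_real)
      then show ?thesis using True by (simp add: Int_commute)
    qed
    show "continuous_on (closure (\<rat> \<inter> {a<..<b})) (\<lambda>x. integral {a..x} f)" unfolding cl by (rule cont)
    show "d \<in> closure (\<rat> \<inter> {a<..<b})" unfolding cl by (rule d)
    show "\<And>x. x \<in> \<rat> \<inter> {a<..<b} \<Longrightarrow> integral {a..x} f = 0" using zero by auto
  qed
  then have "AE x in lebesgue. x \<in> {a..b} \<longrightarrow> f x = 0"
    by (intro AE_zero_of_interval_integrals[OF f]) auto
  then have "AE x in lebesgue. x \<in> {a<..<b} \<longrightarrow> f x = 0" by (rule AE_mp) (auto intro!: AE_I2)
  then show ?thesis by (subst AE_restrict_space_iff) auto
next
  case False
  then show ?thesis by (intro AE_I2) simp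
qed

text \<open>Pairing with the indicators of {0..d} for rational d gives countably many identities in
  t, so one null set of times serves them all; at every other time the difference has a vanishing
  primitive in s.\<close>

lemma has_weak_time_deriv_unique:
  assumes ab: "a < b" and L: "L > 0"
    and v1: "has_weak_time_deriv {a<..<b} {0<..<L} u v1" and v2: "has_weak_time_deriv {a<..<b} {0<..<L} u v2"
  shows "AE t in lebesgue_on {a<..<b}. AE s in lebesgue_on {0<..<L}. v1 t s = v2 t s"
proof -
  let ?I = "lebesgue_on {0<..<L}"
  have V: "v1 \<in> L2L2 {a<..<b} {0<..<L}" "v2 \<in> L2L2 {a<..<b} {0<..<L}"
    using v1 v2 by (auto simp: has_weak_time_deriv_def)
  have V': "AE t in lebesgue_on {a<..<b}. v1 t \<in> square_integrable ?I" "AE t in lebesgue_on {a<..<b}. v2 t \<in> square_integrable ?I"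
    using V by (auto simp: L2L2_iff intro: bochner_measurable_AE)
  have ind: "indicat_real {0..d} \<in> square_integrable ?I" for d
  proof -
    have m: "indicat_real {0..d} \<in> borel_measurable ?I"
      by (rule measurable_restrict_space1, rule borel_measurable_indicator) simp
    have "integrable ?I (\<lambda>x. (indicat_real {0..d} x)\<^sup>2)"
    proof (rule finite_measure.integrable_const_bound[OF finite_measure_lebesgue_on_interval, where B=1])
      show "AE x in ?I. norm ((indicat_real {0..d} x)\<^sup>2) \<le> 1" by (rule AE_I2) (simp add: indicator_def)
      show "(\<lambda>x. (indicat_real {0..d} x)\<^sup>2) \<in> borel_measurable ?I" by (rule borel_measurable_power[OF m])
    qed
    with m show ?thesis by (simp add: square_integrable_def)
  qed
  have "AE t in lebesgue_on {a<..<b}. (LINT s|?I. v1 t s * indicat_real {0..d} s) = (LINT s|?I. v2 t s * indicat_real {0..d} s)" for d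
    by (rule has_weak_deriv_unique[OF ab has_weak_time_deriv_inner[OF v1 ind] has_weak_time_deriv_inner[OF v2 ind]])
  then have "AE t in lebesgue_on {a<..<b}. \<forall>d\<in>\<rat>. (LINT s|?I. v1 t s * indicat_real {0..d} s) = (LINT s|?I. v2 t s * indicat_real {0..d} s)"
    by (subst AE_ball_countable[OF countable_rat]) simp
  with V' show ?thesis
  proof eventually_elim
    case (elim t)
    have "AE s in ?I. v1 t s - v2 t s = 0"
    proof (rule AE_zero_of_rational_integrals)
      have d: "(\<lambda>s. v1 t s - v2 t s) \<in> square_integrable ?I" by (rule square_integrable_diff(1)[OF elim(1,2)])
      then show di: "set_integrable lebesgue {0..L} (\<lambda>s. v1 t s - v2 t s)" by (rule square_integrable_interval_integrable)
      fix d assume dr: "d \<in> \<rat>" "0 < d" "d < L"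
      have "integral {0..d} (\<lambda>s. v1 t s - v2 t s) = integral {0<..<d} (\<lambda>s. v1 t s - v2 t s)"
        by (rule integral_open_interval_real)
      also have "\<dots> = (LINT s|lebesgue_on {0<..<d}. v1 t s - v2 t s)"
      proof (rule lebesgue_integral_eq_integral[symmetric])
        have "set_integrable lebesgue {0<..<d} (\<lambda>s. v1 t s - v2 t s)" by (rule set_integrable_subset[OF di]) (use dr in auto)
        then show "integrable (lebesgue_on {0<..<d}) (\<lambda>s. v1 t s - v2 t s)" by (simp add: set_integrable_iff_integrable_lebesgue_on)
      qed simp
      also have "\<dots> = (LINT s|?I. (if s \<in> {0<..<d} then v1 t s - v2 t s else 0))"
        by (rule integral_restrict[symmetric]) (use dr in auto)
      also have "\<dots> = (LINT s|?I. v1 t s * indicat_real {0..d} s - v2 t s * indicat_real {0..d} s)"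
      proof (rule integral_cong_AE)
        \<comment> \<open>The open interval and the closed indicator differ at the single point
          d.\<close>
        have "AE s in lebesgue. s \<notin> {d}" by (intro AE_not_in) (simp add: negligible_iff_null_sets[symmetric])
        then have "AE s in ?I. s \<noteq> d" by (subst AE_restrict_space_iff) auto
        then show "AE s in ?I. (if s \<in> {0<..<d} then v1 t s - v2 t s else 0) = v1 t s * indicat_real {0..d} s - v2 t s * indicat_real {0..d} s"
          using AE_space by eventually_elim (auto simp: indicator_def)
        show "(\<lambda>s. v1 t s * indicat_real {0..d} s - v2 t s * indicat_real {0..d} s) \<in> borel_measurable ?I"
          using elim(1,2)[THEN square_integrableD(1)] square_integrableD(1)[OF ind] by auto
        show "(\<lambda>s. if s \<in> {0<..<d} then v1 t s - v2 t s else 0) \<in> borel_measurable ?I"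
          using elim(1,2)[THEN square_integrableD(1)]
        proof (intro measurable_If borel_measurable_diff)
          show "{s \<in> space ?I. s \<in> {0<..<d}} \<in> sets ?I"
          proof -
            have "{s \<in> space ?I. s \<in> {0<..<d}} = {0<..<d}" using dr by auto
            moreover have "{0<..<d} \<in> sets ?I" by (subst sets_restrict_space_iff) (use dr in auto)
            ultimately show ?thesis by simp
          qed
        qed auto
      qed
      also have "\<dots> = 0"
        using elim(3) dr(1) by (subst Bochner_Integration.integral_diff) (auto intro!: square_integrable_mult elim(1,2) ind)
      finally show "integral {0..d} (\<lambda>s. v1 t s - v2 t s) = 0" .
    qed
    then show ?case by simp
  qed
qed

lemma weak_time_deriv_properties:
  assumes "a < b" "L > 0" "has_weak_time_deriv {a<..<b} {0<..<L} u v"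
  shows "has_weak_time_deriv {a<..<b} {0<..<L} u (weak_time_deriv {a<..<b} {0<..<L} u)"
    "AE t in lebesgue_on {a<..<b}. AE s in lebesgue_on {0<..<L}. weak_time_deriv {a<..<b} {0<..<L} u t s = v t s"
proof -
  show *: "has_weak_time_deriv {a<..<b} {0<..<L} u (weak_time_deriv {a<..<b} {0<..<L} u)"
    unfolding weak_time_deriv_def by (rule someI[of _ v]) (rule assms)
  show "AE t in lebesgue_on {a<..<b}. AE s in lebesgue_on {0<..<L}. weak_time_deriv {a<..<b} {0<..<L} u t s = v t s"
    by (rule has_weak_time_deriv_unique[OF assms(1,2) * assms(3)])
qed

section \<open>Regularity of periodic Sobolev functions\<close>

lemma weak_deriv_FTC_closed:
  assumes f: "continuous_on UNIV f" "has_weak_deriv {0<..<L} f g" "g \<in> square_integrable (lebesgue_on {0<..<L})"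
    and L: "L > 0" and ab: "0 \<le> a" "a \<le> b" "b \<le> L"
  shows "f b - f a = integral {a..b} g"
proof -
  let ?g = g
  have fc: "continuous_on X f" for X using f(1) by (rule continuous_on_subset) simp
  have gi: "?g integrable_on {0..L}"
    using square_integrable_interval_integrable(2)[OF f(3)] by (rule set_lebesgue_integral_eq_integral(1))
  have gs: "?g integrable_on {x..y}" if "0 \<le> x" "y \<le> L" for x y
    by (rule integrable_on_subinterval[OF gi]) (use that in auto)
  define m where "m = L / 2"
  define P where "P x = f x - integral {0..x} ?g" for x
  have Pc: "continuous_on {0..L} P" unfolding P_def
    by (intro continuous_intros fc indefinite_integral_continuous_1 gi)
  have "P x = P m" if x: "x \<in> {0<..<L}" for x
  proof -
    have *: "P y = P x" if xy: "0 < x" "x \<le> y" "y < L" for x y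
    proof -
      have "f y - f x = integral {x..y} ?g" by (rule weak_deriv_FTC(2)[OF f(2) fc xy])
      moreover have "integral {0..x} ?g + integral {x..y} ?g = integral {0..y} ?g"
        by (rule Henstock_Kurzweil_Integration.integral_combine) (use xy gs in auto)
      ultimately show ?thesis by (simp add: P_def)
    qed
    show ?thesis using *[of x m] *[of m x] x L by (cases "x \<le> m") (auto simp: m_def)
  qed
  \<comment> \<open>Since g is integrable up to the ends, \<open>P\<close> is continuous on the
    closed interval and the interior identity extends to it.\<close>
  then have "P x = P m" if "x \<in> {0..L}" for x
    using continuous_constant_on_closure[of "{0<..<L}" P "P m" x] Pc L that by simp
  then have "P b = P a" using ab by simp
  moreover have "integral {0..a} ?g + integral {a..b} ?g = integral {0..b} ?g"
    by (rule Henstock_Kurzweil_Integration.integral_combine) (use ab gs in auto)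
  ultimately show ?thesis by (simp add: P_def)
qed

lemma W1p_per_FTC:
  assumes f: "f \<in> W1p_per 2 L" and L: "L > 0" and ab: "0 \<le> a" "a \<le> b" "b \<le> L"
  shows "f b - f a = integral {a..b} (weak_deriv {0<..<L} f)"
  using W1p_perD[OF f L] ab by (intro weak_deriv_FTC_closed[OF _ _ _ L]) (auto simp: C_per_def)

lemma integral_cong_AE_lebesgue_on:
  fixes f g :: "real \<Rightarrow> real"
  assumes "g \<in> borel_measurable (lebesgue_on S)" "S \<in> sets lebesgue" "AE x in lebesgue_on S. f x = g x"
  shows "integral\<^sup>L (lebesgue_on S) f = integral\<^sup>L (lebesgue_on S) g"
proof -
  have "AE x in lebesgue_on S. g x = f x" using assms(3) by auto
  then have "f \<in> borel_measurable (lebesgue_on S)" by (rule borel_measurable_lebesgue_on_AE[OF assms(1,2)])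
  then show ?thesis by (intro integral_cong_AE assms)
qed

lemma square_integrable_integral_bound:
  assumes g: "g \<in> square_integrable (lebesgue_on {0<..<L})" and ab: "0 \<le> a" "a \<le> b" "b \<le> L"
  shows "\<bar>integral {a..b} g\<bar> \<le> L2_norm_on (lebesgue_on {0<..<L}) g * sqrt (b - a)"
proof -
  let ?M = "lebesgue_on {a<..<b}"
  have sub: "{a<..<b} \<subseteq> {0<..<L}" using ab by auto
  have gi: "set_integrable lebesgue {0<..<L} g"
    using square_integrable_interval_integrable(1)[OF g] by (simp add: set_integrable_iff_integrable_lebesgue_on)
  have g1: "integrable ?M g"
    using set_integrable_subset[OF gi _ sub] by (simp add: set_integrable_iff_integrable_lebesgue_on)
  have "set_integrable lebesgue {0<..<L} (\<lambda>x. (g x)\<^sup>2)"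
    using square_integrableD(2)[OF g] by (simp add: set_integrable_iff_integrable_lebesgue_on)
  from set_integrable_subset[OF this _ sub] have g2: "integrable ?M (\<lambda>x. (g x)\<^sup>2)"
    by (simp add: set_integrable_iff_integrable_lebesgue_on)
  have gM: "g \<in> square_integrable ?M" using g1 g2 by (simp add: square_integrable_def)
  have one: "(\<lambda>_. 1) \<in> square_integrable ?M" by (rule continuous_square_integrable(1)) (rule continuous_on_const)
  have "integral {a..b} g = (LINT x|?M. g x * 1)"
    using lebesgue_integral_eq_integral[OF g1] by (simp add: integral_open_interval_real)
  then have "\<bar>integral {a..b} g\<bar> \<le> L2_norm_on ?M g * L2_norm_on ?M (\<lambda>_. 1)"
    using L2_Cauchy_Schwarz[OF gM one] by simp
  also have "L2_norm_on ?M (\<lambda>_. 1) = sqrt (b - a)"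
    using continuous_square_integrable(3)[of a b "\<lambda>_. 1"] ab unfolding L2_norm_on_def by simp
  also have "L2_norm_on ?M g * sqrt (b - a) \<le> L2_norm_on (lebesgue_on {0<..<L}) g * sqrt (b - a)"
  proof (rule mult_right_mono)
    have "(LINT x|?M. (g x)\<^sup>2) \<le> (LINT x|lebesgue_on {0<..<L}. (g x)\<^sup>2)"
      by (rule integral_mono_lebesgue_on_AE[OF square_integrableD(2)[OF g] _ _ sub]) auto
    then show "L2_norm_on ?M g \<le> L2_norm_on (lebesgue_on {0<..<L}) g" unfolding L2_norm_on_def by (rule real_sqrt_le_mono)
  qed (use ab in simp)
  finally show ?thesis .
qed

lemma periodic_Hoelder:
  fixes g :: "real \<Rightarrow> real"
  assumes L: "L > 0" and g: "continuous_on UNIV g" "\<And>s. g (s + L) = g s"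
    and H: "\<And>a b. 0 \<le> a \<Longrightarrow> a \<le> b \<Longrightarrow> b \<le> L \<Longrightarrow> \<bar>g b - g a\<bar> \<le> H * sqrt (b - a)"
  obtains K where "\<And>z z'. \<bar>g z - g z'\<bar> \<le> K * sqrt \<bar>z - z'\<bar>"
proof -
  obtain B where B: "\<And>s. \<bar>g s\<bar> \<le> B" using periodic_continuous_bounded[of L g, OF L g] by blast
  have B0: "B \<ge> 0" using B[of 0] by linarith
  have "0 \<le> H * sqrt (L - 0)" using H[of 0 L] L by (intro order_trans[OF abs_ge_zero]) auto
  then have H0: "H \<ge> 0" using L by (simp add: zero_le_mult_iff)
  \<comment> \<open>The part 2 H is for points less than a period apart, where the segment may cross
    one multiple of L and H is used twice; the part 2 B / sqrt L is for points at distance at least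
    L.\<close>
  define K where "K = 2 * H + 2 * B / sqrt L"
  have K: "2 * H \<le> K" "2 * B / sqrt L \<le> K" using B0 H0 L by (auto simp: K_def)
  have ord: "\<bar>g z' - g z\<bar> \<le> K * sqrt (z' - z)" if zz: "z \<le> z'" for z z'
  proof (cases "z' - z < L")
    case True
    obtain r k where rk: "r \<in> {0..<L}" "z = r + of_int k * L" using real_period_decomposition[OF L] by blast
    define r' where "r' = z' - of_int k * L"
    have gr: "g z = g r" "g z' = g r'"
      using periodic_int_shift[of g L r k] periodic_int_shift[of g L r' k] g(2) rk(2) by (simp_all add: r'_def)
    have r': "r \<le> r'" "r' - r = z' - z" "r' - r < L" using zz rk True by (auto simp: r'_def)
    have "\<bar>g r' - g r\<bar> \<le> 2 * H * sqrt (r' - r)"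
    proof (cases "r' \<le> L")
      case True
      have "0 \<le> H * sqrt (r' - r)" using H0 r' by simp
      moreover have "\<bar>g r' - g r\<bar> \<le> H * sqrt (r' - r)" using True rk r' by (intro H) auto
      ultimately show ?thesis unfolding mult.assoc by linarith
    next
      case False
      have "\<bar>g L - g r\<bar> \<le> H * sqrt (L - r)" using rk by (intro H) auto
      also have "\<dots> \<le> H * sqrt (r' - r)" using False H0 by (intro mult_left_mono) auto
      finally have 1: "\<bar>g L - g r\<bar> \<le> H * sqrt (r' - r)" .
      have "\<bar>g (r' - L) - g 0\<bar> \<le> H * sqrt ((r' - L) - 0)" using False rk r' by (intro H) auto
      also have "\<dots> \<le> H * sqrt (r' - r)" using rk H0 by (intro mult_left_mono) auto
      finally have "\<bar>g (r' - L) - g 0\<bar> \<le> H * sqrt (r' - r)" .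
      moreover have "g (r' - L) = g r'" "g 0 = g L" using g(2)[of "r' - L"] g(2)[of 0] by simp_all
      ultimately show ?thesis using 1 by linarith
    qed
    also have "\<dots> \<le> K * sqrt (r' - r)" using K(1) r' by (intro mult_right_mono) auto
    finally show ?thesis using gr r' by simp
  next
    case False
    have "\<bar>g z' - g z\<bar> \<le> 2 * B" using B[of z] B[of z'] by linarith
    also have "\<dots> = 2 * B / sqrt L * sqrt L" using L by simp
    also have "\<dots> \<le> K * sqrt (z' - z)" using False K B0 H0 L by (intro mult_mono) auto
    finally show ?thesis .
  qed
  have "\<bar>g z - g z'\<bar> \<le> K * sqrt \<bar>z - z'\<bar>" for z z'
    using ord[of z z'] ord[of z' z] by (cases "z \<le> z'") (auto simp: abs_minus_commute)
  then show ?thesis by (rule that)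
qed

text \<open>\<open>W2p_per\<close> provides a continuous periodic weak derivative g and, separately,
  one that has a square integrable weak derivative g2. The two agree almost everywhere, so g2 is a
  weak derivative of g as well, and Cauchy-Schwarz gives Hoelder exponent 1/2. Comparing u0 with a
  primitive of g shows that g is its classical derivative.\<close>

lemma W2p_per_regularity:
  assumes u0: "u0 \<in> W2p_per 2 L" and L: "L > 0"
  obtains g H where "\<And>s. (u0 has_real_derivative g s) (at s)" "continuous_on UNIV g" "\<And>s. g (s + L) = g s"
    "\<And>s. u0 (s + L) = u0 s" "\<And>z z'. \<bar>g z - g z'\<bar> \<le> H * sqrt \<bar>z - z'\<bar>"
proof -
  let ?I = "{0<..<L}"
  obtain g where g: "g \<in> C_per L" "has_weak_deriv ?I u0 g" using u0 by (auto simp: W2p_per_def)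
  obtain g1 g2 where g1: "has_weak_deriv ?I u0 g1" "has_weak_deriv ?I g1 g2" "g2 \<in> square_integrable (lebesgue_on ?I)"
    "g1 \<in> square_integrable (lebesgue_on ?I)"
    using u0 by (auto simp: W2p_per_def W2p_def W1p_def Lp_space_2)
  have u0': "continuous_on UNIV u0" "\<And>s. u0 (s + L) = u0 s" using u0 C_per_iff[OF L] by (auto simp: W2p_per_def)
  have g': "continuous_on UNIV g" "\<And>s. g (s + L) = g s" using g(1) C_per_iff[OF L] by auto
  have AE: "AE x in lebesgue_on ?I. g1 x = g x" by (rule has_weak_deriv_unique[OF L g1(1) g(2)])
  have gc: "continuous_on X g" for X using g'(1) by (rule continuous_on_subset) simp
  have gm: "g \<in> borel_measurable (lebesgue_on ?I)" by (intro continuous_imp_measurable_on_sets_lebesgue gc) simp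
  have wd: "has_weak_deriv ?I g g2" unfolding has_weak_deriv_def
  proof (intro conjI ballI)
    show "locally_integrable ?I g" by (intro continuous_imp_locally_integrable gc)
    show "locally_integrable ?I g2" using g1(2) by (simp add: has_weak_deriv_def)
    fix \<psi> assume \<psi>: "\<psi> \<in> test_functions ?I"
    have "(LINT x|lebesgue_on ?I. g1 x * deriv \<psi> x) = (LINT x|lebesgue_on ?I. g x * deriv \<psi> x)"
    proof (rule integral_cong_AE_lebesgue_on)
      have "deriv \<psi> \<in> borel_measurable (lebesgue_on ?I)"
        by (intro continuous_imp_measurable_on_sets_lebesgue test_function_derivative[OF \<psi>]) simp
      with gm show "(\<lambda>x. g x * deriv \<psi> x) \<in> borel_measurable (lebesgue_on ?I)" by (rule borel_measurable_times)
      show "AE x in lebesgue_on ?I. g1 x * deriv \<psi> x = g x * deriv \<psi> x" using AE by auto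
    qed simp
    moreover have "(LINT x|lebesgue_on ?I. g1 x * deriv \<psi> x) = - (LINT x|lebesgue_on ?I. g2 x * \<psi> x)"
      using g1(2) \<psi> unfolding has_weak_deriv_def by blast
    ultimately show "(LINT x|lebesgue_on ?I. g x * deriv \<psi> x) = - (LINT x|lebesgue_on ?I. g2 x * \<psi> x)" by simp
  qed
  have "\<bar>g b - g a\<bar> \<le> L2_norm_on (lebesgue_on ?I) g2 * sqrt (b - a)" if "0 \<le> a" "a \<le> b" "b \<le> L" for a b
    using weak_deriv_FTC_closed[OF g'(1) wd g1(3) L that] square_integrable_integral_bound[OF g1(3) that] by simp
  then obtain H where H: "\<And>z z'. \<bar>g z - g z'\<bar> \<le> H * sqrt \<bar>z - z'\<bar>"
    using periodic_Hoelder[of L g, OF L g'] by blast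
  obtain F where F: "\<And>z. (F has_real_derivative g z) (at z)" using continuous_antiderivative_exists[OF g'(1)] by blast
  \<comment> \<open>\<open>D\<close> is constant on one period by the fundamental theorem and is
    itself periodic, hence constant.\<close>
  define D where "D x = u0 x - F x" for x
  have gs: "g \<in> square_integrable (lebesgue_on ?I)" by (intro continuous_square_integrable gc)
  have FTC: "u0 b - u0 a = F b - F a" if "0 \<le> a" "a \<le> b" "b \<le> L" for a b
    using weak_deriv_FTC_closed[OF u0'(1) g(2) gs L that] integral_derivative(1)[OF that(2) F] by simp
  have FL: "F (x + L) - F x = 0" for x
  proof -
    have "F (x + L) - F x = integral {x..x + L} g" using integral_derivative(1)[OF _ F, of x "x + L"] L by simp
    also have "\<dots> = integral {0..0 + L} g" using L by (subst (1 2) integral_periodic_shift[OF g']) auto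
    also have "\<dots> = F L - F 0" using integral_derivative(1)[OF _ F, of 0 L] L by simp
    also have "\<dots> = 0" using FTC[of 0 L] L u0'(2)[of 0] by simp
    finally show ?thesis .
  qed
  have Dper: "D (x + L) = D x" for x using FL[of x] u0'(2)[of x] by (simp add: D_def)
  have "D x = D 0" for x
  proof -
    obtain r k where rk: "r \<in> {0..<L}" "x = r + of_int k * L" using real_period_decomposition[OF L] by blast
    have "D x = D r" using periodic_int_shift[of D L r k, OF Dper] rk(2) by simp
    also have "\<dots> = D 0" using FTC[of 0 r] rk(1) by (simp add: D_def)
    finally show ?thesis .
  qed
  then have "u0 = (\<lambda>x. F x + D 0)" by (auto simp: D_def fun_eq_iff algebra_simps)
  moreover have "((\<lambda>x. F x + D 0) has_real_derivative g s) (at s)" for s using F[of s] by (auto intro!: derivative_eq_intros)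
  ultimately have "(u0 has_real_derivative g s) (at s)" for s by simp
  then show ?thesis using g' u0'(2) H by (rule that)
qed

section \<open>Jointly continuous functions as paths in L2\<close>

lemma L2_norm_on_continuous_path:
  fixes X :: "real set" and L :: real
  assumes g: "continuous_on (X \<times> UNIV) (\<lambda>p. g (fst p) (snd p))"
  shows "continuous_on X (\<lambda>x. L2_norm_on (lebesgue_on {0<..<L}) (g x))"
proof -
  have sl: "continuous_on {0..L} (g x)" if "x \<in> X" for x
    using continuous_on_compose2[OF g, of "{0..L}" "\<lambda>s. (x, s)"] that by (auto simp: continuous_on_Pair)
  have "continuous_on (X \<times> {0..L}) (\<lambda>p. g (fst p) (snd p))" by (rule continuous_on_subset[OF g]) auto
  then have "continuous_on (X \<times> {0..L}) (\<lambda>p. (g (fst p) (snd p))\<^sup>2)" by (rule continuous_on_power)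
  then have "continuous_on X (\<lambda>x. integral {0..L} (\<lambda>s. (g x s)\<^sup>2))"
    by (rule integral_continuous_on_param_real[of X 0 L "\<lambda>x s. (g x s)\<^sup>2"])
  then have "continuous_on X (\<lambda>x. sqrt (integral {0..L} (\<lambda>s. (g x s)\<^sup>2)))"
    by (rule continuous_on_real_sqrt)
  then show ?thesis
  proof (rule continuous_on_eq)
    fix x assume "x \<in> X"
    then show "sqrt (integral {0..L} (\<lambda>s. (g x s)\<^sup>2)) = L2_norm_on (lebesgue_on {0<..<L}) (g x)"
      unfolding L2_norm_on_def by (subst continuous_square_integrable(3)) (auto intro!: continuous_intros sl)
  qed
qed

lemma L2_continuous_path:
  fixes X :: "real set" and L :: real
  assumes g: "continuous_on (X \<times> UNIV) (\<lambda>p. g (fst p) (snd p))" and t: "t \<in> X"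
  shows "continuous_on X (\<lambda>x. L2_norm_on (lebesgue_on {0<..<L}) (\<lambda>s. g x s - g t s))"
proof (rule L2_norm_on_continuous_path)
  have "continuous_on (X \<times> UNIV) (\<lambda>p. g t (snd p))"
    using continuous_on_compose2[OF g, of "X \<times> UNIV" "\<lambda>p. (t, snd p)"] t
    by (force simp: continuous_on_Pair continuous_on_snd continuous_on_id)
  then show "continuous_on (X \<times> UNIV) (\<lambda>p. g (fst p) (snd p) - g t (snd p))" by (intro continuous_intros g)
qed

lemma L2_path_tendsto:
  fixes X :: "real set" and L :: real
  assumes g: "continuous_on (X \<times> UNIV) (\<lambda>p. g (fst p) (snd p))" and t: "t \<in> X"
    and x: "\<And>n. x n \<in> X" "x \<longlonglongrightarrow> t"
  shows "(\<lambda>n. L2_norm_on (lebesgue_on {0<..<L}) (\<lambda>s. g (x n) s - g t s)) \<longlonglongrightarrow> 0"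
  using continuous_on_tendsto_compose[OF L2_continuous_path[OF g t] x(2) t] x(1)
  by (simp add: L2_norm_on_def)

section \<open>The flow is a weak solution\<close>

text \<open>f has only a weak derivative g, so the product v f is not differentiated. Instead, v f
  minus its expected primitive has increments that are small relative to those of \<open>V\<close>,
  and \<open>constant_of_small_increments\<close> applies. The boundary terms then cancel by
  periodicity.\<close>

lemma W1p_per_integration_by_parts:
  fixes v w f :: "real \<Rightarrow> real"
  assumes f: "f \<in> W1p_per 2 L" and L: "L > 0"
    and v: "\<And>s. (v has_real_derivative w s) (at s)" "v L = v 0" and w: "continuous_on UNIV w"
  shows "(LINT s|lebesgue_on {0<..<L}. w s * f s + v s * weak_deriv {0<..<L} f s) = 0"
proof -
  define g where "g = weak_deriv {0<..<L} f"
  have vc: "continuous_on X v" for X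
    by (intro continuous_at_imp_continuous_on ballI) (rule DERIV_isCont[OF v(1)])
  have wc: "continuous_on X w" for X using w by (rule continuous_on_subset) simp
  have f': "continuous_on UNIV f" "\<And>s. f (s + L) = f s" using W1p_perD(1)[OF f L] C_per_iff[OF L] by auto
  have fc: "continuous_on X f" for X using f'(1) by (rule continuous_on_subset) simp
  have gs: "g \<in> square_integrable (lebesgue_on {0<..<L})" unfolding g_def by (rule W1p_perD(4)[OF f L])
  have gi: "set_integrable lebesgue {0..L} g" by (rule square_integrable_interval_integrable(2)[OF gs])
  have gx: "set_integrable lebesgue {x..y} g" if "0 \<le> x" "y \<le> L" for x y
    by (rule set_integrable_subset[OF gi]) (use that in auto)
  have gHK: "g integrable_on {x..y}" "(\<lambda>s. v s * g s) integrable_on {x..y}" "(\<lambda>s. \<bar>w s\<bar> + \<bar>g s\<bar>) integrable_on {x..y}"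
    if "0 \<le> x" "y \<le> L" for x y
  proof -
    show "g integrable_on {x..y}" by (rule set_lebesgue_integral_eq_integral(1)[OF gx[OF that]])
    have "(\<lambda>s. v s * g s) absolutely_integrable_on {x..y}"
    proof (rule absolutely_integrable_bounded_measurable_product_real[OF _ _ _ gx[OF that]])
      show "v \<in> borel_measurable (lebesgue_on {x..y})" by (intro continuous_imp_measurable_on_sets_lebesgue vc) simp
      show "bounded (v ` {x..y})" by (intro compact_imp_bounded compact_continuous_image vc) simp
    qed simp
    then show "(\<lambda>s. v s * g s) integrable_on {x..y}" by (rule set_lebesgue_integral_eq_integral(1))
    have ga: "(\<lambda>s. \<bar>g s\<bar>) integrable_on {x..y}"
      by (rule set_lebesgue_integral_eq_integral(1)[OF set_integrable_abs[OF gx[OF that]]])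
    show "(\<lambda>s. \<bar>w s\<bar> + \<bar>g s\<bar>) integrable_on {x..y}"
      by (rule Henstock_Kurzweil_Integration.integrable_add[OF integrable_continuous_real ga]) (intro continuous_intros wc)
  qed
  define P where "P x = v x * f x - integral {0..x} (\<lambda>s. w s * f s) - integral {0..x} (\<lambda>s. v s * g s)" for x
  define V where "V x = integral {0..x} (\<lambda>s. \<bar>w s\<bar> + \<bar>g s\<bar>)" for x
  have "P L = P 0"
  proof (rule constant_of_small_increments[where f=P and V=V])
    fix e :: real assume e: "e > 0"
    have uc: "uniformly_continuous_on {0..L} f" "uniformly_continuous_on {0..L} v"
      using compact_uniformly_continuous[OF fc] compact_uniformly_continuous[OF vc] by auto
    obtain d1 where d1: "d1 > 0" "\<And>x y. x \<in> {0..L} \<Longrightarrow> y \<in> {0..L} \<Longrightarrow> \<bar>y - x\<bar> < d1 \<Longrightarrow> \<bar>f y - f x\<bar> < e"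
      using uc(1)[unfolded uniformly_continuous_on_def] e unfolding dist_real_def by metis
    obtain d2 where d2: "d2 > 0" "\<And>x y. x \<in> {0..L} \<Longrightarrow> y \<in> {0..L} \<Longrightarrow> \<bar>y - x\<bar> < d2 \<Longrightarrow> \<bar>v y - v x\<bar> < e"
      using uc(2)[unfolded uniformly_continuous_on_def] e unfolding dist_real_def by metis
    show "\<exists>d>0. \<forall>x\<in>{0..L}. \<forall>y\<in>{0..L}. x \<le> y \<and> y - x < d \<longrightarrow> \<bar>P y - P x\<bar> \<le> e * (V y - V x)"
    proof (intro exI[of _ "min d1 d2"] conjI ballI impI)
      fix x y assume xy: "x \<in> {0..L}" "y \<in> {0..L}" "x \<le> y \<and> y - x < min d1 d2"
      have x0: "0 \<le> x" and yL: "y \<le> L" and xley: "x \<le> y" using xy by auto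
      \<comment> \<open>The fundamental theorem for v and f on [x, y] writes the increment of
        \<open>P\<close> exactly as the integral of \<open>H\<close>, in which only the differences
        f y - f r and v x - v r remain.\<close>
      define H where "H r = w r * f y - w r * f r + v x * g r - v r * g r" for r
      have hw: "(w has_integral v y - v x) {x..y}" by (rule integral_derivative(2)[OF xley v(1)])
      have hg: "(g has_integral f y - f x) {x..y}"
        using integrable_integral[OF gHK(1)[OF x0 yL]] W1p_per_FTC[OF f L x0 xley yL] by (simp add: g_def)
      have hH: "(H has_integral (v y - v x) * f y - integral {x..y} (\<lambda>s. w s * f s) + v x * (f y - f x) - integral {x..y} (\<lambda>s. v s * g s)) {x..y}"
        unfolding H_def
        by (intro has_integral_add has_integral_diff has_integral_mult_left has_integral_mult_right hw hg
            integrable_integral gHK x0 yL integrable_continuous_real continuous_intros wc fc)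
      have comb: "integral {0..y} h = integral {0..x} h + integral {x..y} h" if "h integrable_on {0..y}" for h :: "real \<Rightarrow> real"
        by (rule Henstock_Kurzweil_Integration.integral_combine[symmetric]) (use x0 xley that in auto)
      have "P y - P x = integral {x..y} H"
        unfolding P_def integral_unique[OF hH]
        using comb[of "\<lambda>s. w s * f s"] comb[of "\<lambda>s. v s * g s"] gHK(2)[of 0 y] yL
        by (simp add: integrable_continuous_real continuous_intros wc fc algebra_simps)
      also have "\<bar>\<dots>\<bar> \<le> integral {x..y} (\<lambda>s. e * (\<bar>w s\<bar> + \<bar>g s\<bar>))"
      proof (rule integral_norm_bound_integral[of H "{x..y}", unfolded real_norm_def])
        show "H integrable_on {x..y}" using hH by (rule has_integral_integrable)
        show "(\<lambda>s. e * (\<bar>w s\<bar> + \<bar>g s\<bar>)) integrable_on {x..y}"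
          using integrable_cmul[OF gHK(3)[OF x0 yL], of e] by simp
        fix r assume r: "r \<in> {x..y}"
        have "H r = w r * (f y - f r) + g r * (v x - v r)" by (simp add: H_def algebra_simps)
        then have "\<bar>H r\<bar> \<le> \<bar>w r\<bar> * \<bar>f y - f r\<bar> + \<bar>g r\<bar> * \<bar>v x - v r\<bar>"
          using abs_triangle_ineq[of "w r * (f y - f r)" "g r * (v x - v r)"] by (simp add: abs_mult)
        also have "\<dots> \<le> \<bar>w r\<bar> * e + \<bar>g r\<bar> * e"
          using d1(2)[of r y] d2(2)[of r x] xy r by (intro add_mono mult_left_mono) auto
        finally show "\<bar>H r\<bar> \<le> e * (\<bar>w r\<bar> + \<bar>g r\<bar>)" by (simp add: algebra_simps)
      qed
      also have "\<dots> = e * integral {x..y} (\<lambda>s. \<bar>w s\<bar> + \<bar>g s\<bar>)" by simp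
      also have "\<dots> = e * (V y - V x)" unfolding V_def using comb[of "\<lambda>s. \<bar>w s\<bar> + \<bar>g s\<bar>"] gHK(3)[of 0 y] yL by simp
      finally show "\<bar>P y - P x\<bar> \<le> e * (V y - V x)" .
    qed (use d1 d2 in auto)
  qed (use L in simp)
  then have "integral {0..L} (\<lambda>s. w s * f s) + integral {0..L} (\<lambda>s. v s * g s) = v L * f L - v 0 * f 0"
    unfolding P_def by simp
  also have "\<dots> = 0" using v(2) f'(2)[of 0] by simp
  finally have "integral {0..L} (\<lambda>s. w s * f s + v s * g s) = 0"
    using gHK(2)[of 0 L] by (subst Henstock_Kurzweil_Integration.integral_add) (auto intro!: integrable_continuous_real continuous_intros wc fc)
  moreover have "(LINT s|lebesgue_on {0<..<L}. w s * f s + v s * g s) = integral {0<..<L} (\<lambda>s. w s * f s + v s * g s)"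
  proof (rule lebesgue_integral_eq_integral)
    have "v \<in> square_integrable (lebesgue_on {0<..<L})" by (intro continuous_square_integrable vc)
    then have "integrable (lebesgue_on {0<..<L}) (\<lambda>s. v s * g s)" using gs by (rule square_integrable_mult)
    moreover have "integrable (lebesgue_on {0<..<L}) (\<lambda>s. w s * f s)"
      by (intro continuous_square_integrable continuous_intros wc fc)
    ultimately show "integrable (lebesgue_on {0<..<L}) (\<lambda>s. w s * f s + v s * g s)" by simp
  qed simp
  ultimately show ?thesis by (simp add: g_def integral_open_interval_real)
qed

lemma integrable_inverse_sqrt:
  "integrable (lebesgue_on {0<..<T}) (\<lambda>t. 1 / sqrt t)"
proof (cases "T > 0")
  case True
  have "(\<lambda>t. t powr (-1/2)) integrable_on {0..T}"
    by (rule integrable_on_powr_from_0) (use True in auto)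
  then have "(\<lambda>t. t powr (-1/2)) absolutely_integrable_on {0..T}"
    by (rule nonnegative_absolutely_integrable_1) simp
  then have "(\<lambda>t. t powr (-1/2)) absolutely_integrable_on {0<..<T}"
    by (rule set_integrable_subset) auto
  then have "integrable (lebesgue_on {0<..<T}) (\<lambda>t. t powr (-1/2))"
    by (simp add: set_integrable_iff_integrable_lebesgue_on)
  moreover have "t powr (-1/2) = 1 / sqrt t" if "t \<in> {0<..<T}" for t
    using that by (simp add: powr_minus_divide powr_half_sqrt)
  then have "integrable (lebesgue_on {0<..<T}) (\<lambda>t. t powr (-1/2)) \<longleftrightarrow> integrable (lebesgue_on {0<..<T}) (\<lambda>t. 1 / sqrt t)"
    by (intro Bochner_Integration.integrable_cong) auto
  ultimately show ?thesis by simp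
qed simp

context truncated_flow
begin

lemma u_weak_deriv:
  "has_weak_deriv {0<..<L} (u t) (\<lambda>s. v t s - c)"
  by (rule has_weak_deriv_continuous_derivative[OF L du]) (intro continuous_intros slices)

lemma u_W1p_per: "u t \<in> W1p_per 2 L"
proof (rule W1p_perI[OF _ u_weak_deriv])
  show "u t \<in> C_per L" using C_per_iff[OF L] slices uper by blast
  show "(\<lambda>s. v t s - c) \<in> square_integrable (lebesgue_on {0<..<L})"
    by (intro continuous_square_integrable continuous_intros slices)
qed

lemma u_path: "continuous_on (X \<times> UNIV) (\<lambda>p. u (fst p) (snd p))" "continuous_on (X \<times> UNIV) (\<lambda>p. v (fst p) (snd p))"
  by (intro jointly_continuous_compose[OF uc] jointly_continuous_compose[OF vc] continuous_intros)+

lemma ut_path: "continuous_on ({0<..} \<times> UNIV) (\<lambda>p. ut (fst p) (snd p))"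
  by (intro ut_compose continuous_intros) auto

lemma u_bochner_measurable: "bochner_measurable {0<..<T} (W1p_per 2 L) (W1p_norm 2 {0<..<L}) u"
proof (rule bochner_measurable_path[OF T u_W1p_per])
  fix t x assume x: "x \<longlonglongrightarrow> (t :: real)"
  let ?M = "lebesgue_on {0<..<L}"
  have wd: "L2_norm_on ?M (weak_deriv {0<..<L} (u (x n) - u t)) = L2_norm_on ?M (\<lambda>s. v (x n) s - v t s)" for n
  proof (rule L2_norm_on_cong_AE)
    have "has_weak_deriv {0<..<L} (u (x n) - u t) (\<lambda>s. v (x n) s - v t s)"
    proof (rule has_weak_deriv_continuous_derivative[OF L])
      show "((u (x n) - u t) has_real_derivative v (x n) s - v t s) (at s)" for s
        unfolding fun_diff_def using DERIV_diff[OF du[of "x n" s] du[of t s]] by simp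
    qed (intro continuous_intros slices)
    then show "AE s in ?M. weak_deriv {0<..<L} (u (x n) - u t) s = v (x n) s - v t s"
      by (rule weak_deriv_AE(2)[OF L])
    show "weak_deriv {0<..<L} (u (x n) - u t) \<in> borel_measurable ?M"
      by (intro square_integrableD(1) W1p_perD(4) W1p_per_diff(1) u_W1p_per L)
    show "(\<lambda>s. v (x n) s - v t s) \<in> borel_measurable ?M"
      by (intro square_integrableD(1) continuous_square_integrable continuous_intros slices)
  qed
  show "(\<lambda>n. W1p_norm 2 {0<..<L} (u (x n) - u t)) \<longlonglongrightarrow> 0"
  proof (rule tendsto_zero_mono)
    have "(\<lambda>n. L2_norm_on ?M (\<lambda>s. u (x n) s - u t s) + L2_norm_on ?M (\<lambda>s. v (x n) s - v t s)) \<longlonglongrightarrow> 0 + 0"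
      by (intro tendsto_add L2_path_tendsto[where X=UNIV] u_path x) auto
    then show "(\<lambda>n. L2_norm_on ?M (\<lambda>s. u (x n) s - u t s) + L2_norm_on ?M (\<lambda>s. v (x n) s - v t s)) \<longlonglongrightarrow> 0" by simp
    show "0 \<le> W1p_norm 2 {0<..<L} (u (x n) - u t)" for n
      using W1p_norm_ge(1) L2_norm_on_nonneg order_trans by blast
    show "W1p_norm 2 {0<..<L} (u (x n) - u t) \<le> L2_norm_on ?M (\<lambda>s. u (x n) s - u t s) + L2_norm_on ?M (\<lambda>s. v (x n) s - v t s)" for n
      using W1p_norm_le[of L "u (x n) - u t"] unfolding wd by (simp add: fun_diff_def)
  qed
qed

lemma u_bochner_Linf: "u \<in> bochner_Linf {0<..<T} (W1p_per 2 L) (W1p_norm 2 {0<..<L})"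
proof -
  let ?M = "lebesgue_on {0<..<L}"
  define N where "N t = L2_norm_on ?M (u t) + L2_norm_on ?M (\<lambda>s. v t s - c)" for t
  have "continuous_on {0..T} N" unfolding N_def
    by (intro continuous_intros L2_norm_on_continuous_path u_path)
  then have "bounded (N ` {0..T})" by (intro compact_imp_bounded compact_continuous_image) auto
  then obtain C where C: "\<And>t. t \<in> {0..T} \<Longrightarrow> \<bar>N t\<bar> \<le> C" by (metis bounded_iff image_eqI real_norm_def)
  have "W1p_norm 2 {0<..<L} (u t) \<le> N t" for t
  proof -
    have "L2_norm_on ?M (weak_deriv {0<..<L} (u t)) = L2_norm_on ?M (\<lambda>s. v t s - c)"
      by (rule L2_norm_on_cong_AE[OF weak_deriv_AE(2)[OF L u_weak_deriv]])
         (intro square_integrableD(1) W1p_perD(4) u_W1p_per L continuous_square_integrable continuous_intros slices)+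
    then show ?thesis using W1p_norm_le[of L "u t"] by (simp add: N_def)
  qed
  then have "AE t in lebesgue_on {0<..<T}. W1p_norm 2 {0<..<L} (u t) \<le> C"
    using C by (intro AE_I2) (smt (verit) greaterThanLessThan_iff atLeastAtMost_iff space_lebesgue_on)
  with u_bochner_measurable show ?thesis unfolding bochner_Linf_def by blast
qed

lemma u_L2L2: "u \<in> L2L2 {0<..<T} {0<..<L}"
  unfolding L2L2_iff
proof
  let ?M = "lebesgue_on {0<..<L}"
  show "bochner_measurable {0<..<T} (square_integrable ?M) (L2_norm_on ?M) u"
  proof (rule bochner_measurable_path[OF T])
    show "u t \<in> square_integrable ?M" for t by (intro continuous_square_integrable slices)
    show "(\<lambda>n. L2_norm_on ?M (u (x n) - u t)) \<longlonglongrightarrow> 0" if "x \<longlonglongrightarrow> t" for t x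
      unfolding fun_diff_def by (rule L2_path_tendsto[OF u_path(1)[of UNIV]]) (use that in auto)
  qed
  have "continuous_on {0..T} (\<lambda>t. (L2_norm_on ?M (u t))\<^sup>2)"
    by (intro continuous_intros L2_norm_on_continuous_path u_path)
  then show "integrable (lebesgue_on {0<..<T}) (\<lambda>t. (L2_norm_on ?M (u t))\<^sup>2)" by (rule continuous_square_integrable(2))
qed

lemma ut_slice_square_integrable: "t > 0 \<Longrightarrow> ut t \<in> square_integrable (lebesgue_on {0<..<L})"
  by (intro continuous_square_integrable w_slice)

text \<open>Near t = 0 the square of \<open>ut\<close> grows at most like 1 / sqrt t, which is
  integrable. The exponent goes back to the Hoelder continuity of the initial v; the continuous
  multipliers contribute a bounded part.\<close>

lemma ut_L2L2: "ut \<in> L2L2 {0<..<T} {0<..<L}"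
  unfolding L2L2_iff
proof
  let ?M = "lebesgue_on {0<..<L}"
  show "bochner_measurable {0<..<T} (square_integrable ?M) (L2_norm_on ?M) ut"
  proof (rule bochner_measurable_path[OF T])
    show "ut t \<in> square_integrable ?M" if "t \<in> {0<..T}" for t using that by (intro ut_slice_square_integrable) auto
    show "(\<lambda>n. L2_norm_on ?M (ut (x n) - ut t)) \<longlonglongrightarrow> 0" if "t \<in> {0<..<T}" "\<And>n. x n \<in> {0<..T}" "x \<longlonglongrightarrow> t" for t x
      unfolding fun_diff_def by (rule L2_path_tendsto[OF ut_path]) (use that in auto)
  qed
  have "continuous_on {0..T} (\<lambda>t. \<bar>l1 t\<bar> + \<bar>l2 t\<bar>)"
    by (intro continuous_intros continuous_on_subset[OF l1c] continuous_on_subset[OF l2c]) auto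
  then have "bounded ((\<lambda>t. \<bar>l1 t\<bar> + \<bar>l2 t\<bar>) ` {0..T})" by (intro compact_imp_bounded compact_continuous_image) auto
  then obtain B where B: "\<And>t. t \<in> {0..T} \<Longrightarrow> \<bar>l1 t\<bar> + \<bar>l2 t\<bar> \<le> B"
    unfolding bounded_iff by (metis (no_types, lifting) abs_le_iff image_eqI order_trans real_norm_def)
  have ub: "(ut t s)\<^sup>2 \<le> 2 * (C / sqrt t) + 2 * B\<^sup>2" if t: "t \<in> {0<..<T}" for t s
  proof -
    define q where "q = l1 t * sin (\<theta> t s) - l2 t * cos (\<theta> t s)"
    have "\<bar>q\<bar> \<le> \<bar>l1 t\<bar> * 1 + \<bar>l2 t\<bar> * 1"
      unfolding q_def by (rule order_trans[OF abs_triangle_ineq4], unfold abs_mult, intro add_mono mult_left_mono) auto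
    also have "\<dots> \<le> B" using B[of t] t by simp
    finally have "q\<^sup>2 \<le> B\<^sup>2" by (metis abs_ge_zero power2_abs power_mono)
    moreover have "(w t s)\<^sup>2 \<le> C / sqrt t" using wC[of t s] t by simp
    moreover have "(w t s + q)\<^sup>2 \<le> 2 * (w t s)\<^sup>2 + 2 * q\<^sup>2"
      using zero_le_power2[of "w t s - q"] by (simp add: power2_eq_square algebra_simps)
    moreover have "ut t s = w t s + q" by (simp add: ut_def q_def)
    ultimately show ?thesis by simp
  qed
  show "integrable (lebesgue_on {0<..<T}) (\<lambda>t. (L2_norm_on ?M (ut t))\<^sup>2)"
  proof (rule Bochner_Integration.integrable_bound)
    show "integrable (lebesgue_on {0<..<T}) (\<lambda>t. L * (2 * C * (1 / sqrt t) + 2 * B\<^sup>2))"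
      using integrable_inverse_sqrt finite_measure.integrable_const[OF finite_measure_lebesgue_on_interval]
      by (intro Bochner_Integration.integrable_mult_right Bochner_Integration.integrable_add)
    have "continuous_on {0<..<T} (\<lambda>t. (L2_norm_on ?M (ut t))\<^sup>2)"
      by (intro continuous_intros L2_norm_on_continuous_path continuous_on_subset[OF ut_path]) auto
    then show "(\<lambda>t. (L2_norm_on ?M (ut t))\<^sup>2) \<in> borel_measurable (lebesgue_on {0<..<T})"
      by (intro continuous_imp_measurable_on_sets_lebesgue) auto
    show "AE t in lebesgue_on {0<..<T}. norm ((L2_norm_on ?M (ut t))\<^sup>2) \<le> norm (L * (2 * C * (1 / sqrt t) + 2 * B\<^sup>2))"
    proof (rule AE_I2)
      fix t assume "t \<in> space (lebesgue_on {0<..<T})"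
      then have t: "t \<in> {0<..<T}" by simp
      have uc': "continuous_on {0..L} (\<lambda>s. (ut t s)\<^sup>2)" using t by (intro continuous_intros w_slice) auto
      have "(L2_norm_on ?M (ut t))\<^sup>2 = integral {0..L} (\<lambda>s. (ut t s)\<^sup>2)"
        unfolding L2_norm_on_sq by (rule continuous_square_integrable(3)[OF uc'])
      also have "\<dots> \<le> integral {0..L} (\<lambda>s. 2 * (C / sqrt t) + 2 * B\<^sup>2)"
        by (intro integral_le integrable_continuous_real uc' continuous_on_const ub[OF t])
      also have "\<dots> = L * (2 * C * (1 / sqrt t) + 2 * B\<^sup>2)" using L by simp
      finally show "norm ((L2_norm_on ?M (ut t))\<^sup>2) \<le> norm (L * (2 * C * (1 / sqrt t) + 2 * B\<^sup>2))" by simp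
    qed
  qed
qed

text \<open>\<open>\<omega>\<close> is only square integrable, so the limit is taken in L2: the
  difference quotients are the averages \<open>Q\<close>, which converge to \<open>ut t\<close> in
  the norm.\<close>

lemma u_inner_derivative:
  assumes t: "t \<in> {0<..<T}" and \<omega>: "\<omega> \<in> square_integrable (lebesgue_on {0<..<L})"
  shows "((\<lambda>t. LINT s|lebesgue_on {0<..<L}. u t s * \<omega> s) has_real_derivative (LINT s|lebesgue_on {0<..<L}. ut t s * \<omega> s)) (at t)"
proof -
  let ?M = "lebesgue_on {0<..<L}"
  define Q where "Q z s = integral {0..1} (\<lambda>\<xi>. ut (t + \<xi> * (z - t)) s)" for z s
  have Qc: "continuous_on ({0<..} \<times> UNIV) (\<lambda>p. Q (fst p) (snd p))"
    unfolding Q_def by (rule difference_quotient_continuous) (use t in simp)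
  have Qs: "Q z \<in> square_integrable ?M" if "z > 0" for z
    using continuous_on_compose2[OF Qc, of "{0..L}" "\<lambda>s. (z, s)"] that
    by (intro continuous_square_integrable) (auto simp: continuous_on_Pair)
  have Qt: "Q t = ut t" by (simp add: Q_def fun_eq_iff)
  have us: "u z \<in> square_integrable ?M" for z by (intro continuous_square_integrable slices)
  show ?thesis unfolding has_field_derivative_iff tendsto_at_iff_sequentially comp_def
  proof (intro allI impI)
    fix x assume x: "\<forall>i. x i \<in> UNIV - {t}" "x \<longlonglongrightarrow> t"
    have ev: "\<forall>\<^sub>F n in sequentially. x n \<in> {0<..<T}"
      using topological_tendstoD[OF x(2), of "{0<..<T}"] t by auto
    \<comment> \<open>The sequence may start outside (0, T); finitely many terms are
      skipped.\<close>
    then obtain m where m: "\<And>n. n \<ge> m \<Longrightarrow> x n \<in> {0<..<T}" unfolding eventually_sequentially by blast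
    have "(\<lambda>n. LINT s|?M. Q (x (n + m)) s * \<omega> s) \<longlonglongrightarrow> (LINT s|?M. Q t s * \<omega> s)"
    proof (rule L2_inner_tendsto[where gn="\<lambda>_. \<omega>"])
      show "Q (x (n + m)) \<in> square_integrable ?M" for n using m[of "n + m"] by (intro Qs) auto
      show "Q t \<in> square_integrable ?M" using t by (intro Qs) auto
      show "(\<lambda>n. L2_norm_on ?M (\<lambda>s. Q (x (n + m)) s - Q t s)) \<longlonglongrightarrow> 0"
        by (rule L2_path_tendsto[OF Qc]) (use t m LIMSEQ_ignore_initial_segment[OF x(2)] in auto)
    qed (use \<omega> in \<open>auto simp: L2_norm_on_def\<close>)
    moreover have "(LINT s|?M. Q (x (n + m)) s * \<omega> s) =
        ((LINT s|?M. u (x (n + m)) s * \<omega> s) - (LINT s|?M. u t s * \<omega> s)) / (x (n + m) - t)" for n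
    proof -
      have z: "x (n + m) \<in> {0<..<T}" "x (n + m) \<noteq> t" using m[of "n + m"] x(1) by auto
      have "(LINT s|?M. u (x (n + m)) s * \<omega> s) - (LINT s|?M. u t s * \<omega> s) = (LINT s|?M. u (x (n + m)) s * \<omega> s - u t s * \<omega> s)"
        by (intro Bochner_Integration.integral_diff[symmetric] square_integrable_mult us \<omega>)
      also have "\<dots> = (LINT s|?M. (x (n + m) - t) * (Q (x (n + m)) s * \<omega> s))"
        unfolding left_diff_distrib[symmetric] u_increment[OF t z(1)] Q_def by (simp add: mult.assoc)
      also have "\<dots> = (x (n + m) - t) * (LINT s|?M. Q (x (n + m)) s * \<omega> s)" by simp
      finally show ?thesis using z by simp
    qed
    ultimately have "(\<lambda>n. ((LINT s|?M. u (x (n + m)) s * \<omega> s) - (LINT s|?M. u t s * \<omega> s)) / (x (n + m) - t)) \<longlonglongrightarrow> (LINT s|?M. ut t s * \<omega> s)"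
      by (simp add: Qt)
    then show "(\<lambda>n. ((LINT s|?M. u (x n) s * \<omega> s) - (LINT s|?M. u t s * \<omega> s)) / (x n - t)) \<longlonglongrightarrow> (LINT s|?M. ut t s * \<omega> s)"
      by (rule LIMSEQ_offset)
  qed
qed

text \<open>Each pairing with a fixed \<open>\<omega>\<close> is continuously differentiable on the
  open interval (0, T). Test functions have compact support in it, so the singularity of
  \<open>ut\<close> at t = 0 never meets them.\<close>

lemma u_weak_time_deriv: "has_weak_time_deriv {0<..<T} {0<..<L} u ut"
  unfolding has_weak_time_deriv_def Lp_space_2[of "{0<..<L}"]
proof (intro conjI ballI)
  show "u \<in> bochner_L2 {0<..<T} (square_integrable (lebesgue_on {0<..<L})) (Lp_norm 2 {0<..<L})"
    "ut \<in> bochner_L2 {0<..<T} (square_integrable (lebesgue_on {0<..<L})) (Lp_norm 2 {0<..<L})"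
    using u_L2L2 ut_L2L2 by (simp_all add: Lp_space_2)
  fix \<psi> \<omega> assume \<psi>: "\<psi> \<in> test_functions {0<..<T}" and \<omega>: "\<omega> \<in> square_integrable (lebesgue_on {0<..<L})"
  let ?M = "lebesgue_on {0<..<L}"
  have "has_weak_deriv {0<..<T} (\<lambda>t. LINT s|?M. u t s * \<omega> s) (\<lambda>t. LINT s|?M. ut t s * \<omega> s)"
  proof (rule has_weak_deriv_continuous_derivative[OF T u_inner_derivative[OF _ \<omega>]])
    show "continuous_on {0<..<T} (\<lambda>t. LINT s|?M. ut t s * \<omega> s)"
      unfolding continuous_on_sequentially comp_def
    proof (intro allI ballI impI, elim conjE)
      fix x t assume t: "t \<in> {0<..<T}" and x: "\<forall>n. x n \<in> {0<..<T}" "x \<longlonglongrightarrow> t"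
      show "(\<lambda>n. LINT s|?M. ut (x n) s * \<omega> s) \<longlonglongrightarrow> (LINT s|?M. ut t s * \<omega> s)"
      proof (rule L2_inner_tendsto[where gn="\<lambda>_. \<omega>"])
        show "(\<lambda>n. L2_norm_on ?M (\<lambda>s. ut (x n) s - ut t s)) \<longlonglongrightarrow> 0"
          by (rule L2_path_tendsto[OF ut_path]) (use t x in auto)
      qed (use t x \<omega> in \<open>auto simp: L2_norm_on_def intro: ut_slice_square_integrable\<close>)
    qed
  qed
  with \<psi> have "(LINT t|lebesgue_on {0<..<T}. (LINT s|?M. u t s * \<omega> s) * deriv \<psi> t) =
      - (LINT t|lebesgue_on {0<..<T}. (LINT s|?M. ut t s * \<omega> s) * \<psi> t)"
    unfolding has_weak_deriv_def by blast
  then show "(LINT t|lebesgue_on {0<..<T}. deriv \<psi> t * (LINT s|?M. u t s * \<omega> s)) =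
      - (LINT t|lebesgue_on {0<..<T}. \<psi> t * (LINT s|?M. ut t s * \<omega> s))"
    by (simp only: mult.commute)
qed

lemma phi_eq: "phi L \<eta> s = c * s"
proof -
  have "c = 2 * pi * real \<eta> / L" using cL L by (simp add: field_simps)
  then show ?thesis by (simp add: phi_def)
qed

text \<open>\<open>D\<close> stands for the chosen weak time derivative, which is known to equal
  \<open>ut\<close> only almost everywhere. Once the equation is inserted, the multiplier terms
  cancel and integration by parts in s remains.\<close>

lemma weak_formulation:
  assumes f: "f \<in> W1p_per 2 L" and t: "t \<in> {0<..<T}"
    and D: "AE s in lebesgue_on {0<..<L}. D s = ut t s"
  shows "(LINT s|lebesgue_on {0<..<L}. (D s - l1 t * sin (u t s + phi L \<eta> s) + l2 t * cos (u t s + phi L \<eta> s)) * f s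
     + \<bar>weak_deriv {0<..<L} (\<lambda>x. u t x + phi L \<eta> x) s\<bar> powr (2 - 2)
       * weak_deriv {0<..<L} (\<lambda>x. u t x + phi L \<eta> x) s * weak_deriv {0<..<L} f s) = 0"
proof -
  let ?M = "lebesgue_on {0<..<L}"
  have "((\<lambda>x. u t x + phi L \<eta> x) has_real_derivative v t s) (at s)" for s
    using d\<theta>[of t s] by (simp add: \<theta>_def[abs_def] phi_eq)
  then have wd: "AE s in ?M. weak_deriv {0<..<L} (\<lambda>x. u t x + phi L \<eta> x) s = v t s"
    by (intro weak_deriv_AE(2)[OF L] has_weak_deriv_continuous_derivative[OF L] slices)
  have "(LINT s|?M. (D s - l1 t * sin (u t s + phi L \<eta> s) + l2 t * cos (u t s + phi L \<eta> s)) * f s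
     + \<bar>weak_deriv {0<..<L} (\<lambda>x. u t x + phi L \<eta> x) s\<bar> powr (2 - 2)
       * weak_deriv {0<..<L} (\<lambda>x. u t x + phi L \<eta> x) s * weak_deriv {0<..<L} f s)
     = (LINT s|?M. w t s * f s + v t s * weak_deriv {0<..<L} f s)"
  proof (rule integral_cong_AE_lebesgue_on)
    show "(\<lambda>s. w t s * f s + v t s * weak_deriv {0<..<L} f s) \<in> borel_measurable ?M"
    proof -
      have "w t \<in> borel_measurable ?M" "v t \<in> borel_measurable ?M"
        using t by (auto intro!: continuous_imp_measurable_on_sets_lebesgue w_slice slices)
      then show ?thesis using W1p_perD(2,4)[OF f L, THEN square_integrableD(1)] by auto
    qed
    show "AE s in ?M. (D s - l1 t * sin (u t s + phi L \<eta> s) + l2 t * cos (u t s + phi L \<eta> s)) * f s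
     + \<bar>weak_deriv {0<..<L} (\<lambda>x. u t x + phi L \<eta> x) s\<bar> powr (2 - 2)
       * weak_deriv {0<..<L} (\<lambda>x. u t x + phi L \<eta> x) s * weak_deriv {0<..<L} f s = w t s * f s + v t s * weak_deriv {0<..<L} f s"
      using D wd
    proof eventually_elim
      case (elim s)
      \<comment> \<open>The power is 0 at z = 0, since \<open>0 powr 0 = 0\<close>, and 1 elsewhere;
        the product is z in both cases.\<close>
      have "\<bar>z\<bar> powr (2 - 2) * z = z" for z :: real by simp
      then show ?case unfolding elim by (simp add: ut_def \<theta>_def phi_eq)
    qed
  qed simp
  also have "\<dots> = 0"
  proof (rule W1p_per_integration_by_parts[OF f L])
    show "(v t has_real_derivative w t s) (at s)" for s using t by (intro dv) auto
    show "v t L = v t 0" using vper[of t 0] by simp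
    show "continuous_on UNIV (w t)" using t by (intro w_slice) auto
  qed
  finally show ?thesis .
qed

theorem is_weak_solution:
  assumes closed: "integral {0..L} (\<lambda>s. cos (\<theta> 0 s)) = 0" "integral {0..L} (\<lambda>s. sin (\<theta> 0 s)) = 0"
  shows "weak_solution 2 L \<eta> (u 0) T u"
  unfolding weak_solution_def Let_def
proof (intro conjI)
  let ?M = "lebesgue_on {0<..<L}" and ?J = "lebesgue_on {0<..<T}"
  note wt = weak_time_deriv_properties[OF T L u_weak_time_deriv]
  show "u \<in> bochner_Linf {0<..<T} (W1p_per 2 L) (W1p_norm 2 {0<..<L}) \<inter> H1L2 {0<..<T} {0<..<L}"
    using u_bochner_Linf u_weak_time_deriv by (auto simp: H1L2_def)
  show "time_regular 2 L T u" unfolding time_regular_def Lp_norm_2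
  proof (intro ballI conjI u_W1p_per)
    fix t assume t: "t \<in> {0..<T}"
    have "isCont (\<lambda>r. L2_norm_on ?M (\<lambda>s. u r s - u t s)) t"
      using L2_continuous_path[OF u_path(1)[of UNIV], of t L] by (simp add: continuous_on_eq_continuous_at)
    then have "((\<lambda>r. L2_norm_on ?M (\<lambda>s. u r s - u t s)) \<longlongrightarrow> 0) (at t)"
      by (simp add: isCont_def L2_norm_on_def)
    then show "((\<lambda>r. L2_norm_on ?M (u r - u t)) \<longlongrightarrow> 0) (at t within {0..<T})"
      unfolding fun_diff_def by (rule tendsto_within_subset) simp
  qed
  show "\<exists>l1\<in>Lp_space 2 {0<..<T}. \<exists>l2\<in>Lp_space 2 {0<..<T}. \<forall>\<phi>\<in>bochner_Linf {0<..<T} (W1p_per 2 L) (W1p_norm 2 {0<..<L}).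
     (LINT t|?J. LINT s|?M. (weak_time_deriv {0<..<T} {0<..<L} u t s
        - l1 t * sin (u t s + phi L \<eta> s) + l2 t * cos (u t s + phi L \<eta> s)) * \<phi> t s
        + \<bar>weak_deriv {0<..<L} (\<lambda>x. u t x + phi L \<eta> x) s\<bar> powr (2 - 2)
        * weak_deriv {0<..<L} (\<lambda>x. u t x + phi L \<eta> x) s * weak_deriv {0<..<L} (\<phi> t) s) = 0"
  proof (rule bexI[of _ l1], rule bexI[of _ l2], rule ballI)
    show "l1 \<in> Lp_space 2 {0<..<T}" "l2 \<in> Lp_space 2 {0<..<T}" unfolding Lp_space_2
      by (intro continuous_square_integrable continuous_on_subset[OF l1c] continuous_on_subset[OF l2c]; simp)+
    fix \<phi> assume "\<phi> \<in> bochner_Linf {0<..<T} (W1p_per 2 L) (W1p_norm 2 {0<..<L})"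
    \<comment> \<open>Membership in the Bochner space controls the values of a test function only
      for almost every t, so the inner integral is shown to vanish almost everywhere.\<close>
    then have AE\<phi>: "AE t in ?J. \<phi> t \<in> W1p_per 2 L" unfolding bochner_Linf_def by (blast intro: bochner_measurable_AE)
    show "(LINT t|?J. LINT s|?M. (weak_time_deriv {0<..<T} {0<..<L} u t s
        - l1 t * sin (u t s + phi L \<eta> s) + l2 t * cos (u t s + phi L \<eta> s)) * \<phi> t s
        + \<bar>weak_deriv {0<..<L} (\<lambda>x. u t x + phi L \<eta> x) s\<bar> powr (2 - 2)
        * weak_deriv {0<..<L} (\<lambda>x. u t x + phi L \<eta> x) s * weak_deriv {0<..<L} (\<phi> t) s) = 0"
    proof (rule integral_eq_zero_AE)
      from AE\<phi> wt(2) AE_space show "AE t in ?J. (LINT s|?M. (weak_time_deriv {0<..<T} {0<..<L} u t s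
        - l1 t * sin (u t s + phi L \<eta> s) + l2 t * cos (u t s + phi L \<eta> s)) * \<phi> t s
        + \<bar>weak_deriv {0<..<L} (\<lambda>x. u t x + phi L \<eta> x) s\<bar> powr (2 - 2)
        * weak_deriv {0<..<L} (\<lambda>x. u t x + phi L \<eta> x) s * weak_deriv {0<..<L} (\<phi> t) s) = 0"
      proof eventually_elim
        case (elim t)
        then have "t \<in> {0<..<T}" by simp
        with elim show ?case by (intro weak_formulation)
      qed
    qed
  qed
  show "\<forall>t\<in>{0..<T}. closed_angle L \<eta> (u t)"
  proof
    fix t assume "t \<in> {0..<T}"
    then have t: "t \<in> {0..T}" by simp
    have "(LINT s|?M. cos (\<theta> t s)) = 0" "(LINT s|?M. sin (\<theta> t s)) = 0"
      using constraint_conserved[OF t] closed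
      by (subst continuous_square_integrable(3); auto intro!: continuous_intros slices)+
    then show "closed_angle L \<eta> (u t)" by (simp add: closed_angle_def \<theta>_def phi_eq)
  qed
qed simp

end

section \<open>Paths in the space of square integrable functions\<close>

lemma integral_lebesgue_on_if:
  fixes f :: "real \<Rightarrow> real"
  assumes AJ: "A \<subseteq> J" and A: "A \<in> sets lebesgue" and J: "J \<in> sets lebesgue"
  shows "integrable (lebesgue_on J) (\<lambda>t. if t \<in> A then f t else 0) \<longleftrightarrow> integrable (lebesgue_on A) f"
    "(LINT t|lebesgue_on J. (if t \<in> A then f t else 0)) = (LINT t|lebesgue_on A. f t)"
proof -
  have eq: "(\<lambda>t. if t \<in> J then (if t \<in> A then f t else 0) else 0) = (\<lambda>t. if t \<in> A then f t else 0)"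
    using AJ by (auto simp: fun_eq_iff)
  show "integrable (lebesgue_on J) (\<lambda>t. if t \<in> A then f t else 0) \<longleftrightarrow> integrable (lebesgue_on A) f"
    using Lebesgue_Measure.integrable_restrict_UNIV[OF J, of "\<lambda>t. if t \<in> A then f t else 0"]
      Lebesgue_Measure.integrable_restrict_UNIV[OF A, of f] unfolding eq by simp
  show "(LINT t|lebesgue_on J. (if t \<in> A then f t else 0)) = (LINT t|lebesgue_on A. f t)"
    using Lebesgue_Measure.integral_restrict_UNIV[OF J, of "\<lambda>t. if t \<in> A then f t else 0"]
      Lebesgue_Measure.integral_restrict_UNIV[OF A, of f] unfolding eq by simp
qed

lemma integrable_lebesgue_on_interval:
  fixes f :: "real \<Rightarrow> real"
  assumes f: "integrable (lebesgue_on {A<..<B}) f" and ab: "A \<le> a" "b \<le> B"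
  shows "set_integrable lebesgue {a..b} f"
proof -
  have "f absolutely_integrable_on {A<..<B}" using f by (simp add: set_integrable_iff_integrable_lebesgue_on)
  then have "f absolutely_integrable_on {A..B}"
    by (rule absolutely_integrable_spike_set) (auto intro: negligible_subset[of "{A, B}"])
  then show ?thesis by (rule set_integrable_subset) (use ab in auto)
qed

lemma L2_norm_on_mono:
  assumes "f \<in> square_integrable M" "g \<in> square_integrable M" "\<And>x. \<bar>f x\<bar> \<le> \<bar>g x\<bar>"
  shows "L2_norm_on M f \<le> L2_norm_on M g"
  unfolding L2_norm_on_def
  by (intro real_sqrt_le_mono integral_mono square_integrableD assms) (use assms(3) in \<open>simp add: abs_le_square_iff\<close>)

text \<open>Sequential continuity into L2. The index lives in an arbitrary metric space because
  \<open>L2_path_uniform\<close> applies the notion to pairs of times.\<close>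

definition L2_path :: "'a::metric_space set \<Rightarrow> real \<Rightarrow> ('a \<Rightarrow> real \<Rightarrow> real) \<Rightarrow> bool" where
  "L2_path X L u \<longleftrightarrow> (\<forall>t\<in>X. u t \<in> square_integrable (lebesgue_on {0<..<L}) \<and>
     (\<forall>x. (\<forall>n. x n \<in> X) \<longrightarrow> x \<longlonglongrightarrow> t \<longrightarrow> (\<lambda>n. L2_norm_on (lebesgue_on {0<..<L}) (\<lambda>s. u (x n) s - u t s)) \<longlonglongrightarrow> 0))"

lemma L2_pathD:
  assumes "L2_path X L u" "t \<in> X"
  shows "u t \<in> square_integrable (lebesgue_on {0<..<L})"
    "(\<And>n. x n \<in> X) \<Longrightarrow> x \<longlonglongrightarrow> t \<Longrightarrow> (\<lambda>n. L2_norm_on (lebesgue_on {0<..<L}) (\<lambda>s. u (x n) s - u t s)) \<longlonglongrightarrow> 0"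
  using assms unfolding L2_path_def by blast+

lemma L2_path_compose:
  assumes u: "L2_path X L u" and f: "continuous_on Y f" "f ` Y \<subseteq> X"
  shows "L2_path Y L (\<lambda>y. u (f y))"
  unfolding L2_path_def
proof (intro ballI conjI allI impI)
  fix t assume t: "t \<in> Y"
  then have ft: "f t \<in> X" using f by blast
  show "u (f t) \<in> square_integrable (lebesgue_on {0<..<L})" by (rule L2_pathD(1)[OF u ft])
next
  fix t x assume t: "t \<in> Y" and x: "\<forall>n. x n \<in> Y" "x \<longlonglongrightarrow> t"
  have "(\<lambda>n. f (x n)) \<longlonglongrightarrow> f t"
    using f(1) t x unfolding continuous_on_sequentially comp_def by blast
  then show "(\<lambda>n. L2_norm_on (lebesgue_on {0<..<L}) (\<lambda>s. u (f (x n)) s - u (f t) s)) \<longlonglongrightarrow> 0"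
    by (intro L2_pathD(2)[OF u]) (use f t x in auto)
qed

lemma L2_path_diff:
  assumes u: "L2_path X L u" and v: "L2_path X L v"
  shows "L2_path X L (\<lambda>t s. u t s - v t s)"
  unfolding L2_path_def
proof (intro ballI conjI allI impI)
  fix t assume t: "t \<in> X"
  show "(\<lambda>s. u t s - v t s) \<in> square_integrable (lebesgue_on {0<..<L})"
    by (intro square_integrable_diff L2_pathD(1)[OF u t] L2_pathD(1)[OF v t])
next
  let ?N = "L2_norm_on (lebesgue_on {0<..<L})"
  fix t x assume t: "t \<in> X" and x: "\<forall>n. x n \<in> X" "x \<longlonglongrightarrow> t"
  show "(\<lambda>n. ?N (\<lambda>s. (u (x n) s - v (x n) s) - (u t s - v t s))) \<longlonglongrightarrow> 0"
  proof (rule tendsto_zero_mono[OF _ L2_norm_on_nonneg])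
    show "(\<lambda>n. ?N (\<lambda>s. u (x n) s - u t s) + ?N (\<lambda>s. v t s - v (x n) s)) \<longlonglongrightarrow> 0"
      using tendsto_add[OF L2_pathD(2)[OF u t, of x] L2_pathD(2)[OF v t, of x]] x
      by (simp add: L2_norm_on_def power2_commute)
    fix n
    have xn: "x n \<in> X" using x by blast
    have "(\<lambda>s. (u (x n) s - v (x n) s) - (u t s - v t s)) = (\<lambda>s. (u (x n) s - u t s) + (v t s - v (x n) s))" by auto
    then show "?N (\<lambda>s. (u (x n) s - v (x n) s) - (u t s - v t s)) \<le> ?N (\<lambda>s. u (x n) s - u t s) + ?N (\<lambda>s. v t s - v (x n) s)"
      by (simp only:) (intro L2_norm_on_triangle square_integrable_diff L2_pathD(1)[OF u t] L2_pathD(1)[OF v t] L2_pathD(1)[OF u xn] L2_pathD(1)[OF v xn])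
  qed
qed

lemma L2_path_inner_continuous:
  assumes u: "L2_path X L u" and v: "L2_path X L v"
  shows "continuous_on X (\<lambda>t. LINT s|lebesgue_on {0<..<L}. u t s * v t s)"
  unfolding continuous_on_sequentially comp_def
proof (intro allI ballI impI, elim conjE)
  fix x t assume t: "t \<in> X" and x: "\<forall>n. x n \<in> X" "x \<longlonglongrightarrow> t"
  show "(\<lambda>n. LINT s|lebesgue_on {0<..<L}. u (x n) s * v (x n) s) \<longlonglongrightarrow> (LINT s|lebesgue_on {0<..<L}. u t s * v t s)"
    by (rule L2_inner_tendsto) (use L2_pathD[OF u] L2_pathD[OF v] t x in auto)
qed

lemma L2_path_const:
  assumes "\<omega> \<in> square_integrable (lebesgue_on {0<..<L})"
  shows "L2_path X L (\<lambda>_. \<omega>)"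
  using assms by (simp add: L2_path_def L2_norm_on_def)

text \<open>Superposition with a 1-Lipschitz function does not increase L2 distances, and
  boundedness keeps the values square integrable. It is applied to sine and cosine.\<close>

lemma L2_path_Lipschitz:
  assumes u: "L2_path X L u" and f: "f \<in> borel_measurable (lebesgue_on {0<..<L})"
    and h: "continuous_on UNIV h" "\<And>x y. \<bar>h x - h y\<bar> \<le> \<bar>x - y\<bar>" "\<And>x::real. \<bar>h x :: real\<bar> \<le> 1"
  shows "L2_path X L (\<lambda>t s. h (u t s + f s))"
proof -
  let ?M = "lebesgue_on {0<..<L}"
  have sq: "(\<lambda>s. h (u t s + f s)) \<in> square_integrable ?M" if t: "t \<in> X" for t
  proof -
    have "h \<in> borel_measurable borel" using h(1) by (rule borel_measurable_continuous_onI)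
    moreover have "(\<lambda>s. u t s + f s) \<in> borel_measurable ?M"
      using square_integrableD(1)[OF L2_pathD(1)[OF u t]] f by (rule borel_measurable_add)
    ultimately have m: "(\<lambda>s. h (u t s + f s)) \<in> borel_measurable ?M" by (rule measurable_compose[rotated])
    have "integrable ?M (\<lambda>s. (h (u t s + f s))\<^sup>2)"
    proof (rule finite_measure.integrable_const_bound[OF finite_measure_lebesgue_on_interval])
      show "AE s in ?M. norm ((h (u t s + f s))\<^sup>2) \<le> 1" using h(3) by (intro AE_I2) (simp add: abs_square_le_1)
      show "(\<lambda>s. (h (u t s + f s))\<^sup>2) \<in> borel_measurable ?M" using m by (rule borel_measurable_power)
    qed
    with m show ?thesis by (simp add: square_integrable_def)
  qed
  show ?thesis unfolding L2_path_def
  proof (intro ballI conjI allI impI sq)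
    fix t x assume t: "t \<in> X" and x: "\<forall>n. x n \<in> X" "x \<longlonglongrightarrow> t"
    show "(\<lambda>n. L2_norm_on ?M (\<lambda>s. h (u (x n) s + f s) - h (u t s + f s))) \<longlonglongrightarrow> 0"
    proof (rule tendsto_zero_mono[OF L2_pathD(2)[OF u t] L2_norm_on_nonneg])
      fix n
      have xn: "x n \<in> X" using x by blast
      show "L2_norm_on ?M (\<lambda>s. h (u (x n) s + f s) - h (u t s + f s)) \<le> L2_norm_on ?M (\<lambda>s. u (x n) s - u t s)"
      proof (rule L2_norm_on_mono)
        fix s show "\<bar>h (u (x n) s + f s) - h (u t s + f s)\<bar> \<le> \<bar>u (x n) s - u t s\<bar>"
          using h(2)[of "u (x n) s + f s" "u t s + f s"] by simp
      qed (intro square_integrable_diff sq t xn L2_pathD(1)[OF u])+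
    qed (use x in auto)
  qed
qed

text \<open>The norm of u y - u x is a continuous real function on the compact square of time pairs
  and vanishes on the diagonal; its uniform continuity is that of the path.\<close>

lemma L2_path_uniform:
  assumes u: "L2_path {a..b::real} L u" and e: "e > 0"
  obtains d where "d > 0" "\<And>x y. x \<in> {a..b} \<Longrightarrow> y \<in> {a..b} \<Longrightarrow> \<bar>y - x\<bar> < d \<Longrightarrow>
    L2_norm_on (lebesgue_on {0<..<L}) (\<lambda>s. u y s - u x s) < e"
proof -
  let ?X = "{a..b} \<times> {a..b}" and ?N = "\<lambda>p. L2_norm_on (lebesgue_on {0<..<L}) (\<lambda>s. u (snd p) s - u (fst p) s)"
  have p: "L2_path ?X L (\<lambda>p s. u (snd p) s - u (fst p) s)"
    by (intro L2_path_diff L2_path_compose[OF u] continuous_intros) auto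
  have "continuous_on ?X ?N"
    unfolding L2_norm_on_def power2_eq_square by (intro continuous_on_real_sqrt L2_path_inner_continuous p)
  then have "uniformly_continuous_on ?X ?N"
    by (rule compact_uniformly_continuous) (intro compact_Times compact_Icc)
  then obtain d where d: "d > 0" "\<And>p q. p \<in> ?X \<Longrightarrow> q \<in> ?X \<Longrightarrow> dist q p < d \<Longrightarrow> dist (?N q) (?N p) < e"
    using e by (rule uniformly_continuous_onE) blast
  show ?thesis
  proof (rule that[OF d(1)])
    fix x y assume xy: "x \<in> {a..b}" "y \<in> {a..b}" "\<bar>y - x\<bar> < d"
    have "dist (?N (x, y)) (?N (x, x)) < e"
      by (rule d(2)) (use xy in \<open>auto simp: dist_Pair_Pair dist_real_def\<close>)
    then show "L2_norm_on (lebesgue_on {0<..<L}) (\<lambda>s. u y s - u x s) < e"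
      by (simp add: dist_real_def L2_norm_on_def)
  qed
qed

section \<open>Taylor remainder, Gronwall's inequality and the product rule in time\<close>

lemma abs_trig_taylor:
  fixes x y :: real
  shows "\<bar>sin y - sin x - (y - x) * cos x\<bar> \<le> (y - x)\<^sup>2" "\<bar>cos y - cos x + (y - x) * sin x\<bar> \<le> (y - x)\<^sup>2"
proof -
  have *: "\<bar>F y - F x - (y - x) * f x\<bar> \<le> (y - x)\<^sup>2"
    if F: "\<And>x. (F has_real_derivative f x) (at x)" and f: "\<And>x y. \<bar>f x - f y\<bar> \<le> \<bar>x - y\<bar>" for F f :: "real \<Rightarrow> real"
  proof -
    have "\<exists>z. F y - F x = (y - x) * f z \<and> \<bar>z - x\<bar> \<le> \<bar>y - x\<bar>"
    proof (cases x y rule: linorder_cases)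
      case less
      then obtain z where "z > x" "z < y" "F y - F x = (y - x) * f z" using MVT2[OF less, of F f] F by blast
      then show ?thesis by (intro exI[of _ z]) auto
    next
      case greater
      then obtain z where "z > y" "z < x" "F x - F y = (x - y) * f z" using MVT2[OF greater, of F f] F by blast
      then show ?thesis by (intro exI[of _ z]) (auto simp: algebra_simps)
    qed auto
    then obtain z where z: "F y - F x = (y - x) * f z" "\<bar>z - x\<bar> \<le> \<bar>y - x\<bar>" by blast
    have "F y - F x - (y - x) * f x = (y - x) * (f z - f x)" using z(1) by (simp add: algebra_simps)
    then have "\<bar>F y - F x - (y - x) * f x\<bar> = \<bar>y - x\<bar> * \<bar>f z - f x\<bar>" by (simp add: abs_mult)
    also have "\<dots> \<le> \<bar>y - x\<bar> * \<bar>y - x\<bar>" using f[of z x] z(2) by (intro mult_left_mono) auto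
    finally show ?thesis by (simp add: power2_eq_square)
  qed
  show "\<bar>sin y - sin x - (y - x) * cos x\<bar> \<le> (y - x)\<^sup>2" by (rule *[OF DERIV_sin abs_cos_diff_le])
  show "\<bar>cos y - cos x + (y - x) * sin x\<bar> \<le> (y - x)\<^sup>2"
    using *[OF DERIV_cos, of] abs_sin_diff_le by (simp add: abs_minus_commute)
qed

text \<open>k is only integrable, so the argument is a continuation rather than an exponential
  estimate. If the last zero s of the primitive \<open>G\<close> came before b, there would follow a
  short interval on which k has integral at most 1/2; monotonicity of \<open>G\<close> then gives G
  t <= G t / 2, so \<open>G\<close> would vanish beyond s.\<close>

lemma gronwall_zero:
  fixes g k :: "real \<Rightarrow> real"
  assumes b: "0 \<le> b" and k: "k integrable_on {0..b}" "\<And>t. k t \<ge> 0" and g: "\<And>t. g t \<ge> 0"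
    and kg: "(\<lambda>r. k r * g r) integrable_on {0..b}"
    and le: "\<And>t. t \<in> {0..b} \<Longrightarrow> g t \<le> integral {0..t} (\<lambda>r. k r * g r)"
  shows "g b = 0"
proof -
  define G where "G t = integral {0..t} (\<lambda>r. k r * g r)" for t
  define K where "K t = integral {0..t} k" for t
  have Gd: "G y - G x = integral {x..y} (\<lambda>r. k r * g r)" "K y - K x = integral {x..y} k"
    "(\<lambda>r. k r * g r) integrable_on {x..y}" "k integrable_on {x..y}" if "0 \<le> x" "x \<le> y" "y \<le> b" for x y
  proof -
    have i: "(\<lambda>r. k r * g r) integrable_on {0..y}" "k integrable_on {0..y}"
      using integrable_subinterval_real[OF kg, of 0 y] integrable_subinterval_real[OF k(1), of 0 y] that by auto
    show "G y - G x = integral {x..y} (\<lambda>r. k r * g r)" "K y - K x = integral {x..y} k"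
      using Henstock_Kurzweil_Integration.integral_combine[OF that(1,2) i(1)]
        Henstock_Kurzweil_Integration.integral_combine[OF that(1,2) i(2)] by (auto simp: G_def K_def)
    show "(\<lambda>r. k r * g r) integrable_on {x..y}" "k integrable_on {x..y}"
      using integrable_subinterval_real[OF kg, of x y] integrable_subinterval_real[OF k(1), of x y] that by auto
  qed
  have mono: "G x \<le> G y" if "0 \<le> x" "x \<le> y" "y \<le> b" for x y
    using Gd(1)[OF that] Henstock_Kurzweil_Integration.integral_nonneg[OF Gd(3)[OF that]] k(2) g by simp
  have Gc: "continuous_on {0..b} G" "continuous_on {0..b} K"
    unfolding G_def K_def by (intro indefinite_integral_continuous_1 kg k(1))+
  have G0: "G 0 = 0" by (simp add: G_def)
  define S where "S = {0..b} \<inter> G -` {0}"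
  have "closed S" unfolding S_def by (intro continuous_closed_preimage Gc) auto
  moreover have "S \<noteq> {}" "bdd_above S" using b G0 by (auto simp: S_def intro!: bdd_aboveI[of _ b])
  ultimately have s: "Sup S \<in> S" by (intro closed_contains_Sup)
  define s where "s = Sup S"
  have s0: "0 \<le> s" "s \<le> b" "G s = 0" using s by (auto simp: S_def s_def)
  have "s = b"
  proof (rule ccontr)
    assume "s \<noteq> b"
    then have sb: "s < b" using s0 by simp
    obtain d where d: "d > 0" "\<And>t. t \<in> {0..b} \<Longrightarrow> dist t s < d \<Longrightarrow> dist (K t) (K s) < 1 / 2"
      by (rule continuous_onE[OF Gc(2), of s "1 / 2"]) (use s0 in auto)
    define t where "t = min b (s + d / 2)"
    have t: "s < t" "t \<le> b" "dist t s < d" using sb d(1) by (auto simp: t_def dist_real_def min_def)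
    have "G t = integral {s..t} (\<lambda>r. k r * g r)" using Gd(1)[of s t] s0 t by simp
    also have "\<dots> \<le> integral {s..t} (\<lambda>r. k r * G t)"
    proof (rule Henstock_Kurzweil_Integration.integral_le)
      show "(\<lambda>r. k r * g r) integrable_on {s..t}" using Gd(3)[of s t] s0 t by simp
      show "(\<lambda>r. k r * G t) integrable_on {s..t}"
        by (rule integrable_on_mult_left) (use Gd(4)[of s t] s0 t in simp)
      fix r assume r: "r \<in> {s..t}"
      have "g r \<le> G r" using le[of r] r s0 t by (simp add: G_def)
      also have "G r \<le> G t" using mono[of r t] r s0 t by simp
      finally show "k r * g r \<le> k r * G t" using k(2) by (rule mult_left_mono)
    qed
    also have "\<dots> = (K t - K s) * G t" using Gd(2)[of s t] s0 t by simp
    also have "\<dots> \<le> 1 / 2 * G t"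
    proof (rule mult_right_mono)
      show "K t - K s \<le> 1 / 2" using abs_ge_self[of "K t - K s"] d(2)[of t] t s0 by (simp add: dist_real_def)
      show "0 \<le> G t" using mono[of 0 t] G0 t s0 by simp
    qed
    finally have "G t \<le> 0" by simp
    then have "t \<in> S" using mono[of 0 t] G0 t s0 by (simp add: S_def)
    then have "t \<le> s" unfolding s_def by (rule cSup_upper) (auto simp: S_def intro!: bdd_aboveI[of _ b])
    with t show False by simp
  qed
  then have "g b \<le> 0" using le[of b] s0 by (simp add: G_def)
  with g[of b] show ?thesis by simp
qed

text \<open>u' and v' are merely square integrable in time. On [x, y] the pairing is split by
  freezing v at y and u at x, where the fundamental theorem for a fixed vector applies. The error
  against h is small relative to the integral of \<open>k\<close>, because both paths are uniformly
  continuous.\<close>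

lemma L2_inner_chain_rule:
  assumes T: "T > 0" and u: "has_weak_time_deriv {0<..<T} {0<..<L} u u'" and v: "has_weak_time_deriv {0<..<T} {0<..<L} v v'"
    and up: "L2_path {0..<T} L u" and vp: "L2_path {0..<T} L v" and b: "b \<in> {0..<T}"
  defines "h \<equiv> \<lambda>t. (LINT s|lebesgue_on {0<..<L}. u' t s * v t s) + (LINT s|lebesgue_on {0<..<L}. v' t s * u t s)"
  shows "integrable (lebesgue_on {0<..<T}) h"
    "(LINT s|lebesgue_on {0<..<L}. u b s * v b s) - (LINT s|lebesgue_on {0<..<L}. u 0 s * v 0 s) = integral {0..b} h"
proof -
  let ?M = "lebesgue_on {0<..<L}"
  note L2 = u[unfolded has_weak_time_deriv_def, THEN conjunct1] v[unfolded has_weak_time_deriv_def, THEN conjunct1]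
    u[unfolded has_weak_time_deriv_def, THEN conjunct2, THEN conjunct1] v[unfolded has_weak_time_deriv_def, THEN conjunct2, THEN conjunct1]
  show hi: "integrable (lebesgue_on {0<..<T}) h"
    unfolding h_def using L2 by (intro Bochner_Integration.integrable_add L2L2_inner_integrable) auto
  have hI: "h integrable_on {x..y}" if "0 \<le> x" "y \<le> T" for x y
    by (rule set_lebesgue_integral_eq_integral(1)[OF integrable_lebesgue_on_interval[OF hi that]])
  \<comment> \<open>An integrable majorant for the sum of the norms of u' and v', by z <= z^2 + 1
    for each of them.\<close>
  define k where "k t = (L2_norm_on ?M (u' t))\<^sup>2 + (L2_norm_on ?M (v' t))\<^sup>2 + 2" for t
  have "integrable (lebesgue_on {0<..<T}) k"
    unfolding k_def using L2(3,4)[unfolded L2L2_iff] finite_measure.integrable_const[OF finite_measure_lebesgue_on_interval]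
    by (intro Bochner_Integration.integrable_add) auto
  then have kI: "k integrable_on {x..y}" if "0 \<le> x" "y \<le> T" for x y
    by (rule set_lebesgue_integral_eq_integral(1)[OF integrable_lebesgue_on_interval[OF _ that]])
  have "AE t in lebesgue_on {0<..<T}. u' t \<in> square_integrable ?M \<and> v' t \<in> square_integrable ?M"
    using L2(3,4)[unfolded L2L2_iff] by (intro AE_conjI bochner_measurable_AE) auto
  then have "AE t in lebesgue. t \<in> {0<..<T} \<longrightarrow> u' t \<in> square_integrable ?M \<and> v' t \<in> square_integrable ?M"
    by (subst (asm) AE_restrict_space_iff) auto
  then obtain Z where Z: "negligible Z" "\<And>t. t \<in> {0<..<T} \<Longrightarrow> t \<notin> Z \<Longrightarrow> u' t \<in> square_integrable ?M \<and> v' t \<in> square_integrable ?M"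
    unfolding eventually_ae_filter_negligible by blast
  have sq: "u t \<in> square_integrable ?M" "v t \<in> square_integrable ?M" if "0 \<le> t" "t < T" for t
    using L2_pathD(1)[OF up] L2_pathD(1)[OF vp] that by auto
  have FTC: "(LINT s|?M. p y s * \<omega> s) - (LINT s|?M. p x s * \<omega> s) = integral {x..y} (\<lambda>r. LINT s|?M. p' r s * \<omega> s)"
    "(\<lambda>r. LINT s|?M. p' r s * \<omega> s) integrable_on {x..y}"
    if p: "has_weak_time_deriv {0<..<T} {0<..<L} p p'" "L2_path {0..<T} L p" and \<omega>: "\<omega> \<in> square_integrable ?M"
      and xy: "0 < x" "x \<le> y" "y < T" for p p' \<omega> x y
  proof -
    have "continuous_on {0<..<T} (\<lambda>t. LINT s|?M. p t s * \<omega> s)"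
      by (rule continuous_on_subset[OF L2_path_inner_continuous[OF p(2) L2_path_const[OF \<omega>]]]) auto
    note F = weak_deriv_FTC[OF has_weak_time_deriv_inner[OF p(1) \<omega>] this xy]
    show "(LINT s|?M. p y s * \<omega> s) - (LINT s|?M. p x s * \<omega> s) = integral {x..y} (\<lambda>r. LINT s|?M. p' r s * \<omega> s)"
      by (rule F(2))
    show "(\<lambda>r. LINT s|?M. p' r s * \<omega> s) integrable_on {x..y}" by (rule set_lebesgue_integral_eq_integral(1)[OF F(1)])
  qed
  define P where "P t = (LINT s|?M. u t s * v t s) - integral {0..t} h" for t
  \<comment> \<open>The fundamental theorem for weak derivatives lives on the open interval, so the
    left end is first kept away from 0 and reached by continuity afterwards.\<close>
  have Pb: "P b = P a" if a: "0 < a" "a \<le> b" for a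
  proof (rule constant_of_small_increments[where f=P and V="\<lambda>t. integral {0..t} k", OF a(2)])
    fix e :: real assume e: "e > 0"
    have up': "L2_path {a..b} L u" and vp': "L2_path {a..b} L v"
      by (rule L2_path_compose[OF up, where f="\<lambda>t. t"] L2_path_compose[OF vp, where f="\<lambda>t. t"]; use a b in auto)+
    obtain d1 where d1: "d1 > 0" "\<And>x y. x \<in> {a..b} \<Longrightarrow> y \<in> {a..b} \<Longrightarrow> \<bar>y - x\<bar> < d1 \<Longrightarrow> L2_norm_on ?M (\<lambda>s. u y s - u x s) < e"
      using L2_path_uniform[OF up' e] by blast
    obtain d2 where d2: "d2 > 0" "\<And>x y. x \<in> {a..b} \<Longrightarrow> y \<in> {a..b} \<Longrightarrow> \<bar>y - x\<bar> < d2 \<Longrightarrow> L2_norm_on ?M (\<lambda>s. v y s - v x s) < e"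
      using L2_path_uniform[OF vp' e] by blast
    show "\<exists>d>0. \<forall>x\<in>{a..b}. \<forall>y\<in>{a..b}. x \<le> y \<and> y - x < d \<longrightarrow> \<bar>P y - P x\<bar> \<le> e * (integral {0..y} k - integral {0..x} k)"
    proof (intro exI[of _ "min d1 d2"] conjI ballI impI)
      show "0 < min d1 d2" using d1 d2 by simp
      fix x y assume xy: "x \<in> {a..b}" "y \<in> {a..b}" "x \<le> y \<and> y - x < min d1 d2"
      have x: "0 < x" "x \<le> y" "y < T" using xy a b by auto
      define H where "H r = (LINT s|?M. u' r s * v y s) + (LINT s|?M. v' r s * u x s) - h r" for r
      have sx: "u x \<in> square_integrable ?M" and sy: "v y \<in> square_integrable ?M" using sq x by auto
      have uv: "(LINT s|?M. u y s * v y s) - (LINT s|?M. u x s * v x s)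
          = integral {x..y} (\<lambda>r. LINT s|?M. u' r s * v y s) + integral {x..y} (\<lambda>r. LINT s|?M. v' r s * u x s)"
        using FTC(1)[OF u up sy x] FTC(1)[OF v vp sx x] by (simp add: mult.commute)
      have comb: "integral {0..y} f = integral {0..x} f + integral {x..y} f" if "f integrable_on {0..y}" for f :: "real \<Rightarrow> real"
        by (rule Henstock_Kurzweil_Integration.integral_combine[symmetric]) (use x that in auto)
      have "(H has_integral integral {x..y} (\<lambda>r. LINT s|?M. u' r s * v y s) + integral {x..y} (\<lambda>r. LINT s|?M. v' r s * u x s) - integral {x..y} h) {x..y}"
        unfolding H_def using x by (intro has_integral_add has_integral_diff integrable_integral FTC(2)[OF u up sy x] FTC(2)[OF v vp sx x] hI) auto
      moreover have "integral {x..y} (\<lambda>r. LINT s|?M. u' r s * v y s) + integral {x..y} (\<lambda>r. LINT s|?M. v' r s * u x s) - integral {x..y} h = P y - P x"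
        using uv comb[OF hI] x by (simp add: P_def)
      ultimately have HP: "(H has_integral P y - P x) {x..y}" by simp
      have HP': "((\<lambda>r. if r \<in> Z then 0 else H r) has_integral P y - P x) {x..y}"
        by (rule has_integral_spike[OF Z(1) _ HP]) auto
      have "\<bar>integral {x..y} (\<lambda>r. if r \<in> Z then 0 else H r)\<bar> \<le> integral {x..y} (\<lambda>r. e * k r)"
      proof (rule integral_norm_bound_integral[of "\<lambda>r. if r \<in> Z then 0 else H r" "{x..y}", unfolded real_norm_def])
        show "(\<lambda>r. if r \<in> Z then 0 else H r) integrable_on {x..y}" using HP' by blast
        show "(\<lambda>r. e * k r) integrable_on {x..y}"
          using integrable_cmul[OF kI[of x y], of e] x by simp
        fix r assume r: "r \<in> {x..y}"
        have rab: "r \<in> {a..b}" and rT: "0 < r" "r < T" using r xy x by auto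
        show "\<bar>if r \<in> Z then 0 else H r\<bar> \<le> e * k r"
        proof (cases "r \<in> Z")
          case False
          have s': "u' r \<in> square_integrable ?M" "v' r \<in> square_integrable ?M" and sr: "u r \<in> square_integrable ?M" "v r \<in> square_integrable ?M"
            using Z(2)[of r] False rT sq[of r] by auto
          have diff: "(LINT s|?M. p s * (q s - q' s)) = (LINT s|?M. p s * q s) - (LINT s|?M. p s * q' s)"
            if "p \<in> square_integrable ?M" "q \<in> square_integrable ?M" "q' \<in> square_integrable ?M" for p q q'
            by (simp add: right_diff_distrib Bochner_Integration.integral_diff square_integrable_mult that)
          have Hr: "H r = (LINT s|?M. u' r s * (v y s - v r s)) + (LINT s|?M. v' r s * (u x s - u r s))"
            unfolding H_def h_def diff[OF s'(1) sy sr(2)] diff[OF s'(2) sx sr(1)] by simp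
          have "\<bar>H r\<bar> \<le> L2_norm_on ?M (u' r) * L2_norm_on ?M (\<lambda>s. v y s - v r s) + L2_norm_on ?M (v' r) * L2_norm_on ?M (\<lambda>s. u x s - u r s)"
            using L2_Cauchy_Schwarz[OF s'(1) square_integrable_diff(1)[OF sy sr(2)]] L2_Cauchy_Schwarz[OF s'(2) square_integrable_diff(1)[OF sx sr(1)]]
            unfolding Hr by linarith
          also have "\<dots> \<le> L2_norm_on ?M (u' r) * e + L2_norm_on ?M (v' r) * e"
          proof (intro add_mono mult_left_mono L2_norm_on_nonneg)
            show "L2_norm_on ?M (\<lambda>s. v y s - v r s) \<le> e" by (rule less_imp_le[OF d2(2)]) (use xy rab r in auto)
            show "L2_norm_on ?M (\<lambda>s. u x s - u r s) \<le> e" by (rule less_imp_le[OF d1(2)]) (use xy rab r in auto)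
          qed
          also have "\<dots> = e * (L2_norm_on ?M (u' r) + L2_norm_on ?M (v' r))" by (simp add: algebra_simps)
          also have "\<dots> \<le> e * k r"
          proof (rule mult_left_mono)
            have "z \<le> z\<^sup>2 + 1" for z :: real
              using zero_le_power2[of "z - 1 / 2"] by (simp add: power2_eq_square algebra_simps)
            from this[of "L2_norm_on ?M (u' r)"] this[of "L2_norm_on ?M (v' r)"]
            show "L2_norm_on ?M (u' r) + L2_norm_on ?M (v' r) \<le> k r" by (simp add: k_def)
          qed (use e in simp)
          finally show ?thesis using False by simp
        qed (use e in \<open>simp add: k_def\<close>)
      qed
      also have "\<dots> = e * (integral {0..y} k - integral {0..x} k)" using comb[OF kI] x by simp
      finally show "\<bar>P y - P x\<bar> \<le> e * (integral {0..y} k - integral {0..x} k)" unfolding integral_unique[OF HP'] .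
    qed
  qed
  have "P 0 = P b"
  proof (cases "b = 0")
    case False
    have "continuous_on {0..b} (\<lambda>t. LINT s|?M. u t s * v t s)"
      by (rule continuous_on_subset[OF L2_path_inner_continuous[OF up vp]]) (use b in auto)
    then have "continuous_on {0..b} P" unfolding P_def using b
      by (intro continuous_on_diff indefinite_integral_continuous_1 hI) auto
    then have "continuous_on (closure {0<..b}) P" using False b by (simp add: closure_greaterThanAtMost)
    then show ?thesis
      by (rule continuous_constant_on_closure) (use Pb False b in \<open>auto simp: closure_greaterThanAtMost\<close>)
  qed simp
  then show "(LINT s|?M. u b s * v b s) - (LINT s|?M. u 0 s * v 0 s) = integral {0..b} h" by (simp add: P_def)
qed

section \<open>Test functions cut off in time\<close>

lemma integral_lebesgue_on_open_interval:
  fixes f :: "real \<Rightarrow> real"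
  assumes "integrable (lebesgue_on {a<..<b}) f"
  shows "integral\<^sup>L (lebesgue_on {a<..<b}) f = integral {a..b} f"
  using lebesgue_integral_eq_integral[OF assms] by (simp add: integral_open_interval_real)

lemma integrable_lebesgue_on_subset:
  fixes f :: "real \<Rightarrow> real"
  assumes "integrable (lebesgue_on J) f" "A \<subseteq> J" "A \<in> sets lebesgue" "J \<in> sets lebesgue"
  shows "integrable (lebesgue_on A) f"
  using set_integrable_subset[of lebesgue J f A] assms by (simp add: set_integrable_iff_integrable_lebesgue_on)

lemma integrable_mult_continuous:
  fixes l p :: "real \<Rightarrow> real"
  assumes l: "integrable (lebesgue_on {a<..<b}) l" and p: "continuous_on {a..b} p"
  shows "integrable (lebesgue_on {a<..<b}) (\<lambda>t. l t * p t)"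
proof -
  have "bounded (p ` {a..b})" by (intro compact_imp_bounded compact_continuous_image p) simp
  then obtain B where B: "\<And>t. t \<in> {a..b} \<Longrightarrow> \<bar>p t\<bar> \<le> B" unfolding bounded_iff real_norm_def by (metis image_eqI)
  show ?thesis
  proof (rule Bochner_Integration.integrable_bound)
    show "integrable (lebesgue_on {a<..<b}) (\<lambda>t. B * l t)" using l by (rule Bochner_Integration.integrable_mult_right)
    have "p \<in> borel_measurable (lebesgue_on {a<..<b})"
      by (intro continuous_imp_measurable_on_sets_lebesgue continuous_on_subset[OF p]) auto
    then show "(\<lambda>t. l t * p t) \<in> borel_measurable (lebesgue_on {a<..<b})"
      by (rule borel_measurable_times[OF borel_measurable_integrable[OF l]])
    show "AE t in lebesgue_on {a<..<b}. norm (l t * p t) \<le> norm (B * l t)"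
    proof (rule AE_I2)
      fix t assume "t \<in> space (lebesgue_on {a<..<b})"
      then have "\<bar>p t\<bar> \<le> \<bar>B\<bar>" using B[of t] by auto
      then have "\<bar>p t\<bar> * \<bar>l t\<bar> \<le> \<bar>B\<bar> * \<bar>l t\<bar>" by (rule mult_right_mono) simp
      then show "norm (l t * p t) \<le> norm (B * l t)" by (simp add: abs_mult mult.commute)
    qed
  qed
qed

text \<open>Bochner measurability asks for no continuity in time, so a difference of solutions may
  be switched off outside a time set and remain admissible as a test function. The zero function is
  passed as a parameter \<open>z\<close> because the value type offers subtraction only.\<close>

lemma bochner_measurable_cutoff:
  fixes z :: "'b::minus"
  assumes f: "bochner_measurable J V N f" and g: "bochner_measurable J V N g" and A: "A \<in> sets lebesgue"
    and V: "\<And>a b. a \<in> V \<Longrightarrow> b \<in> V \<Longrightarrow> a - b \<in> V" "z \<in> V" and N0: "N (z - z) = 0"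
    and cont: "\<And>a an b bn. a \<in> V \<Longrightarrow> (\<And>n. an n \<in> V) \<Longrightarrow> (\<lambda>n. N (an n - a)) \<longlonglongrightarrow> 0 \<Longrightarrow>
       b \<in> V \<Longrightarrow> (\<And>n. bn n \<in> V) \<Longrightarrow> (\<lambda>n. N (bn n - b)) \<longlonglongrightarrow> 0 \<Longrightarrow> (\<lambda>n. N ((an n - bn n) - (a - b))) \<longlonglongrightarrow> 0"
  shows "bochner_measurable J V N (\<lambda>t. if t \<in> A then f t - g t else z)"
proof -
  obtain \<sigma> where \<sigma>: "\<And>n. simple_function (lebesgue_on J) (\<sigma> n)" "\<And>n. \<sigma> n ` J \<subseteq> V"
    "AE t in lebesgue_on J. f t \<in> V \<and> (\<lambda>n. N (\<sigma> n t - f t)) \<longlonglongrightarrow> 0"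
    using f unfolding bochner_measurable_def by blast
  obtain \<tau> where \<tau>: "\<And>n. simple_function (lebesgue_on J) (\<tau> n)" "\<And>n. \<tau> n ` J \<subseteq> V"
    "AE t in lebesgue_on J. g t \<in> V \<and> (\<lambda>n. N (\<tau> n t - g t)) \<longlonglongrightarrow> 0"
    using g unfolding bochner_measurable_def by blast
  show ?thesis unfolding bochner_measurable_def
  proof (intro exI[of _ "\<lambda>n t. if t \<in> A then \<sigma> n t - \<tau> n t else z"] conjI allI)
    fix n
    have A': "{x \<in> space (lebesgue_on J). x \<in> A} \<in> sets (lebesgue_on J)"
      using A by (auto simp: sets_restrict_space intro!: image_eqI[of _ _ A])
    show "simple_function (lebesgue_on J) (\<lambda>t. if t \<in> A then \<sigma> n t - \<tau> n t else z)"
      by (rule simple_function_If[OF simple_function_compose2[OF \<sigma>(1) \<tau>(1)] simple_function_const A'])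
    show "(\<lambda>t. if t \<in> A then \<sigma> n t - \<tau> n t else z) ` J \<subseteq> V"
      using \<sigma>(2)[of n] \<tau>(2)[of n] V by auto
    show "AE t in lebesgue_on J. (if t \<in> A then f t - g t else z) \<in> V \<and>
        (\<lambda>n. N ((if t \<in> A then \<sigma> n t - \<tau> n t else z) - (if t \<in> A then f t - g t else z))) \<longlonglongrightarrow> 0"
      using \<sigma>(3) \<tau>(3) AE_space
    proof eventually_elim
      case (elim t)
      then have "t \<in> J" by simp
      then have "\<sigma> n t \<in> V" "\<tau> n t \<in> V" for n using \<sigma>(2) \<tau>(2) by blast+
      then show ?case using elim V N0 cont[of "f t" "\<lambda>n. \<sigma> n t" "g t" "\<lambda>n. \<tau> n t"] by auto
    qed
  qed
qed

text \<open>Each of the two seminorms is at most the norm, and the norm is at most their sum; this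
  crude comparison accounts for the factor 2.\<close>

lemma W1p_norm_diff_le:
  assumes f: "f \<in> W1p_per 2 L" and g: "g \<in> W1p_per 2 L" and L: "L > 0"
  shows "W1p_norm 2 {0<..<L} (f - g) \<le> 2 * (W1p_norm 2 {0<..<L} f + W1p_norm 2 {0<..<L} g)"
proof -
  let ?N = "L2_norm_on (lebesgue_on {0<..<L})" and ?d = "weak_deriv {0<..<L}"
  have tri: "?N (\<lambda>x. p x - q x) \<le> ?N p + ?N q"
    if "p \<in> square_integrable (lebesgue_on {0<..<L})" "q \<in> square_integrable (lebesgue_on {0<..<L})" for p q
    using L2_norm_on_triangle[OF that(1) square_integrable_cmult[OF that(2), of "-1"]] by (simp add: L2_norm_on_def)
  have "?N (?d (f - g)) = ?N (\<lambda>x. ?d f x - ?d g x)"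
    by (intro L2_norm_on_cong_AE W1p_per_diff[OF f g L] square_integrableD(1) W1p_perD(4)[OF _ L] square_integrable_diff f g)
  also have "\<dots> \<le> ?N (?d f) + ?N (?d g)" by (intro tri W1p_perD(4)[OF _ L] f g)
  finally show ?thesis
    using W1p_norm_le[of L "f - g"] tri[OF W1p_perD(2)[OF f L] W1p_perD(2)[OF g L]]
      W1p_norm_ge[of L f] W1p_norm_ge[of L g] by (simp add: fun_diff_def)
qed

text \<open>Even for the zero function \<open>weak_deriv\<close> is an arbitrary choice, so it is
  zero only up to a null set.\<close>

lemma W1p_per_zero:
  assumes L: "L > 0"
  shows "(\<lambda>_. 0) \<in> W1p_per 2 L" "AE s in lebesgue_on {0<..<L}. weak_deriv {0<..<L} (\<lambda>_. 0) s = 0"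
    "W1p_norm 2 {0<..<L} (\<lambda>_. 0) = 0" "W1p_norm 2 {0<..<L} ((\<lambda>_. 0) - (\<lambda>_. 0)) = 0"
proof -
  have wd: "has_weak_deriv {0<..<L} (\<lambda>_. 0) (\<lambda>_. 0)"
    by (rule has_weak_deriv_continuous_derivative[OF L]) simp_all
  show "(\<lambda>_. 0) \<in> W1p_per 2 L"
    by (rule W1p_perI[OF _ wd]) (simp_all add: C_per_def square_integrable_zero)
  show d: "AE s in lebesgue_on {0<..<L}. weak_deriv {0<..<L} (\<lambda>_. 0) s = 0" by (rule weak_deriv_AE(2)[OF L wd])
  have "(LINT s|lebesgue_on {0<..<L}. (weak_deriv {0<..<L} (\<lambda>_. 0) s)\<^sup>2) = 0"
    by (rule integral_eq_zero_AE) (use d in eventually_elim, simp)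
  then show *: "W1p_norm 2 {0<..<L} (\<lambda>_. 0) = 0" by (simp add: W1p_norm_2 L2_norm_on_def)
  have "(\<lambda>_. 0) - (\<lambda>_. 0) = (\<lambda>_::real. 0::real)" by (simp add: fun_eq_iff)
  with * show "W1p_norm 2 {0<..<L} ((\<lambda>_. 0) - (\<lambda>_. 0)) = 0" by simp
qed

lemma W1p_bochner_Linf_cutoff:
  assumes f: "f \<in> bochner_Linf {0<..<T} (W1p_per 2 L) (W1p_norm 2 {0<..<L})"
    and g: "g \<in> bochner_Linf {0<..<T} (W1p_per 2 L) (W1p_norm 2 {0<..<L})"
    and A: "A \<in> sets lebesgue" and L: "L > 0"
  shows "(\<lambda>t. if t \<in> A then f t - g t else (\<lambda>_. 0)) \<in> bochner_Linf {0<..<T} (W1p_per 2 L) (W1p_norm 2 {0<..<L})"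
proof -
  let ?V = "W1p_per 2 L" and ?N = "W1p_norm 2 {0<..<L}"
  have bm: "bochner_measurable {0<..<T} ?V ?N f" "bochner_measurable {0<..<T} ?V ?N g"
    using f g unfolding bochner_Linf_def by auto
  obtain C D where CD: "AE t in lebesgue_on {0<..<T}. ?N (f t) \<le> C" "AE t in lebesgue_on {0<..<T}. ?N (g t) \<le> D"
    using f g unfolding bochner_Linf_def by auto
  have nn: "0 \<le> ?N h" for h using W1p_norm_ge(1)[of L h] L2_norm_on_nonneg order_trans by blast
  have "bochner_measurable {0<..<T} ?V ?N (\<lambda>t. if t \<in> A then f t - g t else (\<lambda>_. 0))"
  proof (rule bochner_measurable_cutoff[OF bm A])
    show "(\<lambda>_. 0) \<in> ?V" "?N ((\<lambda>_. 0) - (\<lambda>_. 0)) = 0" by (rule W1p_per_zero[OF L])+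
    show "a - b \<in> ?V" if "a \<in> ?V" "b \<in> ?V" for a b by (rule W1p_per_diff(1)[OF that L])
    fix a b :: "real \<Rightarrow> real" and an bn :: "nat \<Rightarrow> real \<Rightarrow> real"
    assume a: "a \<in> ?V" "\<And>n. an n \<in> ?V" "(\<lambda>n. ?N (an n - a)) \<longlonglongrightarrow> 0"
      and b: "b \<in> ?V" "\<And>n. bn n \<in> ?V" "(\<lambda>n. ?N (bn n - b)) \<longlonglongrightarrow> 0"
    show "(\<lambda>n. ?N ((an n - bn n) - (a - b))) \<longlonglongrightarrow> 0"
    proof (rule tendsto_zero_mono[OF _ nn])
      show "(\<lambda>n. 2 * (?N (an n - a) + ?N (bn n - b))) \<longlonglongrightarrow> 0"
        using tendsto_mult_left[OF tendsto_add[OF a(3) b(3)], of 2] by simp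
      fix n
      have "(an n - bn n) - (a - b) = (an n - a) - (bn n - b)" by (simp add: fun_eq_iff)
      then show "?N ((an n - bn n) - (a - b)) \<le> 2 * (?N (an n - a) + ?N (bn n - b))"
        by (simp only:) (rule W1p_norm_diff_le[OF W1p_per_diff(1)[OF a(2,1) L] W1p_per_diff(1)[OF b(2,1) L] L])
    qed
  qed
  moreover have "AE t in lebesgue_on {0<..<T}. ?N (if t \<in> A then f t - g t else (\<lambda>_. 0)) \<le> 2 * (\<bar>C\<bar> + \<bar>D\<bar>)"
    using CD bochner_measurable_AE[OF bm(1)] bochner_measurable_AE[OF bm(2)]
  proof eventually_elim
    case (elim t)
    then show ?case using W1p_norm_diff_le[OF elim(3,4) L] W1p_per_zero(3)[OF L] by auto
  qed
  ultimately show ?thesis unfolding bochner_Linf_def by blast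
qed

text \<open>Gives integrability in time of the gradient term on its own, so that the weak equation
  can be split into separate pieces. The constant c will be the slope of \<open>phi\<close>.\<close>

lemma W1p_gradient_pairing_integrable:
  assumes f: "f \<in> bochner_Linf {0<..<T} (W1p_per 2 L) (W1p_norm 2 {0<..<L})"
    and g: "g \<in> bochner_Linf {0<..<T} (W1p_per 2 L) (W1p_norm 2 {0<..<L})" and L: "L > 0"
  shows "integrable (lebesgue_on {0<..<T}) (\<lambda>t. LINT s|lebesgue_on {0<..<L}. (weak_deriv {0<..<L} (f t) s + c) * weak_deriv {0<..<L} (g t) s)"
proof -
  let ?M = "lebesgue_on {0<..<L}" and ?V = "W1p_per 2 L" and ?N = "W1p_norm 2 {0<..<L}" and ?d = "weak_deriv {0<..<L}"
  have bm: "bochner_measurable {0<..<T} ?V ?N f" "bochner_measurable {0<..<T} ?V ?N g"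
    using f g unfolding bochner_Linf_def by auto
  obtain C D where CD: "AE t in lebesgue_on {0<..<T}. ?N (f t) \<le> C" "AE t in lebesgue_on {0<..<T}. ?N (g t) \<le> D"
    using f g unfolding bochner_Linf_def by auto
  have const: "(\<lambda>_. c) \<in> square_integrable ?M" by (rule continuous_square_integrable(1)) (rule continuous_on_const)
  have sq: "?d a \<in> square_integrable ?M" "(\<lambda>s. ?d a s + c) \<in> square_integrable ?M" if "a \<in> ?V" for a
    by (intro square_integrable_add const W1p_perD(4)[OF that L])+
  have lim: "(\<lambda>n. L2_norm_on ?M (\<lambda>s. ?d (an n) s - ?d a s)) \<longlonglongrightarrow> 0"
    if "a \<in> ?V" "\<And>n. an n \<in> ?V" "(\<lambda>n. ?N (an n - a)) \<longlonglongrightarrow> 0" for a an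
  proof (rule tendsto_zero_mono[OF that(3) L2_norm_on_nonneg])
    fix n
    have "L2_norm_on ?M (?d (an n - a)) = L2_norm_on ?M (\<lambda>s. ?d (an n) s - ?d a s)"
      by (rule L2_norm_on_cong_AE[OF W1p_per_diff(2)[OF that(2,1) L]])
         (intro square_integrableD(1) square_integrable_diff sq W1p_per_diff(1)[OF _ _ L] that)+
    then show "L2_norm_on ?M (\<lambda>s. ?d (an n) s - ?d a s) \<le> ?N (an n - a)" using W1p_norm_ge(2)[of L "an n - a"] by simp
  qed
  show ?thesis
  proof (rule finite_measure.integrable_const_bound[OF finite_measure_lebesgue_on_interval])
    show "(\<lambda>t. LINT s|?M. (?d (f t) s + c) * ?d (g t) s) \<in> borel_measurable (lebesgue_on {0<..<T})"
    proof (rule bochner_measurable_compose2[OF bm, where \<Phi>="\<lambda>a b. LINT s|?M. (?d a s + c) * ?d b s"])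
      fix a b :: "real \<Rightarrow> real" and an bn :: "nat \<Rightarrow> real \<Rightarrow> real"
      assume a: "a \<in> ?V" "\<And>n. an n \<in> ?V" "(\<lambda>n. ?N (an n - a)) \<longlonglongrightarrow> 0"
        and b: "b \<in> ?V" "\<And>n. bn n \<in> ?V" "(\<lambda>n. ?N (bn n - b)) \<longlonglongrightarrow> 0"
      show "(\<lambda>n. LINT s|?M. (?d (an n) s + c) * ?d (bn n) s) \<longlonglongrightarrow> (LINT s|?M. (?d a s + c) * ?d b s)"
        by (rule L2_inner_tendsto[OF sq(2)[OF a(2)] sq(2)[OF a(1)] _ sq(1)[OF b(2)] sq(1)[OF b(1)] lim[OF b]])
           (use lim[OF a] in simp)
    qed simp
    show "AE t in lebesgue_on {0<..<T}. norm (LINT s|?M. (?d (f t) s + c) * ?d (g t) s) \<le> (\<bar>C\<bar> + L2_norm_on ?M (\<lambda>_. c)) * \<bar>D\<bar>"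
      using CD bochner_measurable_AE[OF bm(1)] bochner_measurable_AE[OF bm(2)]
    proof eventually_elim
      case (elim t)
      have "norm (LINT s|?M. (?d (f t) s + c) * ?d (g t) s) \<le> L2_norm_on ?M (\<lambda>s. ?d (f t) s + c) * L2_norm_on ?M (?d (g t))"
        unfolding real_norm_def by (rule L2_Cauchy_Schwarz[OF sq(2)[OF elim(3)] sq(1)[OF elim(4)]])
      also have "\<dots> \<le> (\<bar>C\<bar> + L2_norm_on ?M (\<lambda>_. c)) * \<bar>D\<bar>"
      proof (rule mult_mono)
        show "L2_norm_on ?M (\<lambda>s. ?d (f t) s + c) \<le> \<bar>C\<bar> + L2_norm_on ?M (\<lambda>_. c)"
          using L2_norm_on_triangle[OF sq(1)[OF elim(3)] const] W1p_norm_ge(2)[of L "f t"] elim(1) by linarith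
        show "L2_norm_on ?M (?d (g t)) \<le> \<bar>D\<bar>" using W1p_norm_ge(2)[of L "g t"] elim(2) by linarith
        show "0 \<le> \<bar>C\<bar> + L2_norm_on ?M (\<lambda>_. c)" by (simp add: L2_norm_on_nonneg)
      qed (rule L2_norm_on_nonneg)
      finally show ?case .
    qed
  qed
qed

text \<open>If both curves are closed, the linear part of the difference of the tangents integrates to zero,
  so that pairing a multiplier term with the difference is a quadratic expression.\<close>

lemma closed_angle_pairing:
  fixes f g :: "real \<Rightarrow> real"
  assumes f: "continuous_on {0..L} f" and g: "continuous_on {0..L} g"
    and closed: "(LINT s|lebesgue_on {0<..<L}. cos (f s)) = 0" "(LINT s|lebesgue_on {0<..<L}. sin (f s)) = 0"
      "(LINT s|lebesgue_on {0<..<L}. cos (g s)) = 0" "(LINT s|lebesgue_on {0<..<L}. sin (g s)) = 0"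
  shows "\<bar>LINT s|lebesgue_on {0<..<L}. cos (f s) * (g s - f s)\<bar> \<le> (LINT s|lebesgue_on {0<..<L}. (g s - f s)\<^sup>2)"
    "\<bar>LINT s|lebesgue_on {0<..<L}. sin (f s) * (g s - f s)\<bar> \<le> (LINT s|lebesgue_on {0<..<L}. (g s - f s)\<^sup>2)"
proof -
  let ?M = "lebesgue_on {0<..<L}"
  have i: "integrable ?M (\<lambda>s. sin (f s))" "integrable ?M (\<lambda>s. sin (g s))" "integrable ?M (\<lambda>s. cos (f s))" "integrable ?M (\<lambda>s. cos (g s))"
    "integrable ?M (\<lambda>s. (g s - f s) * cos (f s))" "integrable ?M (\<lambda>s. (g s - f s) * sin (f s))" "integrable ?M (\<lambda>s. (g s - f s)\<^sup>2)"
    by (intro continuous_square_integrable(2) continuous_intros f g)+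
  have "(LINT s|?M. sin (g s) - sin (f s) - (g s - f s) * cos (f s)) = - (LINT s|?M. cos (f s) * (g s - f s))"
    using closed i by (simp add: mult.commute)
  moreover have "\<bar>LINT s|?M. sin (g s) - sin (f s) - (g s - f s) * cos (f s)\<bar> \<le> (LINT s|?M. (g s - f s)\<^sup>2)"
    by (rule order_trans[OF integral_abs_bound], rule integral_mono) (intro Bochner_Integration.integrable_abs Bochner_Integration.integrable_diff i abs_trig_taylor)+
  ultimately show "\<bar>LINT s|?M. cos (f s) * (g s - f s)\<bar> \<le> (LINT s|?M. (g s - f s)\<^sup>2)" by simp
  have "(LINT s|?M. cos (g s) - cos (f s) + (g s - f s) * sin (f s)) = (LINT s|?M. sin (f s) * (g s - f s))"
    using closed i by (simp add: mult.commute)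
  moreover have "\<bar>LINT s|?M. cos (g s) - cos (f s) + (g s - f s) * sin (f s)\<bar> \<le> (LINT s|?M. (g s - f s)\<^sup>2)"
    by (rule order_trans[OF integral_abs_bound], rule integral_mono)
       (intro Bochner_Integration.integrable_abs Bochner_Integration.integrable_diff Bochner_Integration.integrable_add i abs_trig_taylor)+
  ultimately show "\<bar>LINT s|?M. sin (f s) * (g s - f s)\<bar> \<le> (LINT s|?M. (g s - f s)\<^sup>2)" by simp
qed

section \<open>Uniqueness of weak solutions\<close>

text \<open>A weak solution with its time derivative and multipliers named, so that two solutions
  with different multipliers can be interpreted side by side.\<close>

locale weak_solution_data =
  fixes L T :: real and \<eta> :: nat and u u' :: "real \<Rightarrow> real \<Rightarrow> real" and l1 l2 :: "real \<Rightarrow> real"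
  assumes L: "L > 0" and T: "T > 0"
    and X: "u \<in> bochner_Linf {0<..<T} (W1p_per 2 L) (W1p_norm 2 {0<..<L})"
    and time_deriv: "has_weak_time_deriv {0<..<T} {0<..<L} u u'"
    and path: "L2_path {0..<T} L u"
    and W1p: "\<And>t. t \<in> {0..<T} \<Longrightarrow> u t \<in> W1p_per 2 L"
    and l1: "l1 \<in> square_integrable (lebesgue_on {0<..<T})" and l2: "l2 \<in> square_integrable (lebesgue_on {0<..<T})"
    and weak: "\<And>\<phi>. \<phi> \<in> bochner_Linf {0<..<T} (W1p_per 2 L) (W1p_norm 2 {0<..<L}) \<Longrightarrow>
      (LINT t|lebesgue_on {0<..<T}. LINT s|lebesgue_on {0<..<L}.
        (u' t s - l1 t * sin (u t s + phi L \<eta> s) + l2 t * cos (u t s + phi L \<eta> s)) * \<phi> t s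
        + \<bar>weak_deriv {0<..<L} (\<lambda>x. u t x + phi L \<eta> x) s\<bar> powr (2 - 2)
        * weak_deriv {0<..<L} (\<lambda>x. u t x + phi L \<eta> x) s * weak_deriv {0<..<L} (\<phi> t) s) = 0"
    and closed: "\<And>t. t \<in> {0..<T} \<Longrightarrow> closed_angle L \<eta> (u t)"

lemma weak_solution_data_exists:
  assumes u: "weak_solution 2 L \<eta> u0 T u" and L: "L > 0" and T: "T > 0"
  obtains u' l1 l2 where "weak_solution_data L T \<eta> u u' l1 l2" "u 0 = u0"
proof -
  let ?X = "bochner_Linf {0<..<T} (W1p_per 2 L) (W1p_norm 2 {0<..<L})" and ?u' = "weak_time_deriv {0<..<T} {0<..<L} u"
  note u' = u[unfolded weak_solution_def Let_def]
  from u' obtain l1 l2 where l: "l1 \<in> Lp_space 2 {0<..<T}" "l2 \<in> Lp_space 2 {0<..<T}"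
    and weak: "\<forall>\<phi>\<in>?X. (LINT t|lebesgue_on {0<..<T}. LINT s|lebesgue_on {0<..<L}.
        (?u' t s - l1 t * sin (u t s + phi L \<eta> s) + l2 t * cos (u t s + phi L \<eta> s)) * \<phi> t s
        + \<bar>weak_deriv {0<..<L} (\<lambda>x. u t x + phi L \<eta> x) s\<bar> powr (2 - 2)
        * weak_deriv {0<..<L} (\<lambda>x. u t x + phi L \<eta> x) s * weak_deriv {0<..<L} (\<phi> t) s) = 0" by blast
  from u' have X: "u \<in> ?X" and H: "u \<in> H1L2 {0<..<T} {0<..<L}" and reg: "time_regular 2 L T u"
    and closed: "\<forall>t\<in>{0..<T}. closed_angle L \<eta> (u t)" and u0: "u 0 = u0" by blast+
  obtain v where v: "has_weak_time_deriv {0<..<T} {0<..<L} u v" using H unfolding H1L2_def by blast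
  have td: "has_weak_time_deriv {0<..<T} {0<..<L} u ?u'" by (rule weak_time_deriv_properties(1)[OF T L v])
  have W: "u t \<in> W1p_per 2 L" if "t \<in> {0..<T}" for t using reg that unfolding time_regular_def by blast
  have path: "L2_path {0..<T} L u" unfolding L2_path_def
  proof (intro ballI conjI allI impI)
    fix t assume t: "t \<in> {0..<T}"
    show "u t \<in> square_integrable (lebesgue_on {0<..<L})" by (rule W1p_perD(2)[OF W[OF t] L])
  next
    fix t x assume t: "t \<in> {0..<T}" and x: "\<forall>n. x n \<in> {0..<T}" "x \<longlonglongrightarrow> t"
    define F where "F r = L2_norm_on (lebesgue_on {0<..<L}) (\<lambda>s. u r s - u t s)" for r
    have "(F \<longlongrightarrow> 0) (at t within {0..<T})"
      using reg t unfolding time_regular_def Lp_norm_2 fun_diff_def F_def by blast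
    moreover have "F t = 0" by (simp add: F_def L2_norm_on_def)
    ultimately have "continuous (at t within {0..<T}) F" by (simp add: continuous_within)
    then have "(\<lambda>n. F (x n)) \<longlonglongrightarrow> F t"
      using x unfolding continuous_within_sequentially comp_def by blast
    then show "(\<lambda>n. L2_norm_on (lebesgue_on {0<..<L}) (\<lambda>s. u (x n) s - u t s)) \<longlonglongrightarrow> 0"
      using \<open>F t = 0\<close> by (simp add: F_def)
  qed
  have "weak_solution_data L T \<eta> u ?u' l1 l2"
    using L T X td path W l[unfolded Lp_space_2] weak closed by unfold_locales blast+
  then show ?thesis using u0 by (rule that)
qed

context weak_solution_data
begin

lemma integrable_multipliers: "integrable (lebesgue_on {0<..<T}) l1" "integrable (lebesgue_on {0<..<T}) l2"
  using square_integrable_interval_integrable(1) l1 l2 by blast+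

lemma phi_continuous: "continuous_on S (phi L \<eta>)"
  unfolding phi_def[abs_def] by (intro continuous_intros) (use L in simp)

lemma slice_continuous: "t \<in> {0..<T} \<Longrightarrow> continuous_on S (u t)"
  using W1p_perD(1)[OF W1p L] by (auto simp: C_per_def intro: continuous_on_subset)

lemma trig_paths:
  "L2_path {0..<T} L (\<lambda>t s. sin (u t s + phi L \<eta> s))" "L2_path {0..<T} L (\<lambda>t s. cos (u t s + phi L \<eta> s))"
proof -
  have m: "phi L \<eta> \<in> borel_measurable (lebesgue_on {0<..<L})"
    by (intro continuous_imp_measurable_on_sets_lebesgue phi_continuous) simp
  show "L2_path {0..<T} L (\<lambda>t s. sin (u t s + phi L \<eta> s))"
    by (rule L2_path_Lipschitz[OF path m, where h=sin]) (auto intro: continuous_intros abs_sin_diff_le)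
  show "L2_path {0..<T} L (\<lambda>t s. cos (u t s + phi L \<eta> s))"
    by (rule L2_path_Lipschitz[OF path m, where h=cos]) (auto intro: continuous_intros abs_cos_diff_le)
qed

text \<open>The space integral of the weak equation of u, tested with g - f and split into pairings
  that are each integrable in time. For two solutions f and g it is used once with u = f and once
  with u = g.\<close>

definition tested :: "(real \<Rightarrow> real \<Rightarrow> real) \<Rightarrow> (real \<Rightarrow> real \<Rightarrow> real) \<Rightarrow> real \<Rightarrow> real" where
  "tested f g t =
     ((LINT s|lebesgue_on {0<..<L}. u' t s * g t s) - (LINT s|lebesgue_on {0<..<L}. u' t s * f t s))
     - l1 t * (LINT s|lebesgue_on {0<..<L}. sin (u t s + phi L \<eta> s) * (g t s - f t s))
     + l2 t * (LINT s|lebesgue_on {0<..<L}. cos (u t s + phi L \<eta> s) * (g t s - f t s))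
     + ((LINT s|lebesgue_on {0<..<L}. (weak_deriv {0<..<L} (u t) s + 2 * pi * real \<eta> / L) * weak_deriv {0<..<L} (g t) s)
        - (LINT s|lebesgue_on {0<..<L}. (weak_deriv {0<..<L} (u t) s + 2 * pi * real \<eta> / L) * weak_deriv {0<..<L} (f t) s))"

lemma weak_deriv_angle:
  assumes t: "t \<in> {0..<T}"
  shows "AE s in lebesgue_on {0<..<L}. weak_deriv {0<..<L} (\<lambda>x. u t x + phi L \<eta> x) s = weak_deriv {0<..<L} (u t) s + 2 * pi * real \<eta> / L"
proof -
  have "(phi L \<eta> has_real_derivative 2 * pi * real \<eta> / L) (at x)" for x
    unfolding phi_def[abs_def] using L by (auto intro!: derivative_eq_intros)
  then have "has_weak_deriv {0<..<L} (phi L \<eta>) (\<lambda>_. 2 * pi * real \<eta> / L)"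
    by (intro has_weak_deriv_continuous_derivative L continuous_on_const)
  from has_weak_deriv_linear[OF L W1p_perD(3)[OF W1p[OF t] L] this, of 1]
  have "has_weak_deriv {0<..<L} (\<lambda>x. u t x + phi L \<eta> x) (\<lambda>x. weak_deriv {0<..<L} (u t) x + 2 * pi * real \<eta> / L)" by simp
  then show ?thesis by (rule weak_deriv_AE(2)[OF L])
qed

lemma tested_integral:
  assumes f: "weak_solution_data L T \<eta> f f' a1 a2" and g: "weak_solution_data L T \<eta> g g' b1 b2" and b: "b \<in> {0<..<T}"
  shows "integrable (lebesgue_on {0<..<b}) (tested f g)" "(LINT t|lebesgue_on {0<..<b}. tested f g t) = 0"
proof -
  let ?M = "lebesgue_on {0<..<L}" and ?J = "lebesgue_on {0<..<T}" and ?d = "weak_deriv {0<..<L}" and ?c = "2 * pi * real \<eta> / L"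
  let ?sin = "\<lambda>t s. sin (u t s + phi L \<eta> s)" and ?cos = "\<lambda>t s. cos (u t s + phi L \<eta> s)"
  interpret f: weak_solution_data L T \<eta> f f' a1 a2 by (rule f)
  interpret g: weak_solution_data L T \<eta> g g' b1 b2 by (rule g)
  have sub: "integrable (lebesgue_on {0<..<b}) p" if "integrable ?J p" for p :: "real \<Rightarrow> real"
    by (rule integrable_lebesgue_on_subset[OF that]) (use b in auto)
  have u'L: "u' \<in> L2L2 {0<..<T} {0<..<L}" and fL: "f \<in> L2L2 {0<..<T} {0<..<L}" and gL: "g \<in> L2L2 {0<..<T} {0<..<L}"
    using time_deriv f.time_deriv g.time_deriv unfolding has_weak_time_deriv_def by blast+
  have pc: "continuous_on {0..b} (\<lambda>t. LINT s|?M. p t s * (g t s - f t s))" if "L2_path {0..<T} L p" for p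
    by (rule continuous_on_subset[OF L2_path_inner_continuous[OF that L2_path_diff[OF g.path f.path]]]) (use b in auto)
  show Qi: "integrable (lebesgue_on {0<..<b}) (tested f g)"
    unfolding tested_def[abs_def]
    by (intro Bochner_Integration.integrable_add Bochner_Integration.integrable_diff integrable_mult_continuous pc trig_paths
        sub integrable_multipliers L2L2_inner_integrable u'L fL gL W1p_gradient_pairing_integrable X f.X g.X L) auto
  \<comment> \<open>The cut at b localises the weak equation to (0, b), which produces an inequality
    for each b, as Gronwall's argument requires.\<close>
  define \<phi> where "\<phi> t = (if t \<in> {0<..<b} then g t - f t else (\<lambda>_. 0))" for t
  have \<phi>: "\<phi> \<in> bochner_Linf {0<..<T} (W1p_per 2 L) (W1p_norm 2 {0<..<L})"
    unfolding \<phi>_def by (rule W1p_bochner_Linf_cutoff[OF g.X f.X _ L]) simp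
  have "0 = (LINT t|?J. LINT s|?M. (u' t s - l1 t * ?sin t s + l2 t * ?cos t s) * \<phi> t s
        + \<bar>?d (\<lambda>x. u t x + phi L \<eta> x) s\<bar> powr (2 - 2) * ?d (\<lambda>x. u t x + phi L \<eta> x) s * ?d (\<phi> t) s)"
    by (rule weak[OF \<phi>, symmetric])
  also have "\<dots> = (LINT t|?J. (if t \<in> {0<..<b} then tested f g t else 0))"
  proof (rule integral_cong_AE_lebesgue_on)
    show "(\<lambda>t. if t \<in> {0<..<b} then tested f g t else 0) \<in> borel_measurable ?J"
      by (rule borel_measurable_integrable, subst integral_lebesgue_on_if(1)) (use Qi b in auto)
    have "AE t in ?J. u' t \<in> square_integrable ?M"
      using u'L unfolding L2L2_iff by (blast intro: bochner_measurable_AE)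
    then show "AE t in ?J. (LINT s|?M. (u' t s - l1 t * ?sin t s + l2 t * ?cos t s) * \<phi> t s
        + \<bar>?d (\<lambda>x. u t x + phi L \<eta> x) s\<bar> powr (2 - 2) * ?d (\<lambda>x. u t x + phi L \<eta> x) s * ?d (\<phi> t) s)
        = (if t \<in> {0<..<b} then tested f g t else 0)"
    proof eventually_elim
      case (elim t)
      show ?case
      proof (cases "t \<in> {0<..<b}")
        case False
        have \<phi>t0: "\<phi> t = (\<lambda>_. 0)" unfolding \<phi>_def by (rule if_not_P[OF False])
        have "(LINT s|?M. (u' t s - l1 t * ?sin t s + l2 t * ?cos t s) * \<phi> t s
          + \<bar>?d (\<lambda>x. u t x + phi L \<eta> x) s\<bar> powr (2 - 2) * ?d (\<lambda>x. u t x + phi L \<eta> x) s * ?d (\<phi> t) s) = 0"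
          by (rule integral_eq_zero_AE, rule AE_mp[OF W1p_per_zero(2)[OF L]], rule AE_I2) (simp add: \<phi>t0)
        then show ?thesis unfolding if_not_P[OF False] .
      next
        case True
        then have t: "t \<in> {0..<T}" using b by auto
        have \<phi>t: "\<phi> t = g t - f t" unfolding \<phi>_def by (rule if_P[OF True])
        have const: "(\<lambda>_. ?c) \<in> square_integrable ?M" by (rule continuous_square_integrable(1)) (rule continuous_on_const)
        have sq: "f t \<in> square_integrable ?M" "g t \<in> square_integrable ?M" "(\<lambda>s. g t s - f t s) \<in> square_integrable ?M"
          "?d (f t) \<in> square_integrable ?M" "?d (g t) \<in> square_integrable ?M" "(\<lambda>s. ?d (u t) s + ?c) \<in> square_integrable ?M"
          "?sin t \<in> square_integrable ?M" "?cos t \<in> square_integrable ?M"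
          by (intro W1p_perD(2,4)[OF _ L] W1p f.W1p g.W1p t square_integrable_diff square_integrable_add const
              L2_pathD(1)[OF trig_paths(1)] L2_pathD(1)[OF trig_paths(2)])+
        note i = square_integrable_mult[OF elim sq(1)] square_integrable_mult[OF elim sq(2)]
          square_integrable_mult[OF sq(7,3)] square_integrable_mult[OF sq(8,3)]
          square_integrable_mult[OF sq(6,4)] square_integrable_mult[OF sq(6,5)]
        let ?E = "\<lambda>s. (u' t s * g t s - u' t s * f t s) - l1 t * (?sin t s * (g t s - f t s)) + l2 t * (?cos t s * (g t s - f t s))
          + ((?d (u t) s + ?c) * ?d (g t) s - (?d (u t) s + ?c) * ?d (f t) s)"
        have iE: "integrable ?M ?E"
          by (intro Bochner_Integration.integrable_add Bochner_Integration.integrable_diff Bochner_Integration.integrable_mult_right i)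
        have "(LINT s|?M. (u' t s - l1 t * ?sin t s + l2 t * ?cos t s) * \<phi> t s
          + \<bar>?d (\<lambda>x. u t x + phi L \<eta> x) s\<bar> powr (2 - 2) * ?d (\<lambda>x. u t x + phi L \<eta> x) s * ?d (\<phi> t) s) = (LINT s|?M. ?E s)"
        proof (rule integral_cong_AE_lebesgue_on[OF borel_measurable_integrable[OF iE]])
          show "AE s in ?M. (u' t s - l1 t * ?sin t s + l2 t * ?cos t s) * \<phi> t s
              + \<bar>?d (\<lambda>x. u t x + phi L \<eta> x) s\<bar> powr (2 - 2) * ?d (\<lambda>x. u t x + phi L \<eta> x) s * ?d (\<phi> t) s = ?E s"
            using weak_deriv_angle[OF t] W1p_per_diff(2)[OF g.W1p[OF t] f.W1p[OF t] L]
          proof eventually_elim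
            case (elim s)
            have "\<bar>z\<bar> powr (2 - 2) * z = z" for z :: real by simp
            then show ?case unfolding \<phi>t elim by (simp only: fun_diff_def) (simp only: algebra_simps)
          qed
        qed simp
        also have "\<dots> = tested f g t"
          unfolding tested_def using i by simp
        finally show ?thesis unfolding if_P[OF True] .
      qed
    qed
  qed simp
  also have "\<dots> = (LINT t|lebesgue_on {0<..<b}. tested f g t)"
    by (rule integral_lebesgue_on_if(2)) (use b in auto)
  finally show "(LINT t|lebesgue_on {0<..<b}. tested f g t) = 0" by simp
qed

end

theorem weak_solution_unique:
  assumes L: "L > 0" and T: "T > 0" and v1: "weak_solution 2 L \<eta> u0 T v1" and v2: "weak_solution 2 L \<eta> u0 T v2"
    and t0: "t0 \<in> {0..<T}"
  shows "v1 t0 = v2 t0"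
proof -
  obtain v1' k1 k2 where d1: "weak_solution_data L T \<eta> v1 v1' k1 k2" and v10: "v1 0 = u0"
    by (rule weak_solution_data_exists[OF v1 L T])
  obtain v2' l1 l2 where d2: "weak_solution_data L T \<eta> v2 v2' l1 l2" and v20: "v2 0 = u0"
    by (rule weak_solution_data_exists[OF v2 L T])
  interpret A: weak_solution_data L T \<eta> v1 v1' k1 k2 by (rule d1)
  interpret B: weak_solution_data L T \<eta> v2 v2' l1 l2 by (rule d2)
  let ?M = "lebesgue_on {0<..<L}" and ?J = "lebesgue_on {0<..<T}" and ?d = "weak_deriv {0<..<L}" and ?c = "2 * pi * real \<eta> / L"
  define g where "g t = (LINT s|?M. (v2 t s - v1 t s)\<^sup>2)" for t
  define m where "m t = \<bar>k1 t\<bar> + \<bar>k2 t\<bar> + \<bar>l1 t\<bar> + \<bar>l2 t\<bar>" for t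
  \<comment> \<open>Half the time derivative of the squared L2 distance, expanded into pairings of
    the weak time derivatives with the two solutions.\<close>
  define D where "D t = ((LINT s|?M. v2' t s * v2 t s) - (LINT s|?M. v2' t s * v1 t s))
    - ((LINT s|?M. v1' t s * v2 t s) - (LINT s|?M. v1' t s * v1 t s))" for t
  have g_nonneg: "g t \<ge> 0" for t unfolding g_def by simp
  have g_zero: "g 0 = 0" by (simp add: g_def v10 v20)
  have mi: "integrable ?J m" unfolding m_def
    by (intro Bochner_Integration.integrable_add Bochner_Integration.integrable_abs A.integrable_multipliers B.integrable_multipliers)
  have sub: "integrable (lebesgue_on {0<..<b}) p" if "integrable ?J p" "b < T" for p :: "real \<Rightarrow> real" and b
    by (rule integrable_lebesgue_on_subset[OF that(1)]) (use that in auto)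
  have gc: "continuous_on {0..b} g" if "b < T" for b
    unfolding g_def power2_eq_square
    by (rule continuous_on_subset[OF L2_path_inner_continuous[OF L2_path_diff[OF B.path A.path] L2_path_diff[OF B.path A.path]]])
       (use that in auto)
  have mg: "integrable (lebesgue_on {0<..<b}) (\<lambda>t. m t * g t)" if "b < T" for b
    by (rule integrable_mult_continuous[OF sub[OF mi that] gc[OF that]])
  have energy: "integrable ?J D \<and> g b = 2 * integral {0..b} D" if b: "b \<in> {0..<T}" for b
  proof -
    note c11 = L2_inner_chain_rule[OF T A.time_deriv A.time_deriv A.path A.path b]
    note c22 = L2_inner_chain_rule[OF T B.time_deriv B.time_deriv B.path B.path b]
    note c12 = L2_inner_chain_rule[OF T A.time_deriv B.time_deriv A.path B.path b]
    let ?h = "\<lambda>a a' q q' t. (LINT s|?M. a' t s * q t s) + (LINT s|?M. q' t s * a t s)"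
    \<comment> \<open>Polarisation: half the product rule for (v2, v2), half of that for (v1, v1),
      minus the mixed one.\<close>
    have D_eq: "D = (\<lambda>t. ?h v2 v2' v2 v2' t / 2 + ?h v1 v1' v1 v1' t / 2 - ?h v1 v1' v2 v2' t)"
      by (simp add: D_def fun_eq_iff)
    have Di: "integrable ?J D" unfolding D_eq
      by (intro Bochner_Integration.integrable_add Bochner_Integration.integrable_diff Bochner_Integration.integrable_divide c11 c22 c12)
    have hk: "p integrable_on {0..b}" if "integrable ?J p" for p :: "real \<Rightarrow> real"
      by (rule set_lebesgue_integral_eq_integral(1)[OF integrable_lebesgue_on_interval[OF that]]) (use b in auto)
    have "(D has_integral integral {0..b} (?h v2 v2' v2 v2') / 2 + integral {0..b} (?h v1 v1' v1 v1') / 2 - integral {0..b} (?h v1 v1' v2 v2')) {0..b}"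
      unfolding D_eq by (intro has_integral_add has_integral_diff has_integral_divide integrable_integral hk c11(1) c22(1) c12(1))
    then have "2 * integral {0..b} D = integral {0..b} (?h v2 v2' v2 v2') + integral {0..b} (?h v1 v1' v1 v1') - 2 * integral {0..b} (?h v1 v1' v2 v2')"
      by (simp add: integral_unique)
    also have "\<dots> = (LINT s|?M. v2 b s * v2 b s) + (LINT s|?M. v1 b s * v1 b s) - 2 * (LINT s|?M. v1 b s * v2 b s)"
      unfolding c11(2)[symmetric] c22(2)[symmetric] c12(2)[symmetric] v10 v20 by simp
    also have "\<dots> = g b"
    proof -
      have sq: "v1 b \<in> square_integrable ?M" "v2 b \<in> square_integrable ?M" using L2_pathD(1)[OF A.path b] L2_pathD(1)[OF B.path b] by auto
      have "g b = (LINT s|?M. v2 b s * v2 b s + v1 b s * v1 b s - 2 * (v1 b s * v2 b s))"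
        unfolding g_def by (simp add: power2_eq_square algebra_simps)
      then show ?thesis using square_integrable_mult[OF sq(1) sq(1)] square_integrable_mult[OF sq(2) sq(2)] square_integrable_mult[OF sq] by simp
    qed
    finally show ?thesis using Di by simp
  qed
  \<comment> \<open>Subtracting the two tested equations leaves \<open>D\<close>, the multiplier
    terms and the integral of the squared gradient difference. The last has the favourable sign; the
    multiplier terms are bounded by \<open>m t * g t\<close>.\<close>
  have estimate: "D t \<le> m t * g t + (B.tested v1 v2 t - A.tested v1 v2 t)" if t: "t \<in> {0..<T}" for t
  proof -
    define p1 where "p1 = (LINT s|?M. sin (v1 t s + phi L \<eta> s) * (v2 t s - v1 t s))"
    define q1 where "q1 = (LINT s|?M. cos (v1 t s + phi L \<eta> s) * (v2 t s - v1 t s))"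
    define p2 where "p2 = (LINT s|?M. sin (v2 t s + phi L \<eta> s) * (v2 t s - v1 t s))"
    define q2 where "q2 = (LINT s|?M. cos (v2 t s + phi L \<eta> s) * (v2 t s - v1 t s))"
    define R where "R a b = (LINT s|?M. (?d (a t) s + ?c) * ?d (b t) s)" for a b :: "real \<Rightarrow> real \<Rightarrow> real"
    have cont: "continuous_on {0..L} (\<lambda>s. v1 t s + phi L \<eta> s)" "continuous_on {0..L} (\<lambda>s. v2 t s + phi L \<eta> s)"
      by (intro continuous_intros A.slice_continuous B.slice_continuous A.phi_continuous t)+
    note cl = A.closed[OF t, unfolded closed_angle_def] B.closed[OF t, unfolded closed_angle_def]
    have "\<bar>q1\<bar> \<le> g t" "\<bar>p1\<bar> \<le> g t"
      using closed_angle_pairing[OF cont] cl by (simp_all add: p1_def q1_def g_def)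
    \<comment> \<open>Expanding around v2 instead of v1 produces the opposite difference.\<close>
    have neg: "(LINT s|?M. h s * (v1 t s - v2 t s)) = - (LINT s|?M. h s * (v2 t s - v1 t s))" for h :: "real \<Rightarrow> real"
      by (subst Bochner_Integration.integral_minus[symmetric]) (simp add: algebra_simps)
    have "\<bar>q2\<bar> \<le> g t" "\<bar>p2\<bar> \<le> g t"
      using closed_angle_pairing[OF cont(2,1)] cl neg[of "\<lambda>s. cos (v2 t s + phi L \<eta> s)"] neg[of "\<lambda>s. sin (v2 t s + phi L \<eta> s)"]
      by (simp_all add: p2_def q2_def g_def power2_commute)
    have prod: "x * y \<le> \<bar>x\<bar> * g t" "- (x * y) \<le> \<bar>x\<bar> * g t" if "\<bar>y\<bar> \<le> g t" for x y :: real
    proof -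
      have "\<bar>x * y\<bar> \<le> \<bar>x\<bar> * g t" unfolding abs_mult by (rule mult_left_mono[OF that]) simp
      then show "x * y \<le> \<bar>x\<bar> * g t" "- (x * y) \<le> \<bar>x\<bar> * g t" by linarith+
    qed
    have mult: "l1 t * p2 - l2 t * q2 - k1 t * p1 + k2 t * q1 \<le> m t * g t"
      using prod(1)[OF \<open>\<bar>p2\<bar> \<le> g t\<close>, of "l1 t"] prod(2)[OF \<open>\<bar>q2\<bar> \<le> g t\<close>, of "l2 t"]
        prod(2)[OF \<open>\<bar>p1\<bar> \<le> g t\<close>, of "k1 t"] prod(1)[OF \<open>\<bar>q1\<bar> \<le> g t\<close>, of "k2 t"]
      unfolding m_def distrib_right by linarith
    have "0 \<le> (R v2 v2 - R v2 v1) - (R v1 v2 - R v1 v1)"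
    proof -
      have const: "(\<lambda>_. ?c) \<in> square_integrable ?M" by (rule continuous_square_integrable(1)) (rule continuous_on_const)
      have sq: "?d (v1 t) \<in> square_integrable ?M" "?d (v2 t) \<in> square_integrable ?M" by (intro W1p_perD(4)[OF _ L] A.W1p B.W1p t)+
      have sq': "(\<lambda>s. ?d (v1 t) s + ?c) \<in> square_integrable ?M" "(\<lambda>s. ?d (v2 t) s + ?c) \<in> square_integrable ?M"
        by (intro square_integrable_add sq const)+
      have "0 \<le> (LINT s|?M. (?d (v2 t) s - ?d (v1 t) s)\<^sup>2)" by simp
      also have "\<dots> = (LINT s|?M. ((?d (v2 t) s + ?c) * ?d (v2 t) s - (?d (v2 t) s + ?c) * ?d (v1 t) s)
          - ((?d (v1 t) s + ?c) * ?d (v2 t) s - (?d (v1 t) s + ?c) * ?d (v1 t) s))"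
        by (rule Bochner_Integration.integral_cong) (simp_all add: power2_eq_square algebra_simps)
      also have "\<dots> = (R v2 v2 - R v2 v1) - (R v1 v2 - R v1 v1)"
        unfolding R_def using square_integrable_mult[OF sq'(1) sq(1)] square_integrable_mult[OF sq'(1) sq(2)]
          square_integrable_mult[OF sq'(2) sq(1)] square_integrable_mult[OF sq'(2) sq(2)] by simp
      finally show ?thesis .
    qed
    moreover have "B.tested v1 v2 t - A.tested v1 v2 t = D t - (l1 t * p2 - l2 t * q2 - k1 t * p1 + k2 t * q1)
        + ((R v2 v2 - R v2 v1) - (R v1 v2 - R v1 v1))"
      unfolding A.tested_def B.tested_def D_def p1_def q1_def p2_def q2_def R_def by simp
    ultimately show ?thesis using mult by linarith
  qed
  \<comment> \<open>Integrating \<open>estimate\<close> over (0, b) removes the tested terms, whose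
    integrals vanish; the factor 2 is the one between \<open>D\<close> and the derivative of
    \<open>g\<close>.\<close>
  have le: "g b \<le> integral {0..b} (\<lambda>r. 2 * m r * g r)" if b: "b \<in> {0..<T}" for b
  proof (cases "b = 0")
    case False
    then have b': "b \<in> {0<..<T}" and bT: "b < T" using b by auto
    note tA = A.tested_integral[OF d1 d2 b'] and tB = B.tested_integral[OF d1 d2 b']
    have Di: "integrable (lebesgue_on {0<..<b}) D" using energy[OF b] sub bT by blast
    have "(LINT t|lebesgue_on {0<..<b}. D t) \<le> (LINT t|lebesgue_on {0<..<b}. m t * g t + (B.tested v1 v2 t - A.tested v1 v2 t))"
    proof (rule integral_mono[OF Di])
      show "integrable (lebesgue_on {0<..<b}) (\<lambda>t. m t * g t + (B.tested v1 v2 t - A.tested v1 v2 t))"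
        by (intro Bochner_Integration.integrable_add Bochner_Integration.integrable_diff mg[OF bT] tA(1) tB(1))
      fix t assume "t \<in> space (lebesgue_on {0<..<b})"
      then show "D t \<le> m t * g t + (B.tested v1 v2 t - A.tested v1 v2 t)" using b by (intro estimate) auto
    qed
    also have "\<dots> = (LINT t|lebesgue_on {0<..<b}. m t * g t)" using mg[OF bT] tA tB by simp
    finally have "integral {0..b} D \<le> integral {0..b} (\<lambda>t. m t * g t)"
      using integral_lebesgue_on_open_interval[OF Di] integral_lebesgue_on_open_interval[OF mg[OF bT]] by simp
    then show ?thesis using energy[OF b] by (simp add: mult.assoc)
  qed (simp add: g_zero)
  have "g t0 = 0"
  proof (rule gronwall_zero[where k="\<lambda>r. 2 * m r" and g=g])
    have t0T: "t0 < T" "0 \<le> t0" using t0 by auto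
    show "0 \<le> t0" by (rule t0T)
    have "integrable ?J (\<lambda>r. 2 * m r)" using mi by (rule Bochner_Integration.integrable_mult_right)
    from set_lebesgue_integral_eq_integral(1)[OF integrable_lebesgue_on_interval[OF this, of 0 t0]]
    show "(\<lambda>r. 2 * m r) integrable_on {0..t0}" using t0T by simp
    have "integrable (lebesgue_on {0<..<t0}) (\<lambda>r. 2 * (m r * g r))" using mg[OF t0T(1)] by (rule Bochner_Integration.integrable_mult_right)
    from set_lebesgue_integral_eq_integral(1)[OF integrable_lebesgue_on_interval[OF this, of 0 t0]]
    show "(\<lambda>r. 2 * m r * g r) integrable_on {0..t0}" by (simp add: mult.assoc)
    show "g t \<le> integral {0..t} (\<lambda>r. 2 * m r * g r)" if "t \<in> {0..t0}" for t using that t0T by (intro le) auto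
    show "0 \<le> 2 * m t" for t by (simp add: m_def)
  qed (rule g_nonneg)
  show "v1 t0 = v2 t0"
  proof
    fix s
    have per: "v1 t0 (s + L) = v1 t0 s" "v2 t0 (s + L) = v2 t0 s" for s
      using W1p_perD(1)[OF A.W1p[OF t0] L] W1p_perD(1)[OF B.W1p[OF t0] L] C_per_iff[OF L] by blast+
    have C: "v1 t0 \<in> C_per L" "v2 t0 \<in> C_per L" using W1p_perD(1)[OF A.W1p[OF t0] L] W1p_perD(1)[OF B.W1p[OF t0] L] by auto
    have c: "continuous_on {0..L} (\<lambda>s. (v2 t0 s - v1 t0 s)\<^sup>2)"
      by (intro continuous_intros A.slice_continuous B.slice_continuous t0)
    \<comment> \<open>The integrand is continuous and nonnegative, so a vanishing integral gives
      pointwise equality on one period, and periodicity extends it.\<close>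
    have "integral {0..L} (\<lambda>s. (v2 t0 s - v1 t0 s)\<^sup>2) = 0"
      using continuous_square_integrable(3)[OF c] \<open>g t0 = 0\<close> by (simp add: g_def)
    then have z: "v2 t0 r = v1 t0 r" if "r \<in> {0..L}" for r
      using integral_eq_0_iff[OF c L] that by simp
    obtain r k where rk: "r \<in> {0..<L}" "s = r + of_int k * L" using real_period_decomposition[OF L] by blast
    then have "v1 t0 s = v1 t0 r" "v2 t0 s = v2 t0 r" using C by (auto simp: C_per_def)
    then show "v1 t0 s = v2 t0 s" using z[of r] rk(1) by simp
  qed
qed

theorem theorem1p2:
  fixes L :: real and \<eta> :: nat and u0 :: "real \<Rightarrow> real"
  assumes "L > 0" and "\<eta> \<ge> 1"
    and "u0 \<in> W2p_per 2 L"
    and "(LINT s|lebesgue_on {0<..<L}. cos (u0 s + phi L \<eta> s)) = 0"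
    and "(LINT s|lebesgue_on {0<..<L}. sin (u0 s + phi L \<eta> s)) = 0"
  shows "\<forall>T>0. \<exists>u. weak_solution 2 L \<eta> u0 T u \<and>
           (\<forall>v. weak_solution 2 L \<eta> u0 T v \<longrightarrow> (\<forall>t\<in>{0..<T}. v t = u t))"
proof (intro allI impI)
  fix T :: real assume T: "T > 0"
  note L = assms(1)
  obtain g H where g: "\<And>s. (u0 has_real_derivative g s) (at s)" "continuous_on UNIV g" "\<And>s. g (s + L) = g s"
    "\<And>s. u0 (s + L) = u0 s" "\<And>z z'. \<bar>g z - g z'\<bar> \<le> H * sqrt \<bar>z - z'\<bar>"
    by (rule W2p_per_regularity[OF assms(3) L]) (rule that)
  \<comment> \<open>The slope of \<open>phi\<close>, so that \<open>v0\<close> is theta_s at time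
    0.\<close>
  define c where "c = 2 * pi * real \<eta> / L"
  define v0 where "v0 s = g s + c" for s
  \<comment> \<open>Adding 1 gives N0 > 0 without a lower bound on the energy.\<close>
  define N0 where "N0 = \<bar>energy L v0\<bar> + 1"
  \<comment> \<open>The determinant bound of \<open>detA_lower_bound\<close> at energy level
    \<open>N0\<close>; it is fixed before the flow exists and is the same for all T.\<close>
  define \<delta> where "\<delta> = L * min L (pi\<^sup>2 / (16 * N0)) / 4"
  have cL: "c * L = 2 * pi * real \<eta>" using L by (simp add: c_def)
  have pos: "N0 > 0" "\<delta> > 0" using L by (simp_all add: N0_def \<delta>_def add_nonneg_pos)
  have v0: "continuous_on UNIV v0" "\<And>s. v0 (s + L) = v0 s" "\<And>z z'. \<bar>v0 z - v0 z'\<bar> \<le> H * sqrt \<bar>z - z'\<bar>"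
    using g(2,3,5) unfolding v0_def by (auto intro: continuous_on_add continuous_on_const)
  have du0: "(u0 has_real_derivative v0 s - c) (at s)" for s using g(1)[of s] by (simp add: v0_def)
  obtain u v w l1 l2 C where flow: "jointly_continuous u" "jointly_continuous v"
    "u 0 = u0" "v 0 = v0"
    "\<And>t s. (u t has_real_derivative v t s - c) (at s)"
    "\<And>t s. u t (s + L) = u t s" "\<And>t s. v t (s + L) = v t s"
    "\<And>t. l1 t = lam1 L N0 \<delta> (\<lambda>s. u t s + c * s) (v t)" "\<And>t. l2 t = lam2 L N0 \<delta> (\<lambda>s. u t s + c * s) (v t)"
    "continuous_on UNIV l1" "continuous_on UNIV l2"
    "\<And>t s. t \<in> {0<..T} \<Longrightarrow> (v t has_real_derivative w t s) (at s)"
    "continuous_on ({0<..} \<times> UNIV) (\<lambda>p. w (fst p) (snd p))"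
    "\<And>t s. w t (s + L) = w t s"
    "\<And>t s. t \<in> {0<..<T} \<Longrightarrow> ((\<lambda>t. u t s) has_real_derivative
        w t s + l1 t * sin (u t s + c * s) - l2 t * cos (u t s + c * s)) (at t)"
    "\<And>t s. t \<in> {0<..T} \<Longrightarrow> (w t s)\<^sup>2 \<le> C / sqrt t"
    by (rule truncated_flow_exists[OF L T pos cL du0 g(4) v0]) (rule that)
  have E0: "energy L (v 0) \<le> N0" unfolding flow(4) N0_def by linarith
  interpret truncated_flow L T c N0 \<delta> C \<eta> u v w l1 l2
    by (rule truncated_flow.intro) (fact L T assms(2) pos cL E0 \<delta>_def flow)+
  have \<theta>0: "\<theta> 0 s = u0 s + phi L \<eta> s" for s by (simp add: \<theta>_def flow(3) phi_eq)
  have sol: "weak_solution 2 L \<eta> u0 T u"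
  proof -
    have "integral {0..L} (\<lambda>s. cos (\<theta> 0 s)) = 0" "integral {0..L} (\<lambda>s. sin (\<theta> 0 s)) = 0"
      using assms(4,5) unfolding \<theta>0[symmetric]
      by (subst continuous_square_integrable(3)[symmetric]; auto intro!: continuous_intros slices)+
    from is_weak_solution[OF this] show ?thesis unfolding flow(3) .
  qed
  then show "\<exists>u. weak_solution 2 L \<eta> u0 T u \<and> (\<forall>v. weak_solution 2 L \<eta> u0 T v \<longrightarrow> (\<forall>t\<in>{0..<T}. v t = u t))"
    using weak_solution_unique[OF L T _ sol] by blast
qed

end
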